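(* Let $H$ and $U$ be two complex Hilbert spaces. Let $A_0:D(A_0)\subset H\longrightarrow H$ be the generator of a $C_0$-semigroup on $H$ and let $B\in\mathcal{L}(U,D(A_0^* )')$ be an admissible control operator for $A_0$. Let $K\in\mathcal{L}(H)$ and let $A_K=A_0+K$ with $D(A_K)=D(A_0)$ (then $A_K$ generates a $C_0$-semigroup on $H$ and $B$ is also admissible for $A_K$). For $T\ge 0$ let $\Phi_T\in\mathcal{L}(L^2(0,+\infty;U),H)$ be the input map of $(A_K,B)$. Let $$\sigma_F=\{\lambda\in\mathbb{C} : \ker(\lambda-A_K^* )\cap\ker B^*\neq\{0\}\},$$ and for every $\lambda\in\mathbb{C}$ let $$E_\lambda=\Big\{z\in\bigcup_{m=1}^{+\infty}\ker(\lambda-A_K^* )^m : B^*(\lambda-A_K^* )^m z=0\ \text{ for all } m\in\mathbb{N}\Big\}.$$ Assume that: (i) there exists $T_0>0$ such that $(A_0,B)$ is exactly controllable in time $T_0$; (ii) $K$ is compact. Then the set $\sigma_F$ is finite, $E_\lambda$ is finite dimensional for every $\lambda\in\mathbb{C}$, and $$\mathrm{Im}\,\Phi_T=\Big(\bigoplus_{\lambda\in\sigma_F}E_\lambda\Big)^{\perp},\qquad \forall T>T_0.$$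
   Context: Let $H,U$ be Hilbert spaces, $A:D(A)\subset H\to H$ the generator of a $C_0$-semigroup $(S_A(t))_{t\ge 0}$ on $H$, and $B\in\mathcal{L}(U,D(A^* )')$, where $D(A^* )$ carries the graph norm and $D(A^* )'$ is its dual with respect to the pivot space $H$ (so $D(A^* )\subset H\subset D(A^* )'$, and $S_A(t)$ extends to a $C_0$-semigroup on $D(A^* )'$). The adjoint of $B$ is $B^*\in\mathcal{L}(D(A^* ),U)$. For $T\ge 0$ the input map $\Phi_T\in\mathcal{L}(L^2(0,+\infty;U),D(A^* )')$ of $(A,B)$ is $\Phi_T u=\int_0^T S_A(T-s)Bu(s)\,ds$. The operator $B$ is admissible for $A$ if $\mathrm{Im}\,\Phi_T\subset H$ for some (equivalently all) $T>0$; then $\Phi_T\in\mathcal{L}(L^2(0,+\infty;U),H)$. For $B$ admissible, the system $\frac{d}{dt}y=Ay+Bu$ on $(0,T)$, $y(0)=y^0\in H$, with $u\in L^2(0,T;U)$, has the unique solution $y\in C^0([0,T];H)$ given by $y(t)=S_A(t)y^0+\Phi_t u$. $(A,B)$ is exactly controllable in time $T>0$ if for every $y^0,y^1\in H$ there is $u\in L^2(0,T;U)$ with $y(T)=y^1$. Here $\mathbb{N}$ contains $0$; the direct sum over an empty set is $\{0\}$; $\perp$ denotes the orthogonal complement in $H$. Note $D(A_K^* )=D(A_0^* )$. *)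

theory Defs
  imports "HOL-Analysis.Analysis"
begin

section \<open>Complex Hilbert spaces\<close>

text \<open>
  The inner product is linear in its first and conjugate linear in its second argument. The
  underlying real structure is the canonical one, with real inner product \<open>Re (cinner x y)\<close>.
  No separability is required, and the zero space is allowed.
\<close>

class complex_hilbert = real_inner + banach +
  fixes scaleC :: "complex \<Rightarrow> 'a \<Rightarrow> 'a"  (infixr "*\<^sub>C" 75)
    and cinner :: "'a \<Rightarrow> 'a \<Rightarrow> complex"
  assumes scaleC_add_right: "c *\<^sub>C (x + y) = c *\<^sub>C x + c *\<^sub>C y"
    and scaleC_add_left: "(c + d) *\<^sub>C x = c *\<^sub>C x + d *\<^sub>C x"
    and scaleC_scaleC: "c *\<^sub>C (d *\<^sub>C x) = (c * d) *\<^sub>C x"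
    and scaleR_eq_scaleC: "r *\<^sub>R x = complex_of_real r *\<^sub>C x"
    and cinner_commute: "cinner x y = cnj (cinner y x)"
    and cinner_add_left: "cinner (x + y) z = cinner x z + cinner y z"
    and cinner_scaleC_left: "cinner (c *\<^sub>C x) y = c * cinner x y"
    and inner_eq_Re_cinner: "inner x y = Re (cinner x y)"

definition bounded_clinear :: "('a::complex_hilbert \<Rightarrow> 'b::complex_hilbert) \<Rightarrow> bool" where
  "bounded_clinear f \<longleftrightarrow> bounded_linear f \<and> (\<forall>c x. f (c *\<^sub>C x) = c *\<^sub>C f x)"

definition compact_op :: "('a::complex_hilbert \<Rightarrow> 'b::complex_hilbert) \<Rightarrow> bool" where
  "compact_op f \<longleftrightarrow> bounded_clinear f \<and> compact (closure (f ` cball 0 1))"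

definition orth_compl :: "'a::complex_hilbert set \<Rightarrow> 'a set" where
  "orth_compl V = {x. \<forall>y\<in>V. cinner x y = 0}"

definition finite_dim :: "'a::complex_hilbert set \<Rightarrow> bool" where
  "finite_dim V \<longleftrightarrow> (\<exists>F. finite F \<and> V = module.span scaleC F)"

definition independent_family :: "'i set \<Rightarrow> ('i \<Rightarrow> 'a::complex_hilbert set) \<Rightarrow> bool" where
  "independent_family I E \<longleftrightarrow>
     (\<forall>z. (\<forall>i\<in>I. z i \<in> E i) \<and> (\<Sum>i\<in>I. z i) = 0 \<longrightarrow> (\<forall>i\<in>I. z i = 0))"

text \<open>
  For a finite index set; it is the internal direct sum when the family is independent.
\<close>

definition subspace_sum :: "'i set \<Rightarrow> ('i \<Rightarrow> 'a::complex_hilbert set) \<Rightarrow> 'a set" where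
  "subspace_sum I E = {(\<Sum>i\<in>I. z i) | z. \<forall>i\<in>I. z i \<in> E i}"

section \<open>Unbounded operators\<close>

text \<open>
  An operator is a pair of its domain and a map; the values outside the domain are irrelevant.
\<close>

type_synonym 'a unbdd_op = "'a set \<times> ('a \<Rightarrow> 'a)"

text \<open>The vector \<open>w\<close> below is unique when the domain of the operator is dense.\<close>

definition op_adjoint :: "'a::complex_hilbert unbdd_op \<Rightarrow> 'a unbdd_op" where
  "op_adjoint A =
     ({\<phi>. \<exists>w. \<forall>x\<in>fst A. cinner (snd A x) \<phi> = cinner x w},
      \<lambda>\<phi>. THE w. \<forall>x\<in>fst A. cinner (snd A x) \<phi> = cinner x w)"

definition op_ker :: "'a::complex_hilbert unbdd_op \<Rightarrow> 'a set" where
  "op_ker A = {z \<in> fst A. snd A z = 0}"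

definition op_shift :: "complex \<Rightarrow> 'a::complex_hilbert unbdd_op \<Rightarrow> 'a unbdd_op" where
  "op_shift c A = (fst A, \<lambda>z. c *\<^sub>C z - snd A z)"

primrec op_power :: "'a::complex_hilbert unbdd_op \<Rightarrow> nat \<Rightarrow> 'a unbdd_op" where
  "op_power A 0 = (UNIV, \<lambda>z. z)"
| "op_power A (Suc m) =
     ({z \<in> fst A. snd A z \<in> fst (op_power A m)}, \<lambda>z. snd (op_power A m) (snd A z))"

definition op_perturb :: "'a::complex_hilbert unbdd_op \<Rightarrow> ('a \<Rightarrow> 'a) \<Rightarrow> 'a unbdd_op" where
  "op_perturb A K = (fst A, \<lambda>x. snd A x + K x)"

section \<open>Semigroups\<close>

definition c0_semigroup :: "(real \<Rightarrow> 'a::complex_hilbert \<Rightarrow> 'a) \<Rightarrow> bool" where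
  "c0_semigroup S \<longleftrightarrow>
     (\<forall>t\<ge>0. bounded_clinear (S t)) \<and> S 0 = id \<and>
     (\<forall>s\<ge>0. \<forall>t\<ge>0. S (s + t) = S s \<circ> S t) \<and>
     (\<forall>x. ((\<lambda>t. S t x) \<longlongrightarrow> x) (at_right 0))"

definition generates :: "'a::complex_hilbert unbdd_op \<Rightarrow> (real \<Rightarrow> 'a \<Rightarrow> 'a) \<Rightarrow> bool" where
  "generates A S \<longleftrightarrow> c0_semigroup S \<and>
     fst A = {x. \<exists>y. ((\<lambda>t. (1 / t) *\<^sub>R (S t x - x)) \<longlongrightarrow> y) (at_right 0)} \<and>
     (\<forall>x\<in>fst A. ((\<lambda>t. (1 / t) *\<^sub>R (S t x - x)) \<longlongrightarrow> snd A x) (at_right 0))"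

definition is_generator :: "'a::complex_hilbert unbdd_op \<Rightarrow> bool" where
  "is_generator A \<longleftrightarrow> (\<exists>S. generates A S)"

text \<open>
  The generator determines the semigroup at all times \<open>t \<ge> 0\<close>; values at negative times are
  never used.
\<close>

definition semigroup_of :: "'a::complex_hilbert unbdd_op \<Rightarrow> real \<Rightarrow> 'a \<Rightarrow> 'a" where
  "semigroup_of A = (SOME S. generates A S)"

section \<open>The dual of the domain of the adjoint with respect to the pivot space\<close>

definition graph_norm :: "'a::complex_hilbert unbdd_op \<Rightarrow> 'a \<Rightarrow> real" where
  "graph_norm A x = sqrt ((norm x)\<^sup>2 + (norm (snd A x))\<^sup>2)"

text \<open>The dual norm for the graph norm of the adjoint.\<close>

definition dual_norm :: "'a::complex_hilbert unbdd_op \<Rightarrow> ('a \<Rightarrow> complex) \<Rightarrow> ennreal" where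
  "dual_norm A \<psi> =
     (SUP \<phi>\<in>{\<phi> \<in> fst (op_adjoint A). graph_norm (op_adjoint A) \<phi> \<le> 1}. ennreal (cmod (\<psi> \<phi>)))"

text \<open>
  Elements of the dual are conjugate linear functionals, so that the inclusion of the pivot
  space (\<open>pivot\<close> below) is complex linear. They are extended by 0 outside the domain of the
  adjoint, so that equality of functionals is equality of functions.
\<close>

definition dual_space :: "'a::complex_hilbert unbdd_op \<Rightarrow> ('a \<Rightarrow> complex) set" where
  "dual_space A = {\<psi>.
     (\<forall>\<phi>\<in>fst (op_adjoint A). \<forall>\<eta>\<in>fst (op_adjoint A). \<psi> (\<phi> + \<eta>) = \<psi> \<phi> + \<psi> \<eta>) \<and>
     (\<forall>c. \<forall>\<phi>\<in>fst (op_adjoint A). \<psi> (c *\<^sub>C \<phi>) = cnj c * \<psi> \<phi>) \<and>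
     (\<forall>\<phi>. \<phi> \<notin> fst (op_adjoint A) \<longrightarrow> \<psi> \<phi> = 0) \<and>
     dual_norm A \<psi> < \<infinity>}"

definition pivot :: "'a::complex_hilbert unbdd_op \<Rightarrow> 'a \<Rightarrow> ('a \<Rightarrow> complex)" where
  "pivot A h = (\<lambda>\<phi>. if \<phi> \<in> fst (op_adjoint A) then cinner h \<phi> else 0)"

text \<open>
  The extension of the semigroup to the dual is the transpose of the restriction of the adjoint
  semigroup to the domain of the adjoint: \<open>\<psi> \<mapsto> \<psi> \<circ> S(t)\<^sup>*\<close>. It maps \<open>pivot A h\<close> to
  \<open>pivot A (S(t) h)\<close>, and it is the only continuous such map since the pivot space is dense.
\<close>

definition semigroup_ext ::
  "'a::complex_hilbert unbdd_op \<Rightarrow> real \<Rightarrow> ('a \<Rightarrow> complex) \<Rightarrow> ('a \<Rightarrow> complex)" where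
  "semigroup_ext A t \<psi> =
     (\<lambda>\<phi>. if \<phi> \<in> fst (op_adjoint A) then \<psi> (snd (op_adjoint (UNIV, semigroup_of A t)) \<phi>) else 0)"

text \<open>
  Bochner integral over \<open>[0, T]\<close> of a function with values in the dual: \<open>f\<close> is the almost
  everywhere limit of simple functions \<open>s n\<close> with \<open>\<integral> \<parallel>f - s n\<parallel> \<longlonglongrightarrow> 0\<close>, and \<open>F\<close> is the limit
  of the integrals of the \<open>s n\<close>, all limits being taken in the dual norm. It is spelled out
  because the dual depends on \<open>A\<close> and hence is not a type of class \<open>banach\<close> (and the
  library's Bochner integral also requires separability).
\<close>

definition has_dual_integral ::
  "'a::complex_hilbert unbdd_op \<Rightarrow> real \<Rightarrow> (real \<Rightarrow> 'a \<Rightarrow> complex) \<Rightarrow> ('a \<Rightarrow> complex) \<Rightarrow> bool" where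
  "has_dual_integral A T f F \<longleftrightarrow> (\<exists>s :: nat \<Rightarrow> real \<Rightarrow> 'a \<Rightarrow> complex.
     (\<forall>n. simple_function (lebesgue_on {0..T}) (s n) \<and> s n ` {0..T} \<subseteq> dual_space A) \<and>
     (AE t in lebesgue_on {0..T}. (\<lambda>n. dual_norm A (\<lambda>\<phi>. f t \<phi> - s n t \<phi>)) \<longlonglongrightarrow> 0) \<and>
     (\<lambda>n. \<integral>\<^sup>+ t. dual_norm A (\<lambda>\<phi>. f t \<phi> - s n t \<phi>) \<partial>lebesgue_on {0..T}) \<longlonglongrightarrow> 0 \<and>
     (\<lambda>n. dual_norm A (\<lambda>\<phi>. F \<phi> -
        (\<Sum>v\<in>s n ` {0..T}. measure lebesgue {t \<in> {0..T}. s n t = v} *\<^sub>R v \<phi>))) \<longlonglongrightarrow> 0)"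

section \<open>Controlled systems\<close>

definition L2 :: "real set \<Rightarrow> (real \<Rightarrow> 'u::complex_hilbert) set" where
  "L2 J = {u.
     (\<exists>s. (\<forall>n. simple_function (lebesgue_on J) (s n)) \<and>
          (AE t in lebesgue_on J. (\<lambda>n::nat. s n t) \<longlonglongrightarrow> u t)) \<and>
     (\<integral>\<^sup>+ t. ennreal ((norm (u t))\<^sup>2) \<partial>lebesgue_on J) < \<infinity>}"

text \<open>Bounded linear maps from the control space to the dual.\<close>

definition control_op ::
  "'a::complex_hilbert unbdd_op \<Rightarrow> ('u::complex_hilbert \<Rightarrow> 'a \<Rightarrow> complex) \<Rightarrow> bool" where
  "control_op A B \<longleftrightarrow>
     (\<forall>u. B u \<in> dual_space A) \<and>
     (\<forall>u v. B (u + v) = (\<lambda>\<phi>. B u \<phi> + B v \<phi>)) \<and>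
     (\<forall>c u. B (c *\<^sub>C u) = (\<lambda>\<phi>. c * B u \<phi>)) \<and>
     (\<exists>C. \<forall>u. dual_norm A (B u) \<le> ennreal (C * norm u))"

text \<open>To be applied to vectors in the domain of the adjoint only.\<close>

definition control_adjoint :: "('u::complex_hilbert \<Rightarrow> 'a \<Rightarrow> complex) \<Rightarrow> 'a \<Rightarrow> 'u" where
  "control_adjoint B \<phi> = (THE w. \<forall>u. B u \<phi> = cinner u w)"

definition input_map_dual :: "'a::complex_hilbert unbdd_op \<Rightarrow> ('u::complex_hilbert \<Rightarrow> 'a \<Rightarrow> complex)
    \<Rightarrow> real \<Rightarrow> (real \<Rightarrow> 'u) \<Rightarrow> ('a \<Rightarrow> complex)" where
  "input_map_dual A B T u =
     (THE F. F \<in> dual_space A \<and>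
        has_dual_integral A T (\<lambda>s. semigroup_ext A (T - s) (B (u s))) F)"

definition admissible_control ::
  "'a::complex_hilbert unbdd_op \<Rightarrow> ('u::complex_hilbert \<Rightarrow> 'a \<Rightarrow> complex) \<Rightarrow> bool" where
  "admissible_control A B \<longleftrightarrow>
     control_op A B \<and> (\<exists>T>0. input_map_dual A B T ` L2 {0<..} \<subseteq> range (pivot A))"

text \<open>The input map with values in the state space, for admissible \<open>B\<close>.\<close>

definition input_map :: "'a::complex_hilbert unbdd_op \<Rightarrow> ('u::complex_hilbert \<Rightarrow> 'a \<Rightarrow> complex)
    \<Rightarrow> real \<Rightarrow> (real \<Rightarrow> 'u) \<Rightarrow> 'a" where
  "input_map A B T u = (THE h. pivot A h = input_map_dual A B T u)"

definition solution :: "'a::complex_hilbert unbdd_op \<Rightarrow> ('u::complex_hilbert \<Rightarrow> 'a \<Rightarrow> complex)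
    \<Rightarrow> 'a \<Rightarrow> (real \<Rightarrow> 'u) \<Rightarrow> real \<Rightarrow> 'a" where
  "solution A B y0 u t = semigroup_of A t y0 + input_map A B t u"

definition exactly_controllable ::
  "'a::complex_hilbert unbdd_op \<Rightarrow> ('u::complex_hilbert \<Rightarrow> 'a \<Rightarrow> complex) \<Rightarrow> real \<Rightarrow> bool" where
  "exactly_controllable A B T \<longleftrightarrow> (\<forall>y0 y1. \<exists>u\<in>L2 {0<..<T}. solution A B y0 u T = y1)"

section \<open>Spectral data of the adjoint\<close>

definition sigma_F ::
  "'a::complex_hilbert unbdd_op \<Rightarrow> ('u::complex_hilbert \<Rightarrow> 'a \<Rightarrow> complex) \<Rightarrow> complex set" where
  "sigma_F A B = {\<mu>.
     op_ker (op_shift \<mu> (op_adjoint A)) \<inter> {z \<in> fst (op_adjoint A). control_adjoint B z = 0} \<noteq> {0}}"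

text \<open>
  Whenever \<open>z\<close> lies in the union of the kernels, all vectors to which \<open>control_adjoint B\<close> is
  applied are in the domain of the adjoint.
\<close>

definition E_space ::
  "'a::complex_hilbert unbdd_op \<Rightarrow> ('u::complex_hilbert \<Rightarrow> 'a \<Rightarrow> complex) \<Rightarrow> complex \<Rightarrow> 'a set" where
  "E_space A B \<mu> = {z \<in> (\<Union>m\<in>{1..}. op_ker (op_power (op_shift \<mu> (op_adjoint A)) m)).
     \<forall>m. control_adjoint B (snd (op_power (op_shift \<mu> (op_adjoint A)) m) z) = 0}"

end

theory Submission
  imports Defs "HOL-Computational_Algebra.Fundamental_Theorem_Algebra"
begin

text \<open>
  By duality, exact controllability of \<open>(A\<^sub>0, B)\<close> in time \<open>T\<^sub>0\<close> is the observability inequality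
  \<open>\<parallel>z\<parallel> \<le> C \<parallel>B\<^sup>* S\<^sub>0(\<cdot>)\<^sup>* z\<parallel>\<close> in \<open>L\<^sup>2(0, T\<^sub>0)\<close>. Compactness of \<open>K\<close> turns it into an inequality for
  \<open>A\<^sub>K\<close> which holds up to finitely many functionals \<open>\<langle>z, v\<rangle>\<close>. Hence the range of \<open>\<Phi>\<^sub>T\<close> is closed for
  \<open>T \<ge> T\<^sub>0\<close>, and its orthogonal complement, the unobservable space, is finite dimensional. These spaces
  decrease with \<open>T\<close>, hence two of them in \<open>(T\<^sub>0, T)\<close> coincide, which makes this one invariant under the
  adjoint semigroup and therefore equal to the unobservable space of every larger time. It is then the largest
  finite dimensional \<open>A\<^sub>K\<^sup>*\<close>-invariant subspace of the kernel of \<open>B\<^sup>*\<close>, and its generalized eigenspaces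
  are the \<open>E\<^sub>\<lambda>\<close>.
\<close>

text \<open>Two obstacles shape the proof. \<open>B\<close> takes values outside the state space, so
  the two input maps are not compared by Duhamel's formula for \<open>B u\<close>, but on vectors of
  the domain of the adjoint, over many short time steps. The resulting error depends only on the
  size of \<open>adj K\<close> along an adjoint orbit; one estimate thus gives both admissibility
  for the perturbed generator and, for compact \<open>K\<close>, observability up to finitely many
  functionals. Secondly, the observation of a state is a function only for states in that domain.
  Its L2 norm is therefore encoded as the support function of the set reached by simple controls of
  norm at most one, which makes sense for every state; a closed range becomes a lower bound for this
  function. Finite dimension is expressed by a finite set of vectors separating points, since this
  is what the compactness of \<open>K\<close> delivers. Strictness of T > T0 enters through the
  descending chain: infinitely many times must fit between T0 and T.\<close>

lemma cinner_scaleC_right: "cinner x (c *\<^sub>C y) = cnj c * cinner x (y::'a::complex_hilbert)"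
  by (metis cinner_commute cinner_scaleC_left complex_cnj_mult)

lemma cinner_add_right: "cinner x (y + z) = cinner x y + cinner x (z::'a::complex_hilbert)"
  by (metis cinner_commute cinner_add_left complex_cnj_add)

text \<open>The imaginary part is the real inner product with \<open>\<i> *\<^sub>C y\<close>.
  Statements on complex subspaces thus reduce to the real inner product, in which almost all later
  limits and estimates are carried out.\<close>

lemma cinner_eq_Complex: "cinner x y = Complex (inner x y) (inner x (\<i> *\<^sub>C (y::'a::complex_hilbert)))"
  by (auto simp: complex_eq_iff inner_eq_Re_cinner cinner_scaleC_right)

lemma cinner_eqI_inner:
  assumes "\<And>x. inner x u = inner x (v::'a::complex_hilbert)"
  shows "u = v"
  by (metis assms inner_commute vector_eq_rdot)

lemma scaleC_simps [simp]:
  "0 *\<^sub>C (x::'a::complex_hilbert) = 0" "1 *\<^sub>C x = x" "c *\<^sub>C (0::'a) = 0"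
  "(- 1) *\<^sub>C x = - x" "c *\<^sub>C (- x) = - (c *\<^sub>C x)" "(- c) *\<^sub>C x = - (c *\<^sub>C x)"
proof -
  have z: "0 *\<^sub>C x = 0" for x :: 'a using scaleR_eq_scaleC[of 0 x] by simp
  show "0 *\<^sub>C x = 0" by (rule z)
  show o: "1 *\<^sub>C x = x" using scaleR_eq_scaleC[of 1 x] by simp
  show "c *\<^sub>C (0::'a) = 0" using scaleC_scaleC[of c 0 "0::'a"] z by simp
  have m: "(- 1) *\<^sub>C x = - x" for x :: 'a using scaleR_eq_scaleC[of "-1" x] by simp
  show "(- 1) *\<^sub>C x = - x" by (rule m)
  show "c *\<^sub>C (- x) = - (c *\<^sub>C x)" "(- c) *\<^sub>C x = - (c *\<^sub>C x)"
    by (metis m mult.commute mult_minus1 scaleC_scaleC)+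
qed

interpretation cvs: vector_space "scaleC :: complex \<Rightarrow> 'a \<Rightarrow> 'a::complex_hilbert"
  by unfold_locales (auto simp: scaleC_add_right scaleC_add_left scaleC_scaleC)

lemma scaleC_diff_right: "c *\<^sub>C (x - y) = c *\<^sub>C x - c *\<^sub>C (y::'a::complex_hilbert)"
  by (rule cvs.scale_right_diff_distrib)

lemma scaleC_scaleR: "c *\<^sub>C (r *\<^sub>R x) = r *\<^sub>R (c *\<^sub>C (x::'a::complex_hilbert))"
  by (simp add: scaleR_eq_scaleC scaleC_scaleC mult.commute)

lemma norm_scaleC: "norm (c *\<^sub>C (x::'a::complex_hilbert)) = cmod c * norm x"
proof -
  have "cinner (c *\<^sub>C x) (c *\<^sub>C x) = (complex_of_real ((cmod c)\<^sup>2)) * cinner x x"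
    by (simp add: cinner_scaleC_left cinner_scaleC_right mult.assoc[symmetric] complex_norm_square
        del: of_real_power)
  hence "inner (c *\<^sub>C x) (c *\<^sub>C x) = (cmod c)\<^sup>2 * inner x x"
    by (simp add: inner_eq_Re_cinner del: of_real_power)
  thus ?thesis by (simp add: norm_eq_sqrt_inner real_sqrt_mult)
qed

lemma bounded_linear_scaleC: "bounded_linear (\<lambda>x::'a::complex_hilbert. c *\<^sub>C x)"
  by (rule bounded_linear_intro[of _ "cmod c"])
    (simp_all add: scaleC_add_right scaleC_scaleR norm_scaleC mult.commute)

lemma cmod_cinner_le: "cmod (cinner x y) \<le> norm x * norm (y::'a::complex_hilbert)"
proof (cases "cinner x y = 0")
  case False
  \<comment> \<open>A phase of modulus one that turns the complex inner product into its modulus, so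
    that the real Cauchy-Schwarz inequality applies.\<close>
  define c where "c = cnj (cinner x y) / cmod (cinner x y)"
  have "c * cinner x y = complex_of_real (cmod (cinner x y))"
    using False complex_norm_square[of "cinner x y"]
    by (simp add: c_def power2_eq_square mult.commute[of "cnj _"] field_simps)
  hence "inner (c *\<^sub>C x) y = cmod (cinner x y)"
    by (simp add: inner_eq_Re_cinner cinner_scaleC_left)
  moreover have "inner (c *\<^sub>C x) y \<le> norm (c *\<^sub>C x) * norm y" by (rule norm_cauchy_schwarz)
  moreover have "cmod c = 1" using False by (simp add: c_def norm_divide)
  ultimately show ?thesis by (simp add: norm_scaleC)
qed simp

lemma inner_scaleC_i: "inner (\<i> *\<^sub>C x) y = - inner x (\<i> *\<^sub>C (y::'a::complex_hilbert))"
  by (simp add: inner_eq_Re_cinner cinner_scaleC_left cinner_scaleC_right)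

text \<open>Orthogonality to \<open>\<i> *\<^sub>C y\<close> supplies the imaginary parts. In this
  way annihilators formed with the real inner product agree with \<open>orth_compl\<close>.\<close>

lemma cinner_zero_iff_inner:
  assumes "\<And>c y. y \<in> V \<Longrightarrow> c *\<^sub>C y \<in> (V::'a::complex_hilbert set)"
  shows "(\<forall>y\<in>V. cinner x y = 0) \<longleftrightarrow> (\<forall>y\<in>V. inner x y = 0)"
proof
  assume "\<forall>y\<in>V. inner x y = 0"
  thus "\<forall>y\<in>V. cinner x y = 0" using assms by (auto simp: cinner_eq_Complex complex_eq_iff)
qed (auto simp: inner_eq_Re_cinner)

lemma bounded_clinear_linear: "bounded_clinear f \<Longrightarrow> bounded_linear f"
  by (simp add: bounded_clinear_def)

subsection \<open>Projections and the Riesz representation\<close>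

text \<open>A minimizing sequence is Cauchy by the parallelogram identity, since midpoints stay in
  the convex set; this replaces compactness. Moving from the limit \<open>p\<close> towards a point
  of \<open>C\<close> cannot decrease the distance, which is the variational inequality. It serves
  for projections onto subspaces and, later, as a separation argument.\<close>

lemma closest_point_convex:
  fixes C :: "'a::{real_inner,complete_space} set"
  assumes C: "closed C" "convex C" "C \<noteq> {}"
  shows "\<exists>p\<in>C. \<forall>y\<in>C. inner (x - p) (y - p) \<le> 0"
proof -
  define d where "d = infdist x C"
  have d0: "d \<ge> 0" by (simp add: d_def infdist_nonneg)
  have dle: "d \<le> dist x y" if "y \<in> C" for y using that by (simp add: d_def infdist_le)
  have "\<exists>y\<in>C. dist x y < d + 1 / real (Suc n)" for n
  proof (rule ccontr)
    assume "\<not> ?thesis"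
    hence "d + 1 / real (Suc n) \<le> infdist x C"
      using C(3) by (auto simp: infdist_def not_less intro!: cINF_greatest)
    thus False by (simp add: d_def)
  qed
  then obtain y where y: "\<And>n. y n \<in> C" "\<And>n. dist x (y n) < d + 1 / real (Suc n)" by metis
  have par: "(dist u v)\<^sup>2 \<le> 2 * (dist x u)\<^sup>2 + 2 * (dist x v)\<^sup>2 - 4 * d\<^sup>2"
    if "u \<in> C" "v \<in> C" for u v
  proof -
    have "(1/2) *\<^sub>R u + (1/2) *\<^sub>R v \<in> C" using C(2) that by (auto simp: convex_def)
    hence "d \<le> norm (x - ((1/2) *\<^sub>R u + (1/2) *\<^sub>R v))" using dle by (auto simp: dist_norm)
    hence "d\<^sup>2 \<le> (norm (x - ((1/2) *\<^sub>R u + (1/2) *\<^sub>R v)))\<^sup>2" using d0 by (intro power_mono)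
    moreover have "4 * (norm (x - ((1/2) *\<^sub>R u + (1/2) *\<^sub>R v)))\<^sup>2
        = 2 * (norm (x - u))\<^sup>2 + 2 * (norm (x - v))\<^sup>2 - (norm (u - v))\<^sup>2"
      by (simp add: power2_norm_eq_inner inner_diff inner_add inner_commute field_simps)
    ultimately show ?thesis by (simp add: dist_norm)
  qed
  have lim: "(\<lambda>n. (d + 1 / real (Suc n))\<^sup>2) \<longlonglongrightarrow> d\<^sup>2"
    using tendsto_power[OF tendsto_add[OF tendsto_const LIMSEQ_inverse_real_of_nat]]
    by (simp add: inverse_eq_divide)
  have "Cauchy y"
  proof (rule metric_CauchyI)
    fix e :: real assume e: "e > 0"
    have "eventually (\<lambda>n. (d + 1 / real (Suc n))\<^sup>2 < d\<^sup>2 + e\<^sup>2 / 4) sequentially"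
      using lim e by (intro order_tendstoD(2)[OF lim]) auto
    then obtain N where N: "\<And>n. n \<ge> N \<Longrightarrow> (d + 1 / real (Suc n))\<^sup>2 < d\<^sup>2 + e\<^sup>2 / 4"
      by (auto simp: eventually_sequentially)
    have s: "(dist x (y n))\<^sup>2 < d\<^sup>2 + e\<^sup>2 / 4" if "n \<ge> N" for n
      using N[OF that] power_mono[OF less_imp_le[OF y(2)[of n]], of 2] by simp
    have "dist (y m) (y n) < e" if "m \<ge> N" "n \<ge> N" for m n
    proof -
      have "(dist (y m) (y n))\<^sup>2 < e\<^sup>2"
        using par[OF y(1) y(1), of m n] s[OF that(1)] s[OF that(2)] by simp
      thus ?thesis using e by (simp add: power2_less_imp_less)
    qed
    thus "\<exists>N. \<forall>m\<ge>N. \<forall>n\<ge>N. dist (y m) (y n) < e" by blast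
  qed
  then obtain p where p: "y \<longlonglongrightarrow> p" using Cauchy_convergent[OF \<open>Cauchy y\<close>] unfolding convergent_def by blast
  have pC: "p \<in> C" using C(1) p y(1) closed_sequentially by blast
  have "(\<lambda>n. dist x (y n)) \<longlonglongrightarrow> dist x p" by (intro tendsto_intros p)
  moreover have "(\<lambda>n. d + 1 / real (Suc n)) \<longlonglongrightarrow> d"
    using tendsto_add[OF tendsto_const LIMSEQ_inverse_real_of_nat, of d]
    by (simp add: inverse_eq_divide)
  ultimately have "dist x p \<le> d" using y(2) by (intro LIMSEQ_le) (auto intro: less_imp_le)
  hence min: "dist x p \<le> dist x z" if "z \<in> C" for z using dle[OF that] by simp
  have "inner (x - p) (z - p) \<le> 0" if z: "z \<in> C" for z
  proof (rule ccontr)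
    define i where "i = inner (x - p) (z - p)"
    define q where "q = inner (z - p) (z - p)"
    assume "\<not> ?thesis"
    hence i: "i > 0" by (simp add: i_def)
    have q: "q \<ge> 0" by (simp add: q_def)
    \<comment> \<open>For a step this short the quadratic term cannot outweigh the linear one; the
      summand 1 keeps the denominator positive without a case distinction.\<close>
    define t where "t = min 1 (i / (q + 1))"
    have t: "0 < t" "t \<le> 1" using i q by (auto simp: t_def)
    have "p + t *\<^sub>R (z - p) = (1 - t) *\<^sub>R p + t *\<^sub>R z" by (simp add: algebra_simps)
    also have "\<dots> \<in> C" using C(2) pC z t by (intro convexD) auto
    finally have "(norm (x - p))\<^sup>2 \<le> (norm (x - (p + t *\<^sub>R (z - p))))\<^sup>2"
      using min by (intro power_mono) (auto simp: dist_norm)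
    also have "\<dots> = (norm ((x - p) - t *\<^sub>R (z - p)))\<^sup>2" by (simp add: algebra_simps)
    also have "\<dots> = (norm (x - p))\<^sup>2 - 2 * t * i + t * t * q"
      unfolding power2_norm_eq_inner i_def q_def
      by (simp add: inner_diff_left inner_diff_right inner_commute algebra_simps)
    finally have "2 * t * i \<le> t * t * q" by simp
    hence "2 * i \<le> t * q" using t by (simp add: mult.assoc)
    moreover have "t * q \<le> (i / (q + 1)) * q" using q by (intro mult_right_mono) (auto simp: t_def)
    moreover have "(i / (q + 1)) * q \<le> i" using i q by (simp add: field_simps)
    ultimately show False using i by simp
  qed
  thus ?thesis using pC by blast
qed

text \<open>In a subspace both \<open>p + y\<close> and \<open>p - y\<close> are competitors, so the
  variational inequality becomes an equality.\<close>

lemma projection_subspace: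
  fixes G :: "'a::{real_inner,complete_space} set"
  assumes "closed G" "subspace G"
  shows "\<exists>p\<in>G. \<forall>y\<in>G. inner (x - p) y = 0"
proof -
  obtain p where p: "p \<in> G" "\<And>y. y \<in> G \<Longrightarrow> inner (x - p) (y - p) \<le> 0"
    using closest_point_convex[OF assms(1) subspace_imp_convex[OF assms(2)], of x]
      subspace_0[OF assms(2)] by blast
  have "inner (x - p) y = 0" if "y \<in> G" for y
    using p(2)[of "p + y"] p(2)[of "p - y"] p(1) that assms(2)
    by (auto simp: subspace_add subspace_diff)
  thus ?thesis using p(1) by blast
qed

lemma subspace_closure:
  fixes G :: "'a::real_normed_vector set"
  assumes "subspace G"
  shows "subspace (closure G)"
proof (rule subspaceI)
  show "0 \<in> closure G" using subspace_0[OF assms] closure_subset by blast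
next
  fix x y assume "x \<in> closure G" "y \<in> closure G"
  then obtain u v where "\<forall>n. u n \<in> G" "u \<longlonglongrightarrow> x" "\<forall>n. v n \<in> G" "v \<longlonglongrightarrow> y"
    unfolding closure_sequential by blast
  thus "x + y \<in> closure G"
    unfolding closure_sequential
    by (intro exI[of _ "\<lambda>n. u n + v n"]) (auto intro: tendsto_add subspace_add[OF assms])
next
  fix c x assume "x \<in> closure G"
  then obtain u where "\<forall>n. u n \<in> G" "u \<longlonglongrightarrow> x"
    unfolding closure_sequential by blast
  thus "c *\<^sub>R x \<in> closure G"
    unfolding closure_sequential
    by (intro exI[of _ "\<lambda>n. c *\<^sub>R u n"]) (auto intro: tendsto_scaleR subspace_scale[OF assms])
qed

lemma closure_eq_UNIV_if_orthogonal_trivial: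
  fixes G :: "'a::{real_inner,complete_space} set"
  assumes "subspace G" "\<And>z. (\<And>x. x \<in> G \<Longrightarrow> inner x z = 0) \<Longrightarrow> z = 0"
  shows "closure G = UNIV"
proof -
  have "x \<in> closure G" for x
  proof -
    obtain p where p: "p \<in> closure G" "\<forall>y\<in>closure G. inner (x - p) y = 0"
      using projection_subspace[of "closure G" x] assms(1) by (auto simp: subspace_closure)
    have "x - p = 0" using p(2) closure_subset by (intro assms(2)) (auto simp: inner_commute)
    thus ?thesis using p(1) by simp
  qed
  thus ?thesis by auto
qed

text \<open>The functional is linear and bounded on \<open>G\<close> only. This form is meant for
  functionals on the graph of an unbounded operator, and the class is real because that graph is
  taken in a product of two state spaces.\<close>

lemma riesz_on_closed_subspace:
  fixes G :: "'a::{real_inner,complete_space} set" and f :: "'a \<Rightarrow> real"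
  assumes G: "closed G" "subspace G"
    and add: "\<And>x y. x \<in> G \<Longrightarrow> y \<in> G \<Longrightarrow> f (x + y) = f x + f y"
    and scale: "\<And>r x. x \<in> G \<Longrightarrow> f (r *\<^sub>R x) = r * f x"
    and bdd: "\<And>x. x \<in> G \<Longrightarrow> \<bar>f x\<bar> \<le> c * norm x"
  shows "\<exists>g\<in>G. \<forall>x\<in>G. f x = inner x g"
proof (cases "\<forall>x\<in>G. f x = 0")
  case True
  thus ?thesis using subspace_0[OF G(2)] by (intro bexI[of _ 0]) auto
next
  case False
  then obtain a where a: "a \<in> G" "f a \<noteq> 0" by blast
  have diff: "f (x - y) = f x - f y" if "x \<in> G" "y \<in> G" for x y
    using add[of x "(-1) *\<^sub>R y"] scale[of y "-1"] that subspace_scale[OF G(2), of y "-1"] by simp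
  define Z where "Z = {x \<in> G. f x = 0}"
  have sub: "subspace Z"
    using G(2) by (auto simp: Z_def subspace_def add scale intro: subspace_0) (use scale[of 0 0] subspace_0[OF G(2)] in auto)
  have "closed Z"
    unfolding closed_sequential_limits
  proof (intro allI impI)
    fix u l assume u: "(\<forall>n. u n \<in> Z) \<and> u \<longlonglongrightarrow> l"
    have lG: "l \<in> G" using u G(1) closed_sequentially[of G u l] by (auto simp: Z_def)
    have "\<bar>f l\<bar> \<le> c * norm (l - u n)" for n
      using bdd[of "l - u n"] diff[OF lG, of "u n"] u lG G(2) by (auto simp: Z_def subspace_diff)
    moreover have "(\<lambda>n. c * norm (l - u n)) \<longlonglongrightarrow> c * norm (l - l)" using u by (intro tendsto_intros) auto
    ultimately have "\<bar>f l\<bar> \<le> c * norm (l - l)" by (intro LIMSEQ_le[OF tendsto_const]) auto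
    thus "l \<in> Z" using lG by (simp add: Z_def)
  qed
  then obtain p where p: "p \<in> Z" "\<And>y. y \<in> Z \<Longrightarrow> inner (a - p) y = 0"
    using projection_subspace[of Z a] sub by blast
  define m where "m = a - p"
  have m: "m \<in> G" "f m = f a" using p(1) a G(2) diff by (auto simp: m_def Z_def subspace_diff)
  have m0: "m \<noteq> 0" using m a(2) scale[of 0 0] subspace_0[OF G(2)] by auto
  define g where "g = (f a / inner m m) *\<^sub>R m"
  have "f x = inner x g" if x: "x \<in> G" for x
  proof -
    have "x - (f x / f a) *\<^sub>R m \<in> Z"
      using x m a G(2) by (auto simp: Z_def diff scale subspace_diff subspace_scale)
    from p(2)[OF this] have "inner m x = (f x / f a) * inner m m"
      by (simp add: m_def[symmetric] inner_diff_right)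
    thus ?thesis using a(2) m0 by (simp add: g_def inner_commute)
  qed
  moreover have "g \<in> G" using m G(2) by (simp add: g_def subspace_scale)
  ultimately show ?thesis by blast
qed

text \<open>The vector representing the real part also yields the imaginary part, since f(i x) = i
  f(x).\<close>

lemma riesz_complex:
  fixes f :: "'a::complex_hilbert \<Rightarrow> complex"
  assumes add: "\<And>x y. f (x + y) = f x + f y" and scale: "\<And>c x. f (c *\<^sub>C x) = c * f x"
    and bdd: "\<And>x. cmod (f x) \<le> C * norm x"
  shows "\<exists>!w. \<forall>x. f x = cinner x w"
proof -
  have "\<exists>g\<in>UNIV. \<forall>x\<in>UNIV. Re (f x) = inner x g"
    by (rule riesz_on_closed_subspace[where c = C])
      (use abs_Re_le_cmod bdd in \<open>auto simp: add scale scaleR_eq_scaleC intro: order_trans\<close>)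
  then obtain w where w: "\<And>x. Re (f x) = inner x w" by auto
  have "Im (f x) = inner x (\<i> *\<^sub>C w)" for x
    using w[of "\<i> *\<^sub>C x"] by (simp add: scale inner_scaleC_i)
  hence "f x = cinner x w" for x using w by (simp add: complex_eq_iff cinner_eq_Complex)
  moreover have "v = w" if "\<forall>x. cinner x w = cinner x v" for v
    using that by (intro cinner_eqI_inner) (simp add: inner_eq_Re_cinner)
  ultimately show ?thesis by (intro ex1I[of _ w]) metis+
qed

subsection \<open>Adjoints of bounded operators\<close>

text \<open>The second component of \<open>op_adjoint\<close> for an everywhere defined operator;
  meaningful for bounded complex-linear \<open>T\<close>.\<close>

definition adj :: "('a::complex_hilbert \<Rightarrow> 'a) \<Rightarrow> 'a \<Rightarrow> 'a" where
  "adj T \<phi> = (THE w. \<forall>x. cinner (T x) \<phi> = cinner x w)"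

lemma cinner_adj:
  assumes "bounded_clinear T"
  shows "cinner (T x) \<phi> = cinner x (adj T \<phi>)"
proof -
  interpret bounded_linear T using assms by (simp add: bounded_clinear_def)
  obtain C where C: "\<And>x. norm (T x) \<le> norm x * C" using bounded by blast
  have "\<exists>!w. \<forall>x. cinner (T x) \<phi> = cinner x w"
  proof (rule riesz_complex)
    show "cmod (cinner (T x) \<phi>) \<le> (C * norm \<phi>) * norm x" for x
    proof -
      have "cmod (cinner (T x) \<phi>) \<le> norm (T x) * norm \<phi>" by (rule cmod_cinner_le)
      also have "\<dots> \<le> norm x * C * norm \<phi>" using C by (intro mult_right_mono) auto
      finally show ?thesis by (simp add: mult_ac)
    qed
  qed (use assms in \<open>auto simp: add cinner_add_left cinner_scaleC_left bounded_clinear_def\<close>)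
  from theI'[OF this] show ?thesis unfolding adj_def by (rule spec)
qed

lemma inner_adj: "bounded_clinear T \<Longrightarrow> inner (T x) \<phi> = inner x (adj T \<phi>)"
  by (simp add: inner_eq_Re_cinner cinner_adj)

lemma inner_adj': "bounded_clinear T \<Longrightarrow> inner (adj T \<phi>) x = inner \<phi> (T x)"
  by (metis inner_adj inner_commute)

lemma op_adjoint_UNIV: "snd (op_adjoint (UNIV, T)) = adj T"
  by (simp add: op_adjoint_def adj_def fun_eq_iff)

lemma norm_le_if_inner_le:
  fixes z :: "'a::real_inner"
  assumes "\<And>x. inner x z \<le> c * norm x" "c \<ge> 0"
  shows "norm z \<le> c"
proof (cases "z = 0")
  case False
  then show ?thesis using assms(1)[of z] by (simp add: power2_norm_eq_inner[symmetric] power2_eq_square)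
qed (use assms in simp)

lemma norm_adj_le:
  assumes T: "bounded_clinear T" and C: "\<And>x. norm (T x) \<le> C * norm x" "C \<ge> 0"
  shows "norm (adj T \<phi>) \<le> C * norm \<phi>"
proof -
  have "(norm (adj T \<phi>))\<^sup>2 = inner (T (adj T \<phi>)) \<phi>"
    using inner_adj[OF T] by (simp add: power2_norm_eq_inner)
  also have "\<dots> \<le> norm (T (adj T \<phi>)) * norm \<phi>" by (rule norm_cauchy_schwarz)
  also have "\<dots> \<le> C * norm (adj T \<phi>) * norm \<phi>" using C by (intro mult_right_mono) auto
  finally have "norm (adj T \<phi>) * norm (adj T \<phi>) \<le> norm (adj T \<phi>) * (C * norm \<phi>)"
    by (simp add: power2_eq_square mult_ac)
  thus ?thesis using C(2) by (cases "adj T \<phi> = 0") auto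
qed

lemma adj_add: "bounded_clinear T \<Longrightarrow> adj T (x + y) = adj T x + adj T y"
  by (rule cinner_eqI_inner) (simp add: inner_adj[symmetric] inner_add_right)

lemma adj_scaleC:
  assumes "bounded_clinear T"
  shows "adj T (c *\<^sub>C x) = c *\<^sub>C adj T x"
proof (rule cinner_eqI_inner)
  fix u
  show "inner u (adj T (c *\<^sub>C x)) = inner u (c *\<^sub>C adj T x)"
    by (simp add: inner_eq_Re_cinner cinner_adj[OF assms, symmetric] cinner_scaleC_right)
qed

lemma bounded_clinear_bound:
  assumes "bounded_clinear T"
  shows "\<exists>C\<ge>0. \<forall>x. norm (T x) \<le> C * norm x"
  using bounded_linear.nonneg_bounded[OF bounded_clinear_linear[OF assms]] by (metis mult.commute)

lemma bounded_clinear_adj: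
  assumes "bounded_clinear T"
  shows "bounded_clinear (adj T)"
proof -
  obtain C where C: "C \<ge> 0" "\<And>x. norm (T x) \<le> C * norm x" using bounded_clinear_bound[OF assms] by blast
  show ?thesis unfolding bounded_clinear_def
    using norm_adj_le[OF assms C(2) C(1)]
    by (auto intro!: bounded_linear_intro[of _ C]
        simp: adj_add[OF assms] adj_scaleC[OF assms] scaleR_eq_scaleC mult.commute)
qed

subsection \<open>Uniform boundedness\<close>

text \<open>The signs of \<open>c\<close> are chosen one after the other so that the diagonal term is never
  cancelled by the preceding ones, while the geometric decay keeps the following ones small.\<close>

lemma gliding_hump:
  fixes a :: "nat \<Rightarrow> nat \<Rightarrow> real"
  assumes L: "\<And>n k. \<bar>a n k\<bar> \<le> L n" "\<And>n. L n / 2 \<le> a n n" "\<And>n. 5 ^ n \<le> L n"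
  shows "\<exists>c. (\<forall>k. \<bar>c k\<bar> = (1/4) ^ k) \<and> (\<forall>M. \<exists>n. M < \<bar>\<Sum>k. c k * a n k\<bar>)"
proof -
  define P where "P f n r \<longleftrightarrow> \<bar>r\<bar> = (1/4) ^ n \<and> 0 \<le> r * a n n * (\<Sum>k<n. f k * a n k)" for f n r
  have "\<exists>c. \<forall>n. P c n (c n)"
  proof (rule dependent_wellorder_choice)
    fix r and f g :: "nat \<Rightarrow> real" and n :: nat
    assume "\<And>y. y < n \<Longrightarrow> f y = g y"
    hence "(\<Sum>k<n. f k * a n k) = (\<Sum>k<n. g k * a n k)" by (intro sum.cong) auto
    thus "P f n r = P g n r" by (simp add: P_def)
  next
    fix n and f :: "nat \<Rightarrow> real"
    show "\<exists>r. P f n r"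
    proof (cases "0 \<le> a n n * (\<Sum>k<n. f k * a n k)")
      case True
      then show ?thesis by (intro exI[of _ "(1/4)^n"]) (auto simp: P_def mult.assoc)
    next
      case False
      then show ?thesis by (intro exI[of _ "-((1/4)^n)"]) (auto simp: P_def mult.assoc mult_nonneg_nonpos)
    qed
  qed
  then obtain c where c: "\<And>n. \<bar>c n\<bar> = (1/4) ^ n"
    "\<And>n. 0 \<le> c n * a n n * (\<Sum>k<n. c k * a n k)" by (auto simp: P_def)
  have geo: "summable (\<lambda>k. (1/4) ^ k * L n :: real)" for n
    by (intro summable_mult2 summable_geometric) auto
  have le: "norm (c k * a n k) \<le> (1/4) ^ k * L n" for n k
    using L(1) by (simp add: abs_mult c(1))
  have summ: "summable (\<lambda>k. c k * a n k)" for n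
    by (rule summable_comparison_test'[OF geo le])
  \<comment> \<open>The diagonal term contributes at least half of \<open>(1/4) ^ n * L n\<close>
    and the tail at most a third of it, which leaves a sixth; the growth \<open>5 ^ n\<close> of
    \<open>L n\<close> beats the decay of the coefficients.\<close>
  have big: "(5/4) ^ n / 6 \<le> \<bar>\<Sum>k. c k * a n k\<bar>" for n
  proof -
    let ?s = "\<Sum>k<n. c k * a n k" and ?t = "\<Sum>k. c (k + Suc n) * a n (k + Suc n)"
    have "(\<Sum>k. c k * a n k) = ?t + (?s + c n * a n n)"
      using suminf_split_initial_segment[OF summ, of n "Suc n"] by simp
    moreover have "\<bar>?t\<bar> \<le> (1/4) ^ n * L n / 3"
    proof -
      have "norm ?t \<le> (\<Sum>k. (1/4) ^ (k + Suc n) * L n)"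
        by (rule norm_suminf_le[OF le summable_ignore_initial_segment[OF geo]])
      also have "\<dots> = (\<Sum>k. (1/4) ^ k * ((1/4) ^ Suc n * L n))"
        by (simp add: power_add mult_ac)
      also have "\<dots> = (\<Sum>k. (1/4) ^ k) * ((1/4) ^ Suc n * L n)"
        by (rule suminf_mult2[symmetric]) (auto intro: summable_geometric)
      also have "\<dots> = (1/4) ^ n * L n / 3" by (subst suminf_geometric) auto
      finally show ?thesis by simp
    qed
    moreover have "(1/4) ^ n * L n / 2 \<le> \<bar>?s + c n * a n n\<bar>"
    proof -
      have "\<bar>c n * a n n\<bar> \<le> \<bar>?s + c n * a n n\<bar>"
        using c(2)[of n] by (smt (verit) mult_nonneg_nonpos mult_less_0_iff zero_le_mult_iff)
      moreover have "(1/4) ^ n * (L n / 2) \<le> \<bar>c n * a n n\<bar>"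
        unfolding abs_mult c(1) using L(2)[of n] by (intro mult_left_mono) auto
      ultimately show ?thesis by simp
    qed
    moreover have "(5/4) ^ n \<le> (1/4) ^ n * L n"
      using mult_left_mono[OF L(3)[of n], of "(1/4)^n"] by (simp add: power_mult_distrib[symmetric])
    ultimately show ?thesis by linarith
  qed
  have "\<exists>n. M < \<bar>\<Sum>k. c k * a n k\<bar>" for M
    using real_arch_pow[of "5/4" "6 * M"] big by (auto intro: less_le_trans[OF _ big])
      (metis big less_le_trans linorder_not_less mult.commute mult_imp_less_div_pos zero_less_numeral)
  thus ?thesis using c(1) by blast
qed

text \<open>If the operator norms were unbounded, \<open>gliding_hump\<close> would give a
  convergent series of almost norming vectors at whose sum the family is unbounded. The inner
  product of the codomain reduces the vectors \<open>f (i n) (x k)\<close> to a real matrix by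
  pairing with unit vectors.\<close>

lemma uniform_boundedness:
  fixes f :: "'i \<Rightarrow> 'a::banach \<Rightarrow> 'b::real_inner"
  assumes lin: "\<And>i. i \<in> I \<Longrightarrow> bounded_linear (f i)"
    and pw: "\<And>x. \<exists>C. \<forall>i\<in>I. norm (f i x) \<le> C"
  shows "\<exists>C\<ge>0. \<forall>i\<in>I. \<forall>x. norm (f i x) \<le> C * norm x"
proof (rule ccontr)
  assume neg: "\<not> ?thesis"
  have "\<exists>i\<in>I. 5 ^ n \<le> onorm (f i)" for n
  proof (rule ccontr)
    assume *: "\<not> ?thesis"
    have "norm (f i x) \<le> 5 ^ n * norm x" if "i \<in> I" for i x
    proof -
      have "norm (f i x) \<le> onorm (f i) * norm x" using lin[OF that] by (rule onorm)
      also have "\<dots> \<le> 5 ^ n * norm x" using * that by (intro mult_right_mono) (auto simp: not_le intro: less_imp_le)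
      finally show ?thesis .
    qed
    thus False using neg by (auto dest!: spec[of _ "5 ^ n"])
  qed
  then obtain i where i: "\<And>n. i n \<in> I" "\<And>n. 5 ^ n \<le> onorm (f (i n))" by metis
  define L where "L n = onorm (f (i n))" for n
  have Lpos: "L n > 0" for n using i(2)[of n] by (simp add: L_def) (meson less_le_trans zero_less_numeral zero_less_power)
  have "\<exists>x. norm x = 1 \<and> L n / 2 \<le> norm (f (i n) x)" for n
  proof -
    interpret bounded_linear "f (i n)" using lin i(1) by blast
    have "\<exists>x. norm (f (i n) x) > L n / 2 * norm x"
    proof (rule ccontr)
      assume "\<not> ?thesis"
      hence "onorm (f (i n)) \<le> L n / 2" using Lpos[of n] by (intro onorm_bound) (auto simp: not_less)
      thus False using Lpos[of n] by (simp add: L_def)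
    qed
    then obtain x where x: "norm (f (i n) x) > L n / 2 * norm x" by blast
    hence "x \<noteq> 0" using zero by auto
    thus ?thesis using x by (intro exI[of _ "(1 / norm x) *\<^sub>R x"]) (auto simp: scaleR field_simps)
  qed
  then obtain x where x: "\<And>n. norm (x n) = 1" "\<And>n. L n / 2 \<le> norm (f (i n) (x n))" by metis
  \<comment> \<open>The direction of \<open>f (i n) (x n)\<close>; pairing with it makes the
    diagonal entry the full norm.\<close>
  define y where "y n = (1 / norm (f (i n) (x n))) *\<^sub>R f (i n) (x n)" for n
  have pos: "norm (f (i n) (x n)) > 0" for n using x(2)[of n] Lpos[of n] by linarith
  have y: "norm (y n) = 1" for n using pos[of n] by (simp add: y_def)
  define a where "a n k = inner (f (i n) (x k)) (y n)" for n k
  have "\<exists>c. (\<forall>k. \<bar>c k\<bar> = (1/4) ^ k) \<and> (\<forall>M. \<exists>n. M < \<bar>\<Sum>k. c k * a n k\<bar>)"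
  proof (rule gliding_hump[where L = L])
    show "\<bar>a n k\<bar> \<le> L n" for n k
    proof -
      have "\<bar>a n k\<bar> \<le> norm (f (i n) (x k)) * norm (y n)" unfolding a_def by (rule Cauchy_Schwarz_ineq2)
      also have "\<dots> \<le> L n" using onorm[OF lin[OF i(1)], of n "x k"] by (simp add: y x L_def)
      finally show ?thesis .
    qed
    show "L n / 2 \<le> a n n" for n
      using x(2)[of n] pos[of n] by (simp add: a_def y_def power2_norm_eq_inner[symmetric] power2_eq_square)
    show "5 ^ n \<le> L n" for n using i(2) by (simp add: L_def)
  qed
  then obtain c where c: "\<And>k. \<bar>c k\<bar> = (1/4) ^ k" "\<And>M. \<exists>n. M < \<bar>\<Sum>k. c k * a n k\<bar>" by blast
  have summ: "summable (\<lambda>k. c k *\<^sub>R x k)"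
    by (rule summable_norm_cancel) (use summable_geometric[of "1/4::real"] in \<open>simp add: c x\<close>)
  define z where "z = (\<Sum>k. c k *\<^sub>R x k)"
  obtain C where C: "\<And>j. j \<in> I \<Longrightarrow> norm (f j z) \<le> C" using pw[of z] by blast
  have "\<bar>\<Sum>k. c k * a n k\<bar> \<le> C" for n
  proof -
    interpret bounded_linear "f (i n)" using lin i(1) by blast
    have bl: "bounded_linear (\<lambda>v. inner (f (i n) v) (y n))"
      by (intro bounded_linear_inner_left_comp) (rule bounded_linear_axioms)
    have "inner (f (i n) z) (y n) = (\<Sum>k. inner (f (i n) (c k *\<^sub>R x k)) (y n))"
      unfolding z_def using bounded_linear.suminf[OF bl summ] .
    also have "\<dots> = (\<Sum>k. c k * a n k)" by (simp add: a_def scaleR)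
    finally have "\<bar>\<Sum>k. c k * a n k\<bar> \<le> norm (f (i n) z) * norm (y n)"
      using Cauchy_Schwarz_ineq2[of "f (i n) z" "y n"] by simp
    thus ?thesis using C[OF i(1), of n] by (simp add: y)
  qed
  thus False using c(2)[of C] by (auto simp: not_less[symmetric])
qed


subsection \<open>Strongly continuous semigroups\<close>

text \<open>Caratheodory's description of the derivative: a factor \<open>g\<close> converging at
  \<open>t\<close> takes the place of difference quotients. This suits semigroups, where increments
  to the left and to the right factor through different times.\<close>

lemma has_vector_derivativeI_slope:
  fixes f :: "real \<Rightarrow> 'a::real_normed_vector"
  assumes "\<And>s. s \<in> X \<Longrightarrow> f s - f t = (s - t) *\<^sub>R g s" "(g \<longlongrightarrow> d) (at t within X)"
  shows "(f has_vector_derivative d) (at t within X)"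
  unfolding has_vector_derivative_def has_derivative_within
proof
  show "bounded_linear (\<lambda>x. x *\<^sub>R d)" by (rule bounded_linear_scaleR_left)
  have "((\<lambda>s. norm (g s - d)) \<longlongrightarrow> 0) (at t within X)"
    using assms(2) by (intro tendsto_norm_zero) (simp add: LIM_zero)
  moreover have "\<forall>\<^sub>F s in at t within X. norm ((1 / norm (s - t)) *\<^sub>R (f s - (f t + (s - t) *\<^sub>R d))) \<le> norm (g s - d)"
    unfolding eventually_at_filter
  proof (intro always_eventually allI impI)
    fix s assume "s \<noteq> t" "s \<in> X"
    hence "f s - (f t + (s - t) *\<^sub>R d) = (s - t) *\<^sub>R (g s - d)"
      using assms(1)[of s] by (simp add: algebra_simps)
    thus "norm ((1 / norm (s - t)) *\<^sub>R (f s - (f t + (s - t) *\<^sub>R d))) \<le> norm (g s - d)"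
      using \<open>s \<noteq> t\<close> by simp
  qed
  ultimately show "((\<lambda>y. (1 / norm (y - t)) *\<^sub>R (f y - (f t + (y - t) *\<^sub>R d))) \<longlongrightarrow> 0) (at t within X)"
    by (rule Lim_null_comparison[rotated])
qed

lemma at_within_atLeast: "at (0::real) within {0..} = at_right 0"
proof -
  have "{0..} - {0} = {0<..} - {0::real}" by auto
  thus ?thesis by (simp add: at_within_def)
qed

lemma c0_linear: "c0_semigroup S \<Longrightarrow> t \<ge> 0 \<Longrightarrow> bounded_linear (S t)"
  by (simp add: c0_semigroup_def bounded_clinear_def)

lemma c0_continuous_0:
  assumes "c0_semigroup S"
  shows "continuous (at 0 within {0..}) (\<lambda>h. S h x)"
  using assms by (simp add: continuous_within at_within_atLeast c0_semigroup_def)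

lemma c0_seq_0:
  assumes "c0_semigroup S" "\<And>n. h n \<ge> 0" "h \<longlonglongrightarrow> 0"
  shows "(\<lambda>n. S (h n) x) \<longlonglongrightarrow> x"
  using c0_continuous_0[OF assms(1), of x] assms
  unfolding continuous_within_sequentially by (auto simp: o_def c0_semigroup_def)

lemma c0_add: "c0_semigroup S \<Longrightarrow> s \<ge> 0 \<Longrightarrow> t \<ge> 0 \<Longrightarrow> S (s + t) x = S s (S t x)"
  by (simp add: c0_semigroup_def)

lemma c0_zero: "c0_semigroup S \<Longrightarrow> S 0 x = x"
  by (simp add: c0_semigroup_def)

lemma c0_scaleC: "c0_semigroup S \<Longrightarrow> t \<ge> 0 \<Longrightarrow> S t (c *\<^sub>C x) = c *\<^sub>C S t x"
  by (simp add: c0_semigroup_def bounded_clinear_def)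

text \<open>Along times tending to 0 every orbit is bounded, so uniform boundedness excludes blow-up
  near 0; the semigroup law carries the bound to every bounded interval. The bound is kept at least
  1 so that its powers increase.\<close>

lemma c0_bound:
  fixes S :: "real \<Rightarrow> 'a::complex_hilbert \<Rightarrow> 'a"
  assumes S: "c0_semigroup S"
  shows "\<exists>M\<ge>1. \<forall>t\<in>{0..\<tau>}. \<forall>x. norm (S t x) \<le> M * norm x"
proof -
  have "\<exists>\<delta>>0. \<exists>C. \<forall>t\<in>{0..\<delta>}. \<forall>x. norm (S t x) \<le> C * norm x"
  proof (rule ccontr)
    assume neg: "\<not> ?thesis"
    have "\<exists>t x. 0 \<le> t \<and> t \<le> 1 / real (Suc n) \<and> norm (S t x) > real n * norm x" for n
    proof (rule ccontr)
      assume "\<not> ?thesis"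
      hence "\<forall>t\<in>{0..1 / real (Suc n)}. \<forall>x. norm (S t x) \<le> real n * norm x" by (auto simp: not_less)
      moreover have "1 / real (Suc n) > 0" by simp
      ultimately show False using neg by blast
    qed
    then obtain t x where t: "\<And>n. 0 \<le> t n" "\<And>n. t n \<le> 1 / real (Suc n)"
      and x: "\<And>n. norm (S (t n) (x n)) > real n * norm (x n)" by metis
    have "(\<lambda>n. 1 / real (Suc n)) \<longlonglongrightarrow> 0"
      using LIMSEQ_inverse_real_of_nat by (simp add: inverse_eq_divide)
    hence t0: "t \<longlonglongrightarrow> 0" by (rule tendsto_sandwich[rotated 3]) (use t in auto)
    have "\<exists>C\<ge>0. \<forall>n\<in>UNIV. \<forall>x. norm (S (t n) x) \<le> C * norm x"
    proof (rule uniform_boundedness)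
      fix x
      have "Bseq (\<lambda>n. S (t n) x)"
        using c0_seq_0[OF S t(1) t0, of x] by (intro convergent_imp_Bseq convergentI)
      thus "\<exists>C. \<forall>n\<in>UNIV. norm (S (t n) x) \<le> C" by (auto simp: Bseq_def)
    qed (use c0_linear[OF S] t in auto)
    then obtain C where C: "\<And>n x. norm (S (t n) x) \<le> C * norm x" by blast
    obtain n where "C < real n" using reals_Archimedean2 by blast
    hence "C * norm (x n) \<le> real n * norm (x n)" by (intro mult_right_mono) auto
    thus False using C[of n "x n"] x[of n] by linarith
  qed
  then obtain \<delta> C where d: "\<delta> > 0" and C: "\<And>t x. 0 \<le> t \<Longrightarrow> t \<le> \<delta> \<Longrightarrow> norm (S t x) \<le> C * norm x"
    by (auto simp: Ball_def)
  define M where "M = max 1 C"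
  have M: "M \<ge> 1" "norm (S t x) \<le> M * norm x" if "0 \<le> t" "t \<le> \<delta>" for t x
    using C[OF that, of x] mult_right_mono[of C M "norm x"] by (auto simp: M_def)
  have M1: "M \<ge> 1" by (simp add: M_def)
  have *: "norm (S t x) \<le> M ^ Suc n * norm x" if "0 \<le> t" "t \<le> real (Suc n) * \<delta>" for n t x
    using that
  proof (induction n arbitrary: t)
    case 0
    then show ?case using M(2)[of t x] by simp
  next
    case (Suc n)
    show ?case
    proof (cases "t \<le> \<delta>")
      case True
      have "M * norm x \<le> M ^ Suc (Suc n) * norm x"
        using self_le_power[OF M1, of "Suc (Suc n)"] by (intro mult_right_mono) auto
      with M(2)[OF Suc.prems(1) True, of x] show ?thesis by linarith
    next
      case False
      have "S t x = S \<delta> (S (t - \<delta>) x)" using c0_add[OF S, of \<delta> "t - \<delta>" x] False d by simp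
      also have "norm \<dots> \<le> M * norm (S (t - \<delta>) x)" using d by (intro M) auto
      also have "\<dots> \<le> M * (M ^ Suc n * norm x)"
        using Suc.prems False M1 by (intro mult_left_mono Suc.IH) (auto simp: algebra_simps)
      finally show ?thesis by (simp add: mult_ac)
    qed
  qed
  obtain n where "\<tau> / \<delta> < real n" using reals_Archimedean2 by blast
  hence "\<tau> \<le> real (Suc n) * \<delta>" using d by (simp add: field_simps)
  hence "\<forall>t\<in>{0..\<tau>}. \<forall>x. norm (S t x) \<le> M ^ Suc n * norm x" using * by auto
  thus ?thesis using one_le_power[OF M1, of "Suc n"] by blast
qed

text \<open>Joint continuity in time and vector, in a form that composes with other continuous
  functions. An increment between two times is the operator of the earlier time applied to an
  increment at 0, so everything reduces to strong continuity at 0 and a local bound.\<close>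

lemma c0_continuous_on:
  fixes S :: "real \<Rightarrow> 'a::complex_hilbert \<Rightarrow> 'a" and g :: "'x::topological_space \<Rightarrow> 'a"
  assumes S: "c0_semigroup S" and f: "continuous_on X f" and g: "continuous_on X g"
    and nonneg: "\<And>u. u \<in> X \<Longrightarrow> f u \<ge> 0"
  shows "continuous_on X (\<lambda>u. S (f u) (g u))"
proof -
  have "continuous_on ({0..} \<times> UNIV) (\<lambda>p. S (fst p) (snd p))"
    unfolding continuous_on_sequentially
  proof (intro allI ballI impI)
    fix p and a :: "real \<times> 'a" assume a: "a \<in> {0..} \<times> UNIV" and p: "(\<forall>n. p n \<in> {0..} \<times> UNIV) \<and> p \<longlonglongrightarrow> a"
    define t x s y where "t = fst a" and "x = snd a" and "s n = fst (p n)" and "y n = snd (p n)" for n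
    have lim: "s \<longlonglongrightarrow> t" "y \<longlonglongrightarrow> x"
      using p unfolding s_def y_def t_def x_def by (auto intro: tendsto_fst tendsto_snd)
    have nn: "t \<ge> 0" "\<And>n. s n \<ge> 0" using a p unfolding s_def t_def by (auto simp: mem_Times_iff)
    obtain \<tau> where \<tau>: "\<And>n. norm (s n) \<le> \<tau>"
      using convergent_imp_Bseq[OF convergentI[OF lim(1)]] by (auto simp: Bseq_def)
    have \<tau>t: "t \<le> \<tau>" using \<tau> by (intro LIMSEQ_le_const2[OF lim(1)]) (auto intro: abs_le_D1)
    obtain M where M: "M \<ge> 1" "\<And>t x. 0 \<le> t \<Longrightarrow> t \<le> \<tau> \<Longrightarrow> norm (S t x) \<le> M * norm x"
      using c0_bound[OF S, of \<tau>] by auto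
    have key: "norm (S v x - S u x) \<le> M * norm (S (v - u) x - x)" if "0 \<le> u" "u \<le> v" "v \<le> \<tau>" for u v
    proof -
      interpret bounded_linear "S u" using c0_linear[OF S that(1)] .
      have "S v x - S u x = S u (S (v - u) x - x)"
        using c0_add[OF S, of u "v - u" x] that by (simp add: diff)
      thus ?thesis using M(2)[of u] that by auto
    qed
    have bd: "norm (S (s n) (y n) - S t x) \<le> M * norm (y n - x) + M * norm (S \<bar>s n - t\<bar> x - x)" for n
    proof -
      interpret bounded_linear "S (s n)" using c0_linear[OF S nn(2)] .
      have sn: "s n \<le> \<tau>" using \<tau>[of n] by simp
      have "norm (S (s n) x - S t x) \<le> M * norm (S \<bar>s n - t\<bar> x - x)"
        using key[of "s n" t] key[of t "s n"] nn \<tau>t sn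
        by (cases "t \<le> s n") (auto simp: norm_minus_commute)
      moreover have "norm (S (s n) (y n) - S (s n) x) \<le> M * norm (y n - x)"
        using M(2)[OF nn(2) sn, of "y n - x"] by (simp add: diff)
      ultimately show ?thesis
        using norm_triangle_ineq[of "S (s n) (y n) - S (s n) x" "S (s n) x - S t x"] by simp
    qed
    have "(\<lambda>n. S \<bar>s n - t\<bar> x) \<longlonglongrightarrow> x"
      by (rule c0_seq_0[OF S]) (auto intro!: tendsto_rabs_zero simp: LIM_zero lim)
    hence "(\<lambda>n. M * norm (y n - x) + M * norm (S \<bar>s n - t\<bar> x - x)) \<longlonglongrightarrow> M * norm (x - x) + M * norm (x - x)"
      by (intro tendsto_intros lim)
    hence "(\<lambda>n. M * norm (y n - x) + M * norm (S \<bar>s n - t\<bar> x - x)) \<longlonglongrightarrow> 0" by simp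
    from Lim_null_comparison[OF always_eventually[OF allI[OF bd]] this]
    have "(\<lambda>n. S (s n) (y n)) \<longlonglongrightarrow> S t x" by (simp only: LIM_zero_iff)
    thus "((\<lambda>p. S (fst p) (snd p)) \<circ> p) \<longlonglongrightarrow> S (fst a) (snd a)"
      by (simp add: o_def s_def y_def t_def x_def)
  qed
  from continuous_on_compose2[OF this continuous_on_Pair[OF f g]] show ?thesis using nonneg by auto
qed

text \<open>The smoothing used throughout: averages of an orbit lie in the domain of the generator
  and tend to \<open>x\<close> as \<open>h\<close> tends to 0.\<close>

definition orbit_mean :: "(real \<Rightarrow> 'a::complex_hilbert \<Rightarrow> 'a) \<Rightarrow> real \<Rightarrow> 'a \<Rightarrow> 'a" where
  "orbit_mean S h x = (1 / h) *\<^sub>R integral {0..h} (\<lambda>s. S s x)"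

lemma c0_orbit_integrable:
  assumes "c0_semigroup S" "a \<ge> 0"
  shows "(\<lambda>s. S s x) integrable_on {a..b}"
  by (intro integrable_continuous_interval c0_continuous_on[OF assms(1)] continuous_intros)
    (use assms in auto)

lemma bounded_clinear_orbit_mean:
  fixes S :: "real \<Rightarrow> 'a::complex_hilbert \<Rightarrow> 'a"
  assumes S: "c0_semigroup S" and h: "h > 0"
  shows "bounded_clinear (orbit_mean S h)"
proof -
  obtain M where M: "M \<ge> 1" "\<And>t x. 0 \<le> t \<Longrightarrow> t \<le> h \<Longrightarrow> norm (S t x) \<le> M * norm x"
    using c0_bound[OF S, of h] by auto
  note int = c0_orbit_integrable[OF S, of 0]
  have cx: "orbit_mean S h (c *\<^sub>C x) = c *\<^sub>C orbit_mean S h x" for c x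
  proof -
    have "integral {0..h} (\<lambda>s. S s (c *\<^sub>C x)) = integral {0..h} ((\<lambda>y. c *\<^sub>C y) \<circ> (\<lambda>s. S s x))"
      by (intro integral_cong) (simp add: c0_scaleC[OF S])
    also have "\<dots> = c *\<^sub>C integral {0..h} (\<lambda>s. S s x)"
      by (intro integral_linear int bounded_linear_scaleC) simp
    finally show ?thesis by (simp add: orbit_mean_def scaleC_scaleR)
  qed
  have "bounded_linear (orbit_mean S h)"
  proof (rule bounded_linear_intro[of _ M])
    fix x y
    have "integral {0..h} (\<lambda>s. S s (x + y)) = integral {0..h} (\<lambda>s. S s x + S s y)"
      by (intro integral_cong) (simp add: linear_simps[OF c0_linear[OF S]])
    also have "\<dots> = integral {0..h} (\<lambda>s. S s x) + integral {0..h} (\<lambda>s. S s y)"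
      by (intro integral_add int) auto
    finally show "orbit_mean S h (x + y) = orbit_mean S h x + orbit_mean S h y"
      by (simp add: orbit_mean_def scaleR_add_right)
    have "norm (integral {0..h} (\<lambda>s. S s x)) \<le> (M * norm x) * (h - 0)"
      by (rule integral_bound) (use h M in \<open>auto intro!: c0_continuous_on[OF S] continuous_intros\<close>)
    thus "norm (orbit_mean S h x) \<le> norm x * M" using h by (simp add: orbit_mean_def field_simps)
  qed (simp add: scaleR_eq_scaleC cx)
  thus ?thesis by (simp add: bounded_clinear_def cx)
qed

lemma orbit_mean_tendsto:
  assumes S: "c0_semigroup S"
  shows "((\<lambda>h. orbit_mean S h x) \<longlongrightarrow> x) (at_right 0)"
proof -
  have "((\<lambda>u. integral {0..u} (\<lambda>s. S s x)) has_vector_derivative S 0 x) (at 0 within {0..1})"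
    by (rule integral_has_vector_derivative) (auto intro!: c0_continuous_on[OF S] continuous_intros)
  hence "((\<lambda>u. (1 / norm (u - 0)) *\<^sub>R (integral {0..u} (\<lambda>s. S s x) - (integral {0..0} (\<lambda>s. S s x) + (u - 0) *\<^sub>R S 0 x))) \<longlongrightarrow> 0)
     (at 0 within {0..1})"
    unfolding has_vector_derivative_def has_derivative_within by blast
  hence "((\<lambda>u. (1 / norm (u - 0)) *\<^sub>R (integral {0..u} (\<lambda>s. S s x) - (integral {0..0} (\<lambda>s. S s x) + (u - 0) *\<^sub>R S 0 x))) \<longlongrightarrow> 0)
     (at_right 0)"
    unfolding at_within_Icc_at_right[OF zero_less_one] .
  moreover have "\<forall>\<^sub>F u in at_right 0. (1 / norm (u - 0)) *\<^sub>R (integral {0..u} (\<lambda>s. S s x) - (integral {0..0} (\<lambda>s. S s x) + (u - 0) *\<^sub>R S 0 x))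
      = orbit_mean S u x - x"
    by (auto simp: eventually_at_filter orbit_mean_def c0_zero[OF S] algebra_simps)
  ultimately have "((\<lambda>u. orbit_mean S u x - x) \<longlongrightarrow> 0) (at_right 0)" by (simp add: filterlim_cong)
  thus ?thesis by (simp add: LIM_zero_iff)
qed

section \<open>The generator, its domain and the derivative of orbits\<close>

locale generator =
  fixes A :: "'a::complex_hilbert unbdd_op" and S :: "real \<Rightarrow> 'a \<Rightarrow> 'a"
  assumes gen: "generates A S"
begin

lemma c0: "c0_semigroup S" using gen by (simp add: generates_def)

lemmas S_linear = c0_linear[OF c0] and S_continuous = c0_continuous_on[OF c0]
  and S_add = c0_add[OF c0] and S_0 = c0_zero[OF c0] and S_scaleC = c0_scaleC[OF c0]

lemma S_bcl: "t \<ge> 0 \<Longrightarrow> bounded_clinear (S t)" using c0 by (simp add: c0_semigroup_def)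

lemma A_tendsto: "x \<in> fst A \<Longrightarrow> ((\<lambda>t. (1 / t) *\<^sub>R (S t x - x)) \<longlongrightarrow> snd A x) (at_right 0)"
  using gen by (simp add: generates_def)

lemma A_eqI:
  assumes "((\<lambda>t. (1 / t) *\<^sub>R (S t x - x)) \<longlongrightarrow> y) (at_right 0)"
  shows "x \<in> fst A" "snd A x = y"
proof -
  show *: "x \<in> fst A" using assms gen by (auto simp: generates_def)
  show "snd A x = y" using A_tendsto[OF *] assms by (rule tendsto_unique[OF trivial_limit_at_right_real])
qed

lemma A_scaleC: assumes "x \<in> fst A" shows "c *\<^sub>C x \<in> fst A" "snd A (c *\<^sub>C x) = c *\<^sub>C snd A x"
proof -
  have ev: "\<forall>\<^sub>F t in at_right 0. c *\<^sub>C ((1 / t) *\<^sub>R (S t x - x)) = (1 / t) *\<^sub>R (S t (c *\<^sub>C x) - (c *\<^sub>C x))"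
    unfolding eventually_at_filter
    by (intro always_eventually allI impI) (simp add: S_scaleC scaleC_scaleR scaleC_diff_right)
  show "c *\<^sub>C x \<in> fst A" "snd A (c *\<^sub>C x) = c *\<^sub>C snd A x"
    using Lim_transform_eventually[OF bounded_linear.tendsto[OF bounded_linear_scaleC A_tendsto[OF assms]] ev]
    by (auto dest: A_eqI)
qed

lemma A_S: assumes x: "x \<in> fst A" and t: "t \<ge> 0" shows "S t x \<in> fst A" "snd A (S t x) = S t (snd A x)"
proof -
  interpret bounded_linear "S t" using t by (rule S_linear)
  have ev: "\<forall>\<^sub>F h in at_right 0. S t ((1 / h) *\<^sub>R (S h x - x)) = (1 / h) *\<^sub>R (S h (S t x) - S t x)"
    unfolding eventually_at_filter
  proof (intro always_eventually allI impI)
    fix h :: real assume "h \<in> {0<..}"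
    hence "S h (S t x) = S t (S h x)" using S_add[of h t x] S_add[of t h x] t by (simp add: add.commute)
    thus "S t ((1 / h) *\<^sub>R (S h x - x)) = (1 / h) *\<^sub>R (S h (S t x) - S t x)" by (simp add: diff scaleR)
  qed
  show "S t x \<in> fst A" "snd A (S t x) = S t (snd A x)"
    using Lim_transform_eventually[OF tendsto[OF A_tendsto[OF x]] ev] by (auto dest: A_eqI)
qed

text \<open>The difference quotient completed by its limit at 0. For \<open>x\<close> in the domain
  it is continuous on all of \<open>{0..}\<close> and can serve as a Caratheodory factor.\<close>

definition quot :: "'a \<Rightarrow> real \<Rightarrow> 'a" where
  "quot x h = (if h = 0 then snd A x else (1 / h) *\<^sub>R (S h x - x))"

lemma quot_eq: "h *\<^sub>R quot x h = S h x - x"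
  by (simp add: quot_def S_0)

lemma quot_0: "quot x 0 = snd A x"
  by (simp add: quot_def)

lemma quot_continuous:
  assumes "x \<in> fst A" shows "continuous_on {0..} (quot x)"
  unfolding continuous_on_eq_continuous_within
proof
  fix t :: real assume t: "t \<in> {0..}"
  show "continuous (at t within {0..}) (quot x)"
  proof (cases "t = 0")
    case True
    have "\<forall>\<^sub>F h in at_right 0. (1 / h) *\<^sub>R (S h x - x) = quot x h"
      unfolding eventually_at_filter by (simp add: quot_def)
    from Lim_transform_eventually[OF A_tendsto[OF assms] this]
    show ?thesis by (simp add: True continuous_within at_within_atLeast quot_0)
  next
    case False
    hence t0: "t > 0" using t by simp
    have "continuous_on {0<..} (\<lambda>h. (1 / h) *\<^sub>R (S h x - x))"
      by (intro continuous_intros S_continuous) auto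
    hence "continuous_on {0<..} (quot x)"
      by (rule continuous_on_eq) (auto simp: quot_def)
    hence "isCont (quot x) t" using t0 by (simp add: continuous_on_eq_continuous_at)
    thus ?thesis by (rule continuous_at_imp_continuous_at_within)
  qed
qed

text \<open>Factoring out the earlier of the two times gives one formula for increments in both
  directions; with \<open>quot_continuous\<close> it yields the derivative of an orbit from both
  sides.\<close>

lemma S_slope:
  assumes "0 \<le> s" "0 \<le> t"
  shows "S s x - S t x = (s - t) *\<^sub>R S (min s t) (quot x \<bar>s - t\<bar>)"
proof -
  interpret bounded_linear "S (min s t)" using assms by (intro S_linear) auto
  have "S (max s t) x = S (min s t) (S \<bar>s - t\<bar> x)"
    using S_add[of s "t - s" x] S_add[of t "s - t" x] assms by (cases "s \<le> t") (auto simp: max_def min_def S_0)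
  hence "S (max s t) x - S (min s t) x = \<bar>s - t\<bar> *\<^sub>R S (min s t) (quot x \<bar>s - t\<bar>)"
    by (simp add: scaleR[symmetric] quot_eq diff)
  thus ?thesis by (cases "s \<le> t") (auto simp: max_def min_def algebra_simps)
qed

lemma S_derivative:
  assumes x: "x \<in> fst A" and t: "t \<ge> 0"
  shows "((\<lambda>s. S s x) has_vector_derivative S t (snd A x)) (at t within {0..})"
proof (rule has_vector_derivativeI_slope[where g = "\<lambda>s. S (min s t) (quot x \<bar>s - t\<bar>)"])
  have "continuous_on {0..} (\<lambda>s. S (min s t) (quot x \<bar>s - t\<bar>))"
    using t by (intro S_continuous continuous_on_compose2[OF quot_continuous[OF x]] continuous_intros) auto
  thus "((\<lambda>s. S (min s t) (quot x \<bar>s - t\<bar>)) \<longlongrightarrow> S t (snd A x)) (at t within {0..})"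
    using t by (auto simp: continuous_on_def quot_0 dest!: bspec[of _ _ t])
qed (use S_slope t in auto)

lemma integral_S_A:
  assumes x: "x \<in> fst A" and h: "h \<ge> 0"
  shows "integral {0..h} (\<lambda>s. S s (snd A x)) = S h x - x"
proof -
  have "((\<lambda>s. S s (snd A x)) has_integral (S h x - S 0 x)) {0..h}"
    by (rule fundamental_theorem_of_calculus[OF h])
      (auto intro: has_vector_derivative_within_subset[OF S_derivative[OF x]])
  thus ?thesis by (simp add: S_0 integral_unique)
qed

lemma orbit_mean_in_domain:
  assumes h: "h > 0"
  shows "orbit_mean S h x \<in> fst A" "snd A (orbit_mean S h x) = (1 / h) *\<^sub>R (S h x - x)"
proof -
  define I where "I a b = integral {a..b} (\<lambda>s. S s x)" for a b
  note int = c0_orbit_integrable[OF c0]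
  have shift: "S t (I 0 h) = I t (t + h)" if "t \<ge> 0" for t
  proof -
    have "S t (I 0 h) = integral {0..h} (S t \<circ> (\<lambda>s. S s x))"
      unfolding I_def by (rule integral_linear[symmetric, OF int S_linear[OF that]]) simp
    also have "\<dots> = integral {0..h} ((\<lambda>s. S s x) \<circ> ((+) t))"
      by (intro integral_cong) (simp add: S_add that)
    also have "\<dots> = I t (t + h)"
      by (simp only: integral_shift_Icc_real I_def add.commute[of _ t] add_0_right)
    finally show ?thesis .
  qed
  \<comment> \<open>The integral over \<open>{0..t + h}\<close> is split at \<open>t\<close> and at
    \<open>h\<close>. This exchanges the roles of \<open>t\<close> and \<open>h\<close>, and the
    right-hand side divided by \<open>t\<close> has a known limit.\<close>
  have eq: "S t (I 0 h) - I 0 h = S h (I 0 t) - I 0 t" if "t > 0" for t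
  proof -
    have "I 0 t + I t (t + h) = I 0 h + I h (t + h)"
      unfolding I_def using Henstock_Kurzweil_Integration.integral_combine[OF _ _ int[of 0 x "t + h"], of t]
        Henstock_Kurzweil_Integration.integral_combine[OF _ _ int[of 0 x "t + h"], of h] that h by simp
    moreover have "S h (I 0 t) = I h (t + h)"
    proof -
      have "S h (I 0 t) = integral {0..t} (S h \<circ> (\<lambda>s. S s x))"
        unfolding I_def by (rule integral_linear[symmetric, OF int S_linear]) (use h in auto)
      also have "\<dots> = integral {0..t} ((\<lambda>s. S s x) \<circ> ((+) h))"
        by (intro integral_cong) (use h in \<open>simp add: S_add\<close>)
      also have "\<dots> = I h (t + h)"
        by (simp only: integral_shift_Icc_real I_def) simp
      finally show ?thesis .
    qed
    ultimately show ?thesis using shift[of t] that by (simp add: algebra_simps)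
  qed
  have bl: "bounded_linear (\<lambda>y. (1 / h) *\<^sub>R (S h y - y))"
    using S_linear[of h] h by (intro bounded_linear_intros) auto
  have ev: "\<forall>\<^sub>F t in at_right 0. (1 / h) *\<^sub>R (S h (orbit_mean S t x) - orbit_mean S t x)
      = (1 / t) *\<^sub>R (S t (orbit_mean S h x) - orbit_mean S h x)"
    unfolding eventually_at_filter
  proof (intro always_eventually allI impI)
    fix t :: real assume "t \<in> {0<..}"
    hence t: "t > 0" by simp
    have "(1 / h) *\<^sub>R (S h (orbit_mean S t x) - orbit_mean S t x) = (1 / (h * t)) *\<^sub>R (S h (I 0 t) - I 0 t)"
      using h by (simp add: orbit_mean_def I_def linear_simps[OF S_linear] scaleR_diff_right)
    moreover have "(1 / t) *\<^sub>R (S t (orbit_mean S h x) - orbit_mean S h x) = (1 / (h * t)) *\<^sub>R (S t (I 0 h) - I 0 h)"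
      using t by (simp add: orbit_mean_def I_def linear_simps[OF S_linear] scaleR_diff_right mult.commute)
    ultimately show "(1 / h) *\<^sub>R (S h (orbit_mean S t x) - orbit_mean S t x)
      = (1 / t) *\<^sub>R (S t (orbit_mean S h x) - orbit_mean S h x)" using eq[OF t] by simp
  qed
  show "orbit_mean S h x \<in> fst A" "snd A (orbit_mean S h x) = (1 / h) *\<^sub>R (S h x - x)"
    using Lim_transform_eventually[OF bounded_linear.tendsto[OF bl orbit_mean_tendsto[OF c0]] ev]
    by (auto dest: A_eqI)
qed

lemma orbit_mean_A:
  assumes "x \<in> fst A" "h > 0"
  shows "orbit_mean S h (snd A x) = (1 / h) *\<^sub>R (S h x - x)"
  using integral_S_A[OF assms(1), of h] assms(2) by (simp add: orbit_mean_def)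

lemma dense: "closure (fst A) = UNIV"
proof -
  have "x \<in> closure (fst A)" for x
  proof (rule Lim_in_closed_set[of "closure (fst A)" "\<lambda>h. orbit_mean S h x" "at_right 0"])
    show "\<forall>\<^sub>F h in at_right 0. orbit_mean S h x \<in> closure (fst A)"
      unfolding eventually_at_filter using orbit_mean_in_domain(1) closure_subset
      by (intro always_eventually) blast
  qed (auto intro: orbit_mean_tendsto[OF c0])
  thus ?thesis by auto
qed

lemma eqI_on_domain:
  assumes "\<And>x. x \<in> fst A \<Longrightarrow> inner x v = inner x w" shows "v = w"
proof (rule cinner_eqI_inner)
  fix u
  have "u \<in> closure (fst A)" using dense by simp
  then obtain y where y: "\<And>n. y n \<in> fst A" "y \<longlonglongrightarrow> u" unfolding closure_sequential by blast
  have "(\<lambda>n. inner (y n) v) \<longlonglongrightarrow> inner u v" "(\<lambda>n. inner (y n) w) \<longlonglongrightarrow> inner u w"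
    by (intro tendsto_intros y)+
  thus "inner u v = inner u w" using assms y(1) LIMSEQ_unique by fastforce
qed

end


subsection \<open>The adjoint semigroup\<close>

context generator
begin

abbreviation "Ds \<equiv> fst (op_adjoint A)"
abbreviation "As \<equiv> snd (op_adjoint A)"
abbreviation "Sa t \<equiv> adj (S t)"

text \<open>The domain of \<open>A\<close> is closed under complex scalars, so the real parts of the
  defining identity already give the complex one, and its density makes \<open>w\<close>
  unique.\<close>

lemma adjointI:
  assumes "\<And>x. x \<in> fst A \<Longrightarrow> inner (snd A x) \<phi> = inner x w"
  shows "\<phi> \<in> Ds" "As \<phi> = w"
proof -
  have c: "cinner (snd A x) \<phi> = cinner x w" if x: "x \<in> fst A" for x
  proof -
    have "inner (snd A x) (\<i> *\<^sub>C \<phi>) = inner x (\<i> *\<^sub>C w)"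
      using assms[OF A_scaleC(1)[OF x, of \<i>]] A_scaleC(2)[OF x, of \<i>] by (simp add: inner_scaleC_i)
    thus ?thesis using assms[OF x] by (simp add: cinner_eq_Complex)
  qed
  thus "\<phi> \<in> Ds" by (auto simp: op_adjoint_def)
  have "(THE w. \<forall>x\<in>fst A. cinner (snd A x) \<phi> = cinner x w) = w"
  proof (rule the_equality)
    fix v assume v: "\<forall>x\<in>fst A. cinner (snd A x) \<phi> = cinner x v"
    show "v = w" by (rule eqI_on_domain) (use v c in \<open>auto simp: inner_eq_Re_cinner\<close>)
  qed (use c in auto)
  thus "As \<phi> = w" by (simp add: op_adjoint_def)
qed

lemma adjoint_inner:
  assumes \<phi>: "\<phi> \<in> Ds" and x: "x \<in> fst A"
  shows "inner (snd A x) \<phi> = inner x (As \<phi>)"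
proof -
  obtain w where w: "\<And>x. x \<in> fst A \<Longrightarrow> cinner (snd A x) \<phi> = cinner x w"
    using \<phi> by (auto simp: op_adjoint_def)
  hence i: "\<And>x. x \<in> fst A \<Longrightarrow> inner (snd A x) \<phi> = inner x w" by (simp add: inner_eq_Re_cinner)
  show ?thesis using i[OF x] adjointI(2)[OF i] by simp
qed

lemma Ds_add: assumes "x \<in> Ds" "y \<in> Ds" shows "x + y \<in> Ds" "As (x + y) = As x + As y"
  using adjointI[of "x + y" "As x + As y"] adjoint_inner assms by (auto simp: inner_add_right)

lemma Ds_scaleC: assumes "x \<in> Ds" shows "c *\<^sub>C x \<in> Ds" "As (c *\<^sub>C x) = c *\<^sub>C As x"
proof -
  have "inner (snd A y) (c *\<^sub>C x) = inner y (c *\<^sub>C As x)" if y: "y \<in> fst A" for y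
  proof -
    have "inner (cnj c *\<^sub>C snd A y) x = inner (cnj c *\<^sub>C y) (As x)"
      using adjoint_inner[OF assms A_scaleC(1)[OF y, of "cnj c"]] A_scaleC(2)[OF y, of "cnj c"] by simp
    thus ?thesis by (simp add: inner_eq_Re_cinner cinner_scaleC_left cinner_scaleC_right)
  qed
  from adjointI[OF this] show "c *\<^sub>C x \<in> Ds" "As (c *\<^sub>C x) = c *\<^sub>C As x" by auto
qed

lemma Ds_scaleR: "x \<in> Ds \<Longrightarrow> r *\<^sub>R x \<in> Ds" "x \<in> Ds \<Longrightarrow> As (r *\<^sub>R x) = r *\<^sub>R As x"
  by (simp_all add: scaleR_eq_scaleC Ds_scaleC)

lemma Ds_0: "0 \<in> Ds" "As 0 = 0"
  using adjointI[of 0 0] by auto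

lemma Ds_diff: assumes "x \<in> Ds" "y \<in> Ds" shows "x - y \<in> Ds" "As (x - y) = As x - As y"
  using Ds_add[OF assms(1) Ds_scaleR(1)[OF assms(2), of "-1"]] Ds_scaleR(2)[OF assms(2), of "-1"] by auto

lemma subspace_Ds: "subspace Ds"
  by (auto simp: subspace_def Ds_0 Ds_add Ds_scaleR)

lemma As_closed:
  assumes "\<And>n. \<phi> n \<in> Ds" "\<phi> \<longlonglongrightarrow> f" "(\<lambda>n. As (\<phi> n)) \<longlonglongrightarrow> w"
  shows "f \<in> Ds" "As f = w"
proof -
  have "inner (snd A x) f = inner x w" if "x \<in> fst A" for x
  proof -
    have "(\<lambda>n. inner (snd A x) (\<phi> n)) \<longlonglongrightarrow> inner (snd A x) f" "(\<lambda>n. inner x (As (\<phi> n))) \<longlonglongrightarrow> inner x w"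
      by (intro tendsto_intros assms)+
    thus ?thesis using adjoint_inner[OF assms(1) that] LIMSEQ_unique by fastforce
  qed
  from adjointI[OF this] show "f \<in> Ds" "As f = w" by auto
qed

lemma Sa_inner: "t \<ge> 0 \<Longrightarrow> inner (S t x) \<phi> = inner x (Sa t \<phi>)"
  by (rule inner_adj[OF S_bcl])

lemma Sa_Ds:
  assumes "\<phi> \<in> Ds" "t \<ge> 0"
  shows "Sa t \<phi> \<in> Ds" "As (Sa t \<phi>) = Sa t (As \<phi>)"
proof -
  have "inner (snd A x) (Sa t \<phi>) = inner x (Sa t (As \<phi>))" if "x \<in> fst A" for x
    using adjoint_inner[OF assms(1) A_S(1)[OF that assms(2)]] A_S(2)[OF that assms(2)] assms
    by (simp add: Sa_inner[symmetric])
  from adjointI[OF this] show "Sa t \<phi> \<in> Ds" "As (Sa t \<phi>) = Sa t (As \<phi>)" by auto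
qed

text \<open>The transposed averages smooth into the domain of the adjoint. They are available before
  the adjoint semigroup is known to be strongly continuous, and they yield the density of
  \<open>Ds\<close> on which that continuity rests.\<close>

lemma adj_orbit_mean_in_Ds:
  assumes h: "h > 0"
  shows "adj (orbit_mean S h) \<phi> \<in> Ds"
proof (rule adjointI(1))
  fix x assume x: "x \<in> fst A"
  have "inner (snd A x) (adj (orbit_mean S h) \<phi>) = inner (orbit_mean S h (snd A x)) \<phi>"
    by (rule inner_adj[OF bounded_clinear_orbit_mean[OF c0 h], symmetric])
  also have "\<dots> = inner x ((1 / h) *\<^sub>R (Sa h \<phi> - \<phi>))"
    using h by (simp add: orbit_mean_A[OF x h] inner_diff_left inner_diff_right Sa_inner)
  finally show "inner (snd A x) (adj (orbit_mean S h) \<phi>) = inner x ((1 / h) *\<^sub>R (Sa h \<phi> - \<phi>))" .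
qed

text \<open>The transposed averages converge weakly to the identity. The criterion serves to show
  that a vector vanishes when orthogonality is known for smooth vectors only.\<close>

lemma eq_0_if_orthogonal_adj_orbit_mean:
  assumes "\<And>h. h > 0 \<Longrightarrow> inner (adj (orbit_mean S h) z) z = 0"
  shows "z = 0"
proof -
  have "\<forall>\<^sub>F h in at_right 0. inner (orbit_mean S h z) z = 0"
    unfolding eventually_at_filter
    using assms inner_adj[OF bounded_clinear_orbit_mean[OF c0]]
    by (intro always_eventually) (auto simp: inner_commute)
  hence "((\<lambda>h. inner (orbit_mean S h z) z) \<longlongrightarrow> 0) (at_right 0)" by (rule tendsto_eventually)
  moreover have "((\<lambda>h. inner (orbit_mean S h z) z) \<longlongrightarrow> inner z z) (at_right 0)"
    by (intro tendsto_intros orbit_mean_tendsto[OF c0])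
  ultimately have "inner z z = 0" by (rule tendsto_unique[OF trivial_limit_at_right_real, rotated])
  thus ?thesis by simp
qed

lemma Ds_dense: "closure Ds = UNIV"
proof (rule closure_eq_UNIV_if_orthogonal_trivial[OF subspace_Ds])
  fix z assume "\<And>x. x \<in> Ds \<Longrightarrow> inner x z = 0"
  thus "z = 0" using adj_orbit_mean_in_Ds by (intro eq_0_if_orthogonal_adj_orbit_mean) auto
qed

lemma ex_Ds_near: assumes "e > 0" shows "\<exists>\<phi>\<in>Ds. norm (x - \<phi>) < e"
proof -
  have "x \<in> closure Ds" using Ds_dense by simp
  thus ?thesis using assms unfolding closure_approachable by (metis dist_norm norm_minus_commute)
qed

lemma ex_Ds_seq: "\<exists>\<phi>. (\<forall>n::nat. \<phi> n \<in> Ds) \<and> \<phi> \<longlonglongrightarrow> x"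
  using Ds_dense closure_sequential[of x Ds] by auto

lemma S_bound_ex: "\<exists>M\<ge>1. (\<forall>t\<in>{0..\<tau>}. \<forall>x. norm (S t x) \<le> M * norm x) \<and> (\<forall>t\<in>{0..\<tau>}. \<forall>x. norm (Sa t x) \<le> M * norm x)"
proof -
  obtain M where "M \<ge> 1" "\<forall>t\<in>{0..\<tau>}. \<forall>x. norm (S t x) \<le> M * norm x" using c0_bound[OF c0] by blast
  thus ?thesis using norm_adj_le[OF S_bcl] by (intro exI[of _ M]) auto
qed

text \<open>The increment of the adjoint orbit is transposed to an average of the orbit of
  \<open>x\<close>, on which \<open>A\<close> can be moved over to \<open>\<phi>\<close>. This
  avoids differentiating the adjoint orbit, whose continuity is not yet known.\<close>

lemma norm_Sa_diff_le:
  assumes \<phi>: "\<phi> \<in> Ds" and t: "t > 0" and M: "M \<ge> 0" "\<And>s x. 0 \<le> s \<Longrightarrow> s \<le> t \<Longrightarrow> norm (S s x) \<le> M * norm x"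
  shows "norm (Sa t \<phi> - \<phi>) \<le> t * M * norm (As \<phi>)"
proof (rule norm_le_if_inner_le)
  fix x
  have "(1 / t) *\<^sub>R (S t x - x) = snd A (orbit_mean S t x)" using orbit_mean_in_domain(2)[OF t, of x] by simp
  hence "S t x - x = t *\<^sub>R snd A (orbit_mean S t x)" using t by (metis scaleR_scaleR nonzero_divide_eq_eq less_irrefl mult.commute scaleR_one)
  hence "inner x (Sa t \<phi> - \<phi>) = t * inner (snd A (orbit_mean S t x)) \<phi>"
    using t by (metis Sa_inner inner_diff_left inner_diff_right inner_scaleR_left less_imp_le)
  also have "\<dots> = t * inner (orbit_mean S t x) (As \<phi>)"
    by (simp add: adjoint_inner[OF \<phi> orbit_mean_in_domain(1)[OF t]])
  also have "\<dots> \<le> t * (norm (orbit_mean S t x) * norm (As \<phi>))"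
    using t by (intro mult_left_mono norm_cauchy_schwarz) auto
  also have "\<dots> \<le> t * (M * norm x * norm (As \<phi>))"
  proof -
    have "norm (integral {0..t} (\<lambda>s. S s x)) \<le> (M * norm x) * (t - 0)"
      by (rule integral_bound) (use t M in \<open>auto intro!: S_continuous continuous_intros\<close>)
    hence "norm (orbit_mean S t x) \<le> M * norm x" using t by (simp add: orbit_mean_def field_simps)
    thus ?thesis using t by (intro mult_left_mono mult_right_mono) auto
  qed
  finally show "inner x (Sa t \<phi> - \<phi>) \<le> t * M * norm (As \<phi>) * norm x" by (simp add: mult_ac)
qed (use t M in auto)

text \<open>On the dense subspace \<open>Ds\<close> adjoint orbits are Lipschitz at 0, and the
  uniform bound on \<open>Sa\<close> near 0 extends their continuity to all vectors.\<close>

lemma c0_adj: "c0_semigroup Sa"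
  unfolding c0_semigroup_def
proof (intro conjI allI impI)
  show "bounded_clinear (Sa t)" if "0 \<le> t" for t by (rule bounded_clinear_adj[OF S_bcl[OF that]])
  show "Sa 0 = id"
    by (rule ext, rule cinner_eqI_inner) (simp add: Sa_inner[symmetric] S_0)
  show "Sa (s + t) = Sa s \<circ> Sa t" if "0 \<le> s" "0 \<le> t" for s t
    by (rule ext, rule cinner_eqI_inner)
      (use that S_add[of t s] in \<open>simp add: Sa_inner[symmetric] add.commute\<close>)
  fix x
  obtain M where M: "M \<ge> 1" "\<And>t x. 0 \<le> t \<Longrightarrow> t \<le> 1 \<Longrightarrow> norm (S t x) \<le> M * norm x"
    "\<And>t x. 0 \<le> t \<Longrightarrow> t \<le> 1 \<Longrightarrow> norm (Sa t x) \<le> M * norm x"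
    using S_bound_ex[of 1] by auto
  show "((\<lambda>t. Sa t x) \<longlongrightarrow> x) (at_right 0)"
  proof (rule tendstoI)
    fix e :: real assume e: "e > 0"
    then obtain \<phi> where \<phi>: "\<phi> \<in> Ds" "norm (x - \<phi>) < e / (3 * M)" using ex_Ds_near[of "e / (3 * M)" x] M(1) by auto
    \<comment> \<open>Below this time the Lipschitz estimate for \<open>\<phi>\<close> stays under
      \<open>e / 3\<close>; the summand 1 covers \<open>As \<phi> = 0\<close>, and the cap 1 is the
      range of validity of \<open>M\<close>.\<close>
    define d where "d = min 1 (e / (3 * M * (norm (As \<phi>) + 1)))"
    have d: "d > 0" using e M(1) by (auto simp: d_def add_nonneg_pos)
    have "dist (Sa t x) x < e" if t: "0 < t" "t < d" for t
    proof -
      interpret bounded_linear "Sa t" using t by (intro bounded_clinear_linear bounded_clinear_adj S_bcl) auto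
      have t1: "t \<le> 1" using t by (simp add: d_def)
      have "norm (Sa t x - Sa t \<phi>) \<le> M * norm (x - \<phi>)"
        using M(3)[of t "x - \<phi>"] t t1 by (simp add: diff)
      also have "\<dots> < e / 3" using \<phi>(2) M(1) by (simp add: field_simps)
      finally have 1: "norm (Sa t x - Sa t \<phi>) < e / 3" .
      have "norm (Sa t \<phi> - \<phi>) \<le> t * M * norm (As \<phi>)"
        by (rule norm_Sa_diff_le[OF \<phi>(1)]) (use t t1 M in auto)
      also have "\<dots> \<le> t * (M * (norm (As \<phi>) + 1))" using t M(1) by (simp add: algebra_simps)
      also have "\<dots> < e / 3"
      proof -
        have "t < e / (3 * M * (norm (As \<phi>) + 1))" using t by (simp add: d_def)
        moreover have "3 * M * (norm (As \<phi>) + 1) > 0" using M(1) by (simp add: add_nonneg_pos)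
        ultimately have "t * (3 * M * (norm (As \<phi>) + 1)) < e" by (simp only: pos_less_divide_eq)
        thus ?thesis by (simp add: algebra_simps)
      qed
      finally have 2: "norm (Sa t \<phi> - \<phi>) < e / 3" .
      have "norm (\<phi> - x) \<le> M * norm (x - \<phi>)" using M(1) mult_right_mono[of 1 M "norm (x - \<phi>)"]
        by (simp add: norm_minus_commute)
      also have "\<dots> < e / 3" using \<phi>(2) M(1) by (simp add: field_simps)
      finally have 3: "norm (\<phi> - x) < e / 3" .
      have "norm (Sa t x - x) \<le> norm (Sa t x - Sa t \<phi>) + norm (Sa t \<phi> - \<phi>) + norm (\<phi> - x)"
        using norm_triangle_ineq[of "Sa t x - Sa t \<phi>" "Sa t \<phi> - \<phi>"]
          norm_triangle_ineq[of "Sa t x - \<phi>" "\<phi> - x"] by simp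
      thus ?thesis using 1 2 3 by (simp add: dist_norm)
    qed
    thus "\<forall>\<^sub>F t in at_right 0. dist (Sa t x) x < e"
      unfolding eventually_at using d by (intro exI[of _ d]) (auto simp: dist_real_def)
  qed
qed

lemmas Sa_continuous = c0_continuous_on[OF c0_adj] and Sa_add = c0_add[OF c0_adj]
  and Sa_0 = c0_zero[OF c0_adj] and Sa_scaleC = c0_scaleC[OF c0_adj] and Sa_linear = c0_linear[OF c0_adj]

end

section \<open>The adjoint semigroups of a generator and of its bounded perturbation\<close>

locale perturbed_generator = U: generator A S + P: generator "op_perturb A K" SK
  for A :: "'a::complex_hilbert unbdd_op" and S :: "real \<Rightarrow> 'a \<Rightarrow> 'a" and K :: "'a \<Rightarrow> 'a"
    and SK :: "real \<Rightarrow> 'a \<Rightarrow> 'a" +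
  assumes K: "bounded_clinear K"
begin

lemma adjoint_perturb:
  "P.Ds = U.Ds" "\<phi> \<in> U.Ds \<Longrightarrow> P.As \<phi> = U.As \<phi> + adj K \<phi>"
proof -
  have 1: "\<phi> \<in> P.Ds" "P.As \<phi> = U.As \<phi> + adj K \<phi>" if "\<phi> \<in> U.Ds" for \<phi>
    using P.adjointI[of \<phi> "U.As \<phi> + adj K \<phi>"] U.adjoint_inner[OF that] inner_adj[OF K]
    by (auto simp: op_perturb_def inner_add_left inner_add_right)
  have 2: "\<phi> \<in> U.Ds" if "\<phi> \<in> P.Ds" for \<phi>
    using U.adjointI[of \<phi> "P.As \<phi> - adj K \<phi>"] P.adjoint_inner[OF that] inner_adj[OF K]
    by (auto simp: op_perturb_def inner_add_left inner_diff_right algebra_simps)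
  show "P.Ds = U.Ds" using 1 2 by blast
  show "\<phi> \<in> U.Ds \<Longrightarrow> P.As \<phi> = U.As \<phi> + adj K \<phi>" by (rule 1)
qed

text \<open>For \<open>x\<close> in the domain, \<open>s \<mapsto> S\<^sub>K(h - s) S(s) x\<close> has derivative \<open>- S\<^sub>K(h - s) K S(s) x\<close>.\<close>

lemma norm_adj_semigroup_diff_le:
  assumes h: "h \<ge> 0" and m: "\<And>s. 0 \<le> s \<Longrightarrow> s \<le> h \<Longrightarrow> norm (adj K (P.Sa s \<psi>)) \<le> m"
    and M: "M \<ge> 0" "\<And>s x. 0 \<le> s \<Longrightarrow> s \<le> h \<Longrightarrow> norm (S s x) \<le> M * norm x"
  shows "norm (U.Sa h \<psi> - P.Sa h \<psi>) \<le> h * M * m"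
proof -
  have m0: "m \<ge> 0" using m[of 0] h norm_ge_zero order_trans by blast
  have dom: "inner x (U.Sa h \<psi> - P.Sa h \<psi>) \<le> h * M * m * norm x" if x: "x \<in> fst A" for x
  proof -
    define F where "F s = SK (h - s) (S s x)" for s
    have x': "S s x \<in> fst (op_perturb A K)" if "s \<ge> 0" for s
      using U.A_S(1)[OF x that] by (simp add: op_perturb_def)
    have der: "(F has_vector_derivative - SK (h - s) (K (S s x))) (at s within {0..h})"
      if s: "s \<in> {0..h}" for s
    proof (rule has_vector_derivativeI_slope)
      define g where "g r = SK (h - r) (S (min r s) (U.quot x \<bar>r - s\<bar>))
        - SK (min (h - r) (h - s)) (P.quot (S s x) \<bar>(h - r) - (h - s)\<bar>)" for r
      show "F r - F s = (r - s) *\<^sub>R g r" if r: "r \<in> {0..h}" for r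
      proof -
        interpret bounded_linear "SK (h - r)" using r by (intro P.S_linear) auto
        have "F r - F s = SK (h - r) (S r x - S s x) + (SK (h - r) (S s x) - SK (h - s) (S s x))"
          by (simp add: F_def diff)
        also have "S r x - S s x = (r - s) *\<^sub>R S (min r s) (U.quot x \<bar>r - s\<bar>)"
          using r s by (intro U.S_slope) auto
        also have "SK (h - r) (S s x) - SK (h - s) (S s x)
            = ((h - r) - (h - s)) *\<^sub>R SK (min (h - r) (h - s)) (P.quot (S s x) \<bar>(h - r) - (h - s)\<bar>)"
          using r s by (intro P.S_slope) auto
        also have "(h - r) - (h - s) = - (r - s)" by simp
        finally show ?thesis by (simp add: g_def scaleR scaleR_diff_right) (simp add: algebra_simps)
      qed
      have "continuous_on {0..h} g" unfolding g_def
        using s by (intro continuous_intros P.S_continuous U.S_continuous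
            continuous_on_compose2[OF U.quot_continuous[OF x]]
            continuous_on_compose2[OF P.quot_continuous[OF x']]) auto
      hence "(g \<longlongrightarrow> g s) (at s within {0..h})" using s by (auto simp: continuous_on_def)
      moreover have "g s = - SK (h - s) (K (S s x))"
      proof -
        interpret bounded_linear "SK (h - s)" using s by (intro P.S_linear) auto
        have "snd (op_perturb A K) (S s x) = S s (snd A x) + K (S s x)"
          using U.A_S(2)[OF x] s by (simp add: op_perturb_def)
        thus ?thesis by (simp add: g_def U.quot_0 P.quot_0 add)
      qed
      ultimately show "(g \<longlongrightarrow> - SK (h - s) (K (S s x))) (at s within {0..h})" by simp
    qed
    \<comment> \<open>Pairing with \<open>\<psi>\<close> gives a real function, so the mean value
      theorem produces a single time at which the bound \<open>m\<close> on the perturbed adjoint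
      orbit is inserted.\<close>
    define f where "f s = inner (F s) \<psi>" for s
    define f' where "f' s = (\<lambda>r. r * (- inner (SK (h - s) (K (S s x))) \<psi>))" for s :: real
    have "(f has_derivative f' s) (at s within {0..h})" if "0 \<le> s" "s \<le> h" for s
    proof -
      have "(f has_vector_derivative inner (- SK (h - s) (K (S s x))) \<psi>) (at s within {0..h})"
        unfolding f_def using der[of s] that
        by (intro bounded_linear.has_vector_derivative[OF bounded_linear_inner_left]) auto
      thus ?thesis by (simp add: has_vector_derivative_def f'_def)
    qed
    from mvt_very_simple[OF h this] obtain s where s: "s \<in> {0..h}" "f h - f 0 = f' s (h - 0)" by blast
    have "\<bar>inner (SK (h - s) (K (S s x))) \<psi>\<bar> = \<bar>inner (S s x) (adj K (P.Sa (h - s) \<psi>))\<bar>"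
      using s P.Sa_inner[of "h - s"] by (simp add: inner_adj[OF K])
    also have "\<dots> \<le> norm (S s x) * norm (adj K (P.Sa (h - s) \<psi>))" by (rule Cauchy_Schwarz_ineq2)
    also have "\<dots> \<le> (M * norm x) * m" using s M m[of "h - s"] by (intro mult_mono) auto
    finally have b: "\<bar>inner (SK (h - s) (K (S s x))) \<psi>\<bar> \<le> M * norm x * m" .
    have "inner x (U.Sa h \<psi> - P.Sa h \<psi>) = f h - f 0"
      using h by (simp add: f_def F_def U.S_0 P.S_0 inner_diff_right U.Sa_inner[symmetric] P.Sa_inner[symmetric])
    also have "\<dots> = h * (- inner (SK (h - s) (K (S s x))) \<psi>)" using s by (simp add: f'_def)
    also have "\<dots> \<le> h * (M * norm x * m)" using b h by (intro mult_left_mono) auto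
    finally show ?thesis by (simp add: mult_ac)
  qed
  show ?thesis
  proof (rule norm_le_if_inner_le)
    fix x
    have "x \<in> closure (fst A)" using U.dense by simp
    then obtain y where y: "\<And>n. y n \<in> fst A" "y \<longlonglongrightarrow> x" unfolding closure_sequential by blast
    show "inner x (U.Sa h \<psi> - P.Sa h \<psi>) \<le> h * M * m * norm x"
      by (rule LIMSEQ_le[of "\<lambda>n. inner (y n) (U.Sa h \<psi> - P.Sa h \<psi>)" _ "\<lambda>n. h * M * m * norm (y n)"])
        (use y dom in \<open>auto intro!: tendsto_intros\<close>)
  qed (use h M m0 in auto)
qed

end


subsection \<open>Bounded perturbations of generators\<close>

lemma has_integral_exp_scaled:
  fixes \<omega> t :: real
  assumes "\<omega> \<noteq> 0" "t \<ge> 0"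
  shows "((\<lambda>s. exp (\<omega> * s)) has_integral (exp (\<omega> * t) - 1) / \<omega>) {0..t}"
proof -
  have "((\<lambda>s. exp (\<omega> * s)) has_integral exp (\<omega> * t) / \<omega> - exp (\<omega> * 0) / \<omega>) {0..t}"
    using assms by (intro fundamental_theorem_of_calculus[where f = "\<lambda>s. exp (\<omega> * s) / \<omega>"])
      (auto intro!: derivative_eq_intros simp: has_real_derivative_iff_has_vector_derivative[symmetric])
  thus ?thesis by (simp add: diff_divide_distrib)
qed

locale bounded_perturbation = generator A S
  for A :: "'a::complex_hilbert unbdd_op" and S :: "real \<Rightarrow> 'a \<Rightarrow> 'a" +
  fixes K :: "'a \<Rightarrow> 'a"
  assumes K: "bounded_clinear K"
begin

text \<open>The integral term of the variation of constants formula; the perturbed semigroup is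
  constructed as the solution of \<open>y t = S t x + volterra y t\<close>.\<close>

definition volterra :: "(real \<Rightarrow> 'a) \<Rightarrow> real \<Rightarrow> 'a" where
  "volterra f t = integral {0..t} (\<lambda>s. S (t - s) (K (f s)))"

lemma K_continuous: "continuous_on X f \<Longrightarrow> continuous_on X (\<lambda>x. K (f x))"
  by (rule bounded_linear.continuous_on[OF bounded_clinear_linear[OF K]])

lemma volterra_integrand_continuous:
  assumes "continuous_on {0..} f"
  shows "continuous_on {0..t} (\<lambda>s. S (t - s) (K (f s)))"
  by (intro S_continuous K_continuous continuous_on_subset[OF assms] continuous_intros) auto

lemma volterra_integrable:
  assumes "continuous_on {0..} f"
  shows "(\<lambda>s. S (t - s) (K (f s))) integrable_on {0..t}"
  by (intro integrable_continuous_interval volterra_integrand_continuous assms)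

text \<open>Substituting \<open>s = t * r\<close> fixes the interval of integration. Continuity in
  \<open>t\<close> and the derivative at 0 then follow from continuity of an integral in its
  parameter.\<close>

lemma volterra_scaled:
  assumes f: "continuous_on {0..} f" and t: "t \<ge> 0"
  shows "volterra f t = t *\<^sub>R integral (cbox 0 1) (\<lambda>r. S (t - t * r) (K (f (t * r))))"
proof (cases "t = 0")
  case False
  hence t0: "t > 0" using t by simp
  have "((\<lambda>s. S (t - s) (K (f s))) has_integral volterra f t) (cbox 0 t)"
    using integrable_integral[OF volterra_integrable[OF f, of t]] by (simp add: volterra_def)
  from has_integral_affinity[OF this False, of 0]
  have "((\<lambda>r. S (t - t * r) (K (f (t * r)))) has_integral (1 / t) *\<^sub>R volterra f t)
      ((\<lambda>x. (1 / t) *\<^sub>R x) ` cbox 0 t)"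
    using t0 by simp
  also have "(\<lambda>x. (1 / t) *\<^sub>R x) ` cbox 0 t = cbox 0 1"
    using image_smult_cbox[of "1 / t" 0 t] t0 by auto
  finally have "integral (cbox 0 1) (\<lambda>r. S (t - t * r) (K (f (t * r)))) = (1 / t) *\<^sub>R volterra f t"
    by (rule integral_unique)
  thus ?thesis using t0 by simp
qed (simp add: volterra_def)

lemma volterra_mean_continuous:
  assumes f: "continuous_on {0..} f"
  shows "continuous_on {0..} (\<lambda>t. integral (cbox 0 1) (\<lambda>r::real. S (t - t * r) (K (f (t * r)))))"
proof (rule integral_continuous_on_param)
  have le: "a * b \<le> a" if "0 \<le> a" "b \<le> 1" for a b :: real using mult_left_mono[OF that(2,1)] by simp
  have "continuous_on ({0..} \<times> cbox 0 1) (\<lambda>p::real \<times> real. S (fst p - fst p * snd p) (K (f (fst p * snd p))))"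
    by (intro S_continuous K_continuous continuous_on_compose2[OF f] continuous_intros) (auto simp: le)
  thus "continuous_on ({0..} \<times> cbox 0 1) (\<lambda>(t, r). S (t - t * r) (K (f (t * r))))"
    by (simp add: split_def)
qed

lemma volterra_continuous:
  assumes f: "continuous_on {0..} f"
  shows "continuous_on {0..} (volterra f)"
  using continuous_on_scaleR[OF continuous_on_id volterra_mean_continuous[OF f]]
  by (rule continuous_on_eq) (simp add: volterra_scaled[OF f])

lemma volterra_add:
  assumes "continuous_on {0..} f" "continuous_on {0..} g" "t \<ge> 0"
  shows "volterra (\<lambda>s. f s + g s) t = volterra f t + volterra g t"
proof -
  have "volterra (\<lambda>s. f s + g s) t = integral {0..t} (\<lambda>s. S (t - s) (K (f s)) + S (t - s) (K (g s)))"
    unfolding volterra_def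
    by (intro integral_cong) (simp add: linear_simps[OF S_linear] linear_simps[OF bounded_clinear_linear[OF K]])
  thus ?thesis unfolding volterra_def by (simp add: integral_add volterra_integrable assms)
qed

lemma volterra_scaleC:
  assumes "continuous_on {0..} f" "t \<ge> 0"
  shows "volterra (\<lambda>s. c *\<^sub>C f s) t = c *\<^sub>C volterra f t"
proof -
  have "volterra (\<lambda>s. c *\<^sub>C f s) t = integral {0..t} ((\<lambda>y. c *\<^sub>C y) \<circ> (\<lambda>s. S (t - s) (K (f s))))"
    unfolding volterra_def
    using K by (intro integral_cong) (simp add: S_scaleC bounded_clinear_def)
  also have "\<dots> = c *\<^sub>C volterra f t"
    unfolding volterra_def by (intro integral_linear volterra_integrable assms bounded_linear_scaleC)
  finally show ?thesis .
qed

lemma volterra_diff: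
  assumes "continuous_on {0..} f" "continuous_on {0..} g" "t \<ge> 0"
  shows "volterra (\<lambda>s. f s - g s) t = volterra f t - volterra g t"
proof -
  have c: "continuous_on {0..} (\<lambda>s. (-1) *\<^sub>C g s)" using assms(2) by (simp add: continuous_on_minus)
  show ?thesis using volterra_add[OF assms(1) c assms(3)] volterra_scaleC[OF assms(2,3), of "-1"] by simp
qed

text \<open>In the weighted norm \<open>sup e\<^sup>-\<^sup>\<omega>\<^sup>t \<parallel>f(t)\<parallel>\<close> the Volterra operator is a contraction.\<close>

lemma volterra_bound:
  assumes f: "continuous_on {0..} f" and M: "M \<ge> 0" "\<And>s x. 0 \<le> s \<Longrightarrow> s \<le> \<tau> \<Longrightarrow> norm (S s x) \<le> M * norm x"
    and k: "k \<ge> 0" "\<And>x. norm (K x) \<le> k * norm x" and \<omega>: "\<omega> > 0" "2 * M * k \<le> \<omega>"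
    and c: "\<And>s. 0 \<le> s \<Longrightarrow> s \<le> \<tau> \<Longrightarrow> norm (f s) \<le> c * exp (\<omega> * s)"
    and t: "0 \<le> t" "t \<le> \<tau>"
  shows "norm (volterra f t) \<le> c / 2 * exp (\<omega> * t)"
proof -
  have c0: "c \<ge> 0" using c[of 0] t by (smt (verit) exp_zero mult_zero_right norm_ge_zero mult_cancel_left1)
  have "norm (volterra f t) \<le> integral {0..t} (\<lambda>s. M * k * c * exp (\<omega> * s))"
    unfolding volterra_def
  proof (rule integral_norm_bound_integral[OF volterra_integrable[OF f]])
    show "(\<lambda>s. M * k * c * exp (\<omega> * s)) integrable_on {0..t}"
      by (intro integrable_continuous_interval continuous_intros)
    fix s assume s: "s \<in> {0..t}"
    have "norm (S (t - s) (K (f s))) \<le> M * norm (K (f s))" using M(2) s t by auto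
    also have "\<dots> \<le> M * (k * norm (f s))" by (intro mult_left_mono k M)
    also have "\<dots> \<le> M * (k * (c * exp (\<omega> * s)))" using c[of s] s t by (intro mult_left_mono k(1) M(1)) auto
    finally show "norm (S (t - s) (K (f s))) \<le> M * k * c * exp (\<omega> * s)" by (simp add: mult_ac)
  qed
  also have "\<dots> = M * k * c * ((exp (\<omega> * t) - 1) / \<omega>)"
    by (intro integral_unique has_integral_mult_right has_integral_exp_scaled) (use \<omega> t in auto)
  \<comment> \<open>The contraction factor one half comes from
    \<open>2 * M * k \<le> \<omega>\<close>; the subtracted 1 is dropped.\<close>
  also have "\<dots> \<le> (\<omega> / 2) * c * (exp (\<omega> * t) / \<omega>)"
    using \<omega> M k c0 by (intro mult_mono divide_right_mono) (auto intro!: mult_nonneg_nonneg simp: t)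
  also have "\<dots> = c / 2 * exp (\<omega> * t)" using \<omega> by simp
  finally show ?thesis .
qed

lemma constants:
  "\<exists>M k \<omega>. M \<ge> 1 \<and> (\<forall>s x. 0 \<le> s \<longrightarrow> s \<le> \<tau> \<longrightarrow> norm (S s x) \<le> M * norm x)
    \<and> k \<ge> 0 \<and> (\<forall>x. norm (K x) \<le> k * norm x) \<and> \<omega> > 0 \<and> 2 * M * k \<le> (\<omega>::real)"
proof -
  obtain M where M: "M \<ge> 1" "\<forall>s\<in>{0..\<tau>}. \<forall>x. norm (S s x) \<le> M * norm x"
    using c0_bound[OF c0, of \<tau>] by blast
  obtain k where k: "k \<ge> 0" "\<forall>x. norm (K x) \<le> k * norm x" using bounded_clinear_bound[OF K] by blast
  show ?thesis by (rule exI[of _ M], rule exI[of _ k], rule exI[of _ "2 * M * k + 1"])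
    (use M k in \<open>auto intro: add_nonneg_pos\<close>)
qed

section \<open>The Dyson-Phillips series of the perturbed semigroup\<close>

primrec dyson :: "'a \<Rightarrow> nat \<Rightarrow> real \<Rightarrow> 'a" where
  "dyson x 0 = (\<lambda>t. S t x)"
| "dyson x (Suc n) = volterra (dyson x n)"

lemma dyson_continuous: "continuous_on {0..} (dyson x n)"
  by (induction n) (auto intro!: volterra_continuous S_continuous continuous_intros)

lemma dyson_bound:
  assumes M: "M \<ge> 1" "\<And>s x. 0 \<le> s \<Longrightarrow> s \<le> \<tau> \<Longrightarrow> norm (S s x) \<le> M * norm x"
    and k: "k \<ge> 0" "\<And>x. norm (K x) \<le> k * norm x" and \<omega>: "\<omega> > 0" "2 * M * k \<le> \<omega>"
    and t: "0 \<le> t" "t \<le> \<tau>"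
  shows "norm (dyson x n t) \<le> M * norm x * (1/2) ^ n * exp (\<omega> * t)"
  using t
proof (induction n arbitrary: t)
  case 0
  have "M * norm x * 1 \<le> M * norm x * exp (\<omega> * t)" using M(1) \<omega>(1) 0 by (intro mult_left_mono) auto
  then show ?case using M(2)[of t x] 0 by simp
next
  case (Suc n)
  have "norm (volterra (dyson x n) t) \<le> (M * norm x * (1/2) ^ n) / 2 * exp (\<omega> * t)"
    by (rule volterra_bound[OF dyson_continuous _ M(2) k \<omega> Suc.IH Suc.prems]) (use M in auto)
  thus ?case by simp
qed

definition SK :: "real \<Rightarrow> 'a \<Rightarrow> 'a" where
  "SK t x = (\<Sum>n. dyson x n t)"

lemma SK_tail:
  assumes M: "M \<ge> 1" "\<And>s x. 0 \<le> s \<Longrightarrow> s \<le> \<tau> \<Longrightarrow> norm (S s x) \<le> M * norm x"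
    and k: "k \<ge> 0" "\<And>x. norm (K x) \<le> k * norm x" and \<omega>: "\<omega> > 0" "2 * M * k \<le> \<omega>"
    and t: "0 \<le> t" "t \<le> \<tau>"
  shows "norm (SK t x - (\<Sum>n<N. dyson x n t)) \<le> 2 * (M * norm x * (1/2) ^ N) * exp (\<omega> * t)"
    "(\<lambda>N. \<Sum>n<N. dyson x n t) \<longlonglongrightarrow> SK t x"
proof -
  note b = dyson_bound[OF assms]
  have g: "summable (\<lambda>n. M * norm x * (1/2) ^ n * exp (\<omega> * t))"
    by (intro summable_mult summable_mult2 summable_geometric) auto
  have s: "summable (\<lambda>n. dyson x n t)"
    by (rule summable_comparison_test'[OF g b])
  thus "(\<lambda>N. \<Sum>n<N. dyson x n t) \<longlonglongrightarrow> SK t x" unfolding SK_def by (rule summable_LIMSEQ)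
  have "SK t x - (\<Sum>n<N. dyson x n t) = (\<Sum>n. dyson x (n + N) t)"
    unfolding SK_def using suminf_minus_initial_segment[OF s] by simp
  also have "norm \<dots> \<le> (\<Sum>n. M * norm x * (1/2) ^ (n + N) * exp (\<omega> * t))"
    by (rule norm_suminf_le[OF b summable_ignore_initial_segment[OF g]])
  also have "\<dots> = (\<Sum>n. (1/2) ^ n * (M * norm x * (1/2) ^ N * exp (\<omega> * t)))" by (simp add: power_add mult_ac)
  also have "\<dots> = (\<Sum>n. (1/2) ^ n) * (M * norm x * (1/2) ^ N * exp (\<omega> * t))"
    by (rule suminf_mult2[symmetric]) (auto intro: summable_geometric)
  also have "\<dots> = 2 * (M * norm x * (1/2) ^ N) * exp (\<omega> * t)" by (subst suminf_geometric) auto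
  finally show "norm (SK t x - (\<Sum>n<N. dyson x n t)) \<le> 2 * (M * norm x * (1/2) ^ N) * exp (\<omega> * t)" .
qed

lemma SK_continuous: "continuous_on {0..} (\<lambda>t. SK t x)"
proof -
  have *: "continuous_on {0..\<tau>} (\<lambda>t. SK t x)" if "\<tau> \<ge> 0" for \<tau>
  proof -
    obtain M k \<omega> where c: "M \<ge> 1" "\<And>s x. 0 \<le> s \<Longrightarrow> s \<le> \<tau> \<Longrightarrow> norm (S s x) \<le> M * norm x"
      "k \<ge> 0" "\<And>x. norm (K x) \<le> k * norm x" "\<omega> > 0" "2 * M * k \<le> \<omega>" using constants[of \<tau>] by blast
    have "uniform_limit {0..\<tau>} (\<lambda>N t. \<Sum>n<N. dyson x n t) (\<lambda>t. SK t x) sequentially"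
      unfolding SK_def
    proof (rule Weierstrass_m_test)
      show "summable (\<lambda>n. M * norm x * (1/2) ^ n * exp (\<omega> * \<tau>))"
        by (intro summable_mult summable_mult2 summable_geometric) auto
      fix n t assume t: "t \<in> {0..\<tau>}"
      hence "norm (dyson x n t) \<le> M * norm x * (1/2) ^ n * exp (\<omega> * t)" by (intro dyson_bound[OF c]) auto
      also have "\<dots> \<le> M * norm x * (1/2) ^ n * exp (\<omega> * \<tau>)" using c(1,5) t by (intro mult_left_mono) auto
      finally show "norm (dyson x n t) \<le> M * norm x * (1/2) ^ n * exp (\<omega> * \<tau>)" .
    qed
    thus ?thesis
      by (rule uniform_limit_theorem[rotated])
        (auto intro!: always_eventually continuous_on_sum continuous_on_subset[OF dyson_continuous])
  qed
  show ?thesis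
    unfolding continuous_on_eq_continuous_within
  proof
    fix t :: real assume t: "t \<in> {0..}"
    hence "continuous (at t within {0..t + 1}) (\<lambda>t. SK t x)"
      using *[of "t + 1"] by (simp add: continuous_on_eq_continuous_within)
    moreover have "at t within {0..t + 1} = at t within {0..}"
      by (rule at_within_nhd[of t "{..<t + 1}"]) auto
    ultimately show "continuous (at t within {0..}) (\<lambda>t. SK t x)" by simp
  qed
qed

text \<open>Partial sums satisfy the equation with an index shift; the tail bound in the weighted
  norm lets the limit pass under the Volterra operator.\<close>

lemma SK_volterra:
  assumes t: "t \<ge> 0"
  shows "SK t x = S t x + volterra (\<lambda>s. SK s x) t"
proof -
  obtain M k \<omega> where c: "M \<ge> 1" "\<And>s x. 0 \<le> s \<Longrightarrow> s \<le> t \<Longrightarrow> norm (S s x) \<le> M * norm x"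
      "k \<ge> 0" "\<And>x. norm (K x) \<le> k * norm x" "\<omega> > 0" "2 * M * k \<le> \<omega>" using constants[of t] by blast
  define P where "P N s = (\<Sum>n<N. dyson x n s)" for N s
  have Pc: "continuous_on {0..} (P N)" for N unfolding P_def by (intro continuous_on_sum dyson_continuous)
  have rec: "P (Suc N) t = S t x + volterra (P N) t" for N
  proof (induction N)
    case 0
    have "integral {0..t} (\<lambda>s. S (t - s) 0) = integral {0..t} (\<lambda>_. 0 :: 'a)"
      by (intro integral_cong) (simp add: linear_simps[OF S_linear])
    then show ?case by (simp add: P_def volterra_def linear_simps[OF bounded_clinear_linear[OF K]])
  next
    case (Suc N)
    have "volterra (P (Suc N)) t = volterra (\<lambda>s. P N s + dyson x N s) t" by (simp add: P_def[abs_def])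
    also have "\<dots> = volterra (P N) t + dyson x (Suc N) t"
      using volterra_add[OF Pc dyson_continuous t] by simp
    finally have "volterra (P (Suc N)) t = volterra (P N) t + dyson x (Suc N) t" .
    moreover have "P (Suc (Suc N)) t = P (Suc N) t + dyson x (Suc N) t" by (simp add: P_def)
    ultimately show ?case using Suc by (simp only: add.assoc)
  qed
  have "(\<lambda>N. P (Suc N) t) \<longlonglongrightarrow> SK t x"
    unfolding P_def using SK_tail(2)[OF c t order_refl] by (rule LIMSEQ_Suc)
  moreover have "(\<lambda>N. S t x + volterra (P N) t) \<longlonglongrightarrow> S t x + volterra (\<lambda>s. SK s x) t"
  proof (intro tendsto_add tendsto_const)
    have "norm (volterra (P N) t - volterra (\<lambda>s. SK s x) t) \<le> (1/2) ^ N * (M * norm x * exp (\<omega> * t))" for N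
    proof -
      have "norm (volterra (\<lambda>s. SK s x - P N s) t) \<le> (2 * (M * norm x * (1/2) ^ N)) / 2 * exp (\<omega> * t)"
        by (rule volterra_bound[OF _ _ c(2-6)])
          (use SK_tail(1)[OF c, where x = x and N = N] c t in \<open>auto intro!: continuous_on_diff SK_continuous Pc simp: P_def[symmetric]\<close>)
      thus ?thesis using volterra_diff[OF SK_continuous Pc t] by (simp add: norm_minus_commute mult_ac)
    qed
    moreover have "(\<lambda>N. (1/2) ^ N * (M * norm x * exp (\<omega> * t))) \<longlonglongrightarrow> 0"
      by (intro tendsto_mult_left_zero LIMSEQ_power_zero) auto
    ultimately have "(\<lambda>N. volterra (P N) t - volterra (\<lambda>s. SK s x) t) \<longlonglongrightarrow> 0"
      by (rule Lim_null_comparison[OF always_eventually[OF allI]])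
    thus "(\<lambda>N. volterra (P N) t) \<longlonglongrightarrow> volterra (\<lambda>s. SK s x) t" by (simp only: LIM_zero_iff)
  qed
  ultimately show ?thesis unfolding rec by (rule LIMSEQ_unique)
qed

text \<open>Iterating the contraction makes the difference of two solutions arbitrarily small.
  Additivity, homogeneity and the semigroup law of \<open>SK\<close> are all obtained by recognising
  both sides as solutions with the same initial value.\<close>

lemma volterra_unique:
  assumes y: "continuous_on {0..} y" "\<And>t. t \<ge> 0 \<Longrightarrow> y t = S t z + volterra y t" and t: "t \<ge> 0"
  shows "y t = SK t z"
proof -
  obtain M k \<omega> where c: "M \<ge> 1" "\<And>s x. 0 \<le> s \<Longrightarrow> s \<le> t \<Longrightarrow> norm (S s x) \<le> M * norm x"
      "k \<ge> 0" "\<And>x. norm (K x) \<le> k * norm x" "\<omega> > 0" "2 * M * k \<le> \<omega>" using constants[of t] by blast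
  define d where "d s = y s - SK s z" for s
  have dc: "continuous_on {0..} d" unfolding d_def by (intro continuous_on_diff y SK_continuous)
  have dv: "d s = volterra d s" if "s \<ge> 0" for s
  proof -
    have "d s = volterra y s - volterra (\<lambda>s. SK s z) s"
      unfolding d_def by (subst y(2)[OF that], subst SK_volterra[OF that]) simp
    thus ?thesis using volterra_diff[OF y(1) SK_continuous that, of z] by (simp add: d_def[abs_def])
  qed
  have "bounded (d ` {0..t})"
    by (intro compact_imp_bounded compact_continuous_image continuous_on_subset[OF dc]) auto
  then obtain C where "\<forall>z\<in>d ` {0..t}. norm z \<le> C" unfolding bounded_iff by blast
  hence C: "norm (d s) \<le> C" if "s \<in> {0..t}" for s using that by blast
  have b: "norm (d s) \<le> C * (1/2) ^ n * exp (\<omega> * s)" if "0 \<le> s" "s \<le> t" for n s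
    using that
  proof (induction n arbitrary: s)
    case 0
    have "norm (d 0) \<le> C" using t by (intro C) auto
    hence C0: "C \<ge> 0" using norm_ge_zero[of "d 0"] by linarith
    have "C * 1 \<le> C * exp (\<omega> * s)" using c(5) 0 C0 by (intro mult_left_mono) auto
    then show ?case using C[of s] 0 by simp
  next
    case (Suc n)
    have "norm (volterra d s) \<le> (C * (1/2) ^ n) / 2 * exp (\<omega> * s)"
      by (rule volterra_bound[OF dc _ c(2-6) Suc.IH Suc.prems]) (use c in auto)
    thus ?case using dv[OF Suc.prems(1)] by simp
  qed
  have lim: "(\<lambda>n. C * (1/2) ^ n * exp (\<omega> * t)) \<longlonglongrightarrow> 0"
    by (intro tendsto_mult_left_zero tendsto_mult_right_zero LIMSEQ_power_zero) auto
  have "norm (d t) \<le> 0" by (rule LIMSEQ_le_const[OF lim]) (use b[OF t order_refl] in blast)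
  thus ?thesis by (simp add: d_def)
qed

lemma SK_bound:
  assumes t: "t \<ge> 0" shows "\<exists>C. \<forall>x. norm (SK t x) \<le> C * norm x"
proof -
  obtain M k \<omega> where c: "M \<ge> 1" "\<And>s x. 0 \<le> s \<Longrightarrow> s \<le> t \<Longrightarrow> norm (S s x) \<le> M * norm x"
      "k \<ge> 0" "\<And>x. norm (K x) \<le> k * norm x" "\<omega> > 0" "2 * M * k \<le> \<omega>" using constants[of t] by blast
  have "norm (SK t x) \<le> (2 * M * exp (\<omega> * t)) * norm x" for x
    using SK_tail(1)[OF c t order_refl, where x = x and N = 0] by (simp add: mult_ac)
  thus ?thesis by blast
qed

lemma SK_add: assumes "t \<ge> 0" shows "SK t (x + y) = SK t x + SK t y"
proof (rule volterra_unique[OF _ _ assms, symmetric])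
  show "continuous_on {0..} (\<lambda>t. SK t x + SK t y)" by (intro continuous_on_add SK_continuous)
  show "SK t x + SK t y = S t (x + y) + volterra (\<lambda>t. SK t x + SK t y) t" if "t \<ge> 0" for t
    using SK_volterra[OF that] volterra_add[OF SK_continuous SK_continuous that]
    by (simp add: linear_simps[OF S_linear[OF that]])
qed

lemma SK_scaleC: assumes "t \<ge> 0" shows "SK t (c *\<^sub>C x) = c *\<^sub>C SK t x"
proof (rule volterra_unique[OF _ _ assms, symmetric])
  show "continuous_on {0..} (\<lambda>t. c *\<^sub>C SK t x)"
    by (intro bounded_linear.continuous_on[OF bounded_linear_scaleC] SK_continuous)
  show "c *\<^sub>C SK t x = S t (c *\<^sub>C x) + volterra (\<lambda>t. c *\<^sub>C SK t x) t" if "t \<ge> 0" for t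
    using SK_volterra[OF that, of x] volterra_scaleC[OF SK_continuous that]
    by (simp add: S_scaleC that scaleC_add_right)
qed

lemma SK_semigroup:
  assumes s: "s \<ge> 0" and t: "t \<ge> 0"
  shows "SK (t + s) x = SK t (SK s x)"
proof (rule volterra_unique[OF _ _ t])
  have sh: "continuous_on {0..} (\<lambda>t. SK (t + s) x)"
    by (rule continuous_on_compose2[OF SK_continuous]) (use s in \<open>auto intro!: continuous_intros\<close>)
  thus "continuous_on {0..} (\<lambda>t. SK (t + s) x)" .
  fix t :: real assume t: "t \<ge> 0"
  \<comment> \<open>The integral over \<open>{0..t + s}\<close> is cut at \<open>s\<close>: the
    first piece becomes \<open>S t\<close> applied to the Volterra term at \<open>s\<close>, the
    second the Volterra term of the shifted solution.\<close>
  let ?f = "\<lambda>r. S (t + s - r) (K (SK r x))"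
  have "integral {0..s} ?f = integral {0..s} (S t \<circ> (\<lambda>r. S (s - r) (K (SK r x))))"
    by (intro integral_cong) (use t S_add in \<open>simp add: add_diff_eq[symmetric]\<close>)
  also have "\<dots> = S t (volterra (\<lambda>r. SK r x) s)"
    unfolding volterra_def by (intro integral_linear volterra_integrable SK_continuous S_linear t)
  finally have 1: "integral {0..s} ?f = S t (volterra (\<lambda>r. SK r x) s)" .
  have "integral {s..t + s} ?f = integral {0 + s..t + s} ?f" by simp
  also have "\<dots> = integral {0..t} (?f \<circ> ((+) s))" by (rule integral_shift_Icc_real[symmetric])
  also have "\<dots> = volterra (\<lambda>t. SK (t + s) x) t" by (simp add: volterra_def o_def add.commute)
  finally have 2: "integral {s..t + s} ?f = volterra (\<lambda>t. SK (t + s) x) t" .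
  have "volterra (\<lambda>r. SK r x) (t + s) = integral {0..s} ?f + integral {s..t + s} ?f"
    unfolding volterra_def
    by (rule Henstock_Kurzweil_Integration.integral_combine[symmetric])
      (use s t in \<open>auto intro: volterra_integrable SK_continuous\<close>)
  with 1 2 show "SK (t + s) x = S t (SK s x) + volterra (\<lambda>t. SK (t + s) x) t"
    using SK_volterra[of "t + s" x] SK_volterra[OF s, of x] S_add[OF t s] s t
    by (simp add: linear_simps[OF S_linear[OF t]])
qed

lemma SK_0: "SK 0 x = x"
  using SK_volterra[of 0 x] by (simp add: volterra_def S_0)

lemma volterra_mean_tendsto: "((\<lambda>t. (1 / t) *\<^sub>R volterra (\<lambda>s. SK s x) t) \<longlongrightarrow> K x) (at_right 0)"
proof -
  let ?g = "\<lambda>t. integral (cbox 0 1) (\<lambda>r::real. S (t - t * r) (K (SK (t * r) x)))"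
  have "(?g \<longlongrightarrow> ?g 0) (at 0 within {0..})"
    using volterra_mean_continuous[OF SK_continuous, of x] unfolding continuous_on_def by (rule bspec) simp
  hence "(?g \<longlongrightarrow> ?g 0) (at_right 0)" unfolding at_within_atLeast .
  moreover have "?g 0 = K x" by (simp add: S_0 SK_0)
  moreover have "\<forall>\<^sub>F t in at_right 0. ?g t = (1 / t) *\<^sub>R volterra (\<lambda>s. SK s x) t"
    unfolding eventually_at_filter
    by (intro always_eventually) (auto simp: volterra_scaled[OF SK_continuous])
  ultimately show ?thesis using Lim_transform_eventually by fastforce
qed

text \<open>The difference quotients of \<open>SK\<close> and \<open>S\<close> at \<open>x\<close>
  differ by a term tending to \<open>K x\<close>, so one converges exactly when the other does. This
  gives equality of the domains and not merely an inclusion.\<close>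

lemma generates_perturb: "generates (op_perturb A K) SK"
proof -
  have eq: "(1 / t) *\<^sub>R (SK t x - x) = (1 / t) *\<^sub>R (S t x - x) + (1 / t) *\<^sub>R volterra (\<lambda>s. SK s x) t" if "t > 0" for t x
    using SK_volterra[of t x] that by (simp add: algebra_simps)
  have 1: "((\<lambda>t. (1 / t) *\<^sub>R (SK t x - x)) \<longlongrightarrow> y + K x) (at_right 0)"
    if "((\<lambda>t. (1 / t) *\<^sub>R (S t x - x)) \<longlongrightarrow> y) (at_right 0)" for x y
    by (rule Lim_transform_eventually[OF tendsto_add[OF that volterra_mean_tendsto]])
      (use eq in \<open>auto simp: eventually_at_filter intro!: always_eventually\<close>)
  have 2: "((\<lambda>t. (1 / t) *\<^sub>R (S t x - x)) \<longlongrightarrow> y - K x) (at_right 0)"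
    if "((\<lambda>t. (1 / t) *\<^sub>R (SK t x - x)) \<longlongrightarrow> y) (at_right 0)" for x y
    by (rule Lim_transform_eventually[OF tendsto_diff[OF that volterra_mean_tendsto]])
      (use eq in \<open>auto simp: eventually_at_filter intro!: always_eventually\<close>)
  have dom: "fst A = {x. \<exists>y. ((\<lambda>t. (1 / t) *\<^sub>R (SK t x - x)) \<longlongrightarrow> y) (at_right 0)}"
    using gen 1 2 unfolding generates_def by blast
  have "c0_semigroup SK"
    unfolding c0_semigroup_def
  proof (intro conjI allI impI)
    fix t :: real assume t: "0 \<le> t"
    obtain C where C: "\<And>x. norm (SK t x) \<le> C * norm x" using SK_bound[OF t] by blast
    show "bounded_clinear (SK t)"
      unfolding bounded_clinear_def using C SK_add[OF t] SK_scaleC[OF t]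
      by (auto intro!: bounded_linear_intro[of _ C] simp: scaleR_eq_scaleC mult.commute)
  next
    show "SK 0 = id" by (auto simp: SK_0)
    show "SK (s + t) = SK s \<circ> SK t" if "0 \<le> s" "0 \<le> t" for s t
      using SK_semigroup[OF that(2,1)] by auto
    fix x
    have "((\<lambda>t. SK t x) \<longlongrightarrow> SK 0 x) (at 0 within {0..})"
      using SK_continuous[of x] unfolding continuous_on_def by (rule bspec) simp
    thus "((\<lambda>t. SK t x) \<longlongrightarrow> x) (at_right 0)" by (simp add: SK_0 at_within_atLeast)
  qed
  thus ?thesis unfolding generates_def
    using dom 1 A_tendsto by (auto simp: op_perturb_def)
qed

end


subsection \<open>Square integrable controls\<close>

abbreviation "Leb T \<equiv> lebesgue_on {0..T::real}"

definition l2ip :: "real \<Rightarrow> (real \<Rightarrow> 'u::real_inner) \<Rightarrow> (real \<Rightarrow> 'u) \<Rightarrow> real" where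
  "l2ip T u g = (\<integral>t. inner (u t) (g t) \<partial>Leb T)"

definition l2sq :: "real \<Rightarrow> (real \<Rightarrow> 'u::real_normed_vector) \<Rightarrow> real" where
  "l2sq T u = (\<integral>t. (norm (u t))\<^sup>2 \<partial>Leb T)"

text \<open>Controls are functions on the whole line vanishing outside \<open>{0..T}\<close>, so
  that shifting, extending and cutting act on the functions themselves. Finitely many values keep
  sums and pairings with continuous functions measurable in a possibly nonseparable control
  space.\<close>

definition simple_controls :: "real \<Rightarrow> (real \<Rightarrow> 'u::real_normed_vector) set" where
  "simple_controls T = {u. simple_function lebesgue u \<and> (\<forall>t. t \<notin> {0..T} \<longrightarrow> u t = 0)}"

text \<open>Everywhere limits of simple functions; every element of \<open>L2\<close> agrees almost everywhere
  with such a function.\<close>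

definition regular_controls :: "real \<Rightarrow> (real \<Rightarrow> 'u::real_normed_vector) set" where
  "regular_controls T = {u. (\<forall>t. t \<notin> {0..T} \<longrightarrow> u t = 0) \<and>
     (\<exists>v. (\<forall>n. simple_function lebesgue (v n)) \<and> (\<forall>t. (\<lambda>n::nat. v n t) \<longlonglongrightarrow> u t)) \<and>
     integrable (Leb T) (\<lambda>t. (norm (u t))\<^sup>2)}"

lemma simple_function_measurable_comp:
  fixes h :: "'b \<Rightarrow> 'c::topological_space"
  assumes "simple_function lebesgue u"
  shows "(\<lambda>t. h (u t)) \<in> borel_measurable (Leb T)"
proof -
  have "(\<lambda>t. h (u t)) \<in> borel_measurable lebesgue"
    by (intro borel_measurable_simple_function) (use simple_function_compose1[OF assms] in auto)
  thus ?thesis by (rule measurable_restrict_space1)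
qed

lemma simple_function_imp_bounded:
  fixes u :: "real \<Rightarrow> 'u::real_normed_vector"
  assumes "simple_function lebesgue u"
  shows "\<exists>R>0. \<forall>t. norm (u t) \<le> R"
proof -
  have "finite (range u)" using simple_functionD(1)[OF assms] by simp
  hence "bounded (range u)" by (rule finite_imp_bounded)
  thus ?thesis by (auto simp: bounded_pos)
qed

lemma simple_inner_measurable:
  fixes u :: "real \<Rightarrow> 'u::real_inner"
  assumes u: "simple_function lebesgue u" and g: "continuous_on {0..T} g"
  shows "(\<lambda>t. inner (u t) (g t)) \<in> borel_measurable (Leb T)"
proof -
  have fin: "finite (range u)" using simple_functionD(1)[OF u] by simp
  have "(\<lambda>t. \<Sum>y\<in>range u. indicator (u -` {y}) t * inner y (g t)) \<in> borel_measurable (Leb T)"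
  proof (intro borel_measurable_sum borel_measurable_times)
    fix y
    have "u -` {y} \<in> sets lebesgue" using simple_functionD(2)[OF u, of "{y}"] by simp
    hence "(indicator (u -` {y}) :: real \<Rightarrow> real) \<in> borel_measurable lebesgue" by simp
    thus "(indicator (u -` {y}) :: real \<Rightarrow> real) \<in> borel_measurable (Leb T)"
      by (rule measurable_restrict_space1)
    show "(\<lambda>t. inner y (g t)) \<in> borel_measurable (Leb T)"
      by (intro continuous_imp_measurable_on_sets_lebesgue continuous_intros g) auto
  qed
  also have "(\<lambda>t. \<Sum>y\<in>range u. indicator (u -` {y}) t * inner y (g t)) = (\<lambda>t. inner (u t) (g t))"
  proof
    fix t
    have "(\<Sum>y\<in>range u. indicator (u -` {y}) t * inner y (g t)) = (\<Sum>y\<in>{u t}. indicator (u -` {y}) t * inner y (g t))"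
      by (rule sum.mono_neutral_right) (use fin in \<open>auto simp: indicator_def\<close>)
    thus "(\<Sum>y\<in>range u. indicator (u -` {y}) t * inner y (g t)) = inner (u t) (g t)" by (simp add: indicator_def)
  qed
  finally show ?thesis .
qed

lemma integrable_const_Leb: "integrable (Leb T) (\<lambda>_. c::real)"
  by (rule finite_measure.integrable_const[OF finite_measure_lebesgue_on]) simp

lemma integrable_bounded_Leb:
  fixes f :: "real \<Rightarrow> real"
  assumes "f \<in> borel_measurable (Leb T)" "\<And>t. t \<in> {0..T} \<Longrightarrow> \<bar>f t\<bar> \<le> C"
  shows "integrable (Leb T) f"
proof (rule Bochner_Integration.integrable_bound[where f = "\<lambda>_. C"])
  show "integrable (Leb T) (\<lambda>_. C)" by (intro integrable_const_Leb)
  show "AE t in Leb T. norm (f t) \<le> norm C" by (rule AE_I2) (use assms(2) in \<open>fastforce\<close>)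
qed (rule assms(1))

lemma simple_controls_regular:
  fixes u :: "real \<Rightarrow> 'u::real_normed_vector"
  assumes u: "u \<in> simple_controls T"
  shows "u \<in> regular_controls T"
proof -
  have s: "simple_function lebesgue u" using u by (simp add: simple_controls_def)
  obtain R where R: "\<And>t. norm (u t) \<le> R" using simple_function_imp_bounded[OF s] by blast
  have "integrable (Leb T) (\<lambda>t. (norm (u t))\<^sup>2)"
    by (rule integrable_bounded_Leb[where C = "R\<^sup>2"])
      (use simple_function_measurable_comp[OF s] R in \<open>auto intro: power_mono\<close>)
  thus ?thesis using u s unfolding simple_controls_def regular_controls_def
    by (auto intro!: exI[of _ "\<lambda>n. u"])
qed

text \<open>Since the control space may be nonseparable, measurability is claimed only for
  real-valued functions of the control, as limits of the same functions of simple ones.\<close>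

lemma regular_norm_measurable:
  assumes u: "u \<in> regular_controls T" and w: "simple_function lebesgue w"
  shows "(\<lambda>t. norm (u t - w t)) \<in> borel_measurable lebesgue"
proof -
  obtain v where v: "\<And>n. simple_function lebesgue (v n)" "\<And>t. (\<lambda>n::nat. v n t) \<longlonglongrightarrow> u t"
    using u by (auto simp: regular_controls_def)
  show ?thesis
  proof (rule borel_measurable_LIMSEQ_real)
    show "(\<lambda>n. norm (v n t - w t)) \<longlonglongrightarrow> norm (u t - w t)" for t by (intro tendsto_intros v)
    show "(\<lambda>t. norm (v n t - w t)) \<in> borel_measurable lebesgue" for n
      by (rule borel_measurable_simple_function)
        (rule simple_function_compose2[OF v(1) w, of "\<lambda>x y. norm (x - y)"])
  qed
qed

lemma regular_norm_measurable_0: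
  assumes u: "u \<in> regular_controls T"
  shows "(\<lambda>t. norm (u t)) \<in> borel_measurable lebesgue"
  using regular_norm_measurable[OF u, of "\<lambda>_. 0"] by simp

lemma regular_inner_measurable:
  fixes u :: "real \<Rightarrow> 'u::real_inner"
  assumes u: "u \<in> regular_controls T" and g: "continuous_on {0..T} g"
  shows "(\<lambda>t. inner (u t) (g t)) \<in> borel_measurable (Leb T)"
proof -
  obtain v where v: "\<And>n. simple_function lebesgue (v n)" "\<And>t. (\<lambda>n::nat. v n t) \<longlonglongrightarrow> u t"
    using u by (auto simp: regular_controls_def)
  show ?thesis
    by (rule borel_measurable_LIMSEQ_real[of _ "\<lambda>n t. inner (v n t) (g t)"])
      (auto intro!: tendsto_intros v simple_inner_measurable g)
qed

lemma continuous_on_Icc_bound: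
  fixes g :: "real \<Rightarrow> 'u::real_normed_vector"
  assumes "continuous_on {0..T} g"
  shows "\<exists>C>0. \<forall>t\<in>{0..T}. norm (g t) \<le> C"
proof -
  have "bounded (g ` {0..T})" using assms by (intro compact_imp_bounded compact_continuous_image) auto
  thus ?thesis by (auto simp: bounded_pos)
qed

lemma regular_norm_integrable:
  fixes u :: "real \<Rightarrow> 'u::real_normed_vector"
  assumes u: "u \<in> regular_controls T"
  shows "integrable (Leb T) (\<lambda>t. norm (u t))"
proof (rule Bochner_Integration.integrable_bound[where f = "\<lambda>t. 1 + (norm (u t))\<^sup>2"])
  show "integrable (Leb T) (\<lambda>t. 1 + (norm (u t))\<^sup>2)"
    using u by (intro Bochner_Integration.integrable_add integrable_const_Leb) (auto simp: regular_controls_def)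
  show "(\<lambda>t. norm (u t)) \<in> borel_measurable (Leb T)"
    by (intro measurable_restrict_space1 regular_norm_measurable_0[OF u])
  have "x \<le> 1 + x\<^sup>2" for x :: real using zero_le_power2[of "x - 1/2"] by (simp add: power2_eq_square algebra_simps)
  thus "AE t in Leb T. norm (norm (u t)) \<le> norm (1 + (norm (u t))\<^sup>2)" by (intro AE_I2) (simp add: abs_of_nonneg add_nonneg_nonneg)
qed

lemma regular_integrable:
  fixes u :: "real \<Rightarrow> 'u::real_inner"
  assumes u: "u \<in> regular_controls T" and g: "continuous_on {0..T} g"
  shows "integrable (Leb T) (\<lambda>t. inner (u t) (g t))"
proof -
  obtain C where C: "C > 0" "\<And>t. t \<in> {0..T} \<Longrightarrow> norm (g t) \<le> C" using continuous_on_Icc_bound[OF g] by blast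
  show ?thesis
  proof (rule Bochner_Integration.integrable_bound[where f = "\<lambda>t. C * norm (u t)"])
    show "AE t in Leb T. norm (inner (u t) (g t)) \<le> norm (C * norm (u t))"
    proof (rule AE_I2)
      fix t assume "t \<in> space (Leb T)"
      hence "norm (u t) * norm (g t) \<le> norm (u t) * C" using C by (intro mult_left_mono) auto
      thus "norm (inner (u t) (g t)) \<le> norm (C * norm (u t))"
        using Cauchy_Schwarz_ineq2[of "u t" "g t"] C(1) by (simp add: mult.commute)
    qed
  qed (intro integrable_mult_right regular_norm_integrable regular_inner_measurable u g)+
qed

text \<open>One sequence serves all modes of convergence that occur later: pointwise, in L1, of the
  squared L2 norms, and weakly against continuous functions.\<close>

lemma regular_approx:
  fixes u :: "real \<Rightarrow> 'u::real_inner"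
  assumes u: "u \<in> regular_controls T"
  shows "\<exists>v. (\<forall>n::nat. v n \<in> simple_controls T) \<and> (\<forall>t. (\<lambda>n. v n t) \<longlonglongrightarrow> u t) \<and>
    (\<lambda>n. \<integral>t. norm (u t - v n t) \<partial>Leb T) \<longlonglongrightarrow> 0 \<and> (\<forall>n. integrable (Leb T) (\<lambda>t. norm (u t - v n t))) \<and>
    (\<lambda>n. l2sq T (v n)) \<longlonglongrightarrow> l2sq T u \<and>
    (\<forall>g. continuous_on {0..T} g \<longrightarrow> (\<lambda>n. l2ip T (v n) g) \<longlonglongrightarrow> l2ip T u g)"
proof -
  obtain w where w: "\<And>n. simple_function lebesgue (w n)" "\<And>t. (\<lambda>n::nat. w n t) \<longlonglongrightarrow> u t"
    using u by (auto simp: regular_controls_def)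
  \<comment> \<open>Discarding values larger than twice the limit makes multiples of
    \<open>norm (u t)\<close> dominate. Where \<open>u t\<close> is not 0 the inequality holds
    eventually, so the limit is unchanged.\<close>
  define v where "v n t = (if norm (w n t) \<le> 2 * norm (u t) then w n t else 0)" for n t
  have vle: "norm (v n t) \<le> 2 * norm (u t)" for n t by (simp add: v_def)
  have vs: "v n \<in> simple_controls T" for n
  proof -
    have m: "{t. norm (w n t) \<le> 2 * norm (u t)} \<in> sets lebesgue"
    proof -
      have "(\<lambda>t. norm (w n t)) \<in> borel_measurable lebesgue"
        by (rule borel_measurable_simple_function) (rule simple_function_compose1[OF w(1)])
      moreover have "(\<lambda>t. 2 * norm (u t)) \<in> borel_measurable lebesgue"
        using regular_norm_measurable_0[OF u] by simp
      ultimately have "{t \<in> space lebesgue. norm (w n t) \<le> 2 * norm (u t)} \<in> sets lebesgue"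
        by (rule borel_measurable_le)
      thus ?thesis by simp
    qed
    have "simple_function lebesgue (\<lambda>t. if t \<in> {t. norm (w n t) \<le> 2 * norm (u t)} then w n t else 0)"
      by (rule simple_function_If_set) (use m w in auto)
    hence "simple_function lebesgue (v n)" by (simp add: v_def[abs_def])
    moreover have "v n t = 0" if "t \<notin> {0..T}" for t
      using vle[of n t] u that by (simp add: regular_controls_def)
    ultimately show ?thesis by (simp add: simple_controls_def)
  qed
  have vl: "(\<lambda>n. v n t) \<longlonglongrightarrow> u t" for t
  proof (cases "u t = 0")
    case True
    hence "v n t = 0" for n by (simp add: v_def)
    then show ?thesis using True by simp
  next
    case False
    have "(\<lambda>n. norm (w n t)) \<longlonglongrightarrow> norm (u t)" by (intro tendsto_intros w)
    moreover have "norm (u t) < 2 * norm (u t)" using False by simp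
    ultimately have "\<forall>\<^sub>F n in sequentially. norm (w n t) < 2 * norm (u t)" by (rule order_tendstoD)
    hence "\<forall>\<^sub>F n in sequentially. w n t = v n t" by eventually_elim (simp add: v_def)
    thus ?thesis by (rule Lim_transform_eventually[OF w(2)])
  qed
  have uv: "norm (u t - v n t) \<le> 3 * norm (u t)" for n t
    using norm_triangle_ineq4[of "u t" "v n t"] vle[of n t] by linarith
  have vsf: "simple_function lebesgue (v n)" for n using vs by (simp add: simple_controls_def)
  note vr = simple_controls_regular[OF vs]
  have 1: "(\<lambda>n. \<integral>t. norm (u t - v n t) \<partial>Leb T) \<longlonglongrightarrow> (\<integral>t. norm (u t - u t) \<partial>Leb T)"
  proof (rule integral_dominated_convergence[where w = "\<lambda>t. 3 * norm (u t)"])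
    show "(\<lambda>t. norm (u t - v n t)) \<in> borel_measurable (Leb T)" for n
      by (rule measurable_restrict_space1[OF regular_norm_measurable[OF u vsf]])
    show "AE t in Leb T. (\<lambda>n. norm (u t - v n t)) \<longlonglongrightarrow> norm (u t - u t)"
      by (intro AE_I2 tendsto_intros vl)
    show "AE t in Leb T. norm (norm (u t - v n t)) \<le> 3 * norm (u t)" for n
      using uv by (intro AE_I2) simp
  qed (auto intro!: integrable_mult_right regular_norm_integrable u)
  have 2: "integrable (Leb T) (\<lambda>t. norm (u t - v n t))" for n
  proof (rule Bochner_Integration.integrable_bound[where f = "\<lambda>t. 3 * norm (u t)"])
    show "(\<lambda>t. norm (u t - v n t)) \<in> borel_measurable (Leb T)"
      by (rule measurable_restrict_space1[OF regular_norm_measurable[OF u vsf]])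
    show "AE t in Leb T. norm (norm (u t - v n t)) \<le> norm (3 * norm (u t))"
      using uv by (intro AE_I2) simp
  qed (auto intro!: integrable_mult_right regular_norm_integrable u)
  have 3: "(\<lambda>n. l2sq T (v n)) \<longlonglongrightarrow> l2sq T u"
    unfolding l2sq_def
  proof (rule integral_dominated_convergence[where w = "\<lambda>t. 4 * (norm (u t))\<^sup>2"])
    show "(\<lambda>t. (norm (u t))\<^sup>2) \<in> borel_measurable (Leb T)"
      by (intro borel_measurable_power measurable_restrict_space1 regular_norm_measurable_0[OF u])
    show "(\<lambda>t. (norm (v n t))\<^sup>2) \<in> borel_measurable (Leb T)" for n
      by (intro borel_measurable_power measurable_restrict_space1 regular_norm_measurable_0[OF vr])
    show "AE t in Leb T. (\<lambda>n. (norm (v n t))\<^sup>2) \<longlonglongrightarrow> (norm (u t))\<^sup>2"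
      by (intro AE_I2 tendsto_intros vl)
    show "AE t in Leb T. norm ((norm (v n t))\<^sup>2) \<le> 4 * (norm (u t))\<^sup>2" for n
    proof (rule AE_I2)
      fix t show "norm ((norm (v n t))\<^sup>2) \<le> 4 * (norm (u t))\<^sup>2"
        using power_mono[OF vle[of n t] norm_ge_zero, of 2] by (simp add: power_mult_distrib)
    qed
  qed (use u in \<open>auto simp: regular_controls_def\<close>)
  have 4: "(\<lambda>n. l2ip T (v n) g) \<longlonglongrightarrow> l2ip T u g" if g: "continuous_on {0..T} g" for g
    unfolding l2ip_def
  proof -
    obtain C where C: "C > 0" "\<And>t. t \<in> {0..T} \<Longrightarrow> norm (g t) \<le> C" using continuous_on_Icc_bound[OF g] by blast
    show "(\<lambda>n. \<integral>t. inner (v n t) (g t) \<partial>Leb T) \<longlonglongrightarrow> (\<integral>t. inner (u t) (g t) \<partial>Leb T)"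
    proof (rule integral_dominated_convergence[where w = "\<lambda>t. 2 * C * norm (u t)"])
      show "(\<lambda>t. inner (u t) (g t)) \<in> borel_measurable (Leb T)" by (rule regular_inner_measurable[OF u g])
      show "(\<lambda>t. inner (v n t) (g t)) \<in> borel_measurable (Leb T)" for n by (rule regular_inner_measurable[OF vr g])
      show "AE t in Leb T. (\<lambda>n. inner (v n t) (g t)) \<longlonglongrightarrow> inner (u t) (g t)" by (intro AE_I2 tendsto_intros vl)
      show "AE t in Leb T. norm (inner (v n t) (g t)) \<le> 2 * C * norm (u t)" for n
      proof (rule AE_I2)
        fix t assume "t \<in> space (Leb T)"
        hence "norm (v n t) * norm (g t) \<le> (2 * norm (u t)) * C" using C vle by (intro mult_mono) auto
        thus "norm (inner (v n t) (g t)) \<le> 2 * C * norm (u t)"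
          using Cauchy_Schwarz_ineq2[of "v n t" "g t"] by (simp add: mult_ac)
      qed
    qed (auto intro!: integrable_mult_right regular_norm_integrable u)
  qed
  show ?thesis using vs vl 1 2 3 4 by (intro exI[of _ v]) auto
qed

lemma Leb_AE_I:
  assumes "T \<ge> 0" "N \<in> null_sets lebesgue" "\<And>t. t \<in> {0<..<T} \<Longrightarrow> t \<notin> N \<Longrightarrow> P t"
  shows "AE t in Leb T. P t"
proof -
  have "N \<union> {0, T} \<in> null_sets lebesgue"
    using assms(2) by (intro null_sets.Un) (auto simp: negligible_iff_null_sets[symmetric])
  moreover have "{x \<in> space lebesgue. \<not> (x \<in> {0..T} \<longrightarrow> P x)} \<subseteq> N \<union> {0, T}"
    using assms(3) by (auto simp: less_le)
  ultimately have "AE t in lebesgue. t \<in> {0..T} \<longrightarrow> P t" by (rule AE_I')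
  thus ?thesis by (subst AE_restrict_space_iff) auto
qed

text \<open>Setting the control to 0 at the endpoints and on the null set where the simple functions
  may fail to converge gives convergence everywhere, and input maps do not see the change. The
  parameter \<open>J\<close> covers controls on \<open>{0<..}\<close> and on \<open>{0<..<T}\<close>
  alike.\<close>

lemma L2_imp_regular:
  fixes u :: "real \<Rightarrow> 'u::complex_hilbert"
  assumes u: "u \<in> L2 J" and J: "J \<in> sets lebesgue" "{0<..<T} \<subseteq> J" and T: "T \<ge> 0"
  shows "\<exists>u'\<in>regular_controls T. AE t in Leb T. u' t = u t"
proof -
  obtain s where s: "\<And>n. simple_function (lebesgue_on J) (s n)" "AE t in lebesgue_on J. (\<lambda>n::nat. s n t) \<longlonglongrightarrow> u t"
    and fin: "(\<integral>\<^sup>+ t. ennreal ((norm (u t))\<^sup>2) \<partial>lebesgue_on J) < \<infinity>"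
    using u by (auto simp: L2_def)
  have "AE t in lebesgue. t \<in> J \<longrightarrow> (\<lambda>n. s n t) \<longlonglongrightarrow> u t"
    using s(2) J(1) by (subst (asm) AE_restrict_space_iff) auto
  then obtain N where N: "N \<in> null_sets lebesgue" "\<And>t. t \<in> J \<Longrightarrow> t \<notin> N \<Longrightarrow> (\<lambda>n. s n t) \<longlonglongrightarrow> u t"
    by (auto elim!: AE_E3)
  define G where "G = {0<..<T} - N"
  have G: "G \<in> sets lebesgue" "G \<subseteq> J" "G \<subseteq> {0..T}" using N(1) J by (auto simp: G_def)
  define v where "v n t = (if t \<in> G then s n t else 0)" for n t
  define u' where "u' t = (if t \<in> G then u t else 0)" for t
  have vs: "simple_function lebesgue (v n)" for n
    unfolding simple_function_def
  proof (intro conjI ballI)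
    have "v n ` space lebesgue \<subseteq> insert 0 (s n ` J)" using G by (auto simp: v_def)
    moreover have "finite (s n ` J)" using simple_functionD(1)[OF s(1), of n] by simp
    ultimately show "finite (v n ` space lebesgue)" by (meson finite_insert finite_subset)
    fix y
    have "s n -` {y} \<inter> J \<in> sets lebesgue"
      using simple_functionD(2)[OF s(1), of n "{y}"] J(1) by (simp add: sets_restrict_space_iff)
    moreover have "v n -` {y} \<inter> space lebesgue = ((s n -` {y} \<inter> J) \<inter> G) \<union> (if y = 0 then - G else {})"
      using G by (auto simp: v_def split: if_splits)
    ultimately show "v n -` {y} \<inter> space lebesgue \<in> sets lebesgue" using G by (auto simp: Compl_in_sets_lebesgue)
  qed
  have vl: "(\<lambda>n. v n t) \<longlonglongrightarrow> u' t" for t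
    using N(2) G by (auto simp: v_def u'_def G_def)
  have meas: "(\<lambda>t. (norm (u' t))\<^sup>2) \<in> borel_measurable (Leb T)"
    by (rule borel_measurable_LIMSEQ_real[of _ "\<lambda>n t. (norm (v n t))\<^sup>2"])
      (auto intro!: tendsto_intros vl simple_function_measurable_comp[OF vs, where h = "\<lambda>x. (norm x)\<^sup>2"])
  have "(\<integral>\<^sup>+ t. ennreal ((norm (u' t))\<^sup>2) \<partial>Leb T) = (\<integral>\<^sup>+ t. ennreal ((norm (u' t))\<^sup>2) * indicator {0..T} t \<partial>lebesgue)"
    by (subst nn_integral_restrict_space) auto
  also have "\<dots> \<le> (\<integral>\<^sup>+ t. ennreal ((norm (u t))\<^sup>2) * indicator J t \<partial>lebesgue)"
    by (intro nn_integral_mono) (use G in \<open>auto simp: u'_def indicator_def\<close>)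
  also have "\<dots> = (\<integral>\<^sup>+ t. ennreal ((norm (u t))\<^sup>2) \<partial>lebesgue_on J)"
    using J by (subst nn_integral_restrict_space) auto
  also note fin
  finally have "integrable (Leb T) (\<lambda>t. (norm (u' t))\<^sup>2)"
    by (intro integrableI_nonneg meas) auto
  moreover have "\<forall>t. t \<notin> {0..T} \<longrightarrow> u' t = 0" using G by (auto simp: u'_def)
  ultimately have "u' \<in> regular_controls T"
    using vs vl unfolding regular_controls_def by blast
  moreover have "AE t in Leb T. u' t = u t"
    by (rule Leb_AE_I[OF T N(1)]) (auto simp: u'_def G_def)
  ultimately show ?thesis by blast
qed

lemma simple_function_lebesgue_on:
  assumes "simple_function lebesgue f" "J \<in> sets lebesgue"
  shows "simple_function (lebesgue_on J) f"
  unfolding simple_function_def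
proof (intro conjI ballI)
  have "finite (range f)" using simple_functionD(1)[OF assms(1)] by simp
  thus "finite (f ` space (lebesgue_on J))" by (rule finite_subset[rotated]) auto
  fix y
  have "f -` {y} \<in> sets lebesgue" using simple_functionD(2)[OF assms(1), of "{y}"] by simp
  thus "f -` {y} \<inter> space (lebesgue_on J) \<in> sets (lebesgue_on J)"
    using assms(2) by (auto simp: sets_restrict_space_iff)
qed

lemma regular_imp_L2:
  fixes u :: "real \<Rightarrow> 'u::complex_hilbert"
  assumes u: "u \<in> regular_controls T"
  shows "u \<in> L2 {0<..}"
proof -
  obtain v where v: "\<And>n. simple_function lebesgue (v n)" "\<And>t. (\<lambda>n::nat. v n t) \<longlonglongrightarrow> u t"
    using u by (auto simp: regular_controls_def)
  have int: "integrable (Leb T) (\<lambda>t. (norm (u t))\<^sup>2)" using u by (simp add: regular_controls_def)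
  have "(\<integral>\<^sup>+ t. ennreal ((norm (u t))\<^sup>2) \<partial>lebesgue_on {0<..}) = (\<integral>\<^sup>+ t. ennreal ((norm (u t))\<^sup>2) * indicator {0<..} t \<partial>lebesgue)"
    by (subst nn_integral_restrict_space) auto
  also have "\<dots> \<le> (\<integral>\<^sup>+ t. ennreal ((norm (u t))\<^sup>2) * indicator {0..T} t \<partial>lebesgue)"
    by (intro nn_integral_mono) (use u in \<open>auto simp: regular_controls_def indicator_def\<close>)
  also have "\<dots> = (\<integral>\<^sup>+ t. ennreal ((norm (u t))\<^sup>2) \<partial>Leb T)"
    by (subst nn_integral_restrict_space) auto
  also have "\<dots> < \<infinity>" using nn_integral_eq_integral[OF int] by simp
  finally show ?thesis unfolding L2_def
    using simple_function_lebesgue_on[OF v(1)] v(2) by (auto intro!: exI[of _ v])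
qed


lemma simple_integrable:
  fixes u :: "real \<Rightarrow> 'u::real_inner"
  assumes u: "simple_function lebesgue u" and g: "continuous_on {0..T} g"
  shows "integrable (Leb T) (\<lambda>t. inner (u t) (g t))"
proof -
  obtain C where C: "C > 0" "\<And>t. t \<in> {0..T} \<Longrightarrow> norm (g t) \<le> C" using continuous_on_Icc_bound[OF g] by blast
  obtain R where R: "R > 0" "\<And>t. norm (u t) \<le> R" using simple_function_imp_bounded[OF u] by blast
  show ?thesis
  proof (rule integrable_bounded_Leb[OF simple_inner_measurable[OF u g]])
    fix t assume "t \<in> {0..T}"
    hence "norm (u t) * norm (g t) \<le> R * C" using R C by (intro mult_mono) auto
    thus "\<bar>inner (u t) (g t)\<bar> \<le> R * C" using Cauchy_Schwarz_ineq2[of "u t" "g t"] by simp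
  qed
qed

lemma simple_l2ip_HK:
  fixes u :: "real \<Rightarrow> 'u::real_inner"
  assumes u: "simple_function lebesgue u" and g: "continuous_on {0..T} g"
  shows "l2ip T u g = integral {0..T} (\<lambda>t. inner (u t) (g t))"
    "(\<lambda>t. inner (u t) (g t)) integrable_on {0..T}"
  unfolding l2ip_def
  by (rule lebesgue_integral_eq_integral[OF simple_integrable[OF assms]], simp)
    (rule integrable_on_lebesgue_on[OF simple_integrable[OF assms]], simp)

lemma simple_l2sq_HK:
  fixes u :: "real \<Rightarrow> 'u::real_normed_vector"
  assumes u: "simple_function lebesgue u"
  shows "l2sq T u = integral {0..T} (\<lambda>t. (norm (u t))\<^sup>2)" "integrable (Leb T) (\<lambda>t. (norm (u t))\<^sup>2)"
    "(\<lambda>t. (norm (u t))\<^sup>2) integrable_on {0..T}"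
proof -
  obtain R where R: "R > 0" "\<And>t. norm (u t) \<le> R" using simple_function_imp_bounded[OF u] by blast
  show *: "integrable (Leb T) (\<lambda>t. (norm (u t))\<^sup>2)"
    by (rule integrable_bounded_Leb[where C = "R\<^sup>2"])
      (use simple_function_measurable_comp[OF u] R in \<open>auto intro: power_mono\<close>)
  show "l2sq T u = integral {0..T} (\<lambda>t. (norm (u t))\<^sup>2)"
    unfolding l2sq_def by (rule lebesgue_integral_eq_integral[OF *]) simp
  show "(\<lambda>t. (norm (u t))\<^sup>2) integrable_on {0..T}"
    by (rule integrable_on_lebesgue_on[OF *]) simp
qed

lemma l2sq_nonneg: "l2sq T u \<ge> 0"
  unfolding l2sq_def by (intro integral_nonneg_AE) auto

lemma l2ip_scale: "l2ip T (\<lambda>t. c *\<^sub>R u t) g = c * l2ip T u g"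
  by (simp add: l2ip_def)

lemma l2sq_scale: "l2sq T (\<lambda>t. c *\<^sub>R u t) = c\<^sup>2 * l2sq T u"
  by (simp add: l2sq_def power_mult_distrib)

lemma simple_controls_simple: "u \<in> simple_controls T \<Longrightarrow> simple_function lebesgue u"
  by (simp add: simple_controls_def)

lemma simple_controls_scale: "u \<in> simple_controls T \<Longrightarrow> (\<lambda>t. c *\<^sub>R u t) \<in> simple_controls T"
  unfolding simple_controls_def using simple_function_compose1[of lebesgue u "\<lambda>x. c *\<^sub>R x"] by auto

lemma simple_controls_add:
  "u \<in> simple_controls T \<Longrightarrow> v \<in> simple_controls T \<Longrightarrow> (\<lambda>t. u t + v t) \<in> simple_controls T"
  unfolding simple_controls_def using simple_function_compose2[of lebesgue u v "(+)"] by auto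

lemma l2ip_add:
  fixes u v :: "real \<Rightarrow> 'u::real_inner"
  assumes "u \<in> simple_controls T" "v \<in> simple_controls T" "continuous_on {0..T} g"
  shows "l2ip T (\<lambda>t. u t + v t) g = l2ip T u g + l2ip T v g"
  unfolding l2ip_def inner_add_left
  by (intro Bochner_Integration.integral_add simple_integrable simple_controls_simple assms)
    (use assms simple_controls_simple in blast)+

lemma l2ip_add_right:
  fixes u :: "real \<Rightarrow> 'u::real_inner"
  assumes "u \<in> regular_controls T" "continuous_on {0..T} g" "continuous_on {0..T} h"
  shows "l2ip T u (\<lambda>t. g t + h t) = l2ip T u g + l2ip T u h"
  unfolding l2ip_def inner_add_right
  by (intro Bochner_Integration.integral_add regular_integrable assms)

lemma l2ip_scaleR_right: "l2ip T u (\<lambda>t. c *\<^sub>R g t) = c * l2ip T u g"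
  by (simp add: l2ip_def)

text \<open>Convexity of the squared norm, checked pointwise from its exact defect, will make the
  reachable set convex.\<close>

lemma l2sq_convex:
  fixes u v :: "real \<Rightarrow> 'u::real_inner"
  assumes "u \<in> simple_controls T" "v \<in> simple_controls T" and a: "a \<ge> 0" "b \<ge> 0" "a + b = 1"
  shows "l2sq T (\<lambda>t. a *\<^sub>R u t + b *\<^sub>R v t) \<le> a * l2sq T u + b * l2sq T v"
proof -
  have su: "simple_function lebesgue u" "simple_function lebesgue v" using assms by (auto simp: simple_controls_def)
  have pt: "(norm (a *\<^sub>R x + b *\<^sub>R y))\<^sup>2 \<le> a * (norm x)\<^sup>2 + b * (norm y)\<^sup>2" for x y :: 'u
  proof -
    have "a * (norm x)\<^sup>2 + b * (norm y)\<^sup>2 - (norm (a *\<^sub>R x + b *\<^sub>R y))\<^sup>2 = a * b * (norm (x - y))\<^sup>2"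
    proof -
      have b: "b = 1 - a" using a by simp
      show ?thesis unfolding b power2_norm_eq_inner
        by (simp add: inner_add inner_diff inner_commute algebra_simps)
    qed
    moreover have "a * b * (norm (x - y))\<^sup>2 \<ge> 0" using a by simp
    ultimately show ?thesis by linarith
  qed
  have "l2sq T (\<lambda>t. a *\<^sub>R u t + b *\<^sub>R v t) \<le> (\<integral>t. a * (norm (u t))\<^sup>2 + b * (norm (v t))\<^sup>2 \<partial>Leb T)"
    unfolding l2sq_def
  proof (rule integral_mono)
    show "integrable (Leb T) (\<lambda>t. (norm (a *\<^sub>R u t + b *\<^sub>R v t))\<^sup>2)"
      by (rule simple_l2sq_HK) (rule simple_function_compose2[OF su, of "\<lambda>x y. a *\<^sub>R x + b *\<^sub>R y"])
  qed (use simple_l2sq_HK(2)[OF su(1), of T] simple_l2sq_HK(2)[OF su(2), of T] pt in auto)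
  also have "\<dots> = a * l2sq T u + b * l2sq T v"
    unfolding l2sq_def using simple_l2sq_HK(2)[OF su(1), of T] simple_l2sq_HK(2)[OF su(2), of T] by simp
  finally show ?thesis .
qed

lemma Leb_integral_extend:
  fixes f :: "real \<Rightarrow> real"
  assumes "\<And>s. s \<notin> {0..t} \<Longrightarrow> f s = 0" "t \<le> T"
  shows "integral\<^sup>L (Leb T) f = integral\<^sup>L (Leb t) f"
proof -
  have "integral\<^sup>L (Leb T) f = integral\<^sup>L (Leb T) (\<lambda>s. if s \<in> {0..t} then f s else 0)"
    by (intro Bochner_Integration.integral_cong) (use assms(1) in auto)
  also have "\<dots> = integral\<^sup>L (Leb t) f"
    using assms(2) by (intro Lebesgue_Measure.integral_restrict) auto
  finally show ?thesis .
qed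

lemma simple_controls_extend:
  assumes "u \<in> simple_controls t" "t \<le> T"
  shows "u \<in> simple_controls T" "l2sq T u = l2sq t u" "l2ip T u g = l2ip t u g"
proof -
  show "u \<in> simple_controls T" using assms by (auto simp: simple_controls_def)
  show "l2sq T u = l2sq t u" "l2ip T u g = l2ip t u g" unfolding l2sq_def l2ip_def
    by (rule Leb_integral_extend; use assms in \<open>simp add: simple_controls_def\<close>)+
qed

lemma simple_controls_truncate:
  assumes u: "u \<in> simple_controls T" and t: "t \<le> T"
  defines "v \<equiv> \<lambda>s. if s \<le> t then u s else 0"
  shows "v \<in> simple_controls t" "l2sq t v \<le> l2sq T u" "l2ip t v g = l2ip t u g"
proof -
  have su: "simple_function lebesgue u" using u by (simp add: simple_controls_def)
  have "simple_function lebesgue (\<lambda>s. if s \<in> {..t} then u s else 0)"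
    by (rule simple_function_If_set) (use su in auto)
  hence sv: "simple_function lebesgue v" by (simp add: v_def)
  thus v: "v \<in> simple_controls t" using u by (auto simp: simple_controls_def v_def)
  have "l2sq t v = l2sq T v" using simple_controls_extend(2)[OF v t] by simp
  also have "\<dots> \<le> l2sq T u"
    unfolding l2sq_def
    by (rule integral_mono) (use simple_l2sq_HK(2)[OF su, of T] simple_l2sq_HK(2)[OF sv, of T] in \<open>auto simp: v_def\<close>)
  finally show "l2sq t v \<le> l2sq T u" .
  show "l2ip t v g = l2ip t u g" unfolding l2ip_def
    by (intro Bochner_Integration.integral_cong) (auto simp: v_def)
qed

lemma simple_function_translate:
  assumes "simple_function lebesgue u"
  shows "simple_function lebesgue (\<lambda>s::real. u (s - a))"
  unfolding simple_function_def
proof (intro conjI ballI)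
  have "finite (range u)" using simple_functionD(1)[OF assms] by simp
  thus "finite ((\<lambda>s. u (s - a)) ` space lebesgue)" by (rule finite_subset[rotated]) auto
  fix y
  have "u -` {y} \<in> sets lebesgue" using simple_functionD(2)[OF assms, of "{y}"] by simp
  hence "(\<lambda>x. a + x) ` (u -` {y}) \<in> sets lebesgue" by (rule lebesgue_sets_translation)
  moreover have "(\<lambda>s. u (s - a)) -` {y} \<inter> space lebesgue = (\<lambda>x. a + x) ` (u -` {y})"
  proof (intro equalityI subsetI)
    fix s assume "s \<in> (\<lambda>s. u (s - a)) -` {y} \<inter> space lebesgue"
    thus "s \<in> (\<lambda>x. a + x) ` (u -` {y})" by (intro image_eqI[of _ _ "s - a"]) auto
  qed auto
  ultimately show "(\<lambda>s. u (s - a)) -` {y} \<inter> space lebesgue \<in> sets lebesgue" by simp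
qed

text \<open>A delay by \<open>a\<close>. The integrals are passed to the gauge integral, where the
  interval can be translated, and the vanishing of \<open>v\<close> before \<open>a\<close> accounts
  for the added interval.\<close>

lemma simple_controls_shift:
  fixes u :: "real \<Rightarrow> 'u::real_inner"
  assumes u: "u \<in> simple_controls T" and a: "a \<ge> 0"
  defines "v \<equiv> \<lambda>s. u (s - a)"
  shows "v \<in> simple_controls (T + a)" "l2sq (T + a) v = l2sq T u"
    "continuous_on {0..T + a} g \<Longrightarrow> l2ip (T + a) v g = l2ip T u (\<lambda>s. g (s + a))"
proof -
  have su: "simple_function lebesgue u" using u by (simp add: simple_controls_def)
  have sv: "simple_function lebesgue v" unfolding v_def by (rule simple_function_translate[OF su])
  show "v \<in> simple_controls (T + a)" using u a sv by (auto simp: simple_controls_def v_def)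
  have shift: "integral {0..T + a} f = integral {0..T} (f \<circ> ((+) a))"
    if "\<And>s. s \<notin> {a..T + a} \<Longrightarrow> f s = 0" for f :: "real \<Rightarrow> real"
  proof -
    have "integral {0..T} (f \<circ> ((+) a)) = integral {a..T + a} f"
      using integral_shift_Icc_real[of 0 T f a] by simp
    also have "\<dots> = integral {0..T + a} (\<lambda>s. if s \<in> {a..T + a} then f s else 0)"
      using Henstock_Kurzweil_Integration.integral_restrict_Int[of "{0..T + a}" "{a..T + a}" f] a
      by (simp add: Int_absorb1)
    also have "(\<lambda>s. if s \<in> {a..T + a} then f s else 0) = f" using that by auto
    finally show ?thesis by (simp add: o_def)
  qed
  have v0: "v s = 0" if "s \<notin> {a..T + a}" for s using u that by (auto simp: simple_controls_def v_def)
  show "l2sq (T + a) v = l2sq T u"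
    unfolding simple_l2sq_HK(1)[OF su] simple_l2sq_HK(1)[OF sv]
    by (subst shift) (use v0 in \<open>auto simp: v_def o_def\<close>)
  assume g: "continuous_on {0..T + a} g"
  have g': "continuous_on {0..T} (\<lambda>s. g (s + a))"
    by (rule continuous_on_compose2[OF g]) (use a in \<open>auto intro!: continuous_intros\<close>)
  show "l2ip (T + a) v g = l2ip T u (\<lambda>s. g (s + a))"
    unfolding simple_l2ip_HK(1)[OF su g'] simple_l2ip_HK(1)[OF sv g]
    by (subst shift) (use v0 in \<open>auto simp: v_def o_def add.commute\<close>)
qed

text \<open>Partial sums of a series of simple controls are again simple, so no closure property of
  strongly measurable functions is needed.\<close>

lemma series_control:
  fixes u :: "nat \<Rightarrow> real \<Rightarrow> 'u::{real_inner,banach}"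
  assumes u: "\<And>k. u k \<in> simple_controls T" "\<And>k. l2sq T (u k) \<le> 1" and c: "\<And>k. \<bar>c k\<bar> \<le> (1/2) ^ k"
  shows "\<exists>w\<in>regular_controls T. \<forall>g. continuous_on {0..T} g \<longrightarrow> (\<lambda>k. c k * l2ip T (u k) g) sums l2ip T w g"
proof -
  have su: "simple_function lebesgue (u k)" for k using u by (simp add: simple_controls_def)
  \<comment> \<open>The weighted sum of squared norms has integral at most 2 by monotone
    convergence. Hence it is finite almost everywhere, and twice its value dominates the squared
    norms of all partial sums.\<close>
  define q :: "real \<Rightarrow> ennreal" where "q t = (\<Sum>k. ennreal ((1/2) ^ k * (norm (u k t))\<^sup>2))" for t
  have qm: "q \<in> borel_measurable lebesgue"
    unfolding q_def
  proof (rule borel_measurable_suminf_order)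
    fix k
    have "simple_function lebesgue (\<lambda>t. ennreal ((1/2) ^ k * (norm (u k t))\<^sup>2))"
      by (rule simple_function_compose1[OF su])
    thus "(\<lambda>t. ennreal ((1/2) ^ k * (norm (u k t))\<^sup>2)) \<in> borel_measurable lebesgue"
      by (rule borel_measurable_simple_function)
  qed
  have qmT: "q \<in> borel_measurable (Leb T)" by (rule measurable_restrict_space1[OF qm])
  have "(\<integral>\<^sup>+ t. q t \<partial>Leb T) = (\<Sum>k. \<integral>\<^sup>+ t. ennreal ((1/2) ^ k * (norm (u k t))\<^sup>2) \<partial>Leb T)"
    unfolding q_def by (rule nn_integral_suminf) (rule simple_function_measurable_comp[OF su])
  also have "\<dots> \<le> (\<Sum>k. ennreal ((1/2) ^ k))"
  proof (rule suminf_le)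
    fix k
    have "(\<integral>\<^sup>+ t. ennreal ((1/2) ^ k * (norm (u k t))\<^sup>2) \<partial>Leb T) = ennreal (\<integral>t. (1/2) ^ k * (norm (u k t))\<^sup>2 \<partial>Leb T)"
      by (rule nn_integral_eq_integral) (use simple_l2sq_HK(2)[OF su, of T k] in auto)
    also have "\<dots> = ennreal ((1/2) ^ k * l2sq T (u k))" by (simp add: l2sq_def)
    also have "\<dots> \<le> ennreal ((1/2) ^ k)"
      using mult_left_mono[OF u(2), of "(1/2) ^ k" k] by (intro ennreal_leI) simp
    finally show "(\<integral>\<^sup>+ t. ennreal ((1/2) ^ k * (norm (u k t))\<^sup>2) \<partial>Leb T) \<le> ennreal ((1/2) ^ k)" .
  qed auto
  also have "\<dots> = ennreal 2"
    by (rule suminf_ennreal_eq) (use geometric_sums[of "1/2::real"] in auto)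
  finally have qfin: "(\<integral>\<^sup>+ t. q t \<partial>Leb T) \<le> ennreal 2" .
  have qAE: "AE t in Leb T. q t \<noteq> \<infinity>"
    by (rule nn_integral_noteq_infinite[OF qmT]) (use qfin in \<open>auto simp: top_unique\<close>)
  define G where "G = {t. q t \<noteq> \<infinity>}"
  have G: "G \<in> sets lebesgue"
  proof -
    have "{t \<in> space lebesgue. q t \<noteq> \<infinity>} \<in> sets lebesgue" using qm by measurable
    thus ?thesis by (simp add: G_def)
  qed
  define Q where "Q t = enn2real (q t)" for t
  have Qm: "Q \<in> borel_measurable (Leb T)" unfolding Q_def using qmT by measurable
  have Q0: "Q t \<ge> 0" for t by (simp add: Q_def)
  have Qint: "integrable (Leb T) Q"
  proof (rule integrableI_nonneg[OF Qm])
    have "(\<integral>\<^sup>+ t. ennreal (Q t) \<partial>Leb T) \<le> (\<integral>\<^sup>+ t. q t \<partial>Leb T)"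
      by (intro nn_integral_mono) (simp add: Q_def ennreal_enn2real_if)
    also note qfin
    finally show "(\<integral>\<^sup>+ t. ennreal (Q t) \<partial>Leb T) < \<infinity>" by (simp add: le_less_trans)
  qed (simp add: Q0)
  have sQ: "summable (\<lambda>k. (1/2) ^ k * (norm (u k t))\<^sup>2)" "(\<Sum>k. (1/2) ^ k * (norm (u k t))\<^sup>2) = Q t"
    if t: "t \<in> G" for t
  proof -
    show s: "summable (\<lambda>k. (1/2) ^ k * (norm (u k t))\<^sup>2)"
      by (rule summable_suminf_not_top) (use t in \<open>auto simp: G_def q_def\<close>)
    have "q t = ennreal (\<Sum>k. (1/2) ^ k * (norm (u k t))\<^sup>2)"
      unfolding q_def by (rule suminf_ennreal2[OF _ s]) auto
    thus "(\<Sum>k. (1/2) ^ k * (norm (u k t))\<^sup>2) = Q t"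
      by (simp add: Q_def suminf_nonneg[OF s])
  qed
  define p where "p n t = (\<Sum>k<n. c k *\<^sub>R u k t)" for n t
  define v where "v n t = (if t \<in> G then p n t else 0)" for n t
  define w where "w t = (if t \<in> G then (\<Sum>k. c k *\<^sub>R u k t) else 0)" for t
  have ps: "p n \<in> simple_controls T" for n
  proof (induction n)
    case 0
    then show ?case by (simp add: p_def simple_controls_def)
  next
    case (Suc n)
    have "p (Suc n) = (\<lambda>t. p n t + c n *\<^sub>R u n t)" by (simp add: p_def fun_eq_iff)
    thus ?case using simple_controls_add[OF Suc simple_controls_scale[OF u(1)]] by simp
  qed
  have vs: "v n \<in> simple_controls T" for n
  proof -
    have "simple_function lebesgue (\<lambda>t. if t \<in> G then p n t else 0)"
      by (rule simple_function_If_set) (use ps G in \<open>auto simp: simple_controls_def\<close>)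
    hence "simple_function lebesgue (v n)" by (simp add: v_def[abs_def])
    thus ?thesis using ps[of n] by (auto simp: simple_controls_def v_def)
  qed
  have x1: "x \<le> 1 + x\<^sup>2" for x :: real
    using zero_le_power2[of "x - 1/2"] by (simp add: power2_eq_square algebra_simps)
  have vl: "(\<lambda>n. v n t) \<longlonglongrightarrow> w t" for t
  proof (cases "t \<in> G")
    case True
    have "summable (\<lambda>k. c k *\<^sub>R u k t)"
    proof (rule summable_comparison_test')
      show "summable (\<lambda>k. (1/2) ^ k + (1/2) ^ k * (norm (u k t))\<^sup>2)"
        by (intro summable_add sQ(1)[OF True] summable_geometric) auto
      fix k
      have "norm (c k *\<^sub>R u k t) \<le> (1/2) ^ k * norm (u k t)" using c[of k] by (simp add: mult_right_mono)
      also have "\<dots> \<le> (1/2) ^ k * (1 + (norm (u k t))\<^sup>2)" by (intro mult_left_mono x1) auto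
      finally show "norm (c k *\<^sub>R u k t) \<le> (1/2) ^ k + (1/2) ^ k * (norm (u k t))\<^sup>2" by (simp add: algebra_simps)
    qed
    from summable_LIMSEQ[OF this] show ?thesis using True by (simp add: v_def w_def p_def)
  qed (simp add: v_def w_def)
  \<comment> \<open>Cauchy-Schwarz with each weight \<open>(1/2) ^ k\<close> split into two square
    roots; the factor 2 bounds the sum of the weights.\<close>
  have vb: "(norm (v n t))\<^sup>2 \<le> 2 * Q t" for n t
  proof (cases "t \<in> G")
    case True
    have "norm (p n t) \<le> (\<Sum>k<n. norm (c k *\<^sub>R u k t))" unfolding p_def by (rule norm_sum)
    also have "\<dots> \<le> (\<Sum>k<n. sqrt ((1/2) ^ k) * (sqrt ((1/2) ^ k) * norm (u k t)))"
      using c by (intro sum_mono) (simp add: mult.assoc[symmetric] mult_right_mono)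
    finally have "(norm (p n t))\<^sup>2 \<le> (\<Sum>k<n. sqrt ((1/2) ^ k) * (sqrt ((1/2) ^ k) * norm (u k t)))\<^sup>2"
      by (intro power_mono) auto
    also have "\<dots> \<le> (\<Sum>k<n. (sqrt ((1/2) ^ k))\<^sup>2) * (\<Sum>k<n. (sqrt ((1/2) ^ k) * norm (u k t))\<^sup>2)"
      by (rule Cauchy_Schwarz_ineq_sum)
    also have "\<dots> = (\<Sum>k<n. (1/2) ^ k) * (\<Sum>k<n. (1/2) ^ k * (norm (u k t))\<^sup>2)"
      by (simp add: power_mult_distrib)
    also have "\<dots> \<le> 2 * Q t"
    proof (intro mult_mono)
      have "(\<Sum>k<n. (1/2::real) ^ k) \<le> (\<Sum>k. (1/2) ^ k)"
        by (intro sum_le_suminf summable_geometric) auto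
      thus "(\<Sum>k<n. (1/2::real) ^ k) \<le> 2" by (simp add: suminf_geometric)
      show "(\<Sum>k<n. (1/2) ^ k * (norm (u k t))\<^sup>2) \<le> Q t"
        unfolding sQ(2)[OF True, symmetric] by (intro sum_le_suminf sQ(1)[OF True]) auto
    qed (auto intro: sum_nonneg)
    finally show ?thesis using True by (simp add: v_def)
  qed (simp add: v_def Q0)
  have wb: "(norm (w t))\<^sup>2 \<le> 2 * Q t" for t
  proof (rule LIMSEQ_le_const2)
    show "(\<lambda>n. (norm (v n t))\<^sup>2) \<longlonglongrightarrow> (norm (w t))\<^sup>2" by (intro tendsto_intros vl)
  qed (use vb in blast)
  have "(\<lambda>t. (norm (w t))\<^sup>2) \<in> borel_measurable (Leb T)"
    by (rule borel_measurable_LIMSEQ_real[of _ "\<lambda>n t. (norm (v n t))\<^sup>2"])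
      (auto intro!: tendsto_intros vl simple_function_measurable_comp[OF simple_controls_simple[OF vs], where h = "\<lambda>x. (norm x)\<^sup>2"])
  hence "integrable (Leb T) (\<lambda>t. (norm (w t))\<^sup>2)"
    by (rule Bochner_Integration.integrable_bound[where f = "\<lambda>t. 2 * Q t", rotated])
      (use Qint wb Q0 in auto)
  moreover have "w t = 0" if "t \<notin> {0..T}" for t
    using u(1) that by (simp add: w_def simple_controls_def)
  moreover have "\<forall>n. simple_function lebesgue (v n)" using simple_controls_simple[OF vs] by blast
  ultimately have w: "w \<in> regular_controls T"
    using vl unfolding regular_controls_def by blast
  have "(\<lambda>k. c k * l2ip T (u k) g) sums l2ip T w g" if g: "continuous_on {0..T} g" for g
  proof -
    obtain C where C: "C > 0" "\<And>t. t \<in> {0..T} \<Longrightarrow> norm (g t) \<le> C" using continuous_on_Icc_bound[OF g] by blast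
    have lim: "(\<lambda>n. l2ip T (v n) g) \<longlonglongrightarrow> l2ip T w g"
      unfolding l2ip_def
    proof (rule integral_dominated_convergence[where w = "\<lambda>t. C * (1 + 2 * Q t)"])
      show "(\<lambda>t. inner (w t) (g t)) \<in> borel_measurable (Leb T)" by (rule regular_inner_measurable[OF w g])
      show "(\<lambda>t. inner (v n t) (g t)) \<in> borel_measurable (Leb T)" for n
        by (rule simple_inner_measurable[OF simple_controls_simple[OF vs] g])
      show "AE t in Leb T. (\<lambda>n. inner (v n t) (g t)) \<longlonglongrightarrow> inner (w t) (g t)" by (intro AE_I2 tendsto_intros vl)
      show "AE t in Leb T. norm (inner (v n t) (g t)) \<le> C * (1 + 2 * Q t)" for n
      proof (rule AE_I2)
        fix t assume "t \<in> space (Leb T)"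
        hence t: "t \<in> {0..T}" by simp
        have "norm (v n t) \<le> 1 + 2 * Q t" using x1[of "norm (v n t)"] vb[of n t] by linarith
        hence "norm (v n t) * norm (g t) \<le> (1 + 2 * Q t) * C" using C(2)[OF t] Q0[of t] by (intro mult_mono) auto
        thus "norm (inner (v n t) (g t)) \<le> C * (1 + 2 * Q t)"
          using Cauchy_Schwarz_ineq2[of "v n t" "g t"] by (simp add: mult_ac)
      qed
    qed (auto intro!: Bochner_Integration.integrable_add integrable_const_Leb Qint)
    have eq: "l2ip T (v n) g = (\<Sum>k<n. c k * l2ip T (u k) g)" for n
    proof -
      have "l2ip T (v n) g = l2ip T (p n) g"
        unfolding l2ip_def
      proof (rule integral_cong_AE)
        show "AE t in Leb T. inner (v n t) (g t) = inner (p n t) (g t)"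
          using qAE by eventually_elim (simp add: v_def G_def)
      qed (rule simple_inner_measurable[OF simple_controls_simple g], rule vs ps)+
      also have "\<dots> = (\<integral>t. (\<Sum>k<n. c k * inner (u k t) (g t)) \<partial>Leb T)"
        by (simp add: l2ip_def p_def inner_sum_left)
      also have "\<dots> = (\<Sum>k<n. c k * l2ip T (u k) g)"
        by (subst Bochner_Integration.integral_sum) (auto simp: l2ip_def intro!: simple_integrable[OF su g])
      finally show ?thesis .
    qed
    show ?thesis using lim unfolding eq sums_def .
  qed
  thus ?thesis using w by blast
qed


subsection \<open>The input map as a weak integral\<close>

text \<open>With \<open>h\<close> the evaluation at a vector, the sum on the right is the one in
  \<open>has_dual_integral\<close>: tested against a fixed vector, the dual-valued integral of a
  simple function is an ordinary integral.\<close>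

lemma simple_lebesgue_integral:
  fixes h :: "'b \<Rightarrow> complex"
  assumes s: "simple_function (Leb T) s"
  shows "integrable (Leb T) (\<lambda>t. h (s t))"
    "(\<integral>t. h (s t) \<partial>Leb T) = (\<Sum>v\<in>s ` {0..T}. measure lebesgue {t \<in> {0..T}. s t = v} *\<^sub>R h v)"
proof -
  have fin: "finite (s ` {0..T})" using simple_functionD(1)[OF s] by simp
  have E: "{t \<in> {0..T}. s t = v} \<in> sets (Leb T)" for v
  proof -
    have "s -` {v} \<inter> {0..T} \<in> sets (Leb T)" using simple_functionD(2)[OF s, of "{v}"] by simp
    also have "s -` {v} \<inter> {0..T} = {t \<in> {0..T}. s t = v}" by auto
    finally show ?thesis .
  qed
  have fm: "emeasure (Leb T) X \<noteq> top" for X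
    by (rule finite_measure.emeasure_finite[OF finite_measure_lebesgue_on]) simp
  have eq: "h (s t) = (\<Sum>v\<in>s ` {0..T}. indicator {t \<in> {0..T}. s t = v} t *\<^sub>R h v)" if t: "t \<in> {0..T}" for t
  proof -
    have "(\<Sum>v\<in>s ` {0..T}. indicator {t \<in> {0..T}. s t = v} t *\<^sub>R h v)
        = (\<Sum>v\<in>{s t}. indicator {t \<in> {0..T}. s t = v} t *\<^sub>R h v)"
      by (rule sum.mono_neutral_right) (use fin t in \<open>auto simp: indicator_def\<close>)
    thus ?thesis using t by (simp add: indicator_def)
  qed
  have int: "integrable (Leb T) (\<lambda>t. indicator {t \<in> {0..T}. s t = v} t *\<^sub>R h v)" for v
    using E fm by (intro integrable_scaleR_left) (auto simp: less_top intro!: integrable_real_indicator)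
  show "integrable (Leb T) (\<lambda>t. h (s t))"
    by (subst Bochner_Integration.integrable_cong[OF refl eq]) (use int in auto)
  have "(\<integral>t. h (s t) \<partial>Leb T) = (\<integral>t. (\<Sum>v\<in>s ` {0..T}. indicator {t \<in> {0..T}. s t = v} t *\<^sub>R h v) \<partial>Leb T)"
    by (rule Bochner_Integration.integral_cong[OF refl]) (use eq in simp)
  also have "\<dots> = (\<Sum>v\<in>s ` {0..T}. (\<integral>t. indicator {t \<in> {0..T}. s t = v} t *\<^sub>R h v \<partial>Leb T))"
    by (rule Bochner_Integration.integral_sum[OF int])
  also have "\<dots> = (\<Sum>v\<in>s ` {0..T}. measure lebesgue {t \<in> {0..T}. s t = v} *\<^sub>R h v)"
  proof (rule sum.cong[OF refl])
    fix v
    have "(\<integral>t. indicator {t \<in> {0..T}. s t = v} t *\<^sub>R h v \<partial>Leb T) = measure (Leb T) {t \<in> {0..T}. s t = v} *\<^sub>R h v"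
      using E fm by (subst Bochner_Integration.integral_scaleR_left) (auto simp: less_top Int_absorb2 subset_iff intro!: integrable_real_indicator)
    also have "measure (Leb T) {t \<in> {0..T}. s t = v} = measure lebesgue {t \<in> {0..T}. s t = v}"
      by (rule measure_restrict_space) auto
    finally show "(\<integral>t. indicator {t \<in> {0..T}. s t = v} t *\<^sub>R h v \<partial>Leb T) = measure lebesgue {t \<in> {0..T}. s t = v} *\<^sub>R h v" .
  qed
  finally show "(\<integral>t. h (s t) \<partial>Leb T) = (\<Sum>v\<in>s ` {0..T}. measure lebesgue {t \<in> {0..T}. s t = v} *\<^sub>R h v)" .
qed

section \<open>The control operator, its adjoint and functionals bounded in the graph norm\<close>

locale control_system = generator A "semigroup_of A"
  for A :: "'a::complex_hilbert unbdd_op" +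
  fixes B :: "'u::complex_hilbert \<Rightarrow> 'a \<Rightarrow> complex"
  assumes control: "control_op A B"
begin

abbreviation "S \<equiv> semigroup_of A"
abbreviation "gn \<equiv> graph_norm (op_adjoint A)"
abbreviation "Bs \<equiv> control_adjoint B"

lemma gn_bounds: "norm \<phi> \<le> gn \<phi>" "norm (As \<phi>) \<le> gn \<phi>" "gn \<phi> \<le> norm \<phi> + norm (As \<phi>)" "0 \<le> gn \<phi>"
proof -
  show "norm \<phi> \<le> gn \<phi>" "norm (As \<phi>) \<le> gn \<phi>" unfolding graph_norm_def
    by (auto intro: real_le_rsqrt)
  show "gn \<phi> \<le> norm \<phi> + norm (As \<phi>)" unfolding graph_norm_def by (rule sqrt_sum_squares_le_sum) auto
  show "0 \<le> gn \<phi>" by (simp add: graph_norm_def)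
qed

lemma gn_scaleC: "\<phi> \<in> Ds \<Longrightarrow> gn (c *\<^sub>C \<phi>) = cmod c * gn \<phi>"
  by (simp add: graph_norm_def Ds_scaleC norm_scaleC power_mult_distrib flip: distrib_left)
    (simp add: real_sqrt_mult)

lemma gn_pos_scale:
  assumes "\<phi> \<in> Ds" "gn \<phi> > 0" shows "gn (complex_of_real (1 / gn \<phi>) *\<^sub>C \<phi>) = 1"
  using assms by (simp add: gn_scaleC norm_divide)

lemma cmod_le_dual_norm:
  assumes "\<phi> \<in> Ds" "gn \<phi> \<le> 1" shows "ennreal (cmod (\<psi> \<phi>)) \<le> dual_norm A \<psi>"
  unfolding dual_norm_def by (rule SUP_upper) (use assms in simp)

lemma dual_norm_leI:
  assumes "\<And>\<phi>. \<phi> \<in> Ds \<Longrightarrow> cmod (\<psi> \<phi>) \<le> c * gn \<phi>" "c \<ge> 0"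
  shows "dual_norm A \<psi> \<le> ennreal c"
  unfolding dual_norm_def
proof (rule SUP_least)
  fix \<phi> assume \<phi>: "\<phi> \<in> {\<phi> \<in> Ds. gn \<phi> \<le> 1}"
  have "cmod (\<psi> \<phi>) \<le> c * gn \<phi>" using \<phi> assms(1) by simp
  also have "\<dots> \<le> c * 1" using \<phi> assms(2) by (intro mult_left_mono) auto
  finally show "ennreal (cmod (\<psi> \<phi>)) \<le> ennreal c" by (intro ennreal_leI) simp
qed

lemma dual_norm_le_imp:
  assumes "\<And>c \<phi>. \<phi> \<in> Ds \<Longrightarrow> \<psi> (c *\<^sub>C \<phi>) = cnj c * \<psi> \<phi>" "dual_norm A \<psi> \<le> ennreal c" "c \<ge> 0" "\<phi> \<in> Ds"
  shows "cmod (\<psi> \<phi>) \<le> c * gn \<phi>"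
proof (cases "gn \<phi> = 0")
  case True
  hence "\<phi> = 0" using gn_bounds(1)[of \<phi>] by simp
  hence "\<psi> \<phi> = 0" using assms(1)[OF assms(4), of 0] by simp
  thus ?thesis using True by simp
next
  case False
  hence g: "gn \<phi> > 0" using gn_bounds(4)[of \<phi>] by simp
  let ?\<phi> = "complex_of_real (1 / gn \<phi>) *\<^sub>C \<phi>"
  have "ennreal (cmod (\<psi> ?\<phi>)) \<le> ennreal c"
    by (rule order_trans[OF cmod_le_dual_norm assms(2)]) (simp_all only: gn_pos_scale[OF assms(4) g] Ds_scaleC(1)[OF assms(4)])
  hence "cmod (\<psi> ?\<phi>) \<le> c" using assms(3) by simp
  thus ?thesis using g by (simp add: assms(1)[OF assms(4)] norm_mult field_simps norm_divide)
qed

lemma B_dual: "B u \<in> dual_space A" using control by (simp add: control_op_def)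

lemma B_add_right: "\<phi> \<in> Ds \<Longrightarrow> \<eta> \<in> Ds \<Longrightarrow> B u (\<phi> + \<eta>) = B u \<phi> + B u \<eta>"
  using B_dual[of u] by (simp add: dual_space_def)

lemma B_scaleC_right: "\<phi> \<in> Ds \<Longrightarrow> B u (c *\<^sub>C \<phi>) = cnj c * B u \<phi>"
  using B_dual[of u] by (simp add: dual_space_def)

lemma B_bound: "\<exists>\<beta>\<ge>0. \<forall>u. \<forall>\<phi>\<in>Ds. cmod (B u \<phi>) \<le> \<beta> * norm u * gn \<phi>"
proof -
  obtain C where C: "\<And>u. dual_norm A (B u) \<le> ennreal (C * norm u)" using control by (auto simp: control_op_def)
  have "cmod (B u \<phi>) \<le> \<bar>C\<bar> * norm u * gn \<phi>" if "\<phi> \<in> Ds" for u \<phi>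
  proof (rule dual_norm_le_imp[OF B_scaleC_right _ _ that])
    have "ennreal (C * norm u) \<le> ennreal (\<bar>C\<bar> * norm u)" by (intro ennreal_leI mult_right_mono) auto
    with C[of u] show "dual_norm A (B u) \<le> ennreal (\<bar>C\<bar> * norm u)" by (rule order_trans)
  qed auto
  thus ?thesis by (intro exI[of _ "\<bar>C\<bar>"]) auto
qed

lemma Bs_cinner:
  assumes "\<phi> \<in> Ds" shows "B u \<phi> = cinner u (Bs \<phi>)"
proof -
  obtain \<beta> where \<beta>: "\<And>u. cmod (B u \<phi>) \<le> \<beta> * norm u * gn \<phi>" using B_bound assms by blast
  have "\<exists>!w. \<forall>u. B u \<phi> = cinner u w"
    by (rule riesz_complex[where C = "\<beta> * gn \<phi>"]) (use control \<beta> in \<open>auto simp: control_op_def mult_ac\<close>)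
  from theI'[OF this] show ?thesis unfolding control_adjoint_def by (rule spec)
qed

lemma Bs_add: assumes "\<phi> \<in> Ds" "\<eta> \<in> Ds" shows "Bs (\<phi> + \<eta>) = Bs \<phi> + Bs \<eta>"
proof (rule cinner_eqI_inner)
  fix u
  have "cinner u (Bs (\<phi> + \<eta>)) = cinner u (Bs \<phi> + Bs \<eta>)"
    using assms by (simp add: Bs_cinner[symmetric] Ds_add B_add_right cinner_add_right)
  thus "inner u (Bs (\<phi> + \<eta>)) = inner u (Bs \<phi> + Bs \<eta>)" by (simp add: inner_eq_Re_cinner)
qed

lemma Bs_scaleC: assumes "\<phi> \<in> Ds" shows "Bs (c *\<^sub>C \<phi>) = c *\<^sub>C Bs \<phi>"
proof (rule cinner_eqI_inner)
  fix u
  have "cinner u (Bs (c *\<^sub>C \<phi>)) = cinner u (c *\<^sub>C Bs \<phi>)"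
    using assms by (simp add: Bs_cinner[symmetric] Ds_scaleC B_scaleC_right cinner_scaleC_right)
  thus "inner u (Bs (c *\<^sub>C \<phi>)) = inner u (c *\<^sub>C Bs \<phi>)" by (simp add: inner_eq_Re_cinner)
qed

lemma Bs_diff: assumes "\<phi> \<in> Ds" "\<eta> \<in> Ds" shows "Bs (\<phi> - \<eta>) = Bs \<phi> - Bs \<eta>"
  using Bs_add[OF assms(1) Ds_scaleC(1)[OF assms(2), of "-1"]] Bs_scaleC[OF assms(2), of "-1"] by simp

lemma Bs_bound: "\<exists>\<beta>>0. \<forall>\<phi>\<in>Ds. norm (Bs \<phi>) \<le> \<beta> * gn \<phi>"
proof -
  obtain \<beta> where \<beta>: "\<beta> \<ge> 0" "\<And>u \<phi>. \<phi> \<in> Ds \<Longrightarrow> cmod (B u \<phi>) \<le> \<beta> * norm u * gn \<phi>" using B_bound by blast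
  have "norm (Bs \<phi>) \<le> (\<beta> + 1) * gn \<phi>" if \<phi>: "\<phi> \<in> Ds" for \<phi>
  proof (rule norm_le_if_inner_le)
    fix u
    have "inner u (Bs \<phi>) \<le> cmod (B u \<phi>)"
      unfolding inner_eq_Re_cinner Bs_cinner[OF \<phi>, symmetric] by (rule complex_Re_le_cmod)
    also have "\<dots> \<le> \<beta> * norm u * gn \<phi>" using \<beta>(2)[OF \<phi>] .
    also have "\<dots> \<le> (\<beta> + 1) * gn \<phi> * norm u" using gn_bounds(4)[of \<phi>] by (simp add: algebra_simps)
    finally show "inner u (Bs \<phi>) \<le> (\<beta> + 1) * gn \<phi> * norm u" .
  qed (use \<beta>(1) gn_bounds in auto)
  thus ?thesis using \<beta>(1) by (intro exI[of _ "\<beta> + 1"]) auto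
qed

lemma Bs_continuous:
  fixes f :: "'x::topological_space \<Rightarrow> 'a"
  assumes f: "continuous_on X f" "continuous_on X (\<lambda>x. As (f x))" and D: "\<And>x. x \<in> X \<Longrightarrow> f x \<in> Ds"
  shows "continuous_on X (\<lambda>x. Bs (f x))"
  unfolding continuous_on_def
proof
  fix x assume x: "x \<in> X"
  obtain \<beta> where \<beta>: "\<beta> > 0" "\<And>\<phi>. \<phi> \<in> Ds \<Longrightarrow> norm (Bs \<phi>) \<le> \<beta> * gn \<phi>" using Bs_bound by blast
  have "((\<lambda>y. \<beta> * (norm (f y - f x) + norm (As (f y) - As (f x)))) \<longlongrightarrow> \<beta> * (norm (f x - f x) + norm (As (f x) - As (f x)))) (at x within X)"
    using f x by (intro tendsto_intros) (auto simp: continuous_on_def)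
  hence "((\<lambda>y. \<beta> * (norm (f y - f x) + norm (As (f y) - As (f x)))) \<longlongrightarrow> 0) (at x within X)" by simp
  moreover have "\<forall>\<^sub>F y in at x within X. norm (Bs (f y) - Bs (f x)) \<le> \<beta> * (norm (f y - f x) + norm (As (f y) - As (f x)))"
    unfolding eventually_at_filter
  proof (intro always_eventually allI impI)
    fix y assume y: "y \<in> X"
    have "norm (Bs (f y) - Bs (f x)) = norm (Bs (f y - f x))" using D[OF x] D[OF y] by (simp add: Bs_diff)
    also have "\<dots> \<le> \<beta> * gn (f y - f x)" using D[OF x] D[OF y] by (intro \<beta> Ds_diff)
    also have "\<dots> \<le> \<beta> * (norm (f y - f x) + norm (As (f y - f x)))" using \<beta>(1) by (intro mult_left_mono gn_bounds) auto
    finally show "norm (Bs (f y) - Bs (f x)) \<le> \<beta> * (norm (f y - f x) + norm (As (f y) - As (f x)))"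
      using D[OF x] D[OF y] by (simp add: Ds_diff)
  qed
  ultimately have "((\<lambda>y. Bs (f y) - Bs (f x)) \<longlongrightarrow> 0) (at x within X)"
    by (rule Lim_null_comparison[rotated])
  thus "((\<lambda>y. Bs (f y)) \<longlongrightarrow> Bs (f x)) (at x within X)" by (simp only: LIM_zero_iff)
qed

lemma Bs_Sa_continuous:
  assumes \<phi>: "\<phi> \<in> Ds" and f: "continuous_on X f" "\<And>x. x \<in> X \<Longrightarrow> f x \<ge> 0"
  shows "continuous_on X (\<lambda>x. Bs (Sa (f x) \<phi>))"
proof (rule Bs_continuous)
  show "continuous_on X (\<lambda>x. Sa (f x) \<phi>)" by (intro Sa_continuous f continuous_on_const)
  have "continuous_on X (\<lambda>x. Sa (f x) (As \<phi>))" by (intro Sa_continuous f continuous_on_const)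
  thus "continuous_on X (\<lambda>x. As (Sa (f x) \<phi>))" by (rule continuous_on_eq) (simp add: Sa_Ds \<phi> f)
qed (simp add: Sa_Ds \<phi> f)

lemma Bs_Sa_reversed_continuous:
  "\<phi> \<in> Ds \<Longrightarrow> continuous_on {0..T} (\<lambda>t. Bs (Sa (T - t) \<phi>))"
  by (rule Bs_Sa_continuous) (auto intro!: continuous_intros)

text \<open>The real part of the pairing of the input map with \<open>\<phi>\<close>.\<close>

definition ell :: "real \<Rightarrow> 'a \<Rightarrow> (real \<Rightarrow> 'u) \<Rightarrow> real" where
  "ell T \<phi> u = l2ip T u (\<lambda>t. Bs (Sa (T - t) \<phi>))"

text \<open>The value which the dual-valued integral turns out to have, obtained by integrating the
  scalar pairings for each vector separately. The extension by 0 is the normal form used in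
  \<open>dual_space\<close>.\<close>

definition weak_input :: "real \<Rightarrow> (real \<Rightarrow> 'u) \<Rightarrow> 'a \<Rightarrow> complex" where
  "weak_input T u \<phi> = (if \<phi> \<in> Ds then (\<integral>t. cinner (u t) (Bs (Sa (T - t) \<phi>)) \<partial>Leb T) else 0)"

lemma Sa_i: "\<phi> \<in> Ds \<Longrightarrow> t \<ge> 0 \<Longrightarrow> Bs (Sa t (c *\<^sub>C \<phi>)) = c *\<^sub>C Bs (Sa t \<phi>)"
  by (simp add: Sa_scaleC Bs_scaleC Sa_Ds)

lemma weak_input_integrable:
  assumes u: "u \<in> regular_controls T" and \<phi>: "\<phi> \<in> Ds"
  shows "integrable (Leb T) (\<lambda>t. cinner (u t) (Bs (Sa (T - t) \<phi>)))"
    "weak_input T u \<phi> = Complex (ell T \<phi> u) (ell T (\<i> *\<^sub>C \<phi>) u)"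
proof -
  have eq: "cinner (u t) (Bs (Sa (T - t) \<phi>)) = complex_of_real (inner (u t) (Bs (Sa (T - t) \<phi>)))
      + \<i> * complex_of_real (inner (u t) (Bs (Sa (T - t) (\<i> *\<^sub>C \<phi>))))" if "t \<in> {0..T}" for t
    using that by (simp add: Sa_i[OF \<phi>] cinner_eq_Complex complex_eq_iff)
  have 1: "integrable (Leb T) (\<lambda>t. inner (u t) (Bs (Sa (T - t) \<phi>)))"
    "integrable (Leb T) (\<lambda>t. inner (u t) (Bs (Sa (T - t) (\<i> *\<^sub>C \<phi>))))"
    by (intro regular_integrable u Bs_Sa_reversed_continuous \<phi> Ds_scaleC)+
  have int: "integrable (Leb T) (\<lambda>t. complex_of_real (inner (u t) (Bs (Sa (T - t) \<phi>)))
      + \<i> * complex_of_real (inner (u t) (Bs (Sa (T - t) (\<i> *\<^sub>C \<phi>)))))"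
    by (intro Bochner_Integration.integrable_add integrable_mult_right integrable_of_real 1)
  show "integrable (Leb T) (\<lambda>t. cinner (u t) (Bs (Sa (T - t) \<phi>)))"
    by (subst Bochner_Integration.integrable_cong[OF refl eq]) (use int in auto)
  have "(\<integral>t. cinner (u t) (Bs (Sa (T - t) \<phi>)) \<partial>Leb T) = (\<integral>t. complex_of_real (inner (u t) (Bs (Sa (T - t) \<phi>)))
      + \<i> * complex_of_real (inner (u t) (Bs (Sa (T - t) (\<i> *\<^sub>C \<phi>)))) \<partial>Leb T)"
    by (rule Bochner_Integration.integral_cong[OF refl]) (use eq in simp)
  also have "\<dots> = complex_of_real (ell T \<phi> u) + \<i> * complex_of_real (ell T (\<i> *\<^sub>C \<phi>) u)"
    unfolding ell_def l2ip_def
    by (subst Bochner_Integration.integral_add) (auto intro!: integrable_mult_right integrable_of_real 1)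
  finally show "weak_input T u \<phi> = Complex (ell T \<phi> u) (ell T (\<i> *\<^sub>C \<phi>) u)"
    using \<phi> by (simp add: weak_input_def complex_eq_iff)
qed

text \<open>A functional bounded in the graph norm is a bounded functional on the graph of
  \<open>As\<close>, which is closed, so it has a representing pair in the product space. In this
  form it can be applied to adjoint orbits by moving the semigroup onto \<open>p\<close> and
  \<open>q\<close>.\<close>

lemma dual_riesz:
  assumes \<psi>: "\<psi> \<in> dual_space A"
  shows "\<exists>p q. \<forall>\<phi>\<in>Ds. Re (\<psi> \<phi>) = inner \<phi> p + inner (As \<phi>) q"
proof -
  define G where "G = (\<lambda>\<phi>. (\<phi>, As \<phi>)) ` Ds"
  have add: "\<psi> (x + y) = \<psi> x + \<psi> y" if "x \<in> Ds" "y \<in> Ds" for x y using \<psi> that by (simp add: dual_space_def)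
  have scale: "\<psi> (c *\<^sub>C x) = cnj c * \<psi> x" if "x \<in> Ds" for c x using \<psi> that by (simp add: dual_space_def)
  obtain c where c: "c \<ge> 0" "dual_norm A \<psi> = ennreal c"
    using \<psi> by (cases "dual_norm A \<psi>") (auto simp: dual_space_def)
  have "\<exists>g\<in>G. \<forall>x\<in>G. Re (\<psi> (fst x)) = inner x g"
  proof (rule riesz_on_closed_subspace[where c = c])
    show "closed G"
      unfolding closed_sequential_limits
    proof (intro allI impI)
      fix z l assume z: "(\<forall>n. z n \<in> G) \<and> z \<longlonglongrightarrow> l"
      have 1: "fst (z n) \<in> Ds" "As (fst (z n)) = snd (z n)" for n
      proof -
        have "z n \<in> G" using z by blast
        thus "fst (z n) \<in> Ds" "As (fst (z n)) = snd (z n)" by (auto simp: G_def)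
      qed
      have 2: "(\<lambda>n. fst (z n)) \<longlonglongrightarrow> fst l" "(\<lambda>n. As (fst (z n))) \<longlonglongrightarrow> snd l"
        using z by (auto simp: 1 intro: tendsto_fst tendsto_snd)
      show "l \<in> G" using As_closed[OF 1(1) 2] by (auto simp: G_def image_iff intro!: bexI[of _ "fst l"] prod_eqI)
    qed
    show "subspace G"
    proof (rule subspaceI)
      show "0 \<in> G" unfolding G_def by (rule image_eqI[of _ _ 0]) (auto simp: Ds_0 zero_prod_def)
    qed (auto simp: G_def image_iff Ds_add Ds_scaleR)
    show "Re (\<psi> (fst (x + y))) = Re (\<psi> (fst x)) + Re (\<psi> (fst y))" if "x \<in> G" "y \<in> G" for x y
      using that add by (auto simp: G_def)
    show "Re (\<psi> (fst (r *\<^sub>R x))) = r * Re (\<psi> (fst x))" if "x \<in> G" for r x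
      using that scale by (auto simp: G_def scaleR_eq_scaleC)
    show "\<bar>Re (\<psi> (fst x))\<bar> \<le> c * norm x" if x: "x \<in> G" for x
    proof -
      have "\<bar>Re (\<psi> (fst x))\<bar> \<le> cmod (\<psi> (fst x))" by (rule abs_Re_le_cmod)
      also have "\<dots> \<le> c * gn (fst x)"
        by (rule dual_norm_le_imp[OF scale]) (use x c in \<open>auto simp: G_def\<close>)
      also have "gn (fst x) = norm x" using x by (auto simp: G_def graph_norm_def norm_prod_def)
      finally show ?thesis .
    qed
  qed
  then obtain g where g: "\<And>x. x \<in> G \<Longrightarrow> Re (\<psi> (fst x)) = inner x g" by blast
  have "Re (\<psi> \<phi>) = inner \<phi> (fst g) + inner (As \<phi>) (snd g)" if "\<phi> \<in> Ds" for \<phi>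
    using g[of "(\<phi>, As \<phi>)"] that by (simp add: G_def inner_prod_def)
  thus ?thesis by blast
qed

text \<open>Uniformity over the graph-norm ball is continuity of \<open>S(t) B w\<close> in the dual
  norm. The representation in \<open>dual_riesz\<close> reduces it to uniform continuity of the
  orbits \<open>S t p\<close> and \<open>S t q\<close>; real and imaginary part use a quarter of
  \<open>e\<close> for each orbit.\<close>

lemma B_Sa_uniformly_continuous:
  assumes e: "e > 0"
  shows "\<exists>\<delta>>0. \<forall>t\<in>{0..T}. \<forall>t'\<in>{0..T}. dist t t' < \<delta> \<longrightarrow>
    (\<forall>\<phi>\<in>Ds. cmod (B w (Sa t \<phi>) - B w (Sa t' \<phi>)) \<le> e * gn \<phi>)"
proof -
  obtain p q where pq: "\<And>\<phi>. \<phi> \<in> Ds \<Longrightarrow> Re (B w \<phi>) = inner \<phi> p + inner (As \<phi>) q"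
    using dual_riesz[OF B_dual] by blast
  have uc: "uniformly_continuous_on {0..T} (\<lambda>t. S t x)" for x
    by (intro compact_uniformly_continuous S_continuous continuous_intros) auto
  obtain d1 where d1: "d1 > 0" "\<And>t t'. t \<in> {0..T} \<Longrightarrow> t' \<in> {0..T} \<Longrightarrow> dist t t' < d1 \<Longrightarrow> norm (S t p - S t' p) < e / 4"
    using uc[of p] e unfolding uniformly_continuous_on_def dist_norm
    by (metis (no_types, opaque_lifting) norm_minus_commute zero_less_divide_iff zero_less_numeral)
  obtain d2 where d2: "d2 > 0" "\<And>t t'. t \<in> {0..T} \<Longrightarrow> t' \<in> {0..T} \<Longrightarrow> dist t t' < d2 \<Longrightarrow> norm (S t q - S t' q) < e / 4"
    using uc[of q] e unfolding uniformly_continuous_on_def dist_norm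
    by (metis (no_types, opaque_lifting) norm_minus_commute zero_less_divide_iff zero_less_numeral)
  have "cmod (B w (Sa t \<phi>) - B w (Sa t' \<phi>)) \<le> e * gn \<phi>"
    if t: "t \<in> {0..T}" "t' \<in> {0..T}" "dist t t' < min d1 d2" and \<phi>: "\<phi> \<in> Ds" for t t' \<phi>
  proof -
    have re: "\<bar>Re (B w (Sa t \<phi>) - B w (Sa t' \<phi>))\<bar> \<le> e / 2 * gn \<phi>" if \<phi>: "\<phi> \<in> Ds" for \<phi>
    proof -
      have "Re (B w (Sa t \<phi>) - B w (Sa t' \<phi>)) = inner \<phi> (S t p - S t' p) + inner (As \<phi>) (S t q - S t' q)"
        using t \<phi> by (simp add: pq Sa_Ds inner_adj'[OF S_bcl] inner_diff_right)
      also have "\<bar>\<dots>\<bar> \<le> norm \<phi> * norm (S t p - S t' p) + norm (As \<phi>) * norm (S t q - S t' q)"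
        by (intro order_trans[OF abs_triangle_ineq] add_mono Cauchy_Schwarz_ineq2)
      also have "\<dots> \<le> gn \<phi> * (e / 4) + gn \<phi> * (e / 4)"
        using d1(2)[of t t'] d2(2)[of t t'] t gn_bounds[of \<phi>] by (intro add_mono mult_mono) auto
      finally show ?thesis by (simp add: algebra_simps)
    qed
    have "Im (B w (Sa t \<phi>) - B w (Sa t' \<phi>)) = Re (B w (Sa t (\<i> *\<^sub>C \<phi>)) - B w (Sa t' (\<i> *\<^sub>C \<phi>)))"
      using t \<phi> by (simp add: Sa_scaleC B_scaleC_right Sa_Ds)
    hence im: "\<bar>Im (B w (Sa t \<phi>) - B w (Sa t' \<phi>))\<bar> \<le> e / 2 * gn \<phi>"
      using re[OF Ds_scaleC(1)[OF \<phi>, of \<i>]] gn_scaleC[OF \<phi>, of \<i>] by simp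
    show ?thesis using cmod_le[of "B w (Sa t \<phi>) - B w (Sa t' \<phi>)"] re[OF \<phi>] im by simp
  qed
  thus ?thesis using d1(1) d2(1) by (intro exI[of _ "min d1 d2"]) auto
qed

end


section \<open>The Bochner integral in the dual and its weak form\<close>

context control_system
begin

lemma gn_Sa_le:
  assumes "\<phi> \<in> Ds" "t \<ge> 0" "M \<ge> 0" "\<And>x. norm (Sa t x) \<le> M * norm x"
  shows "gn (Sa t \<phi>) \<le> M * gn \<phi>"
proof -
  have "(norm (Sa t \<phi>))\<^sup>2 + (norm (Sa t (As \<phi>)))\<^sup>2 \<le> (M * norm \<phi>)\<^sup>2 + (M * norm (As \<phi>))\<^sup>2"
    by (intro add_mono power_mono assms) auto
  also have "\<dots> = M\<^sup>2 * ((norm \<phi>)\<^sup>2 + (norm (As \<phi>))\<^sup>2)" by (simp add: power_mult_distrib algebra_simps)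
  finally show ?thesis
    using assms by (simp add: graph_norm_def Sa_Ds real_sqrt_mult[symmetric] real_le_lsqrt)
      (metis abs_of_nonneg real_sqrt_abs real_sqrt_le_mono real_sqrt_mult)
qed

lemma dual_space_bound:
  assumes "\<psi> \<in> dual_space A"
  shows "\<exists>c\<ge>0. \<forall>\<phi>\<in>Ds. cmod (\<psi> \<phi>) \<le> c * gn \<phi>"
proof -
  obtain c where c: "c \<ge> 0" "dual_norm A \<psi> = ennreal c"
    using assms by (cases "dual_norm A \<psi>") (auto simp: dual_space_def)
  have "cmod (\<psi> \<phi>) \<le> c * gn \<phi>" if "\<phi> \<in> Ds" for \<phi>
    by (rule dual_norm_le_imp[OF _ _ c(1) that]) (use assms c in \<open>auto simp: dual_space_def\<close>)
  thus ?thesis using c by blast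
qed

lemma dual_spaceI:
  assumes "\<And>\<phi> \<eta>. \<phi> \<in> Ds \<Longrightarrow> \<eta> \<in> Ds \<Longrightarrow> \<psi> (\<phi> + \<eta>) = \<psi> \<phi> + \<psi> \<eta>"
    "\<And>c \<phi>. \<phi> \<in> Ds \<Longrightarrow> \<psi> (c *\<^sub>C \<phi>) = cnj c * \<psi> \<phi>" "\<And>\<phi>. \<phi> \<notin> Ds \<Longrightarrow> \<psi> \<phi> = 0"
    and "\<And>\<phi>. \<phi> \<in> Ds \<Longrightarrow> cmod (\<psi> \<phi>) \<le> c * gn \<phi>" "c \<ge> 0"
  shows "\<psi> \<in> dual_space A"
proof -
  have "dual_norm A \<psi> \<le> ennreal c" using assms by (intro dual_norm_leI)
  hence "dual_norm A \<psi> < \<infinity>" by (rule le_less_trans) simp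
  thus ?thesis using assms by (auto simp: dual_space_def)
qed

lemma semigroup_ext_eq:
  "semigroup_ext A t \<psi> \<phi> = (if \<phi> \<in> Ds then \<psi> (Sa t \<phi>) else 0)"
  by (simp add: semigroup_ext_def op_adjoint_UNIV)

lemma semigroup_ext_dual:
  assumes \<psi>: "\<psi> \<in> dual_space A" and t: "t \<ge> 0"
  shows "semigroup_ext A t \<psi> \<in> dual_space A"
proof -
  obtain c where c: "c \<ge> 0" "\<And>\<phi>. \<phi> \<in> Ds \<Longrightarrow> cmod (\<psi> \<phi>) \<le> c * gn \<phi>" using dual_space_bound[OF \<psi>] by blast
  obtain M where M: "M \<ge> 1" "\<And>x. norm (Sa t x) \<le> M * norm x" using S_bound_ex[of t] t by auto
  show ?thesis
  proof (rule dual_spaceI[where c = "c * M"])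
    fix \<phi> assume \<phi>: "\<phi> \<in> Ds"
    have "cmod (\<psi> (Sa t \<phi>)) \<le> c * gn (Sa t \<phi>)" using \<phi> t by (intro c Sa_Ds)
    also have "\<dots> \<le> c * (M * gn \<phi>)" using \<phi> t M c(1) by (intro mult_left_mono gn_Sa_le) auto
    finally show "cmod (semigroup_ext A t \<psi> \<phi>) \<le> c * M * gn \<phi>" using \<phi> by (simp add: semigroup_ext_eq mult_ac)
  qed (use \<psi> t c M in \<open>auto simp: semigroup_ext_eq Ds_add Ds_scaleC linear_simps[OF Sa_linear] Sa_scaleC Sa_Ds dual_space_def\<close>)
qed

lemma semigroup_ext_B:
  "\<phi> \<in> Ds \<Longrightarrow> t \<ge> 0 \<Longrightarrow> semigroup_ext A t (B w) \<phi> = cinner w (Bs (Sa t \<phi>))"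
  by (simp add: semigroup_ext_eq Bs_cinner Sa_Ds)

lemma cmod_weak_input_le:
  assumes u: "u \<in> regular_controls T"
  shows "\<exists>c\<ge>0. \<forall>\<phi>\<in>Ds. cmod (weak_input T u \<phi>) \<le> c * gn \<phi>"
proof -
  obtain \<beta> where \<beta>: "\<beta> > 0" "\<And>\<phi>. \<phi> \<in> Ds \<Longrightarrow> norm (Bs \<phi>) \<le> \<beta> * gn \<phi>" using Bs_bound by blast
  obtain M where M: "M \<ge> 1" "\<And>t x. t \<in> {0..T} \<Longrightarrow> norm (Sa t x) \<le> M * norm x" using S_bound_ex[of T] by auto
  let ?I = "\<integral>t. norm (u t) \<partial>Leb T"
  have I0: "?I \<ge> 0" by (intro integral_nonneg_AE) auto
  have "cmod (weak_input T u \<phi>) \<le> \<beta> * M * ?I * gn \<phi>" if \<phi>: "\<phi> \<in> Ds" for \<phi>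
  proof -
    have "cmod (weak_input T u \<phi>) \<le> (\<integral>t. cmod (cinner (u t) (Bs (Sa (T - t) \<phi>))) \<partial>Leb T)"
      using \<phi> by (simp add: weak_input_def)
    also have "\<dots> \<le> (\<integral>t. norm (u t) * (\<beta> * M * gn \<phi>) \<partial>Leb T)"
    proof (rule integral_mono)
      show "integrable (Leb T) (\<lambda>t. cmod (cinner (u t) (Bs (Sa (T - t) \<phi>))))"
        by (intro integrable_norm weak_input_integrable u \<phi>)
      show "integrable (Leb T) (\<lambda>t. norm (u t) * (\<beta> * M * gn \<phi>))"
        by (intro integrable_mult_left regular_norm_integrable u)
      fix t assume "t \<in> space (Leb T)"
      hence t: "T - t \<in> {0..T}" "T - t \<ge> 0" by auto
      have "norm (Bs (Sa (T - t) \<phi>)) \<le> \<beta> * gn (Sa (T - t) \<phi>)" using \<phi> t by (intro \<beta> Sa_Ds)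
      also have "\<dots> \<le> \<beta> * (M * gn \<phi>)" using M t \<phi> \<beta>(1) by (intro mult_left_mono gn_Sa_le) auto
      finally have "norm (u t) * norm (Bs (Sa (T - t) \<phi>)) \<le> norm (u t) * (\<beta> * (M * gn \<phi>))"
        by (intro mult_left_mono) auto
      thus "cmod (cinner (u t) (Bs (Sa (T - t) \<phi>))) \<le> norm (u t) * (\<beta> * M * gn \<phi>)"
        using cmod_cinner_le[of "u t" "Bs (Sa (T - t) \<phi>)"] by (simp add: mult_ac)
    qed
    also have "\<dots> = \<beta> * M * ?I * gn \<phi>" by (simp add: mult_ac)
    finally show ?thesis .
  qed
  thus ?thesis using \<beta>(1) M(1) I0 by (intro exI[of _ "\<beta> * M * ?I"]) auto
qed

lemma weak_input_dual:
  assumes u: "u \<in> regular_controls T"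
  shows "weak_input T u \<in> dual_space A"
proof -
  obtain c where c: "c \<ge> 0" "\<And>\<phi>. \<phi> \<in> Ds \<Longrightarrow> cmod (weak_input T u \<phi>) \<le> c * gn \<phi>"
    using cmod_weak_input_le[OF u] by blast
  show ?thesis
  proof (rule dual_spaceI[OF _ _ _ c(2,1)])
    fix \<phi> \<eta> assume *: "\<phi> \<in> Ds" "\<eta> \<in> Ds"
    have "(\<integral>t. cinner (u t) (Bs (Sa (T - t) (\<phi> + \<eta>))) \<partial>Leb T) =
        (\<integral>t. cinner (u t) (Bs (Sa (T - t) \<phi>)) + cinner (u t) (Bs (Sa (T - t) \<eta>)) \<partial>Leb T)"
      by (rule Bochner_Integration.integral_cong)
        (use * in \<open>auto simp: linear_simps[OF Sa_linear] Bs_add Sa_Ds cinner_add_right\<close>)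
    thus "weak_input T u (\<phi> + \<eta>) = weak_input T u \<phi> + weak_input T u \<eta>"
      using * weak_input_integrable(1)[OF u] by (simp add: weak_input_def Ds_add)
  next
    fix c \<phi> assume *: "\<phi> \<in> Ds"
    have "(\<integral>t. cinner (u t) (Bs (Sa (T - t) (c *\<^sub>C \<phi>))) \<partial>Leb T) =
        (\<integral>t. cnj c * cinner (u t) (Bs (Sa (T - t) \<phi>)) \<partial>Leb T)"
      by (rule Bochner_Integration.integral_cong) (use * in \<open>auto simp: Sa_i cinner_scaleC_right\<close>)
    thus "weak_input T u (c *\<^sub>C \<phi>) = cnj c * weak_input T u \<phi>"
      using * by (simp add: weak_input_def Ds_scaleC)
  qed (simp add: weak_input_def)
qed

text \<open>Convergence in the dual norm implies convergence on every vector of graph norm at most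
  1, where the integrals of the simple functions are scalar; both candidates are their limit.
  Homogeneity extends the equality to \<open>Ds\<close>.\<close>

lemma dual_integral_unique:
  assumes u: "u \<in> regular_controls T" and eq: "AE t in Leb T. u t = u0 t"
    and F: "F \<in> dual_space A" "has_dual_integral A T (\<lambda>s. semigroup_ext A (T - s) (B (u0 s))) F"
  shows "F = weak_input T u"
proof -
  obtain s where s: "\<And>n. simple_function (Leb T) (s n)" "\<And>n. s n ` {0..T} \<subseteq> dual_space A"
    and l1: "(\<lambda>n::nat. \<integral>\<^sup>+ t. dual_norm A (\<lambda>\<phi>. semigroup_ext A (T - t) (B (u0 t)) \<phi> - s n t \<phi>) \<partial>Leb T) \<longlonglongrightarrow> 0"
    and l2: "(\<lambda>n. dual_norm A (\<lambda>\<phi>. F \<phi> -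
        (\<Sum>v\<in>s n ` {0..T}. measure lebesgue {t \<in> {0..T}. s n t = v} *\<^sub>R v \<phi>))) \<longlonglongrightarrow> 0"
    using F(2) unfolding has_dual_integral_def by blast
  have small: "F \<phi> = weak_input T u \<phi>" if \<phi>: "\<phi> \<in> Ds" "gn \<phi> \<le> 1" for \<phi>
  proof -
    define I where "I n = (\<integral>t. s n t \<phi> \<partial>Leb T)" for n
    have I: "I n = (\<Sum>v\<in>s n ` {0..T}. measure lebesgue {t \<in> {0..T}. s n t = v} *\<^sub>R v \<phi>)" for n
      unfolding I_def by (rule simple_lebesgue_integral(2)[OF s(1), of "\<lambda>v. v \<phi>"])
    have Iint: "integrable (Leb T) (\<lambda>t. s n t \<phi>)" for n
      by (rule simple_lebesgue_integral(1)[OF s(1), of "\<lambda>v. v \<phi>"])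
    have "(\<lambda>n. ennreal (cmod (F \<phi> - I n))) \<longlonglongrightarrow> 0"
    proof (rule tendsto_sandwich[OF _ _ tendsto_const l2])
      show "\<forall>\<^sub>F n in sequentially. ennreal (cmod (F \<phi> - I n)) \<le> dual_norm A (\<lambda>\<phi>. F \<phi> -
        (\<Sum>v\<in>s n ` {0..T}. measure lebesgue {t \<in> {0..T}. s n t = v} *\<^sub>R v \<phi>))"
        unfolding I by (intro always_eventually allI cmod_le_dual_norm[OF \<phi>])
    qed auto
    hence 1: "(\<lambda>n. cmod (F \<phi> - I n)) \<longlonglongrightarrow> 0" by (simp add: tendsto_ennreal_iff flip: ennreal_0)
    have "(\<lambda>n. ennreal (cmod (weak_input T u \<phi> - I n))) \<longlonglongrightarrow> 0"
    proof (rule tendsto_sandwich[OF _ _ tendsto_const l1])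
      show "\<forall>\<^sub>F n in sequentially. ennreal (cmod (weak_input T u \<phi> - I n)) \<le>
        (\<integral>\<^sup>+ t. dual_norm A (\<lambda>\<phi>. semigroup_ext A (T - t) (B (u0 t)) \<phi> - s n t \<phi>) \<partial>Leb T)"
      proof (intro always_eventually allI)
        fix n
        have "weak_input T u \<phi> - I n = (\<integral>t. cinner (u t) (Bs (Sa (T - t) \<phi>)) - s n t \<phi> \<partial>Leb T)"
          using \<phi>(1) weak_input_integrable(1)[OF u \<phi>(1)] Iint by (simp add: weak_input_def I_def)
        also have "ennreal (cmod \<dots>) \<le> (\<integral>\<^sup>+ t. ennreal (cmod (cinner (u t) (Bs (Sa (T - t) \<phi>)) - s n t \<phi>)) \<partial>Leb T)"
          using weak_input_integrable(1)[OF u \<phi>(1)] Iint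
          by (intro integral_norm_bound_ennreal Bochner_Integration.integrable_diff)
        also have "\<dots> \<le> (\<integral>\<^sup>+ t. dual_norm A (\<lambda>\<phi>. semigroup_ext A (T - t) (B (u0 t)) \<phi> - s n t \<phi>) \<partial>Leb T)"
        proof (rule nn_integral_mono_AE)
          have "AE t in Leb T. t \<in> space (Leb T)" by (rule AE_space)
          with eq show "AE t in Leb T. ennreal (cmod (cinner (u t) (Bs (Sa (T - t) \<phi>)) - s n t \<phi>))
            \<le> dual_norm A (\<lambda>\<phi>. semigroup_ext A (T - t) (B (u0 t)) \<phi> - s n t \<phi>)"
          proof eventually_elim
            case (elim t)
            hence "cinner (u t) (Bs (Sa (T - t) \<phi>)) = semigroup_ext A (T - t) (B (u0 t)) \<phi>"
              using \<phi>(1) by (simp add: semigroup_ext_B)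
            thus ?case using cmod_le_dual_norm[OF \<phi>, of "\<lambda>\<phi>. semigroup_ext A (T - t) (B (u0 t)) \<phi> - s n t \<phi>"] by simp
          qed
        qed
        finally show "ennreal (cmod (weak_input T u \<phi> - I n)) \<le>
          (\<integral>\<^sup>+ t. dual_norm A (\<lambda>\<phi>. semigroup_ext A (T - t) (B (u0 t)) \<phi> - s n t \<phi>) \<partial>Leb T)" .
      qed
    qed auto
    hence 2: "(\<lambda>n. cmod (weak_input T u \<phi> - I n)) \<longlonglongrightarrow> 0" by (simp add: tendsto_ennreal_iff flip: ennreal_0)
    have "(\<lambda>n. F \<phi> - I n) \<longlonglongrightarrow> 0" "(\<lambda>n. weak_input T u \<phi> - I n) \<longlonglongrightarrow> 0"
      using 1 2 by (auto intro: tendsto_norm_zero_cancel)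
    from tendsto_diff[OF this] show ?thesis by (simp add: LIMSEQ_const_iff)
  qed
  have hom: "F (c *\<^sub>C \<phi>) = cnj c * F \<phi>" "weak_input T u (c *\<^sub>C \<phi>) = cnj c * weak_input T u \<phi>" if "\<phi> \<in> Ds" for c \<phi>
    using F(1) weak_input_dual[OF u] that by (auto simp: dual_space_def)
  show ?thesis
  proof
    fix \<phi>
    show "F \<phi> = weak_input T u \<phi>"
    proof (cases "\<phi> \<in> Ds")
      case False
      thus ?thesis using F(1) by (simp add: dual_space_def weak_input_def)
    next
      case True
      show ?thesis
      proof (cases "gn \<phi> \<le> 1")
        case True
        then show ?thesis using small \<open>\<phi> \<in> Ds\<close> by blast
      next
        case False
        hence g: "gn \<phi> > 0" by simp
        let ?\<phi> = "complex_of_real (1 / gn \<phi>) *\<^sub>C \<phi>"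
        have "F ?\<phi> = weak_input T u ?\<phi>"
          using gn_pos_scale[OF True g] Ds_scaleC(1)[OF True] by (intro small) auto
        thus ?thesis using g by (simp add: hom[OF True])
      qed
    qed
  qed
qed

text \<open>Simple functions arise by replacing \<open>u\<close> by simple controls and freezing the
  semigroup on a time grid. The grid is adapted to the finitely many values of \<open>v n\<close>,
  so the modulus of continuity of each single \<open>S(t) B w\<close> is enough.\<close>

lemma dual_integral_exists:
  assumes T: "T \<ge> 0" and u: "u \<in> regular_controls T" and eq: "AE t in Leb T. u t = u0 t"
  shows "has_dual_integral A T (\<lambda>s. semigroup_ext A (T - s) (B (u0 s))) (weak_input T u)"
proof -
  obtain v where v: "\<And>n. v n \<in> simple_controls T" "\<And>t. (\<lambda>n::nat. v n t) \<longlonglongrightarrow> u t"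
    "(\<lambda>n. \<integral>t. norm (u t - v n t) \<partial>Leb T) \<longlonglongrightarrow> 0" "\<And>n. integrable (Leb T) (\<lambda>t. norm (u t - v n t))"
    using regular_approx[OF u] by blast
  obtain \<beta> where \<beta>: "\<beta> > 0" "\<And>\<phi>. \<phi> \<in> Ds \<Longrightarrow> norm (Bs \<phi>) \<le> \<beta> * gn \<phi>" using Bs_bound by blast
  obtain M where M: "M \<ge> 1" "\<And>t x. t \<in> {0..T} \<Longrightarrow> norm (Sa t x) \<le> M * norm x" using S_bound_ex[of T] by auto
  have "\<exists>N::nat. N > 0 \<and> (\<forall>w\<in>range (v n). \<forall>t\<in>{0..T}. \<forall>t'\<in>{0..T}. dist t t' < 1 / real N \<longrightarrow>
      (\<forall>\<phi>\<in>Ds. cmod (B w (Sa t \<phi>) - B w (Sa t' \<phi>)) \<le> 1 / real (Suc n) * gn \<phi>))" for n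
  proof -
    have "\<forall>w. \<exists>\<delta>>0. \<forall>t\<in>{0..T}. \<forall>t'\<in>{0..T}. dist t t' < \<delta> \<longrightarrow>
      (\<forall>\<phi>\<in>Ds. cmod (B w (Sa t \<phi>) - B w (Sa t' \<phi>)) \<le> 1 / real (Suc n) * gn \<phi>)"
      by (intro allI B_Sa_uniformly_continuous) simp
    then obtain \<delta> where \<delta>: "\<And>w. \<delta> w > 0" "\<And>w t t' \<phi>. t \<in> {0..T} \<Longrightarrow> t' \<in> {0..T} \<Longrightarrow> dist t t' < \<delta> w \<Longrightarrow>
      \<phi> \<in> Ds \<Longrightarrow> cmod (B w (Sa t \<phi>) - B w (Sa t' \<phi>)) \<le> 1 / real (Suc n) * gn \<phi>" by metis
    have fin: "finite (range (v n))"
      using simple_functionD(1)[OF simple_controls_simple[OF v(1)], of n] by simp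
    hence pos: "Min (\<delta> ` range (v n)) > 0" using \<delta>(1) by (subst Min_gr_iff) auto
    then obtain N where N: "inverse (real (Suc N)) < Min (\<delta> ` range (v n))" using reals_Archimedean by blast
    have dl: "1 / real (Suc N) < \<delta> w" if "w \<in> range (v n)" for w
    proof -
      have "Min (\<delta> ` range (v n)) \<le> \<delta> w" using fin that by (intro Min_le) auto
      thus ?thesis using N by (simp add: inverse_eq_divide)
    qed
    show ?thesis
    proof (intro exI[of _ "Suc N"] conjI ballI impI)
      fix w t t' \<phi> assume *: "w \<in> range (v n)" "t \<in> {0..T}" "t' \<in> {0..T}" "dist t t' < 1 / real (Suc N)" "\<phi> \<in> Ds"
      show "cmod (B w (Sa t \<phi>) - B w (Sa t' \<phi>)) \<le> 1 / real (Suc n) * gn \<phi>"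
        by (rule \<delta>(2)[OF *(2,3) less_trans[OF *(4) dl[OF *(1)]] *(5)])
    qed simp
  qed
  then obtain N where N: "\<And>n. N n > (0::nat)" and NB: "\<And>n w t t' \<phi>. w \<in> range (v n) \<Longrightarrow> t \<in> {0..T} \<Longrightarrow> t' \<in> {0..T} \<Longrightarrow>
    dist t t' < 1 / real (N n) \<Longrightarrow> \<phi> \<in> Ds \<Longrightarrow> cmod (B w (Sa t \<phi>) - B w (Sa t' \<phi>)) \<le> 1 / real (Suc n) * gn \<phi>" by metis
  \<comment> \<open>Time rounded down to the grid of mesh \<open>1 / N n\<close>.\<close>
  define r where "r n t = of_int \<lfloor>t * real (N n)\<rfloor> / real (N n)" for n and t :: real
  have r: "0 \<le> r n t" "r n t \<le> t" "t - r n t < 1 / real (N n)" if "t \<ge> 0" for n t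
  proof -
    have fl: "0 \<le> t * real (N n) - of_int \<lfloor>t * real (N n)\<rfloor>" "t * real (N n) - of_int \<lfloor>t * real (N n)\<rfloor> < 1"
      by linarith+
    have Np: "real (N n) > 0" using N by simp
    have eq: "t - r n t = (t * real (N n) - of_int \<lfloor>t * real (N n)\<rfloor>) / real (N n)"
      using Np by (simp add: r_def diff_divide_distrib)
    have "0 \<le> t - r n t" "t - r n t < 1 / real (N n)"
      unfolding eq using fl Np by (auto intro!: divide_nonneg_pos divide_strict_right_mono simp del: of_nat_0_less_iff)
    thus "r n t \<le> t" "t - r n t < 1 / real (N n)" by auto
    show "0 \<le> r n t" using that by (simp add: r_def)
  qed
  have rs: "simple_function (Leb T) (r n)" for n
  proof (rule simple_function_borel_measurable)
    have "r n \<in> borel_measurable borel" unfolding r_def by measurable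
    hence "r n \<in> borel_measurable lebesgue" by (simp add: measurable_completion)
    thus "r n \<in> borel_measurable (Leb T)" by (rule measurable_restrict_space1)
    have "r n ` {0..T} \<subseteq> (\<lambda>k. of_int k / real (N n)) ` {0..\<lfloor>T * real (N n)\<rfloor>}"
      by (auto simp: r_def intro!: imageI floor_mono mult_right_mono)
    hence "finite (r n ` {0..T})" by (rule finite_subset) auto
    thus "finite (r n ` space (Leb T))" by simp
  qed
  define s where "s n t = semigroup_ext A (T - r n t) (B (v n t))" for n t
  have ss: "simple_function (Leb T) (s n)" for n
  proof -
    have "simple_function (Leb T) (\<lambda>t. (\<lambda>x y. semigroup_ext A (T - x) (B y)) (r n t) (v n t))"
      by (rule simple_function_compose2[OF rs simple_function_lebesgue_on[OF simple_controls_simple[OF v(1)]]]) simp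
    thus ?thesis by (simp add: s_def[abs_def])
  qed
  have sd: "s n t \<in> dual_space A" if "t \<in> {0..T}" for n t
    unfolding s_def using r[of t n] that by (intro semigroup_ext_dual B_dual) auto
  \<comment> \<open>Scalar majorant of the error in the dual norm: the first summand stems from
    replacing the control, the second from freezing the semigroup. Its values and its integral tend
    to 0 and control every limit required of the dual-valued integral.\<close>
  define c where "c n t = \<beta> * M * norm (u t - v n t) + 1 / real (Suc n)" for n t
  have c0: "c n t \<ge> 0" for n t using \<beta>(1) M(1) by (simp add: c_def)
  have diff: "cmod (semigroup_ext A (T - t) (B (u t)) \<phi> - s n t \<phi>) \<le> c n t * gn \<phi>"
    if t: "t \<in> {0..T}" and \<phi>: "\<phi> \<in> Ds" for n t \<phi>
  proof -
    have t': "T - t \<in> {0..T}" "T - r n t \<in> {0..T}" "dist (T - t) (T - r n t) < 1 / real (N n)"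
      using t r[of t n] by (auto simp: dist_real_def)
    have "semigroup_ext A (T - t) (B (u t)) \<phi> - s n t \<phi>
        = cinner (u t - v n t) (Bs (Sa (T - t) \<phi>)) + (B (v n t) (Sa (T - t) \<phi>) - B (v n t) (Sa (T - r n t) \<phi>))"
    proof -
      have "cinner (u t - v n t) w = cinner (u t) w - cinner (v n t) w" for w
        using cinner_add_left[of "u t - v n t" "v n t" w] by simp
      thus ?thesis using \<phi> t' by (simp add: s_def semigroup_ext_eq Bs_cinner Sa_Ds)
    qed
    also have "cmod \<dots> \<le> cmod (cinner (u t - v n t) (Bs (Sa (T - t) \<phi>))) + cmod (B (v n t) (Sa (T - t) \<phi>) - B (v n t) (Sa (T - r n t) \<phi>))"
      by (rule norm_triangle_ineq)
    also have "\<dots> \<le> norm (u t - v n t) * (\<beta> * (M * gn \<phi>)) + 1 / real (Suc n) * gn \<phi>"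
    proof (rule add_mono)
      have "norm (Bs (Sa (T - t) \<phi>)) \<le> \<beta> * gn (Sa (T - t) \<phi>)" using \<phi> t by (intro \<beta> Sa_Ds) auto
      also have "\<dots> \<le> \<beta> * (M * gn \<phi>)" using M t \<phi> \<beta>(1) by (intro mult_left_mono gn_Sa_le) auto
      finally have "norm (u t - v n t) * norm (Bs (Sa (T - t) \<phi>)) \<le> norm (u t - v n t) * (\<beta> * (M * gn \<phi>))"
        by (intro mult_left_mono) auto
      thus "cmod (cinner (u t - v n t) (Bs (Sa (T - t) \<phi>))) \<le> norm (u t - v n t) * (\<beta> * (M * gn \<phi>))"
        using cmod_cinner_le[of "u t - v n t" "Bs (Sa (T - t) \<phi>)"] by simp
      show "cmod (B (v n t) (Sa (T - t) \<phi>) - B (v n t) (Sa (T - r n t) \<phi>)) \<le> 1 / real (Suc n) * gn \<phi>"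
        by (rule NB[OF _ t' \<phi>]) simp
    qed
    also have "\<dots> = c n t * gn \<phi>" by (simp add: c_def algebra_simps)
    finally show ?thesis .
  qed
  have dn: "dual_norm A (\<lambda>\<phi>. semigroup_ext A (T - t) (B (u t)) \<phi> - s n t \<phi>) \<le> ennreal (c n t)"
    if "t \<in> {0..T}" for n t
    using diff[OF that] c0 by (intro dual_norm_leI)
  have inv: "(\<lambda>n. 1 / real (Suc n)) \<longlonglongrightarrow> 0"
    using LIMSEQ_inverse_real_of_nat by (simp add: inverse_eq_divide)
  have cint: "integrable (Leb T) (c n)" for n
    unfolding c_def by (intro Bochner_Integration.integrable_add integrable_mult_right v integrable_const_Leb)
  have cval: "(\<integral>t. c n t \<partial>Leb T) = \<beta> * M * (\<integral>t. norm (u t - v n t) \<partial>Leb T) + T * (1 / real (Suc n))" for n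
  proof -
    have "(\<integral>t. 1 / real (Suc n) \<partial>Leb T) = measure (Leb T) {0..T} * (1 / real (Suc n))"
      by simp
    moreover have "measure (Leb T) {0..T} = T"
      using T by (subst measure_restrict_space) auto
    ultimately show ?thesis
      unfolding c_def by (subst Bochner_Integration.integral_add) (auto intro!: integrable_mult_right v integrable_const_Leb)
  qed
  have clim: "(\<lambda>n. \<integral>t. c n t \<partial>Leb T) \<longlonglongrightarrow> 0"
    unfolding cval using tendsto_add[OF tendsto_mult_right_zero[OF v(3), of "\<beta> * M"] tendsto_mult_right_zero[OF inv, of T]] by simp
  show ?thesis
    unfolding has_dual_integral_def
  proof (intro exI[of _ s] conjI allI)
    show "simple_function (Leb T) (s n)" "s n ` {0..T} \<subseteq> dual_space A" for n using ss sd by auto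
    have AEs: "AE t in Leb T. t \<in> space (Leb T)" by (rule AE_space)
    show "AE t in Leb T. (\<lambda>n. dual_norm A (\<lambda>\<phi>. semigroup_ext A (T - t) (B (u0 t)) \<phi> - s n t \<phi>)) \<longlonglongrightarrow> 0"
      using eq AEs
    proof eventually_elim
      case (elim t)
      have "(\<lambda>n. c n t) \<longlonglongrightarrow> \<beta> * M * norm (u t - u t) + 0"
        unfolding c_def by (intro tendsto_intros v inv)
      hence "(\<lambda>n. ennreal (c n t)) \<longlonglongrightarrow> ennreal 0" by (intro tendsto_ennrealI) simp
      hence lim: "(\<lambda>n. ennreal (c n t)) \<longlonglongrightarrow> 0" by simp
      show ?case
        by (rule tendsto_sandwich[OF _ _ tendsto_const lim]) (use dn[of t] elim in auto)
    qed
    have lim: "(\<lambda>n. ennreal (\<integral>t. c n t \<partial>Leb T)) \<longlonglongrightarrow> 0" using tendsto_ennrealI[OF clim] by simp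
    show "(\<lambda>n. \<integral>\<^sup>+ t. dual_norm A (\<lambda>\<phi>. semigroup_ext A (T - t) (B (u0 t)) \<phi> - s n t \<phi>) \<partial>Leb T) \<longlonglongrightarrow> 0"
    proof (rule tendsto_sandwich[OF _ _ tendsto_const lim])
      show "\<forall>\<^sub>F n in sequentially. (\<integral>\<^sup>+ t. dual_norm A (\<lambda>\<phi>. semigroup_ext A (T - t) (B (u0 t)) \<phi> - s n t \<phi>) \<partial>Leb T)
         \<le> ennreal (\<integral>t. c n t \<partial>Leb T)"
      proof (intro always_eventually allI)
        fix n
        have "(\<integral>\<^sup>+ t. dual_norm A (\<lambda>\<phi>. semigroup_ext A (T - t) (B (u0 t)) \<phi> - s n t \<phi>) \<partial>Leb T)
          \<le> (\<integral>\<^sup>+ t. ennreal (c n t) \<partial>Leb T)"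
        proof (rule nn_integral_mono_AE)
          show "AE t in Leb T. dual_norm A (\<lambda>\<phi>. semigroup_ext A (T - t) (B (u0 t)) \<phi> - s n t \<phi>) \<le> ennreal (c n t)"
            using eq AEs
          proof eventually_elim
            case (elim t)
            thus ?case using dn[of t n] by simp
          qed
        qed
        also have "\<dots> = ennreal (\<integral>t. c n t \<partial>Leb T)"
          by (rule nn_integral_eq_integral[OF cint]) (use c0 in auto)
        finally show "(\<integral>\<^sup>+ t. dual_norm A (\<lambda>\<phi>. semigroup_ext A (T - t) (B (u0 t)) \<phi> - s n t \<phi>) \<partial>Leb T)
         \<le> ennreal (\<integral>t. c n t \<partial>Leb T)" .
      qed
    qed auto
    show "(\<lambda>n. dual_norm A (\<lambda>\<phi>. weak_input T u \<phi> -
        (\<Sum>v\<in>s n ` {0..T}. measure lebesgue {t \<in> {0..T}. s n t = v} *\<^sub>R v \<phi>))) \<longlonglongrightarrow> 0"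
    proof (rule tendsto_sandwich[OF _ _ tendsto_const lim])
      show "\<forall>\<^sub>F n in sequentially. dual_norm A (\<lambda>\<phi>. weak_input T u \<phi> -
        (\<Sum>v\<in>s n ` {0..T}. measure lebesgue {t \<in> {0..T}. s n t = v} *\<^sub>R v \<phi>)) \<le> ennreal (\<integral>t. c n t \<partial>Leb T)"
      proof (intro always_eventually allI dual_norm_leI)
        fix n \<phi> assume \<phi>: "\<phi> \<in> Ds"
        note sl = simple_lebesgue_integral[OF ss, of "\<lambda>v. v \<phi>"]
        have "cmod (weak_input T u \<phi> - (\<integral>t. s n t \<phi> \<partial>Leb T)) = cmod (\<integral>t. cinner (u t) (Bs (Sa (T - t) \<phi>)) - s n t \<phi> \<partial>Leb T)"
          using \<phi> weak_input_integrable(1)[OF u \<phi>] sl(1) by (simp add: weak_input_def)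
        also have "\<dots> \<le> (\<integral>t. cmod (cinner (u t) (Bs (Sa (T - t) \<phi>)) - s n t \<phi>) \<partial>Leb T)" by (rule integral_norm_bound)
        also have "\<dots> \<le> (\<integral>t. c n t * gn \<phi> \<partial>Leb T)"
        proof (rule integral_mono)
          show "integrable (Leb T) (\<lambda>t. cmod (cinner (u t) (Bs (Sa (T - t) \<phi>)) - s n t \<phi>))"
            by (intro integrable_norm Bochner_Integration.integrable_diff weak_input_integrable(1)[OF u \<phi>] sl(1))
          show "integrable (Leb T) (\<lambda>t. c n t * gn \<phi>)" by (intro integrable_mult_left cint)
          fix t assume "t \<in> space (Leb T)"
          thus "cmod (cinner (u t) (Bs (Sa (T - t) \<phi>)) - s n t \<phi>) \<le> c n t * gn \<phi>"
            using diff[OF _ \<phi>, of t n] \<phi> by (simp add: semigroup_ext_B)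
        qed
        also have "\<dots> = (\<integral>t. c n t \<partial>Leb T) * gn \<phi>" by simp
        finally show "cmod (weak_input T u \<phi> - (\<Sum>v\<in>s n ` {0..T}. measure lebesgue {t \<in> {0..T}. s n t = v} *\<^sub>R v \<phi>))
          \<le> (\<integral>t. c n t \<partial>Leb T) * gn \<phi>" unfolding sl(2) .
      qed (intro integral_nonneg_AE, use c0 in auto)
    qed auto
  qed
qed

lemma input_map_dual_eq:
  assumes "T \<ge> 0" "u \<in> regular_controls T" "AE t in Leb T. u t = u0 t"
  shows "input_map_dual A B T u0 = weak_input T u"
  unfolding input_map_dual_def
  by (rule the_equality)
    (use assms dual_integral_exists dual_integral_unique weak_input_dual in blast)+

text \<open>\<open>Ds\<close> is a complex subspace, so the real parts on \<open>Ds\<close>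
  determine both functionals.\<close>

lemma pivot_eq_weak_input_iff:
  assumes u: "u \<in> regular_controls T"
  shows "pivot A h = weak_input T u \<longleftrightarrow> (\<forall>\<phi>\<in>Ds. inner h \<phi> = ell T \<phi> u)"
proof
  assume *: "pivot A h = weak_input T u"
  show "\<forall>\<phi>\<in>Ds. inner h \<phi> = ell T \<phi> u"
  proof
    fix \<phi> assume \<phi>: "\<phi> \<in> Ds"
    have "cinner h \<phi> = weak_input T u \<phi>" using fun_cong[OF *, of \<phi>] \<phi> by (simp add: pivot_def)
    thus "inner h \<phi> = ell T \<phi> u" by (simp add: weak_input_integrable(2)[OF u \<phi>] inner_eq_Re_cinner)
  qed
next
  assume *: "\<forall>\<phi>\<in>Ds. inner h \<phi> = ell T \<phi> u"
  show "pivot A h = weak_input T u"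
  proof
    fix \<phi> show "pivot A h \<phi> = weak_input T u \<phi>"
      using * by (auto simp: pivot_def weak_input_integrable(2)[OF u] cinner_eq_Complex Ds_scaleC)
        (simp add: weak_input_def)
  qed
qed

lemma pivot_inj: assumes "pivot A h = pivot A k" shows "h = k"
proof -
  have eq: "inner h \<phi> = inner k \<phi>" if "\<phi> \<in> Ds" for \<phi>
    using fun_cong[OF assms, of \<phi>] that by (simp add: pivot_def inner_eq_Re_cinner)
  have "inner x (h - k) = 0" for x
  proof -
    obtain \<phi> where \<phi>: "\<And>n::nat. \<phi> n \<in> Ds" "\<phi> \<longlonglongrightarrow> x" using ex_Ds_seq by blast
    have "(\<lambda>n. inner (\<phi> n) (h - k)) \<longlonglongrightarrow> inner x (h - k)" by (intro tendsto_intros \<phi>)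
    moreover have "inner (\<phi> n) (h - k) = 0" for n using eq[OF \<phi>(1)[of n]] by (simp add: inner_diff_right inner_commute)
    ultimately show ?thesis by (simp add: LIMSEQ_const_iff)
  qed
  from this[of "h - k"] show ?thesis by simp
qed

text \<open>Later facts about the input map are derived from this characterisation by duality with
  \<open>ell\<close>.\<close>

lemma input_mapI:
  assumes "T \<ge> 0" "u \<in> regular_controls T" "AE t in Leb T. u t = u0 t" "\<And>\<phi>. \<phi> \<in> Ds \<Longrightarrow> inner h \<phi> = ell T \<phi> u"
  shows "input_map A B T u0 = h" "input_map_dual A B T u0 = pivot A h"
proof -
  show *: "input_map_dual A B T u0 = pivot A h"
    using pivot_eq_weak_input_iff[OF assms(2), of h] assms(4) input_map_dual_eq[OF assms(1-3)] by simp
  show "input_map A B T u0 = h"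
    unfolding input_map_def * by (rule the_equality) (auto dest: pivot_inj)
qed

end


subsection \<open>Admissibility\<close>

text \<open>Boundedness makes the functional uniformly continuous on \<open>G\<close>, so it extends
  to the closure; linearity and the bound pass to the extension by limits.\<close>

lemma riesz_dense:
  fixes G :: "'a::{real_inner,complete_space} set" and f :: "'a \<Rightarrow> real"
  assumes G: "subspace G" "closure G = UNIV"
    and add: "\<And>x y. x \<in> G \<Longrightarrow> y \<in> G \<Longrightarrow> f (x + y) = f x + f y"
    and scale: "\<And>r x. x \<in> G \<Longrightarrow> f (r *\<^sub>R x) = r * f x"
    and bdd: "\<And>x. x \<in> G \<Longrightarrow> \<bar>f x\<bar> \<le> c * norm x"
  shows "\<exists>g. \<forall>x\<in>G. f x = inner x g"
proof -
  have diff: "f x - f y = f (x - y)" if "x \<in> G" "y \<in> G" for x y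
    using add[of x "(-1) *\<^sub>R y"] scale[of y "-1"] that subspace_scale[OF G(1), of y "-1"] by simp
  have "(\<bar>c\<bar> + 1)-lipschitz_on G f"
  proof (rule lipschitz_onI)
    fix x y assume "x \<in> G" "y \<in> G"
    hence "\<bar>f x - f y\<bar> \<le> c * norm (x - y)" using bdd[of "x - y"] diff subspace_diff[OF G(1)] by simp
    also have "\<dots> \<le> (\<bar>c\<bar> + 1) * norm (x - y)" by (intro mult_right_mono) auto
    finally show "dist (f x) (f y) \<le> (\<bar>c\<bar> + 1) * dist x y" by (simp add: dist_norm)
  qed auto
  hence "uniformly_continuous_on G f" by (rule lipschitz_on_uniformly_continuous)
  then obtain g where g: "uniformly_continuous_on (closure G) g" "\<And>x. x \<in> G \<Longrightarrow> f x = g x"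
    by (rule uniformly_continuous_on_extension_on_closure) blast
  have cont: "isCont g x" for x
    using uniformly_continuous_imp_continuous[OF g(1)] G(2) by (simp add: continuous_on_eq_continuous_at)
  have seq: "\<exists>u. (\<forall>n::nat. u n \<in> G) \<and> u \<longlonglongrightarrow> x" for x
    using G(2) closure_sequential[of x G] by auto
  have lim: "(\<lambda>n. g (u n)) \<longlonglongrightarrow> g x" if "u \<longlonglongrightarrow> x" for u :: "nat \<Rightarrow> 'a" and x
    using isCont_tendsto_compose[OF cont that] .
  have "\<exists>h\<in>UNIV. \<forall>x\<in>UNIV. g x = inner x h"
  proof (rule riesz_on_closed_subspace[where c = c])
    fix x y :: 'a and r :: real
    obtain u where u: "\<And>n::nat. u n \<in> G" "u \<longlonglongrightarrow> x" using seq by blast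
    obtain v where v: "\<And>n::nat. v n \<in> G" "v \<longlonglongrightarrow> y" using seq by blast
    have "(\<lambda>n. g (u n + v n)) \<longlonglongrightarrow> g (x + y)" by (intro lim tendsto_add u v)
    moreover have "(\<lambda>n. g (u n) + g (v n)) \<longlonglongrightarrow> g x + g y" by (intro lim tendsto_add u v)
    moreover have "g (u n + v n) = g (u n) + g (v n)" for n
      using add[OF u(1) v(1), of n n] by (simp add: g(2)[symmetric] u v subspace_add[OF G(1)])
    ultimately show "g (x + y) = g x + g y" using LIMSEQ_unique by fastforce
    have "(\<lambda>n. g (r *\<^sub>R u n)) \<longlonglongrightarrow> g (r *\<^sub>R x)" by (intro lim tendsto_scaleR u tendsto_const)
    moreover have "(\<lambda>n. r * g (u n)) \<longlonglongrightarrow> r * g x" by (intro lim tendsto_mult u tendsto_const)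
    moreover have "g (r *\<^sub>R u n) = r * g (u n)" for n
      using scale[OF u(1), of r n] by (simp add: g(2)[symmetric] u subspace_scale[OF G(1)])
    ultimately show "g (r *\<^sub>R x) = r * g x" using LIMSEQ_unique by fastforce
    show "\<bar>g x\<bar> \<le> c * norm x"
    proof (rule LIMSEQ_le)
      show "(\<lambda>n. \<bar>g (u n)\<bar>) \<longlonglongrightarrow> \<bar>g x\<bar>" by (intro tendsto_intros lim u)
      show "(\<lambda>n. c * norm (u n)) \<longlonglongrightarrow> c * norm x" by (intro tendsto_intros u)
      show "\<exists>N. \<forall>n\<ge>N. \<bar>g (u n)\<bar> \<le> c * norm (u n)" using bdd[OF u(1)] by (simp add: g(2)[symmetric] u)
    qed
  qed auto
  thus ?thesis using g(2) by auto
qed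

text \<open>The supremum of \<open>ell T \<phi>\<close> over these controls is the L2 norm of the
  observation \<open>Bs (Sa t \<phi>)\<close> on \<open>{0..T}\<close>; this lets suprema stand in
  for a Hilbert space of controls.\<close>

definition unit_controls :: "real \<Rightarrow> (real \<Rightarrow> 'u::complex_hilbert) set" where
  "unit_controls T = {u \<in> simple_controls T. l2sq T u \<le> 1}"

lemma unit_controls_neg: "u \<in> unit_controls T \<Longrightarrow> (\<lambda>t. - u t) \<in> unit_controls T"
  using simple_controls_scale[of u T "-1"] l2sq_scale[of T "-1" u] by (simp add: unit_controls_def)

lemma unit_controls_0: "(\<lambda>t. 0) \<in> unit_controls T"
  by (simp add: unit_controls_def simple_controls_def l2sq_def)

lemma simple_control_scaled_unit:
  assumes "u \<in> simple_controls T" "l2sq T u \<le> r\<^sup>2" "r > 0"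
  shows "(\<lambda>t. (1 / r) *\<^sub>R u t) \<in> unit_controls T"
  using simple_controls_scale[OF assms(1), of "1 / r"] l2sq_scale[of T "1 / r" u] assms(2,3)
  by (simp add: unit_controls_def power_divide)

context control_system
begin

lemma ell_scale_u: "ell T \<phi> (\<lambda>t. c *\<^sub>R u t) = c * ell T \<phi> u"
  by (simp add: ell_def l2ip_scale)

lemma ell_neg_u: "ell T \<phi> (\<lambda>t. - u t) = - ell T \<phi> u"
  using ell_scale_u[of T \<phi> "-1" u] by simp

lemma ell_add_u:
  "u \<in> simple_controls T \<Longrightarrow> v \<in> simple_controls T \<Longrightarrow> \<phi> \<in> Ds \<Longrightarrow> ell T \<phi> (\<lambda>t. u t + v t) = ell T \<phi> u + ell T \<phi> v"
  unfolding ell_def by (intro l2ip_add Bs_Sa_reversed_continuous)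

lemma ell_add:
  assumes "u \<in> regular_controls T" "\<phi> \<in> Ds" "\<eta> \<in> Ds"
  shows "ell T (\<phi> + \<eta>) u = ell T \<phi> u + ell T \<eta> u"
proof -
  have "ell T (\<phi> + \<eta>) u = l2ip T u (\<lambda>t. Bs (Sa (T - t) \<phi>) + Bs (Sa (T - t) \<eta>))"
    unfolding ell_def l2ip_def
    by (rule Bochner_Integration.integral_cong) (use assms in \<open>auto simp: linear_simps[OF Sa_linear] Bs_add Sa_Ds\<close>)
  thus ?thesis unfolding ell_def by (simp add: l2ip_add_right Bs_Sa_reversed_continuous assms)
qed

lemma ell_scaleR:
  assumes "\<phi> \<in> Ds"
  shows "ell T (r *\<^sub>R \<phi>) u = r * ell T \<phi> u"
proof -
  have "ell T (r *\<^sub>R \<phi>) u = l2ip T u (\<lambda>t. r *\<^sub>R Bs (Sa (T - t) \<phi>))"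
    unfolding ell_def l2ip_def
    by (rule Bochner_Integration.integral_cong) (use assms in \<open>auto simp: scaleR_eq_scaleC Sa_i\<close>)
  thus ?thesis unfolding ell_def by (simp add: l2ip_scaleR_right)
qed

text \<open>For a single vector the observation is continuous, hence bounded on
  \<open>{0..T}\<close>; the constant still depends on the vector.\<close>

lemma ell_finite:
  assumes T: "T \<ge> 0" and \<phi>: "\<phi> \<in> Ds"
  shows "\<exists>c. \<forall>u\<in>unit_controls T. \<bar>ell T \<phi> u\<bar> \<le> c"
proof -
  obtain C where C: "C > 0" "\<And>t. t \<in> {0..T} \<Longrightarrow> norm (Bs (Sa (T - t) \<phi>)) \<le> C"
    using continuous_on_Icc_bound[OF Bs_Sa_reversed_continuous[OF \<phi>]] by blast
  have "\<bar>ell T \<phi> u\<bar> \<le> C * (T + 1)" if u: "u \<in> unit_controls T" for u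
  proof -
    have su: "simple_function lebesgue u" and us: "u \<in> simple_controls T" using u by (auto simp: unit_controls_def simple_controls_def)
    note int = simple_integrable[OF su Bs_Sa_reversed_continuous[OF \<phi>, of T]]
    have "\<bar>ell T \<phi> u\<bar> \<le> (\<integral>t. \<bar>inner (u t) (Bs (Sa (T - t) \<phi>))\<bar> \<partial>Leb T)"
      unfolding ell_def l2ip_def by (rule integral_abs_bound)
    also have "\<dots> \<le> (\<integral>t. C * (1 + (norm (u t))\<^sup>2) \<partial>Leb T)"
    proof (rule integral_mono)
      show "integrable (Leb T) (\<lambda>t. \<bar>inner (u t) (Bs (Sa (T - t) \<phi>))\<bar>)" by (intro integrable_abs int)
      show "integrable (Leb T) (\<lambda>t. C * (1 + (norm (u t))\<^sup>2))"
        by (intro integrable_mult_right Bochner_Integration.integrable_add integrable_const_Leb simple_l2sq_HK(2)[OF su])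
      fix t assume "t \<in> space (Leb T)"
      hence "norm (u t) * norm (Bs (Sa (T - t) \<phi>)) \<le> norm (u t) * C" using C by (intro mult_left_mono) auto
      also have "\<dots> \<le> (1 + (norm (u t))\<^sup>2) * C"
        using zero_le_power2[of "norm (u t) - 1/2"] C(1)
        by (intro mult_right_mono) (simp_all add: power2_eq_square algebra_simps)
      finally show "\<bar>inner (u t) (Bs (Sa (T - t) \<phi>))\<bar> \<le> C * (1 + (norm (u t))\<^sup>2)"
        using Cauchy_Schwarz_ineq2[of "u t" "Bs (Sa (T - t) \<phi>)"] by (simp add: mult.commute)
    qed
    also have "\<dots> = C * (T + l2sq T u)"
    proof -
      have "measure (Leb T) {0..T} = T"
        using T by (subst measure_restrict_space) auto
      thus ?thesis unfolding l2sq_def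
        using simple_l2sq_HK(2)[OF su, of T] integrable_const_Leb[of T 1] by simp
    qed
    also have "\<dots> \<le> C * (T + 1)" using u C(1) by (intro mult_left_mono) (auto simp: unit_controls_def)
    finally show ?thesis .
  qed
  thus ?thesis by blast
qed

text \<open>The dual form of admissibility: the observation has L2 norm at most \<open>C\<close>
  times the norm of the state.\<close>

definition admissible_bound :: "real \<Rightarrow> real \<Rightarrow> bool" where
  "admissible_bound T C \<longleftrightarrow> C \<ge> 0 \<and> (\<forall>\<phi>\<in>Ds. \<forall>u\<in>unit_controls T. \<bar>ell T \<phi> u\<bar> \<le> C * norm \<phi>)"

lemma ell_regular_le:
  assumes u: "u \<in> regular_controls T" "l2sq T u \<le> r\<^sup>2" "r \<ge> 0" and \<phi>: "\<phi> \<in> Ds"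
    and c: "\<And>v. v \<in> unit_controls T \<Longrightarrow> \<bar>ell T \<phi> v\<bar> \<le> c"
  shows "\<bar>ell T \<phi> u\<bar> \<le> c * r"
proof -
  have c0: "c \<ge> 0" using c[OF unit_controls_0] by linarith
  obtain v where v: "\<And>n::nat. v n \<in> simple_controls T" "(\<lambda>n. l2sq T (v n)) \<longlonglongrightarrow> l2sq T u"
    "\<And>g. continuous_on {0..T} g \<Longrightarrow> (\<lambda>n. l2ip T (v n) g) \<longlonglongrightarrow> l2ip T u g"
    using regular_approx[OF u(1)] by blast
  have eps: "\<bar>ell T \<phi> u\<bar> \<le> c * (r + e)" if e: "e > 0" for e
  proof (rule LIMSEQ_le_const2)
    show "(\<lambda>n. \<bar>ell T \<phi> (v n)\<bar>) \<longlonglongrightarrow> \<bar>ell T \<phi> u\<bar>"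
      unfolding ell_def by (intro tendsto_intros v Bs_Sa_reversed_continuous \<phi>)
    have "l2sq T u < (r + e)\<^sup>2" using u(2,3) e power_strict_mono[of r "r + e" 2] by simp
    hence "\<forall>\<^sub>F n in sequentially. l2sq T (v n) < (r + e)\<^sup>2" using v(2) by (rule order_tendstoD(2)[rotated])
    then obtain N where N: "\<And>n. n \<ge> N \<Longrightarrow> l2sq T (v n) < (r + e)\<^sup>2" by (auto simp: eventually_sequentially)
    have re: "r + e > 0" using e u(3) by simp
    have "\<bar>ell T \<phi> (v n)\<bar> \<le> c * (r + e)" if "n \<ge> N" for n
    proof -
      have "\<bar>ell T \<phi> (\<lambda>t. (1 / (r + e)) *\<^sub>R v n t)\<bar> \<le> c"
        by (intro c simple_control_scaled_unit v re) (use N[OF that] in simp)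
      thus ?thesis unfolding ell_scale_u using re by (simp add: abs_mult field_simps)
    qed
    thus "\<exists>N. \<forall>n\<ge>N. \<bar>ell T \<phi> (v n)\<bar> \<le> c * (r + e)" by blast
  qed
  show ?thesis
  proof (rule field_le_epsilon)
    fix e :: real assume e: "e > 0"
    have "c * (e / (c + 1)) \<le> e" using c0 e by (simp add: field_simps)
    moreover have "\<bar>ell T \<phi> u\<bar> \<le> c * (r + e / (c + 1))"
      using c0 e by (intro eps) simp
    ultimately show "\<bar>ell T \<phi> u\<bar> \<le> c * r + e" by (simp add: distrib_left)
  qed
qed

text \<open>\<open>ell\<close> sees a control through the time left until the end, so delaying the
  control and prolonging the horizon by the same amount changes nothing.\<close>

lemma ell_shift:
  assumes u: "u \<in> simple_controls T" and a: "a \<ge> 0" and \<phi>: "\<phi> \<in> Ds"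
  shows "ell (T + a) \<phi> (\<lambda>s. u (s - a)) = ell T \<phi> u"
  unfolding ell_def
  using simple_controls_shift(3)[OF u a Bs_Sa_reversed_continuous[OF \<phi>]] by simp

text \<open>The control is switched off for the last \<open>a\<close> time units: free evolution
  acts on its result, in dual form through \<open>Sa a\<close>.\<close>

lemma ell_extend:
  assumes u: "u \<in> simple_controls T" and a: "a \<ge> 0" and T: "T \<ge> 0" and \<phi>: "\<phi> \<in> Ds"
  shows "ell (T + a) \<phi> u = ell T (Sa a \<phi>) u"
proof -
  have "ell (T + a) \<phi> u = l2ip T u (\<lambda>t. Bs (Sa (T + a - t) \<phi>))"
    unfolding ell_def by (rule simple_controls_extend(3)[OF u]) (use a in simp)
  also have "\<dots> = ell T (Sa a \<phi>) u"
    unfolding ell_def l2ip_def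
  proof (rule Bochner_Integration.integral_cong[OF refl])
    fix t assume t: "t \<in> space (Leb T)"
    have "Sa (T + a - t) \<phi> = Sa (T - t) (Sa a \<phi>)"
      using Sa_add[of "T - t" a \<phi>] a t by (simp add: algebra_simps)
    thus "inner (u t) (Bs (Sa (T + a - t) \<phi>)) = inner (u t) (Bs (Sa (T - t) (Sa a \<phi>)))" by simp
  qed
  finally show ?thesis .
qed

lemma unit_controls_shift:
  "u \<in> unit_controls T \<Longrightarrow> a \<ge> 0 \<Longrightarrow> (\<lambda>s. u (s - a)) \<in> unit_controls (T + a)"
  using simple_controls_shift(1,2)[of u T a] by (auto simp: unit_controls_def)

lemma unit_controls_extend:
  "u \<in> unit_controls t \<Longrightarrow> t \<le> T \<Longrightarrow> u \<in> unit_controls T"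
  using simple_controls_extend(1,2)[of u t T] by (auto simp: unit_controls_def)

lemma admissible_bound_mono:
  assumes "admissible_bound T C" "0 \<le> t" "t \<le> T"
  shows "admissible_bound t C"
  unfolding admissible_bound_def
proof (intro conjI ballI)
  fix \<phi> and u :: "real \<Rightarrow> 'u" assume *: "\<phi> \<in> Ds" "u \<in> unit_controls t"
  have e: "t + (T - t) = T" by simp
  have "ell (t + (T - t)) \<phi> (\<lambda>s. u (s - (T - t))) = ell t \<phi> u"
    by (intro ell_shift) (use assms * in \<open>auto simp: unit_controls_def\<close>)
  moreover have "(\<lambda>s. u (s - (T - t))) \<in> unit_controls (t + (T - t))"
    by (rule unit_controls_shift) (use * assms in auto)
  hence "\<bar>ell T \<phi> (\<lambda>s. u (s - (T - t)))\<bar> \<le> C * norm \<phi>"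
    using assms(1) *(1) unfolding admissible_bound_def e by blast
  ultimately show "\<bar>ell t \<phi> u\<bar> \<le> C * norm \<phi>" unfolding e by simp
qed (use assms in \<open>simp add: admissible_bound_def\<close>)

lemma unit_controls_split:
  assumes u: "u \<in> unit_controls (T + t)" and T: "T \<ge> 0" "t \<ge> 0"
  shows "\<exists>u1\<in>unit_controls T. \<exists>w\<in>unit_controls t. \<forall>\<phi>\<in>Ds. ell (T + t) \<phi> u = ell T (Sa t \<phi>) u1 + ell t \<phi> w"
proof -
  have us: "u \<in> simple_controls (T + t)" and su: "simple_function lebesgue u" using u by (auto simp: unit_controls_def simple_controls_def)
  \<comment> \<open>The point \<open>T\<close> itself is left to the second piece \<open>w\<close>,
    so that the two pieces add up to \<open>u\<close> everywhere.\<close>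
  define u1 where "u1 s = (if s < T then u s else 0)" for s
  define w where "w s = (if s \<in> {0..t} then u (s - (- T)) else 0)" for s
  have 1: "u1 \<in> simple_controls T"
  proof -
    have "simple_function lebesgue (\<lambda>s. if s \<in> {..<T} then u s else 0)"
      by (rule simple_function_If_set) (use su in auto)
    hence "simple_function lebesgue u1" by (simp add: u1_def[abs_def])
    thus ?thesis using us by (auto simp: simple_controls_def u1_def)
  qed
  have 2: "w \<in> simple_controls t"
  proof -
    have "simple_function lebesgue (\<lambda>s. if s \<in> {0..t} then u (s - (- T)) else 0)"
      by (rule simple_function_If_set) (use simple_function_translate[OF su, of "- T"] in auto)
    thus ?thesis by (auto simp: simple_controls_def w_def[abs_def])
  qed
  have dec: "u = (\<lambda>s. u1 s + w (s - T))"
  proof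
    fix s show "u s = u1 s + w (s - T)"
      using us by (auto simp: u1_def w_def simple_controls_def)
  qed
  have w': "(\<lambda>s. w (s - T)) \<in> simple_controls (t + T)" "l2sq (t + T) (\<lambda>s. w (s - T)) = l2sq t w"
    using simple_controls_shift(1,2)[OF 2 T(1)] by auto
  have u1s: "u1 \<in> simple_controls (t + T)" "l2sq (t + T) u1 = l2sq T u1"
    using simple_controls_extend(1,2)[OF 1, of "t + T"] T by auto
  have le: "l2sq (t + T) v \<le> 1" if v: "v \<in> simple_controls (t + T)" "\<And>s. norm (v s) \<le> norm (u s)" for v
  proof -
    have "l2sq (t + T) v \<le> l2sq (t + T) u"
      unfolding l2sq_def
      by (rule integral_mono) (use simple_l2sq_HK(2)[OF su] simple_l2sq_HK(2)[OF simple_controls_simple[OF v(1)]] v(2) in \<open>auto intro: power_mono\<close>)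
    thus ?thesis using u by (simp add: unit_controls_def add.commute)
  qed
  have u1: "u1 \<in> unit_controls T" using 1 le[OF u1s(1)] u1s(2) by (auto simp: unit_controls_def u1_def)
  have "norm (w (s - T)) \<le> norm (u s)" for s by (simp add: w_def)
  hence w1: "w \<in> unit_controls t" using 2 le[OF w'(1)] w'(2) by (auto simp: unit_controls_def)
  have "ell (T + t) \<phi> u = ell T (Sa t \<phi>) u1 + ell t \<phi> w" if \<phi>: "\<phi> \<in> Ds" for \<phi>
  proof -
    have "ell (T + t) \<phi> u = ell (T + t) \<phi> u1 + ell (T + t) \<phi> (\<lambda>s. w (s - T))"
      by (subst dec, rule ell_add_u) (use u1s w' \<phi> in \<open>auto simp: add.commute\<close>)
    also have "ell (T + t) \<phi> u1 = ell T (Sa t \<phi>) u1" by (rule ell_extend[OF 1 T(2,1) \<phi>])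
    also have "ell (T + t) \<phi> (\<lambda>s. w (s - T)) = ell t \<phi> w"
      using ell_shift[OF 2 T(1) \<phi>] by (simp add: add.commute)
    finally show ?thesis .
  qed
  thus ?thesis using u1 w1 by blast
qed

lemma admissible_bound_add:
  assumes C: "admissible_bound T C" "admissible_bound t D" and T: "T \<ge> 0" "t \<ge> 0"
  shows "\<exists>E. admissible_bound (T + t) E"
proof -
  obtain M where M: "M \<ge> 1" "\<And>x. norm (Sa t x) \<le> M * norm x" using S_bound_ex[of t] T by auto
  have C0: "C \<ge> 0" "D \<ge> 0" using C by (auto simp: admissible_bound_def)
  have "\<bar>ell (T + t) \<phi> u\<bar> \<le> (C * M + D) * norm \<phi>" if \<phi>: "\<phi> \<in> Ds" and u: "u \<in> unit_controls (T + t)" for \<phi> u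
  proof -
    obtain u1 w where uw: "u1 \<in> unit_controls T" "w \<in> unit_controls t"
      "ell (T + t) \<phi> u = ell T (Sa t \<phi>) u1 + ell t \<phi> w"
      using unit_controls_split[OF u T] \<phi> by blast
    have "\<bar>ell (T + t) \<phi> u\<bar> \<le> \<bar>ell T (Sa t \<phi>) u1\<bar> + \<bar>ell t \<phi> w\<bar>" unfolding uw(3) by (rule abs_triangle_ineq)
    also have "\<dots> \<le> C * norm (Sa t \<phi>) + D * norm \<phi>"
      using C uw \<phi> T by (intro add_mono) (auto simp: admissible_bound_def Sa_Ds)
    also have "\<dots> \<le> C * (M * norm \<phi>) + D * norm \<phi>" using M C0 by (intro add_mono mult_left_mono) auto
    finally show ?thesis by (simp add: algebra_simps)
  qed
  thus ?thesis using C0 M by (intro exI[of _ "C * M + D"]) (auto simp: admissible_bound_def)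
qed

lemma admissible_bound_all:
  assumes "admissible_bound T C" "T > 0" "t \<ge> 0"
  shows "\<exists>D. admissible_bound t D"
proof -
  have *: "\<exists>D. admissible_bound (real (Suc n) * T) D" for n
  proof (induction n)
    case 0
    then show ?case using assms by auto
  next
    case (Suc n)
    then obtain D where "admissible_bound (real (Suc n) * T) D" by blast
    from admissible_bound_add[OF this assms(1)] show ?case using assms(2) by (simp add: algebra_simps)
  qed
  obtain n where "t / T < real n" using reals_Archimedean2 by blast
  hence "t \<le> real (Suc n) * T" using assms(2) by (simp add: field_simps)
  thus ?thesis using *[of n] admissible_bound_mono assms(3) by blast
qed

text \<open>Failing a bound, \<open>gliding_hump\<close> and \<open>series_control\<close> combine
  almost optimal controls for unit vectors \<open>\<phi> n\<close> into one control whose functional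
  is unbounded on these vectors, so that no \<open>h\<close> can represent it. This plays the part
  of the closed graph theorem.\<close>

lemma admissible_imp_bound:
  assumes T: "T \<ge> 0" and ex: "\<And>u. u \<in> regular_controls T \<Longrightarrow> \<exists>h. \<forall>\<phi>\<in>Ds. inner h \<phi> = ell T \<phi> u"
  shows "\<exists>C. admissible_bound T C"
proof (rule ccontr)
  assume neg: "\<not> ?thesis"
  have "\<exists>\<phi> u. \<phi> \<in> Ds \<and> norm \<phi> = 1 \<and> u \<in> unit_controls T \<and> 5 ^ n \<le> ell T \<phi> u" for n :: nat
  proof -
    have "\<not> admissible_bound T (5 ^ n)" using neg by blast
    then obtain \<phi> u where *: "\<phi> \<in> Ds" "u \<in> unit_controls T" "\<bar>ell T \<phi> u\<bar> > 5 ^ n * norm \<phi>"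
      by (auto simp: admissible_bound_def not_le)
    have "ell T 0 u = 0" using ell_scaleR[OF Ds_0(1), of T 0 u] by simp
    hence n: "norm \<phi> > 0" using * by auto
    obtain v where v: "v \<in> unit_controls T" "ell T \<phi> v > 5 ^ n * norm \<phi>"
    proof (cases "ell T \<phi> u \<ge> 0")
      case True thus ?thesis using that[of u] * by simp
    next
      case False thus ?thesis using that[of "\<lambda>t. - u t"] * unit_controls_neg[OF *(2)] by (simp add: ell_neg_u)
    qed
    have "5 ^ n \<le> (1 / norm \<phi>) * ell T \<phi> v" using v(2) n by (simp add: field_simps)
    thus ?thesis using *(1) n v(1)
      by (intro exI[of _ "(1 / norm \<phi>) *\<^sub>R \<phi>"] exI[of _ v]) (auto simp: Ds_scaleR ell_scaleR)
  qed
  then obtain \<phi> u0 where \<phi>: "\<And>n. \<phi> n \<in> Ds" "\<And>n. norm (\<phi> n) = 1"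
    and u0: "\<And>n. u0 n \<in> unit_controls T" "\<And>n. 5 ^ n \<le> ell T (\<phi> n) (u0 n)" by metis
  \<comment> \<open>Finite for each \<open>n\<close> by \<open>ell_finite\<close>, and at least
    \<open>5 ^ n\<close> by the choice of \<open>\<phi> n\<close>.\<close>
  define L where "L n = (SUP u\<in>unit_controls T. ell T (\<phi> n) u)" for n
  have bdd: "bdd_above (ell T (\<phi> n) ` unit_controls T)" for n
    using ell_finite[OF T \<phi>(1), of n] by (auto simp: bdd_above_def) (meson abs_le_D1)
  have le: "ell T (\<phi> n) u \<le> L n" if "u \<in> unit_controls T" for n u
    unfolding L_def by (rule cSUP_upper[OF that bdd])
  have L5: "5 ^ n \<le> L n" for n using le[OF u0(1)] u0(2) order_trans by blast
  have Lpos: "L n > 0" for n using L5[of n] by (meson less_le_trans zero_less_numeral zero_less_power)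
  have "\<exists>u\<in>unit_controls T. L n / 2 \<le> ell T (\<phi> n) u" for n
  proof (rule ccontr)
    assume "\<not> ?thesis"
    hence "L n \<le> L n / 2" unfolding L_def[of n] using u0(1)
      by (intro cSUP_least) (auto simp: L_def not_le intro: less_imp_le)
    thus False using Lpos[of n] by simp
  qed
  then obtain u where u: "\<And>n. u n \<in> unit_controls T" "\<And>n. L n / 2 \<le> ell T (\<phi> n) (u n)" by metis
  have "\<exists>c. (\<forall>k. \<bar>c k\<bar> = (1/4) ^ k) \<and> (\<forall>M. \<exists>n. M < \<bar>\<Sum>k. c k * ell T (\<phi> n) (u k)\<bar>)"
  proof (rule gliding_hump[where L = L])
    show "\<bar>ell T (\<phi> n) (u k)\<bar> \<le> L n" for n k
      using le[OF u(1), of n k] le[OF unit_controls_neg[OF u(1)], of n k] by (simp add: ell_neg_u)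
  qed (use u L5 in auto)
  then obtain c where c: "\<And>k. \<bar>c k\<bar> = (1/4) ^ k" "\<And>M. \<exists>n. M < \<bar>\<Sum>k. c k * ell T (\<phi> n) (u k)\<bar>" by blast
  have "\<exists>w\<in>regular_controls T. \<forall>g. continuous_on {0..T} g \<longrightarrow> (\<lambda>k. c k * l2ip T (u k) g) sums l2ip T w g"
  proof (rule series_control)
    show "\<bar>c k\<bar> \<le> (1/2) ^ k" for k unfolding c by (intro power_mono) auto
  qed (use u in \<open>auto simp: unit_controls_def\<close>)
  then obtain w where w: "w \<in> regular_controls T"
    "\<And>g. continuous_on {0..T} g \<Longrightarrow> (\<lambda>k. c k * l2ip T (u k) g) sums l2ip T w g" by blast
  obtain h where h: "\<And>\<phi>. \<phi> \<in> Ds \<Longrightarrow> inner h \<phi> = ell T \<phi> w" using ex[OF w(1)] by blast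
  have "\<bar>\<Sum>k. c k * ell T (\<phi> n) (u k)\<bar> \<le> norm h" for n
  proof -
    have "(\<Sum>k. c k * ell T (\<phi> n) (u k)) = inner h (\<phi> n)"
      unfolding h[OF \<phi>(1)] unfolding ell_def
      by (rule sums_unique[symmetric]) (intro w(2) Bs_Sa_reversed_continuous \<phi>)
    thus ?thesis using Cauchy_Schwarz_ineq2[of h "\<phi> n"] \<phi>(2) by simp
  qed
  thus False using c(2)[of "norm h"] by (auto simp: not_less[symmetric])
qed

text \<open>One direction is uniform boundedness, the other the Riesz theorem on the dense domain.
  The estimate is the form in which independence of the time and stability under perturbation can be
  shown.\<close>

lemma admissible_iff:
  "admissible_control A B \<longleftrightarrow> (\<exists>T>0. \<exists>C. admissible_bound T C)"
proof
  assume "admissible_control A B"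
  then obtain T where T: "T > 0" "input_map_dual A B T ` L2 {0<..} \<subseteq> range (pivot A)"
    by (auto simp: admissible_control_def)
  have "\<exists>C. admissible_bound T C"
  proof (rule admissible_imp_bound)
    fix u :: "real \<Rightarrow> 'u" assume u: "u \<in> regular_controls T"
    have "input_map_dual A B T u = weak_input T u" using T u by (intro input_map_dual_eq) auto
    thus "\<exists>h. \<forall>\<phi>\<in>Ds. inner h \<phi> = ell T \<phi> u"
      using T(2) regular_imp_L2[OF u] pivot_eq_weak_input_iff[OF u] by (metis image_subset_iff imageE)
  qed (use T in simp)
  thus "\<exists>T>0. \<exists>C. admissible_bound T C" using T by blast
next
  assume "\<exists>T>0. \<exists>C. admissible_bound T C"
  then obtain T C where T: "T > 0" "admissible_bound T C" by blast
  have "input_map_dual A B T u0 \<in> range (pivot A)" if u0: "u0 \<in> L2 {0<..}" for u0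
  proof -
    have sub: "{0<..<T} \<subseteq> {0<..}" by auto
    obtain u where u: "u \<in> regular_controls T" "AE t in Leb T. u t = u0 t"
      using L2_imp_regular[OF u0 _ sub less_imp_le[OF T(1)]] by auto
    have "\<exists>h. \<forall>\<phi>\<in>Ds. ell T \<phi> u = inner \<phi> h"
    proof (rule riesz_dense[OF subspace_Ds Ds_dense])
      show "\<bar>ell T \<phi> u\<bar> \<le> (C * sqrt (l2sq T u)) * norm \<phi>" if "\<phi> \<in> Ds" for \<phi>
      proof -
        have "\<bar>ell T \<phi> u\<bar> \<le> (C * norm \<phi>) * sqrt (l2sq T u)"
          by (rule ell_regular_le[OF u(1) _ _ that]) (use T that l2sq_nonneg[of T u] in \<open>auto simp: admissible_bound_def\<close>)
        thus ?thesis by (simp add: mult_ac)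
      qed
    qed (auto simp: ell_add u ell_scaleR)
    then obtain h where "\<forall>\<phi>\<in>Ds. ell T \<phi> u = inner \<phi> h" by blast
    hence "inner h \<phi> = ell T \<phi> u" if "\<phi> \<in> Ds" for \<phi> using that by (simp add: inner_commute)
    thus ?thesis using input_mapI(2)[OF _ u] T by fastforce
  qed
  thus "admissible_control A B" using control T by (auto simp: admissible_control_def)
qed

end

section \<open>The input map with values in the state space\<close>

locale admissible_system = control_system A B
  for A :: "'a::complex_hilbert unbdd_op" and B :: "'u::complex_hilbert \<Rightarrow> 'a \<Rightarrow> complex" +
  assumes admissible: "admissible_control A B"
begin

abbreviation "\<Phi> \<equiv> input_map A B"

lemma admissible_bound_ex: "t \<ge> 0 \<Longrightarrow> \<exists>C. admissible_bound t C"
  using admissible admissible_bound_all by (auto simp: admissible_iff)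

lemma input_map_regular:
  assumes T: "T \<ge> 0" and u: "u \<in> regular_controls T"
  shows "\<phi> \<in> Ds \<Longrightarrow> inner (\<Phi> T u) \<phi> = ell T \<phi> u"
    and "AE t in Leb T. u t = u0 t \<Longrightarrow> \<Phi> T u0 = \<Phi> T u"
proof -
  obtain C where C: "admissible_bound T C" using admissible_bound_ex[OF T] by blast
  have "\<exists>h. \<forall>\<phi>\<in>Ds. ell T \<phi> u = inner \<phi> h"
  proof (rule riesz_dense[OF subspace_Ds Ds_dense])
    show "\<bar>ell T \<phi> u\<bar> \<le> (C * sqrt (l2sq T u)) * norm \<phi>" if "\<phi> \<in> Ds" for \<phi>
    proof -
      have "\<bar>ell T \<phi> u\<bar> \<le> (C * norm \<phi>) * sqrt (l2sq T u)"
        by (rule ell_regular_le[OF u _ _ that]) (use C that l2sq_nonneg[of T u] in \<open>auto simp: admissible_bound_def\<close>)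
      thus ?thesis by (simp add: mult_ac)
    qed
  qed (auto simp: ell_add u ell_scaleR)
  then obtain h where "\<forall>\<phi>\<in>Ds. ell T \<phi> u = inner \<phi> h" by blast
  hence h: "inner h \<phi> = ell T \<phi> u" if "\<phi> \<in> Ds" for \<phi> using that by (simp add: inner_commute)
  have hu: "\<Phi> T u = h" by (rule input_mapI(1)[OF T u _ h]) auto
  show "\<phi> \<in> Ds \<Longrightarrow> inner (\<Phi> T u) \<phi> = ell T \<phi> u" using h hu by simp
  show "AE t in Leb T. u t = u0 t \<Longrightarrow> \<Phi> T u0 = \<Phi> T u" using input_mapI(1)[OF T u _ h] hu by auto
qed

lemma eq_if_inner_Ds:
  assumes "\<And>\<phi>. \<phi> \<in> Ds \<Longrightarrow> inner h \<phi> = inner k \<phi>" shows "h = k"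
proof -
  have "inner \<phi> (h - k) = 0" if "\<phi> \<in> Ds" for \<phi>
    using assms[OF that] by (simp add: inner_diff_right inner_commute)
  hence "inner (adj (orbit_mean S r) (h - k)) (h - k) = 0" if "r > 0" for r
    using adj_orbit_mean_in_Ds[OF that] by blast
  thus ?thesis using eq_0_if_orthogonal_adj_orbit_mean[of "h - k"] by simp
qed

lemma input_map_eqI:
  assumes "T \<ge> 0" "u \<in> regular_controls T" "\<And>\<phi>. \<phi> \<in> Ds \<Longrightarrow> inner h \<phi> = ell T \<phi> u"
  shows "\<Phi> T u = h"
  by (rule eq_if_inner_Ds) (use assms input_map_regular(1) in simp)

lemma input_map_image:
  assumes T: "T \<ge> 0" and J: "J \<in> sets lebesgue" "{0<..<T} \<subseteq> J"
  shows "\<Phi> T ` L2 J \<subseteq> \<Phi> T ` regular_controls T"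
proof
  fix y assume "y \<in> \<Phi> T ` L2 J"
  then obtain u0 where u0: "u0 \<in> L2 J" "y = \<Phi> T u0" by blast
  obtain u where "u \<in> regular_controls T" "AE t in Leb T. u t = u0 t" using L2_imp_regular[OF u0(1) J T] by blast
  thus "y \<in> \<Phi> T ` regular_controls T" using input_map_regular(2)[OF T] u0(2) by blast
qed

lemma input_map_L2: "T \<ge> 0 \<Longrightarrow> \<Phi> T ` L2 {0<..} = \<Phi> T ` regular_controls T"
  by (intro equalityI image_mono subsetI regular_imp_L2 input_map_image) auto

lemma input_map_scale:
  assumes "T \<ge> 0" "u \<in> simple_controls T"
  shows "\<Phi> T (\<lambda>t. c *\<^sub>R u t) = c *\<^sub>R \<Phi> T u"
  using assms by (intro input_map_eqI simple_controls_regular simple_controls_scale)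
    (simp_all add: ell_scale_u input_map_regular(1) simple_controls_regular)

lemma input_map_add:
  assumes "T \<ge> 0" "u \<in> simple_controls T" "v \<in> simple_controls T"
  shows "\<Phi> T (\<lambda>t. u t + v t) = \<Phi> T u + \<Phi> T v"
  using assms by (intro input_map_eqI simple_controls_regular simple_controls_add)
    (simp_all add: ell_add_u input_map_regular(1) inner_add_left simple_controls_regular)

lemma input_map_shift:
  assumes "T \<ge> 0" "u \<in> simple_controls T" "a \<ge> 0"
  shows "\<Phi> (T + a) (\<lambda>s. u (s - a)) = \<Phi> T u"
  using assms by (intro input_map_eqI simple_controls_regular simple_controls_shift(1))
    (simp_all add: ell_shift input_map_regular(1) simple_controls_regular)

lemma input_map_extend:
  assumes "T \<ge> 0" "u \<in> simple_controls T" "a \<ge> 0"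
  shows "\<Phi> (T + a) u = S a (\<Phi> T u)"
  using assms by (intro input_map_eqI simple_controls_regular simple_controls_extend(1)[of u T "T + a"])
    (simp_all add: ell_extend input_map_regular(1) Sa_inner Sa_Ds simple_controls_regular)

lemma norm_input_map_le:
  assumes C: "admissible_bound T C" and T: "T \<ge> 0" and u: "u \<in> regular_controls T" "l2sq T u \<le> r\<^sup>2" "r \<ge> 0"
  shows "norm (\<Phi> T u) \<le> C * r"
proof (rule norm_le_if_inner_le)
  fix x
  obtain \<phi> where \<phi>: "\<And>n::nat. \<phi> n \<in> Ds" "\<phi> \<longlonglongrightarrow> x" using ex_Ds_seq by blast
  have C0: "C \<ge> 0" using C by (simp add: admissible_bound_def)
  show "inner x (\<Phi> T u) \<le> C * r * norm x"
  proof (rule LIMSEQ_le)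
    show "(\<lambda>n. inner (\<phi> n) (\<Phi> T u)) \<longlonglongrightarrow> inner x (\<Phi> T u)" by (intro tendsto_intros \<phi>)
    show "(\<lambda>n. C * r * norm (\<phi> n)) \<longlonglongrightarrow> C * r * norm x" by (intro tendsto_intros \<phi>)
    have "inner (\<phi> n) (\<Phi> T u) \<le> C * r * norm (\<phi> n)" for n
    proof -
      have "\<bar>ell T (\<phi> n) u\<bar> \<le> (C * norm (\<phi> n)) * r"
        by (rule ell_regular_le[OF u \<phi>(1)]) (use C \<phi>(1) in \<open>auto simp: admissible_bound_def\<close>)
      thus ?thesis using input_map_regular(1)[OF T u(1) \<phi>(1), of n] by (simp add: inner_commute mult_ac)
    qed
    thus "\<exists>N. \<forall>n\<ge>N. inner (\<phi> n) (\<Phi> T u) \<le> C * r * norm (\<phi> n)" by blast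
  qed
qed (use C u in \<open>simp add: admissible_bound_def\<close>)

end


subsection \<open>Comparison of the perturbed and the unperturbed system\<close>

text \<open>A mean value inequality for a function known only through its increments: the error per
  step is small relative to the step, uniformly in the starting time, so equal steps add up.\<close>

lemma increment_bound:
  fixes f :: "real \<Rightarrow> real"
  assumes T: "T \<ge> 0" and L: "L \<ge> 0"
    and inc: "\<And>\<epsilon>. \<epsilon> > 0 \<Longrightarrow> \<exists>\<delta>>0. \<forall>t h. 0 \<le> t \<longrightarrow> 0 \<le> h \<longrightarrow> h < \<delta> \<longrightarrow> t + h \<le> T \<longrightarrow> \<bar>f (t + h) - f t\<bar> \<le> (L + \<epsilon>) * h"
  shows "\<bar>f T - f 0\<bar> \<le> L * T"
proof -
  have "\<bar>f T - f 0\<bar> \<le> (L + \<epsilon>) * T" if e: "\<epsilon> > 0" for \<epsilon>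
  proof -
    obtain \<delta> where \<delta>: "\<delta> > 0" "\<And>t h. 0 \<le> t \<Longrightarrow> 0 \<le> h \<Longrightarrow> h < \<delta> \<Longrightarrow> t + h \<le> T \<Longrightarrow> \<bar>f (t + h) - f t\<bar> \<le> (L + \<epsilon>) * h"
      using inc[OF e] by blast
    obtain N :: nat where N: "T / \<delta> < real N" using reals_Archimedean2 by blast
    have N0: "real N > 0" using N T \<delta>(1) by (meson divide_nonneg_pos le_less_trans)
    define h where "h = T / real N"
    have h: "0 \<le> h" "h < \<delta>" "real N * h = T" using T N N0 \<delta>(1) by (auto simp: h_def field_simps)
    have "k \<le> N \<Longrightarrow> \<bar>f (real k * h) - f 0\<bar> \<le> (L + \<epsilon>) * (real k * h)" for k
    proof (induction k)
      case (Suc k)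
      have "real (Suc k) * h \<le> real N * h" using Suc.prems h(1) by (intro mult_right_mono) auto
      hence "\<bar>f (real k * h + h) - f (real k * h)\<bar> \<le> (L + \<epsilon>) * h"
        using h by (intro \<delta>) (auto simp: algebra_simps)
      moreover have "\<bar>f (real k * h) - f 0\<bar> \<le> (L + \<epsilon>) * (real k * h)" using Suc by simp
      ultimately have "\<bar>f (real k * h + h) - f 0\<bar> \<le> (L + \<epsilon>) * (real k * h) + (L + \<epsilon>) * h" by linarith
      thus ?case by (simp add: algebra_simps)
    qed simp
    from this[of N] h(3) show ?thesis by simp
  qed
  hence *: "\<bar>f T - f 0\<bar> \<le> L * T + e * T" if "e > 0" for e using that by (simp add: distrib_right)
  show ?thesis
  proof (rule field_le_epsilon)
    fix e :: real assume e: "e > 0"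
    have "e / (T + 1) * T \<le> e" using T e by (simp add: field_simps)
    thus "\<bar>f T - f 0\<bar> \<le> L * T + e" using *[of "e / (T + 1)"] T e by simp
  qed
qed

context control_system
begin

text \<open>Separates the action before \<open>t\<close>, which is followed by \<open>h\<close> time
  units of free evolution, from that on the short last interval. The control is not cut, since
  \<open>ell t\<close> ignores its values after \<open>t\<close>.\<close>

lemma ell_combine:
  assumes u: "simple_function lebesgue u" and \<phi>: "\<phi> \<in> Ds" and t: "0 \<le> t" "0 \<le> h"
  shows "ell (t + h) \<phi> u = ell t (Sa h \<phi>) u + integral {t..t + h} (\<lambda>s. inner (u s) (Bs (Sa (t + h - s) \<phi>)))"
proof -
  let ?f = "\<lambda>s. inner (u s) (Bs (Sa (t + h - s) \<phi>))"
  note HK = simple_l2ip_HK[OF u Bs_Sa_reversed_continuous[OF \<phi>, of "t + h"]]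
  have "ell (t + h) \<phi> u = integral {0..t + h} ?f" unfolding ell_def by (rule HK(1))
  also have "\<dots> = integral {0..t} ?f + integral {t..t + h} ?f"
    by (rule Henstock_Kurzweil_Integration.integral_combine[symmetric]) (use t HK(2) in auto)
  also have "integral {0..t} ?f = integral {0..t} (\<lambda>s. inner (u s) (Bs (Sa (t - s) (Sa h \<phi>))))"
  proof (rule Henstock_Kurzweil_Integration.integral_cong)
    fix s assume "s \<in> {0..t}"
    thus "?f s = inner (u s) (Bs (Sa (t - s) (Sa h \<phi>)))"
      using Sa_add[of "t - s" h \<phi>] t by (simp add: algebra_simps)
  qed
  also have "\<dots> = ell t (Sa h \<phi>) u"
    unfolding ell_def
    by (rule simple_l2ip_HK(1)[OF u Bs_Sa_reversed_continuous, symmetric]) (use \<phi> t in \<open>simp add: Sa_Ds\<close>)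
  finally show ?thesis .
qed

lemma ell_truncate_le:
  assumes C: "admissible_bound T C" and t: "0 \<le> t" "t \<le> T" and \<phi>: "\<phi> \<in> Ds" and u: "u \<in> unit_controls T"
  shows "\<bar>ell t \<phi> u\<bar> \<le> C * norm \<phi>"
proof -
  let ?v = "\<lambda>s. if s \<le> t then u s else 0"
  have us: "u \<in> simple_controls T" "l2sq T u \<le> 1" using u by (auto simp: unit_controls_def)
  note tr = simple_controls_truncate[OF us(1) t(2)]
  have "?v \<in> unit_controls t" using tr(1,2) us(2) by (auto simp: unit_controls_def)
  hence "\<bar>ell t \<phi> ?v\<bar> \<le> C * norm \<phi>"
    using admissible_bound_mono[OF C t] \<phi> unfolding admissible_bound_def by blast
  thus ?thesis by (simp add: ell_def tr(3))
qed

text \<open>The two graph norms are equivalent, so \<open>B\<close> is bounded into either dual. The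
  constant \<open>2 + k\<close> bounds the old graph norm on the new unit ball: 1 for the vector and
  \<open>1 + k\<close> for its image under \<open>As\<close>.\<close>

lemma control_op_perturb:
  assumes K: "bounded_clinear K" and P: "generator (op_perturb A K) SK"
  shows "control_op (op_perturb A K) B"
proof -
  interpret pg: perturbed_generator A S K SK
    using P K by (simp add: perturbed_generator_def perturbed_generator_axioms_def generator_axioms)
  obtain k where k: "k \<ge> 0" "\<And>x. norm (adj K x) \<le> k * norm x"
    using bounded_clinear_bound[OF bounded_clinear_adj[OF K]] by blast
  obtain \<beta> where \<beta>: "\<beta> \<ge> 0" "\<And>u \<phi>. \<phi> \<in> Ds \<Longrightarrow> cmod (B u \<phi>) \<le> \<beta> * norm u * gn \<phi>" using B_bound by blast
  have D: "fst (op_adjoint (op_perturb A K)) = Ds" by (rule pg.adjoint_perturb(1))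
  have g: "gn \<phi> \<le> 2 + k" if \<phi>: "\<phi> \<in> Ds" and le: "graph_norm (op_adjoint (op_perturb A K)) \<phi> \<le> 1" for \<phi>
  proof -
    have 1: "norm \<phi> \<le> 1" "norm (snd (op_adjoint (op_perturb A K)) \<phi>) \<le> 1"
      using le unfolding graph_norm_def
      by (auto intro: order_trans[OF real_sqrt_ge_abs1, OF le[unfolded graph_norm_def]]
          order_trans[OF _ le[unfolded graph_norm_def]] real_le_rsqrt)
    have "norm (adj K \<phi>) \<le> k * 1" using k 1(1) by (meson mult_left_mono order_trans)
    moreover have "norm (As \<phi>) \<le> norm (As \<phi> + adj K \<phi>) + norm (adj K \<phi>)"
      using norm_triangle_ineq4[of "As \<phi> + adj K \<phi>" "adj K \<phi>"] by simp
    ultimately show ?thesis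
      using 1 gn_bounds(3)[of \<phi>] pg.adjoint_perturb(2)[OF \<phi>] by simp
  qed
  have dn: "dual_norm (op_perturb A K) (B u) \<le> ennreal (\<beta> * (2 + k) * norm u)" for u
    unfolding dual_norm_def D
  proof (rule SUP_least)
    fix \<phi> assume *: "\<phi> \<in> {\<phi> \<in> Ds. graph_norm (op_adjoint (op_perturb A K)) \<phi> \<le> 1}"
    have "cmod (B u \<phi>) \<le> \<beta> * norm u * gn \<phi>" using \<beta>(2) * by auto
    also have "\<dots> \<le> \<beta> * norm u * (2 + k)" using g * \<beta>(1) by (intro mult_left_mono) auto
    finally show "ennreal (cmod (B u \<phi>)) \<le> ennreal (\<beta> * (2 + k) * norm u)"
      by (intro ennreal_leI) (simp add: mult_ac)
  qed
  have "B u \<in> dual_space (op_perturb A K)" for u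
    using B_dual[of u] le_less_trans[OF dn[of u], of \<infinity>] by (auto simp: dual_space_def D)
  thus ?thesis using control dn unfolding control_op_def by blast
qed

end

lemma norm_le_if_inner_le_unit:
  fixes z :: "'a::real_inner"
  assumes "\<And>x. norm x \<le> 1 \<Longrightarrow> inner x z \<le> c" "c \<ge> 0"
  shows "norm z \<le> c"
proof (cases "z = 0")
  case False
  thus ?thesis using assms(1)[of "(1 / norm z) *\<^sub>R z"] by (simp add: power2_norm_eq_inner[symmetric] power2_eq_square)
qed (use assms in simp)

locale perturbed_system = U: admissible_system A B + P: control_system "op_perturb A K" B
  for A :: "'a::complex_hilbert unbdd_op" and B :: "'u::complex_hilbert \<Rightarrow> 'a \<Rightarrow> complex" and K :: "'a \<Rightarrow> 'a" +
  assumes K: "bounded_clinear K"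
begin

sublocale pg: perturbed_generator A "semigroup_of A" K "semigroup_of (op_perturb A K)"
  by unfold_locales (rule K)

lemma Ds_eq: "P.Ds = U.Ds" by (rule pg.adjoint_perturb(1))

text \<open>Uniformity in \<open>\<tau>\<close> comes from compactness of the square of times and
  continuity of the pair \<open>D\<close>, which vanishes at \<open>\<sigma> = 0\<close>. The graph
  norm appears because \<open>U.Bs\<close> will be applied to the difference.\<close>

lemma semigroup_difference_gn:
  assumes \<phi>: "\<phi> \<in> U.Ds" and T: "T \<ge> 0" and e: "\<epsilon> > 0"
  shows "\<exists>\<delta>>0. \<forall>\<tau>\<in>{0..T}. \<forall>\<sigma>\<in>{0..T}. \<sigma> < \<delta> \<longrightarrow>
    U.gn (U.Sa \<sigma> (P.Sa \<tau> \<phi>) - P.Sa \<sigma> (P.Sa \<tau> \<phi>)) \<le> \<epsilon>"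
proof -
  define \<alpha> where "\<alpha> r = U.As (P.Sa r \<phi>)" for r
  have PD: "P.Sa r \<phi> \<in> U.Ds" if "r \<ge> 0" for r using P.Sa_Ds(1)[of \<phi> r] \<phi> that by (simp add: Ds_eq)
  \<comment> \<open>Along the perturbed orbit the unperturbed adjoint is the perturbed one minus a
    bounded term, hence continuous.\<close>
  have \<alpha>c: "continuous_on {0..} \<alpha>"
  proof -
    have "continuous_on {0..} (\<lambda>r. P.Sa r (P.As \<phi>) - adj K (P.Sa r \<phi>))"
      by (intro continuous_on_diff P.Sa_continuous continuous_intros
          bounded_linear.continuous_on[OF bounded_clinear_linear[OF bounded_clinear_adj[OF K]]]) auto
    thus ?thesis
    proof (rule continuous_on_eq)
      fix r :: real assume r: "r \<in> {0..}"
      show "P.Sa r (P.As \<phi>) - adj K (P.Sa r \<phi>) = \<alpha> r"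
        using P.Sa_Ds(2)[of \<phi> r] pg.adjoint_perturb(2)[OF PD, of r] \<phi> r
        by (simp add: \<alpha>_def Ds_eq) (metis add_diff_cancel_right')
    qed
  qed
  define D where "D p = (U.Sa (fst p) (P.Sa (snd p) \<phi>) - P.Sa (fst p + snd p) \<phi>,
      U.Sa (fst p) (\<alpha> (snd p)) - \<alpha> (fst p + snd p))" for p :: "real \<times> real"
  have "continuous_on ({0..T} \<times> {0..T}) D"
    unfolding D_def
    by (intro continuous_on_Pair continuous_on_diff U.Sa_continuous P.Sa_continuous
        continuous_on_compose2[OF \<alpha>c] continuous_intros) auto
  hence "uniformly_continuous_on ({0..T} \<times> {0..T}) D"
    by (intro compact_uniformly_continuous compact_Times) auto
  then obtain \<delta> where \<delta>: "\<delta> > 0" "\<And>p q. p \<in> {0..T} \<times> {0..T} \<Longrightarrow> q \<in> {0..T} \<times> {0..T} \<Longrightarrow> dist q p < \<delta> \<Longrightarrow> dist (D q) (D p) < \<epsilon> / 2"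
    using e unfolding uniformly_continuous_on_def by (metis half_gt_zero)
  have "U.gn (U.Sa \<sigma> (P.Sa \<tau> \<phi>) - P.Sa \<sigma> (P.Sa \<tau> \<phi>)) \<le> \<epsilon>"
    if t: "\<tau> \<in> {0..T}" "\<sigma> \<in> {0..T}" "\<sigma> < \<delta>" for \<tau> \<sigma>
  proof -
    have "dist (D (\<sigma>, \<tau>)) (D (0, \<tau>)) < \<epsilon> / 2"
      by (rule \<delta>(2)) (use t T in \<open>auto simp: dist_prod_def dist_real_def\<close>)
    moreover have "D (0, \<tau>) = 0" by (simp add: D_def U.Sa_0 zero_prod_def)
    ultimately have n: "norm (D (\<sigma>, \<tau>)) < \<epsilon> / 2" by simp
    have sg: "P.Sa \<sigma> (P.Sa \<tau> \<phi>) = P.Sa (\<sigma> + \<tau>) \<phi>" using P.Sa_add[of \<sigma> \<tau> \<phi>] t by simp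
    have D1: "U.Sa \<sigma> (P.Sa \<tau> \<phi>) \<in> U.Ds" "P.Sa (\<sigma> + \<tau>) \<phi> \<in> U.Ds"
      using t PD by (auto intro!: U.Sa_Ds(1))
    let ?x = "U.Sa \<sigma> (P.Sa \<tau> \<phi>) - P.Sa (\<sigma> + \<tau>) \<phi>"
    have "U.As ?x = U.Sa \<sigma> (\<alpha> \<tau>) - \<alpha> (\<sigma> + \<tau>)"
      using t PD[of \<tau>] by (simp add: U.Ds_diff(2)[OF D1] \<alpha>_def U.Sa_Ds(2))
    hence "D (\<sigma>, \<tau>) = (?x, U.As ?x)" by (simp add: D_def)
    hence "norm ?x \<le> norm (D (\<sigma>, \<tau>))" "norm (U.As ?x) \<le> norm (D (\<sigma>, \<tau>))"
      by (metis norm_fst_le norm_snd_le fst_conv snd_conv)+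
    thus ?thesis using n U.gn_bounds(3)[of ?x] unfolding sg by linarith
  qed
  thus ?thesis using \<delta>(1) by blast
qed

text \<open>Follows \<open>U.ell t (P.Sa (T - t) \<phi>) u\<close> for \<open>t\<close> from 0 to \<open>T\<close>; since \<open>u\<close> is bounded,
  the control terms of the two systems differ by \<open>o(h)\<close> over a time step \<open>h\<close>.\<close>

lemma ell_difference:
  assumes \<phi>: "\<phi> \<in> U.Ds" and u: "u \<in> unit_controls T" and T: "T \<ge> 0" and C: "U.admissible_bound T C"
    and M: "M \<ge> 0" "\<And>s x. 0 \<le> s \<Longrightarrow> s \<le> T \<Longrightarrow> norm (semigroup_of A s x) \<le> M * norm x"
    and m: "\<And>s. 0 \<le> s \<Longrightarrow> s \<le> T \<Longrightarrow> norm (adj K (P.Sa s \<phi>)) \<le> m"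
  shows "\<bar>U.ell T \<phi> u - P.ell T \<phi> u\<bar> \<le> C * M * m * T"
proof -
  have su: "simple_function lebesgue u" using u by (simp add: unit_controls_def simple_controls_def)
  obtain R where R: "R > 0" "\<And>t. norm (u t) \<le> R" using simple_function_imp_bounded[OF su] by blast
  obtain \<beta> where \<beta>: "\<beta> > 0" "\<And>\<phi>. \<phi> \<in> U.Ds \<Longrightarrow> norm (U.Bs \<phi>) \<le> \<beta> * U.gn \<phi>" using U.Bs_bound by blast
  have PD: "P.Sa r \<phi> \<in> U.Ds" if "r \<ge> 0" for r using P.Sa_Ds(1)[of \<phi> r] \<phi> that by (simp add: Ds_eq)
  have m0: "m \<ge> 0" using m[of 0] T norm_ge_zero order_trans by blast
  have C0: "C \<ge> 0" using C by (simp add: U.admissible_bound_def)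
  let ?g = "\<lambda>s. inner (u s) (U.Bs (P.Sa (T - s) \<phi>))"
  note gHK = simple_l2ip_HK[OF su P.Bs_Sa_reversed_continuous[of \<phi> T], unfolded Ds_eq, OF \<phi>]
  \<comment> \<open>The subtracted integral is the contribution of the controls up to time
    \<open>t\<close> in the perturbed system, so \<open>f\<close> leads from 0 to the difference of
    the two functionals.\<close>
  define f where "f t = U.ell t (P.Sa (T - t) \<phi>) u - integral {0..t} ?g" for t
  have fT: "f T - f 0 = U.ell T \<phi> u - P.ell T \<phi> u"
  proof -
    have "U.ell 0 x u = 0" if "x \<in> U.Ds" for x
      unfolding U.ell_def by (subst simple_l2ip_HK(1)[OF su U.Bs_Sa_reversed_continuous[OF that]]) simp
    thus ?thesis using gHK(1) T PD[of T] by (simp add: f_def P.Sa_0 P.ell_def)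
  qed
  have "\<bar>f T - f 0\<bar> \<le> C * M * m * T"
  proof (rule increment_bound[OF T])
    show "0 \<le> C * M * m" using C0 M m0 by simp
    fix \<epsilon> :: real assume e: "\<epsilon> > 0"
    \<comment> \<open>The bound \<open>R\<close> of the control and the bound \<open>\<beta>\<close>
      of \<open>U.Bs\<close> will turn this back into \<open>\<epsilon>\<close>.\<close>
    define \<epsilon>' where "\<epsilon>' = \<epsilon> / (R * \<beta>)"
    have e': "\<epsilon>' > 0" using e R \<beta> by (simp add: \<epsilon>'_def)
    obtain \<delta> where \<delta>: "\<delta> > 0" "\<And>\<tau> \<sigma>. \<tau> \<in> {0..T} \<Longrightarrow> \<sigma> \<in> {0..T} \<Longrightarrow> \<sigma> < \<delta> \<Longrightarrow>
       U.gn (U.Sa \<sigma> (P.Sa \<tau> \<phi>) - P.Sa \<sigma> (P.Sa \<tau> \<phi>)) \<le> \<epsilon>'"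
      using semigroup_difference_gn[OF \<phi> T e'] by blast
    have "\<bar>f (t + h) - f t\<bar> \<le> (C * M * m + \<epsilon>) * h" if t: "0 \<le> t" "0 \<le> h" "h < \<delta>" "t + h \<le> T" for t h
    proof -
      define \<tau> where "\<tau> = T - (t + h)"
      define \<psi> where "\<psi> = P.Sa \<tau> \<phi>"
      have \<tau>: "\<tau> \<in> {0..T}" using t by (simp add: \<tau>_def)
      have \<psi>: "\<psi> \<in> U.Ds" using PD \<tau> by (simp add: \<psi>_def)
      have Pa: "P.Sa s \<psi> = P.Sa (s + \<tau>) \<phi>" if "s \<ge> 0" for s
        using P.Sa_add[of s \<tau> \<phi>] that \<tau> by (simp add: \<psi>_def)
      have Ph: "P.Sa (T - t) \<phi> = P.Sa h \<psi>" using Pa[of h] t by (simp add: \<tau>_def)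
      have UD: "U.Sa s \<psi> \<in> U.Ds" "P.Sa s \<psi> \<in> U.Ds" if "s \<ge> 0" for s
        using U.Sa_Ds(1)[OF \<psi> that] P.Sa_Ds(1)[of \<psi> s] \<psi> that by (simp_all add: Ds_eq)
      let ?U = "\<lambda>s. inner (u s) (U.Bs (U.Sa (t + h - s) \<psi>))"
      let ?P = "\<lambda>s. inner (u s) (U.Bs (P.Sa (t + h - s) \<psi>))"
      have i1: "?U integrable_on {t..t + h}"
        by (rule integrable_subinterval_real[OF simple_l2ip_HK(2)[OF su U.Bs_Sa_reversed_continuous[OF \<psi>, of "t + h"]]])
          (use t in auto)
      have "\<psi> \<in> P.Ds" using \<psi> by (simp add: Ds_eq)
      hence i2: "?P integrable_on {t..t + h}"
        by (intro integrable_subinterval_real[OF simple_l2ip_HK(2)[OF su P.Bs_Sa_reversed_continuous, of \<psi> "t + h"]])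
          (use t in auto)
      have gP: "integral {t..t + h} ?g = integral {t..t + h} ?P"
      proof (rule Henstock_Kurzweil_Integration.integral_cong)
        fix s assume "s \<in> {t..t + h}"
        thus "?g s = ?P s" using Pa[of "t + h - s"] by (simp add: \<tau>_def)
      qed
      have gc: "integral {0..t + h} ?g = integral {0..t} ?g + integral {t..t + h} ?g"
        by (rule Henstock_Kurzweil_Integration.integral_combine[symmetric])
          (use t integrable_subinterval_real[OF gHK(2), of 0 "t + h"] in auto)
      \<comment> \<open>Additivity of \<open>ell\<close> in the vector is stated for regular
        controls, so \<open>u\<close> is cut at \<open>t\<close> for this step.\<close>
      have ex: "U.ell t (U.Sa h \<psi>) u - U.ell t (P.Sa h \<psi>) u = U.ell t (U.Sa h \<psi> - P.Sa h \<psi>) u"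
      proof -
        let ?v = "\<lambda>s. if s \<le> t then u s else 0"
        have us: "u \<in> simple_controls T" using u by (simp add: unit_controls_def)
        have tT: "t \<le> T" using t by simp
        have v: "?v \<in> regular_controls t" by (intro simple_controls_regular simple_controls_truncate(1)[OF us tT])
        have eq: "U.ell t x u = U.ell t x ?v" for x by (simp add: U.ell_def simple_controls_truncate(3)[OF us tT])
        have "U.ell t (U.Sa h \<psi> - P.Sa h \<psi>) ?v + U.ell t (P.Sa h \<psi>) ?v = U.ell t (U.Sa h \<psi>) ?v"
          using U.ell_add[OF v U.Ds_diff(1)[OF UD, of h h] UD(2), of h] t by simp
        thus ?thesis unfolding eq by linarith
      qed
      have "f (t + h) - f t = U.ell t (U.Sa h \<psi> - P.Sa h \<psi>) u + integral {t..t + h} (\<lambda>s. ?U s - ?P s)"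
      proof -
        have "f (t + h) = U.ell t (U.Sa h \<psi>) u + integral {t..t + h} ?U - integral {0..t + h} ?g"
          unfolding f_def \<tau>_def[symmetric] \<psi>_def[symmetric] using U.ell_combine[OF su \<psi> t(1,2)] by simp
        thus ?thesis
          unfolding gc gP by (simp add: f_def Ph ex[symmetric] Henstock_Kurzweil_Integration.integral_diff[OF i1 i2])
      qed
      moreover have "\<bar>U.ell t (U.Sa h \<psi> - P.Sa h \<psi>) u\<bar> \<le> C * (h * M * m)"
      proof -
        have "norm (U.Sa h \<psi> - P.Sa h \<psi>) \<le> h * M * m"
        proof (rule pg.norm_adj_semigroup_diff_le)
          fix s assume s: "0 \<le> s" "s \<le> h"
          thus "norm (adj K (P.Sa s \<psi>)) \<le> m" using t unfolding Pa[OF s(1)] by (intro m) (auto simp: \<tau>_def)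
        qed (use t M in auto)
        hence "C * norm (U.Sa h \<psi> - P.Sa h \<psi>) \<le> C * (h * M * m)" using C0 by (rule mult_left_mono)
        moreover have "\<bar>U.ell t (U.Sa h \<psi> - P.Sa h \<psi>) u\<bar> \<le> C * norm (U.Sa h \<psi> - P.Sa h \<psi>)"
          by (rule U.ell_truncate_le[OF C _ _ U.Ds_diff(1)[OF UD] u]) (use t in auto)
        ultimately show ?thesis by linarith
      qed
      moreover have "\<bar>integral {t..t + h} (\<lambda>s. ?U s - ?P s)\<bar> \<le> \<epsilon> * h"
      proof -
        have "norm (integral {t..t + h} (\<lambda>s. ?U s - ?P s)) \<le> integral {t..t + h} (\<lambda>s. \<epsilon>)"
        proof (rule integral_norm_bound_integral)
          show "(\<lambda>s. ?U s - ?P s) integrable_on {t..t + h}"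
            by (rule Henstock_Kurzweil_Integration.integrable_diff[OF i1 i2])
          fix s assume s: "s \<in> {t..t + h}"
          let ?x = "U.Sa (t + h - s) \<psi> - P.Sa (t + h - s) \<psi>"
          have "?U s - ?P s = inner (u s) (U.Bs ?x)"
            using s UD[of "t + h - s"] by (simp add: U.Bs_diff inner_diff_right)
          hence "norm (?U s - ?P s) \<le> norm (u s) * norm (U.Bs ?x)" using Cauchy_Schwarz_ineq2 by simp
          also have "\<dots> \<le> R * (\<beta> * \<epsilon>')"
          proof (rule mult_mono[OF R(2)])
            have "norm (U.Bs ?x) \<le> \<beta> * U.gn ?x" using s by (intro \<beta> U.Ds_diff UD) auto
            also have "\<dots> \<le> \<beta> * \<epsilon>'"
              using \<delta>(2)[OF \<tau>, of "t + h - s"] s t \<beta>(1) by (intro mult_left_mono) (auto simp: \<psi>_def[symmetric])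
            finally show "norm (U.Bs ?x) \<le> \<beta> * \<epsilon>'" .
          qed (use R in auto)
          also have "\<dots> = \<epsilon>" using R \<beta> by (simp add: \<epsilon>'_def)
          finally show "norm (?U s - ?P s) \<le> \<epsilon>" .
        qed auto
        thus ?thesis using t by (simp add: mult.commute)
      qed
      ultimately have "\<bar>f (t + h) - f t\<bar> \<le> C * (h * M * m) + \<epsilon> * h" by linarith
      thus ?thesis by (simp add: algebra_simps)
    qed
    thus "\<exists>\<delta>>0. \<forall>t h. 0 \<le> t \<longrightarrow> 0 \<le> h \<longrightarrow> h < \<delta> \<longrightarrow> t + h \<le> T \<longrightarrow> \<bar>f (t + h) - f t\<bar> \<le> (C * M * m + \<epsilon>) * h"
      using \<delta>(1) by blast
  qed
  thus ?thesis by (simp add: fT)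
qed

text \<open>The vector enters only through the size of \<open>adj K\<close> along its perturbed
  adjoint orbit. A crude bound on this size gives admissibility; a small one up to finitely many
  functionals gives observability.\<close>

lemma ell_difference_ex:
  assumes T: "T \<ge> 0"
  shows "\<exists>a\<ge>0. \<forall>\<phi>\<in>U.Ds. \<forall>u\<in>unit_controls T. \<forall>m. (\<forall>s\<in>{0..T}. norm (adj K (P.Sa s \<phi>)) \<le> m) \<longrightarrow>
     \<bar>U.ell T \<phi> u - P.ell T \<phi> u\<bar> \<le> a * m"
proof -
  obtain C where C: "U.admissible_bound T C" using U.admissible_bound_ex[OF T] by blast
  obtain M where M: "M \<ge> 1" "\<forall>s\<in>{0..T}. \<forall>x. norm (semigroup_of A s x) \<le> M * norm x"
    using U.S_bound_ex[of T] by blast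
  have C0: "C \<ge> 0" using C by (simp add: U.admissible_bound_def)
  have "\<bar>U.ell T \<phi> u - P.ell T \<phi> u\<bar> \<le> (C * M * T) * m"
    if "\<phi> \<in> U.Ds" "u \<in> unit_controls T" "\<forall>s\<in>{0..T}. norm (adj K (P.Sa s \<phi>)) \<le> m" for \<phi> u m
    using ell_difference[OF that(1,2) T C, of M m] M that(3) by (simp add: mult_ac)
  thus ?thesis using C0 M(1) T by (intro exI[of _ "C * M * T"]) auto
qed

lemma admissible_perturb: "admissible_control (op_perturb A K) B"
proof -
  obtain C where C: "U.admissible_bound 1 C" using U.admissible_bound_ex[of 1] by auto
  obtain a where a: "a \<ge> 0" "\<forall>\<phi>\<in>U.Ds. \<forall>u\<in>unit_controls 1. \<forall>m. (\<forall>s\<in>{0..1}. norm (adj K (P.Sa s \<phi>)) \<le> m) \<longrightarrow>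
     \<bar>U.ell 1 \<phi> u - P.ell 1 \<phi> u\<bar> \<le> a * m" using ell_difference_ex[of 1] by auto
  obtain k where k: "k \<ge> 0" "\<And>x. norm (adj K x) \<le> k * norm x"
    using bounded_clinear_bound[OF bounded_clinear_adj[OF K]] by blast
  obtain M where M: "M \<ge> 1" "\<And>s x. s \<in> {0..1} \<Longrightarrow> norm (P.Sa s x) \<le> M * norm x"
    using P.S_bound_ex[of 1] by blast
  have "\<bar>P.ell 1 \<phi> u\<bar> \<le> (C + a * (k * M)) * norm \<phi>" if *: "\<phi> \<in> P.Ds" "u \<in> unit_controls 1" for \<phi> u
  proof -
    have "norm (adj K (P.Sa s \<phi>)) \<le> k * (M * norm \<phi>)" if "s \<in> {0..1}" for s
      using order_trans[OF k(2) mult_left_mono[OF M(2)[OF that] k(1)]] .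
    hence "\<bar>U.ell 1 \<phi> u - P.ell 1 \<phi> u\<bar> \<le> a * (k * (M * norm \<phi>))" using a(2) * by (simp add: Ds_eq)
    moreover have "\<bar>U.ell 1 \<phi> u\<bar> \<le> C * norm \<phi>" using C * by (simp add: U.admissible_bound_def Ds_eq)
    ultimately show ?thesis by (simp add: algebra_simps abs_le_iff)
  qed
  moreover have "C \<ge> 0" using C by (simp add: U.admissible_bound_def)
  ultimately have "P.admissible_bound 1 (C + a * (k * M))"
    using a(1) k(1) M(1) unfolding P.admissible_bound_def by auto
  thus ?thesis unfolding P.admissible_iff by (intro exI[of _ 1]) auto
qed

text \<open>The vectors of \<open>V\<close> form a finite net of the compact set of all \<open>S\<^sub>K(s) K x\<close>.\<close>

lemma compact_perturbation_small:
  assumes comp: "compact_op K" and e: "\<epsilon> > 0"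
  shows "\<exists>V. finite V \<and> (\<forall>\<phi>. \<forall>s\<in>{0..T}. norm (adj K (P.Sa s \<phi>)) \<le> \<epsilon> * norm \<phi> + (\<Sum>v\<in>V. \<bar>inner \<phi> v\<bar>))"
proof -
  let ?X = "(\<lambda>p. semigroup_of (op_perturb A K) (fst p) (snd p)) ` ({0..T} \<times> closure (K ` cball 0 1))"
  have "compact ?X"
    using comp by (intro compact_continuous_image P.S_continuous continuous_intros compact_Times)
      (auto simp: compact_op_def)
  then obtain V where V: "finite V" "?X \<subseteq> (\<Union>v\<in>V. ball v \<epsilon>)"
    unfolding compact_eq_totally_bounded using e by blast
  have "norm (adj K (P.Sa s \<phi>)) \<le> \<epsilon> * norm \<phi> + (\<Sum>v\<in>V. \<bar>inner \<phi> v\<bar>)" if s: "s \<in> {0..T}" for s \<phi>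
  proof (rule norm_le_if_inner_le_unit)
    fix x :: 'a assume x: "norm x \<le> 1"
    have Kx: "K x \<in> closure (K ` cball 0 1)" using x closure_subset by fastforce
    have "(s, K x) \<in> {0..T} \<times> closure (K ` cball 0 1)" using s Kx by blast
    from imageI[OF this, of "\<lambda>p. semigroup_of (op_perturb A K) (fst p) (snd p)"]
    have "semigroup_of (op_perturb A K) s (K x) \<in> ?X" by simp
    then obtain v where v: "v \<in> V" "dist v (semigroup_of (op_perturb A K) s (K x)) < \<epsilon>" using V(2) by auto
    have "inner x (adj K (P.Sa s \<phi>)) = inner (semigroup_of (op_perturb A K) s (K x)) \<phi>"
      using s P.Sa_inner[of s] by (simp add: inner_adj[OF K])
    also have "\<dots> = inner (semigroup_of (op_perturb A K) s (K x) - v) \<phi> + inner \<phi> v"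
      by (simp add: inner_diff_left inner_commute[of \<phi> v])
    also have "\<dots> \<le> \<epsilon> * norm \<phi> + (\<Sum>v\<in>V. \<bar>inner \<phi> v\<bar>)"
    proof (rule add_mono)
      have "inner (semigroup_of (op_perturb A K) s (K x) - v) \<phi> \<le> norm (semigroup_of (op_perturb A K) s (K x) - v) * norm \<phi>"
        by (rule norm_cauchy_schwarz)
      also have "\<dots> \<le> \<epsilon> * norm \<phi>" using v(2) by (intro mult_right_mono) (auto simp: dist_norm norm_minus_commute)
      finally show "inner (semigroup_of (op_perturb A K) s (K x) - v) \<phi> \<le> \<epsilon> * norm \<phi>" .
      have "\<bar>inner \<phi> v\<bar> \<le> (\<Sum>v\<in>V. \<bar>inner \<phi> v\<bar>)" using v(1) V(1) by (intro member_le_sum) auto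
      thus "inner \<phi> v \<le> (\<Sum>v\<in>V. \<bar>inner \<phi> v\<bar>)" by linarith
    qed
    finally show "inner x (adj K (P.Sa s \<phi>)) \<le> \<epsilon> * norm \<phi> + (\<Sum>v\<in>V. \<bar>inner \<phi> v\<bar>)" .
  qed (use e in \<open>auto intro!: add_nonneg_nonneg sum_nonneg\<close>)
  thus ?thesis using V(1) by blast
qed

end


subsection \<open>Support functions in Hilbert space\<close>

text \<open>A normalised sequence violating the claim has \<open>Q\<close> tending to 0. The
  remaining functional converges along a subsequence, which the assumed inequality then makes
  Cauchy. Its limit is a unit vector of \<open>G\<close> with \<open>Q\<close> equal to 0, which
  \<open>ker\<close> forbids.\<close>

lemma seminorm_bound_drop_functional:
  fixes G :: "'a::{real_inner,banach} set" and Q :: "'a \<Rightarrow> real"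
  assumes G: "closed G" "subspace G"
    and sub: "\<And>x y. Q (x - y) \<le> Q x + Q y" and hom: "\<And>r x. Q (r *\<^sub>R x) = \<bar>r\<bar> * Q x"
    and cont: "\<And>x. Q x \<le> C * norm x" and ker: "\<And>x. x \<in> G \<Longrightarrow> Q x = 0 \<Longrightarrow> x = 0"
    and nn: "\<And>x. Q x \<ge> 0"
    and c: "c \<ge> 0" "\<And>z. z \<in> G \<Longrightarrow> norm z \<le> c * (Q z + \<bar>inner z v\<bar>)"
  shows "\<exists>c'\<ge>0. \<forall>z\<in>G. norm z \<le> c' * Q z"
proof (rule ccontr)
  assume neg: "\<not> ?thesis"
  have "\<exists>z\<in>G. norm z = 1 \<and> Q z \<le> 1 / real (Suc n)" for n
  proof -
    obtain z where z: "z \<in> G" "norm z > real (Suc n) * Q z"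
      using neg by (metis linorder_not_less of_nat_0_le_iff)
    have n0: "norm z > 0" using z(2) nn[of z] by (meson le_less_trans mult_nonneg_nonneg of_nat_0_le_iff)
    have "Q ((1 / norm z) *\<^sub>R z) \<le> 1 / real (Suc n)"
      using z(2) n0 by (simp add: hom field_simps)
    moreover have "(1 / norm z) *\<^sub>R z \<in> G" using z(1) G(2) by (simp add: subspace_scale)
    moreover have "norm ((1 / norm z) *\<^sub>R z) = 1" using n0 by simp
    ultimately show ?thesis by blast
  qed
  then obtain z where z: "\<And>n. z n \<in> G" "\<And>n. norm (z n) = 1" "\<And>n. Q (z n) \<le> 1 / real (Suc n)" by metis
  have "bounded (range (\<lambda>n. inner (z n) v))"
  proof (rule boundedI)
    fix x assume "x \<in> range (\<lambda>n. inner (z n) v)"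
    thus "norm x \<le> norm v" using Cauchy_Schwarz_ineq2[of "z _" v] z(2) by auto
  qed
  then obtain l r where r: "strict_mono r" "((\<lambda>n. inner (z n) v) \<circ> r) \<longlonglongrightarrow> l"
    using bounded_imp_convergent_subsequence by blast
  have inv: "(\<lambda>n. 1 / real (Suc n)) \<longlonglongrightarrow> 0"
    using LIMSEQ_inverse_real_of_nat by (simp add: inverse_eq_divide)
  have Q0: "(\<lambda>n. Q (z (r n))) \<longlonglongrightarrow> 0"
  proof (rule tendsto_sandwich[OF _ _ tendsto_const])
    show "(\<lambda>n. 1 / real (Suc (r n))) \<longlonglongrightarrow> 0" using LIMSEQ_subseq_LIMSEQ[OF inv r(1)] by (simp add: o_def)
  qed (use nn z(3) in auto)
  have "Cauchy (\<lambda>n. z (r n))"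
  proof (rule metric_CauchyI)
    fix e :: real assume e: "e > 0"
    \<comment> \<open>With \<open>Q\<close> of the difference at most \<open>2 * d\<close> and the
      functional at most \<open>d\<close>, the inequality gives \<open>3 * c * d\<close>, which is
      less than \<open>e\<close>.\<close>
    define d where "d = e / (3 * (c + 1))"
    have d: "d > 0" using e c by (simp add: d_def)
    obtain N1 where N1: "\<And>n. n \<ge> N1 \<Longrightarrow> Q (z (r n)) < d"
      using order_tendstoD(2)[OF Q0 d] by (auto simp: eventually_sequentially)
    have "Cauchy ((\<lambda>n. inner (z n) v) \<circ> r)" using r(2) by (rule LIMSEQ_imp_Cauchy)
    then obtain N2 where N2: "\<And>m n. m \<ge> N2 \<Longrightarrow> n \<ge> N2 \<Longrightarrow> \<bar>inner (z (r m)) v - inner (z (r n)) v\<bar> < d"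
      using d unfolding Cauchy_def dist_real_def o_def by metis
    have "dist (z (r m)) (z (r n)) < e" if mn: "m \<ge> max N1 N2" "n \<ge> max N1 N2" for m n
    proof -
      have "dist (z (r m)) (z (r n)) \<le> c * (Q (z (r m) - z (r n)) + \<bar>inner (z (r m) - z (r n)) v\<bar>)"
        unfolding dist_norm by (intro c subspace_diff[OF G(2)] z)
      also have "\<dots> \<le> c * (3 * d)"
      proof (rule mult_left_mono[OF _ c(1)])
        have "Q (z (r m) - z (r n)) \<le> d + d" using sub[of "z (r m)" "z (r n)"] N1[of m] N1[of n] mn by simp
        moreover have "\<bar>inner (z (r m) - z (r n)) v\<bar> \<le> d" using N2[of m n] mn by (simp add: inner_diff_left)
        ultimately show "Q (z (r m) - z (r n)) + \<bar>inner (z (r m) - z (r n)) v\<bar> \<le> 3 * d" by simp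
      qed
      also have "\<dots> < e" using e c(1) by (simp add: d_def field_simps)
      finally show ?thesis .
    qed
    thus "\<exists>M. \<forall>m\<ge>M. \<forall>n\<ge>M. dist (z (r m)) (z (r n)) < e" by blast
  qed
  then obtain x where x: "(\<lambda>n. z (r n)) \<longlonglongrightarrow> x" using Cauchy_convergent unfolding convergent_def by blast
  have xG: "x \<in> G" using closed_sequentially[OF G(1) _ x] z(1) by blast
  have nx: "norm x = 1" using tendsto_norm[OF x] z(2) by (simp add: LIMSEQ_const_iff)
  have "Q x \<le> Q (z (r n)) + C * norm (z (r n) - x)" for n
    using sub[of "z (r n)" "z (r n) - x"] cont[of "z (r n) - x"] by simp
  moreover have "(\<lambda>n. Q (z (r n)) + C * norm (z (r n) - x)) \<longlonglongrightarrow> 0 + C * norm (x - x)"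
    by (intro tendsto_intros Q0 x)
  ultimately have "Q x \<le> 0 + C * norm (x - x)" by (intro LIMSEQ_le_const) auto
  hence "Q x = 0" using nn[of x] by simp
  with ker[OF xG] nx show False by simp
qed

text \<open>Functionals are removed one at a time by absorbing the current one into the seminorm;
  triviality of the kernel is preserved when \<open>Q\<close> grows.\<close>

lemma seminorm_bound_drop_functionals:
  fixes G :: "'a::{real_inner,banach} set" and Q :: "'a \<Rightarrow> real"
  assumes G: "closed G" "subspace G" and V: "finite V"
    and sub: "\<And>x y. Q (x - y) \<le> Q x + Q y" and hom: "\<And>r x. Q (r *\<^sub>R x) = \<bar>r\<bar> * Q x"
    and cont: "\<And>x. Q x \<le> C * norm x" and ker: "\<And>x. x \<in> G \<Longrightarrow> Q x = 0 \<Longrightarrow> x = 0"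
    and nn: "\<And>x. Q x \<ge> 0"
    and c: "c \<ge> 0" "\<And>z. z \<in> G \<Longrightarrow> norm z \<le> c * (Q z + (\<Sum>v\<in>V. \<bar>inner z v\<bar>))"
  shows "\<exists>c'\<ge>0. \<forall>z\<in>G. norm z \<le> c' * Q z"
  using V sub hom cont ker nn c
proof (induction V arbitrary: Q C c rule: finite_induct)
  case empty
  then show ?case by auto
next
  case (insert v V)
  define R where "R x = Q x + \<bar>inner x v\<bar>" for x
  have "\<exists>c'\<ge>0. \<forall>z\<in>G. norm z \<le> c' * R z"
  proof (rule insert.IH[of R "C + norm v" c])
    show "R (x - y) \<le> R x + R y" for x y
      using insert.prems(1)[of x y] by (simp add: R_def inner_diff_left)
    show "R (r *\<^sub>R x) = \<bar>r\<bar> * R x" for r x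
      using insert.prems(2) by (simp add: R_def abs_mult algebra_simps)
    show "R x \<le> (C + norm v) * norm x" for x
      using insert.prems(3)[of x] Cauchy_Schwarz_ineq2[of x v] by (simp add: R_def algebra_simps)
    show "x = 0" if "x \<in> G" "R x = 0" for x
      using insert.prems(4)[OF that(1)] insert.prems(5)[of x] that(2) by (simp add: R_def)
    show "R x \<ge> 0" for x using insert.prems(5)[of x] by (simp add: R_def)
    show "c \<ge> 0" by (rule insert.prems)
    show "norm z \<le> c * (R z + (\<Sum>v\<in>V. \<bar>inner z v\<bar>))" if "z \<in> G" for z
      using insert.prems(7)[OF that] insert.hyps by (simp add: R_def add_ac)
  qed
  then obtain c' where "c' \<ge> 0" "\<And>z. z \<in> G \<Longrightarrow> norm z \<le> c' * (Q z + \<bar>inner z v\<bar>)" by (auto simp: R_def)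
  thus ?case using seminorm_bound_drop_functional[OF G insert.prems(1-5)] by blast
qed

section \<open>Support function, biannihilator and closed range for a bounded symmetric convex
  set\<close>

locale balanced_set =
  fixes W :: "'a::{real_inner,banach} set" and C :: real
  assumes zero: "0 \<in> W" and neg: "w \<in> W \<Longrightarrow> - w \<in> W" and conv: "convex W"
    and bdd: "w \<in> W \<Longrightarrow> norm w \<le> C"
begin

text \<open>For the image of the unit ball of controls this is the norm of the observation, so lower
  bounds for \<open>supp\<close> are observability inequalities.\<close>

definition supp :: "'a \<Rightarrow> real" where
  "supp z = (SUP w\<in>W. inner w z)"

lemma inner_le: "w \<in> W \<Longrightarrow> inner w z \<le> C * norm z"
  using norm_cauchy_schwarz[of w z] mult_right_mono[OF bdd norm_ge_zero, of w z] by linarith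

lemma bdd_above: "bdd_above ((\<lambda>w. inner w z) ` W)"
  using inner_le by (auto intro!: bdd_aboveI)

lemma inner_le_supp: "w \<in> W \<Longrightarrow> inner w z \<le> supp z"
  unfolding supp_def by (rule cSUP_upper[OF _ bdd_above])

lemma abs_inner_le_supp: "w \<in> W \<Longrightarrow> \<bar>inner w z\<bar> \<le> supp z"
  using inner_le_supp[of w z] inner_le_supp[OF neg, of w z] by auto

lemma supp_leI: "(\<And>w. w \<in> W \<Longrightarrow> inner w z \<le> c) \<Longrightarrow> supp z \<le> c"
  unfolding supp_def using zero by (intro cSUP_least) auto

lemma supp_nonneg: "supp z \<ge> 0"
  using inner_le_supp[OF zero, of z] by simp

lemma supp_le_norm: "supp z \<le> C * norm z"
  by (rule supp_leI) (rule inner_le)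

lemma supp_diff: "supp (x - y) \<le> supp x + supp y"
proof (rule supp_leI)
  fix w assume "w \<in> W"
  thus "inner w (x - y) \<le> supp x + supp y"
    using inner_le_supp[of w x] abs_inner_le_supp[of w y] by (simp add: inner_diff_right)
qed

lemma supp_scale: "supp (r *\<^sub>R x) = \<bar>r\<bar> * supp x"
proof -
  have le: "supp (r *\<^sub>R x) \<le> \<bar>r\<bar> * supp x" for r x
  proof (rule supp_leI)
    fix w assume "w \<in> W"
    hence "\<bar>r\<bar> * \<bar>inner w x\<bar> \<le> \<bar>r\<bar> * supp x" by (intro mult_left_mono abs_inner_le_supp) auto
    thus "inner w (r *\<^sub>R x) \<le> \<bar>r\<bar> * supp x" using abs_ge_self[of "r * inner w x"] by (simp add: abs_mult)
  qed
  show ?thesis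
  proof (cases "r = 0")
    case True
    have "supp (0::'a) = 0" unfolding supp_def using zero by (simp add: image_constant_conv) force
    thus ?thesis using True by simp
  next
    case False
    have "\<bar>r\<bar> * supp x = \<bar>r\<bar> * supp ((1 / r) *\<^sub>R (r *\<^sub>R x))" using False by simp
    also have "\<dots> \<le> \<bar>r\<bar> * (\<bar>1 / r\<bar> * supp (r *\<^sub>R x))" by (intro mult_left_mono le) auto
    also have "\<dots> = supp (r *\<^sub>R x)" using False by (simp add: abs_divide)
    finally show ?thesis using le[of r x] by linarith
  qed
qed

definition annihilator :: "'a set" where
  "annihilator = {z. \<forall>w\<in>W. inner w z = 0}"

lemma supp_eq_0_iff: "supp z = 0 \<longleftrightarrow> z \<in> annihilator"
proof
  assume "supp z = 0"
  thus "z \<in> annihilator" using abs_inner_le_supp[of _ z] by (fastforce simp: annihilator_def)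
next
  assume "z \<in> annihilator"
  hence "supp z \<le> 0" by (intro supp_leI) (auto simp: annihilator_def)
  thus "supp z = 0" using supp_nonneg[of z] by linarith
qed

text \<open>The closed real linear span of \<open>W\<close>, expressed by duality.\<close>

definition biannihilator :: "'a set" where
  "biannihilator = {x. \<forall>z\<in>annihilator. inner x z = 0}"

lemma subspace_biannihilator: "subspace biannihilator"
  by (auto simp: subspace_def biannihilator_def inner_add_left)

lemma closed_biannihilator: "closed biannihilator"
proof -
  have "biannihilator = (\<Inter>z\<in>annihilator. {x. inner x z = 0})" by (auto simp: biannihilator_def)
  moreover have "closed {x. inner x z = 0}" for z :: 'a
    by (intro closed_Collect_eq continuous_intros)
  ultimately show ?thesis by auto
qed

lemma closure_subset_biannihilator: "closure W \<subseteq> biannihilator"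
  by (rule closure_minimal[OF _ closed_biannihilator]) (auto simp: biannihilator_def annihilator_def)

text \<open>Separation by projection: if \<open>y\<close> were outside the closure, the vector
  \<open>z\<close> from its projection to \<open>y\<close> would satisfy
  \<open>supp z < c * norm z\<close>. The lower bound applies because \<open>z\<close> stays in
  \<open>biannihilator\<close>.\<close>

lemma in_closure_if_small:
  assumes c: "\<And>z. z \<in> biannihilator \<Longrightarrow> c * norm z \<le> supp z" and y: "y \<in> biannihilator" "norm y \<le> c"
  shows "y \<in> closure W"
proof -
  obtain p where p: "p \<in> closure W" "\<And>w. w \<in> closure W \<Longrightarrow> inner (y - p) (w - p) \<le> 0"
    using closest_point_convex[of "closure W" y] zero conv closure_subset[of W] by (auto intro: convex_closure)
  define z where "z = y - p"
  have zG: "z \<in> biannihilator"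
    unfolding z_def using p(1) closure_subset_biannihilator y(1) by (intro subspace_diff[OF subspace_biannihilator]) auto
  have "supp z \<le> inner p z"
  proof (rule supp_leI)
    fix w assume "w \<in> W"
    hence "inner z (w - p) \<le> 0" using p(2) closure_subset z_def by blast
    thus "inner w z \<le> inner p z" by (simp add: inner_diff_right inner_commute)
  qed
  also have "inner p z = inner y z - (norm z)\<^sup>2"
    by (simp add: z_def power2_norm_eq_inner inner_diff_left inner_diff_right)
  also have "\<dots> \<le> c * norm z - (norm z)\<^sup>2"
    using norm_cauchy_schwarz[of y z] mult_right_mono[OF y(2) norm_ge_zero, of z] by linarith
  finally have "(norm z)\<^sup>2 \<le> 0" using c[OF zG] by linarith
  hence "z = 0" by simp
  thus ?thesis using p(1) by (simp add: z_def)
qed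

text \<open>Successive approximation, as in the proof of the open mapping theorem.\<close>

lemma series_representation:
  assumes c: "c > 0" "\<And>z. z \<in> biannihilator \<Longrightarrow> c * norm z \<le> supp z" and y: "y \<in> biannihilator" "norm y \<le> c"
  shows "\<exists>w. (\<forall>k::nat. w k \<in> W) \<and> (\<lambda>k. (1/2) ^ k *\<^sub>R w k) sums y"
proof -
  have "\<exists>w\<in>W. norm (r - w) \<le> c / 2" if r: "r \<in> biannihilator" "norm r \<le> c" for r
  proof -
    have "r \<in> closure W" by (rule in_closure_if_small[OF c(2) r])
    then obtain w where "w \<in> W" "dist w r < c / 2" using c(1) unfolding closure_approachable by (metis half_gt_zero)
    thus ?thesis by (auto simp: dist_norm norm_minus_commute intro!: bexI[of _ w])
  qed
  then obtain g where g: "\<And>r. r \<in> biannihilator \<Longrightarrow> norm r \<le> c \<Longrightarrow> g r \<in> W \<and> norm (r - g r) \<le> c / 2" by metis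
  \<comment> \<open>Each remainder is doubled, which keeps it in the ball of radius \<open>c\<close>
    and produces the weights \<open>(1/2) ^ k\<close>.\<close>
  define r where "r = rec_nat y (\<lambda>_ x. 2 *\<^sub>R (x - g x))"
  have r0: "r 0 = y" and rS: "r (Suc k) = 2 *\<^sub>R (r k - g (r k))" for k by (simp_all add: r_def)
  have r: "r k \<in> biannihilator \<and> norm (r k) \<le> c" for k
  proof (induction k)
    case 0
    then show ?case using y by (simp add: r0)
  next
    case (Suc k)
    have "g (r k) \<in> biannihilator" using g Suc closure_subset closure_subset_biannihilator by blast
    then show ?case unfolding rS
      using g[of "r k"] Suc by (auto intro!: subspace_scale subspace_diff subspace_biannihilator)
  qed
  have part: "y - (\<Sum>k<n. (1/2) ^ k *\<^sub>R g (r k)) = (1/2) ^ n *\<^sub>R r n" for n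
  proof (induction n)
    case 0
    then show ?case by (simp add: r0)
  next
    case (Suc n)
    have "y - (\<Sum>k<Suc n. (1/2) ^ k *\<^sub>R g (r k)) = (1/2) ^ n *\<^sub>R r n - (1/2) ^ n *\<^sub>R g (r n)"
      using Suc by (simp add: algebra_simps)
    also have "\<dots> = (1/2) ^ Suc n *\<^sub>R r (Suc n)" by (simp add: rS scaleR_diff_right)
    finally show ?case .
  qed
  have "(\<lambda>n. y - (\<Sum>k<n. (1/2) ^ k *\<^sub>R g (r k))) \<longlonglongrightarrow> 0"
  proof (rule Lim_null_comparison)
    show "\<forall>\<^sub>F n in sequentially. norm (y - (\<Sum>k<n. (1/2) ^ k *\<^sub>R g (r k))) \<le> (1/2) ^ n * c"
      unfolding part using r by (intro always_eventually allI) (simp add: mult_left_mono)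
    show "(\<lambda>n. (1/2) ^ n * c) \<longlonglongrightarrow> 0" by (intro tendsto_mult_left_zero LIMSEQ_power_zero) auto
  qed
  hence "(\<lambda>n. y - (y - (\<Sum>k<n. (1/2) ^ k *\<^sub>R g (r k)))) \<longlonglongrightarrow> y - 0" by (intro tendsto_diff tendsto_const)
  hence "(\<lambda>k. (1/2) ^ k *\<^sub>R g (r k)) sums y" by (simp add: sums_def)
  thus ?thesis using g r by (intro exI[of _ "\<lambda>k. g (r k)"]) auto
qed

lemma supp_lower_bound:
  assumes V: "finite V" and c: "c \<ge> 0" "\<And>z. norm z \<le> c * (supp z + (\<Sum>v\<in>V. \<bar>inner z v\<bar>))"
  shows "\<exists>c'>0. \<forall>z\<in>biannihilator. c' * norm z \<le> supp z"
proof -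
  have "\<exists>c'\<ge>0. \<forall>z\<in>biannihilator. norm z \<le> c' * supp z"
  proof (rule seminorm_bound_drop_functionals[OF closed_biannihilator subspace_biannihilator V
        supp_diff supp_scale supp_le_norm _ supp_nonneg c])
    fix x assume "x \<in> biannihilator" "supp x = 0"
    hence "inner x x = 0" by (auto simp: supp_eq_0_iff biannihilator_def)
    thus "x = 0" by simp
  qed
  then obtain c' where c': "c' \<ge> 0" "\<And>z. z \<in> biannihilator \<Longrightarrow> norm z \<le> c' * supp z" by blast
  have "1 / (c' + 1) * norm z \<le> supp z" if "z \<in> biannihilator" for z
  proof -
    have "norm z \<le> (c' + 1) * supp z" using c'(2)[OF that] supp_nonneg[of z] by (simp add: algebra_simps)
    thus ?thesis using c'(1) by (simp add: field_simps)
  qed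
  thus ?thesis using c'(1) by (intro exI[of _ "1 / (c' + 1)"]) auto
qed

end


subsection \<open>Finite dimensional subspaces\<close>

abbreviation csubspace :: "'a::complex_hilbert set \<Rightarrow> bool" where
  "csubspace \<equiv> module.subspace (scaleC :: complex \<Rightarrow> 'a \<Rightarrow> 'a)"

abbreviation cspan :: "'a::complex_hilbert set \<Rightarrow> 'a set" where
  "cspan \<equiv> module.span (scaleC :: complex \<Rightarrow> 'a \<Rightarrow> 'a)"

text \<open>The functionals given by \<open>V\<close> separate the points of \<open>N\<close>. A
  finite such \<open>V\<close> bounds the dimension and is inherited by subspaces, which suits
  induction over \<open>V\<close>.\<close>

definition orth_trivial :: "'a::complex_hilbert set \<Rightarrow> 'a set \<Rightarrow> bool" where
  "orth_trivial V N \<longleftrightarrow> (\<forall>z\<in>N. (\<forall>v\<in>V. cinner z v = 0) \<longrightarrow> z = 0)"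

lemma orth_trivial_subset: "orth_trivial V N \<Longrightarrow> M \<subseteq> N \<Longrightarrow> orth_trivial V M"
  by (auto simp: orth_trivial_def)

lemma cinner_diff_left: "cinner (x - y) z = cinner x z - cinner (y::'a::complex_hilbert) z"
  using cinner_add_left[of "x - y" y z] by simp

lemma cinner_zero_left [simp]: "cinner 0 (z::'a::complex_hilbert) = 0"
  using cinner_add_left[of 0 0 z] by simp

lemma csubspace_kernel:
  assumes "csubspace N" shows "csubspace {z \<in> N. cinner z v = 0}"
  using assms by (auto simp: cvs.subspace_def cinner_add_left cinner_scaleC_left)

text \<open>The kernel of one functional in \<open>N\<close> is covered by induction, and
  \<open>N\<close> exceeds it by at most the line through a vector \<open>e\<close> outside
  it.\<close>

lemma finite_dim_if_orth_trivial:
  assumes "finite V" "csubspace N" "orth_trivial V N"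
  shows "finite_dim N"
  using assms
proof (induction V arbitrary: N rule: finite_induct)
  case empty
  hence "N = {0}" using cvs.subspace_0 by (auto simp: orth_trivial_def)
  thus ?case unfolding finite_dim_def by (intro exI[of _ "{}"]) simp
next
  case (insert v V)
  let ?M = "{z \<in> N. cinner z v = 0}"
  have "finite_dim ?M"
    using insert.prems by (intro insert.IH csubspace_kernel) (auto simp: orth_trivial_def)
  then obtain F where F: "finite F" "?M = cspan F" by (auto simp: finite_dim_def)
  show ?case
  proof (cases "N = ?M")
    case True
    thus ?thesis using F by (auto simp: finite_dim_def)
  next
    case False
    then obtain e where e: "e \<in> N" "cinner e v \<noteq> 0" by blast
    have "N = cspan (insert e F)"
    proof
      have "F \<subseteq> N" using F(2) cvs.span_superset[of F] by blast
      thus "cspan (insert e F) \<subseteq> N" using e insert.prems(1) by (intro cvs.span_minimal) auto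
      show "N \<subseteq> cspan (insert e F)"
      proof
        fix z assume z: "z \<in> N"
        let ?c = "cinner z v / cinner e v"
        have "z - ?c *\<^sub>C e \<in> ?M"
          using z e insert.prems(1) by (auto simp: cinner_diff_left cinner_scaleC_left intro: cvs.subspace_diff cvs.subspace_scale)
        hence "z - ?c *\<^sub>C e \<in> cspan F" using F(2) by simp
        thus "z \<in> cspan (insert e F)" using cvs.span_breakdown_eq[of z e F] by blast
      qed
    qed
    thus ?thesis using F(1) unfolding finite_dim_def by (intro exI[of _ "insert e F"]) auto
  qed
qed

text \<open>The kernels of one functional stabilise by induction. If the functional vanishes on a
  later member, the chain agrees with the kernels from there on; if it never does, every member
  contains a vector outside the kernel, which together with the stable kernel recovers the whole
  space.\<close>

lemma chain_stabilizes:
  fixes G :: "nat \<Rightarrow> 'a::complex_hilbert set"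
  assumes "finite V" "\<And>k. csubspace (G k)" "\<And>j k. j \<le> k \<Longrightarrow> G k \<subseteq> G j" "orth_trivial V (G 0)"
  shows "\<exists>k. \<forall>j\<ge>k. G j = G k"
  using assms
proof (induction V arbitrary: G rule: finite_induct)
  case empty
  have "G k = {0}" for k
    using empty.prems(1)[of k] empty.prems(2)[of 0 k] empty.prems(3) cvs.subspace_0[of "G k"]
    by (auto simp: orth_trivial_def)
  thus ?case by auto
next
  case (insert v V)
  define M where "M k = {z \<in> G k. cinner z v = 0}" for k
  have "\<exists>k. \<forall>j\<ge>k. M j = M k"
  proof (rule insert.IH)
    show "csubspace (M k)" for k unfolding M_def by (intro csubspace_kernel insert.prems)
    show "M k \<subseteq> M j" if "j \<le> k" for j k using insert.prems(2)[OF that] by (auto simp: M_def)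
    show "orth_trivial V (M 0)" using insert.prems(3) by (auto simp: orth_trivial_def M_def)
  qed
  then obtain k0 where k0: "\<And>j. j \<ge> k0 \<Longrightarrow> M j = M k0" by blast
  show ?case
  proof (cases "\<exists>k\<ge>k0. G k = M k")
    case True
    then obtain k where k: "k \<ge> k0" "G k = M k" by blast
    have "G j = G k" if j: "j \<ge> k" for j
    proof -
      have "M j = M k" using k0[of j] k0[of k] j k(1) by simp
      moreover have "G j \<subseteq> G k" by (rule insert.prems(2)[OF j])
      moreover have "M j \<subseteq> G j" by (auto simp: M_def)
      ultimately show ?thesis using k(2) by blast
    qed
    thus ?thesis by blast
  next
    case False
    have "G j = G k0" if j: "j \<ge> k0" for j
    proof
      show "G j \<subseteq> G k0" by (rule insert.prems(2)[OF j])
      show "G k0 \<subseteq> G j"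
      proof
        fix z assume z: "z \<in> G k0"
        obtain e where e: "e \<in> G j" "cinner e v \<noteq> 0" using False j by (auto simp: M_def)
        have e0: "e \<in> G k0" using e insert.prems(2)[OF j] by blast
        let ?c = "cinner z v / cinner e v"
        have "z - ?c *\<^sub>C e \<in> M k0"
          using z e e0 insert.prems(1)[of k0]
          by (auto simp: M_def cinner_diff_left cinner_scaleC_left intro: cvs.subspace_diff cvs.subspace_scale)
        hence "z - ?c *\<^sub>C e \<in> G j" using k0[OF j] by (auto simp: M_def)
        hence "(z - ?c *\<^sub>C e) + ?c *\<^sub>C e \<in> G j"
          using e insert.prems(1)[of j] by (intro cvs.subspace_add cvs.subspace_scale)
        thus "z \<in> G j" by simp
      qed
    qed
    thus ?thesis by blast
  qed
qed

text \<open>Gram-Schmidt over a spanning set: the component of \<open>e\<close> orthogonal to the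
  previous span corrects the projection.\<close>

lemma finite_dim_projection:
  assumes "finite_dim G"
  shows "\<exists>p\<in>G. \<forall>y\<in>G. cinner (z - p) y = 0"
proof -
  obtain F where F: "finite F" "G = cspan F" using assms by (auto simp: finite_dim_def)
  have "\<forall>z. \<exists>p\<in>cspan F. \<forall>y\<in>F. cinner (z - p) y = 0"
    using F(1)
  proof (induction F rule: finite_induct)
    case (insert e F)
    show ?case
    proof
      fix z
      obtain q where q: "q \<in> cspan F" "\<forall>y\<in>F. cinner (e - q) y = 0" using insert.IH by blast
      obtain p where p: "p \<in> cspan F" "\<forall>y\<in>F. cinner (z - p) y = 0" using insert.IH by blast
      define d where "d = e - q"
      have orth: "cinner x y = 0" if "\<forall>y\<in>F. cinner x y = 0" "y \<in> cspan F" for x y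
        using that(2)
      proof (induction rule: cvs.span_induct_alt)
        case base
        show ?case using cinner_scaleC_right[of x 0 0] by simp
      next
        case (step c a b)
        thus ?case using that(1) by (simp add: cinner_add_right cinner_scaleC_right)
      qed
      have ein: "x \<in> cspan (insert e F)" if "x \<in> cspan F" for x using that cvs.span_mono[of F "insert e F"] by blast
      have din: "d \<in> cspan (insert e F)"
        unfolding d_def by (intro cvs.span_diff ein q cvs.span_base) simp
      show "\<exists>p\<in>cspan (insert e F). \<forall>y\<in>insert e F. cinner (z - p) y = 0"
      proof (cases "d = 0")
        case True
        hence "e = q" by (simp add: d_def)
        hence "e \<in> cspan F" using q by simp
        hence "cinner (z - p) e = 0" using orth[OF p(2)] by blast
        thus ?thesis using p ein by (intro bexI[of _ p]) auto
      next
        case False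
        have dd: "cinner d d \<noteq> 0" using False by (auto simp: cinner_eq_Complex complex_eq_iff)
        define c where "c = cinner (z - p) d / cinner d d"
        have c: "cinner (z - (p + c *\<^sub>C d)) y = cinner (z - p) y - c * cinner d y" for y
          by (simp add: diff_diff_eq[symmetric] cinner_diff_left cinner_scaleC_left)
        have yF: "cinner (z - (p + c *\<^sub>C d)) y = 0" if "y \<in> F" for y
          using that p(2) q(2) unfolding c by (simp add: d_def)
        have "cinner (z - (p + c *\<^sub>C d)) d = 0" using dd unfolding c by (simp add: c_def)
        moreover have "cinner (z - (p + c *\<^sub>C d)) q = 0" by (rule orth[OF _ q(1)]) (use yF in blast)
        moreover have "e = d + q" by (simp add: d_def)
        ultimately have "cinner (z - (p + c *\<^sub>C d)) e = 0" by (simp add: cinner_add_right)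
        thus ?thesis using yF p din ein
          by (intro bexI[of _ "p + c *\<^sub>C d"]) (auto intro: cvs.span_add cvs.span_scale)
      qed
    qed
  qed (auto intro: bexI[of _ 0])
  then obtain p where p: "p \<in> cspan F" "\<forall>y\<in>F. cinner (z - p) y = 0" by blast
  have "cinner (z - p) y = 0" if "y \<in> cspan F" for y
    using that
  proof (induction rule: cvs.span_induct_alt)
    case base
    show ?case using cinner_scaleC_right[of "z - p" 0 0] by simp
  next
    case (step c a b)
    thus ?case using p(2) by (simp add: cinner_add_right cinner_scaleC_right)
  qed
  thus ?thesis using p(1) F(2) by blast
qed

subsection \<open>Generalized eigenspaces of an operator on a finite dimensional space\<close>

text \<open>\<open>T\<close> is linear on \<open>N\<close> only; in the application it is an
  unbounded operator restricted to an invariant subspace of its domain.\<close>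

locale finite_dim_operator =
  fixes N :: "'a::complex_hilbert set" and V :: "'a set" and T :: "'a \<Rightarrow> 'a"
  assumes V: "finite V" and N: "csubspace N" and triv: "orth_trivial V N"
    and T_in: "z \<in> N \<Longrightarrow> T z \<in> N"
    and T_add: "x \<in> N \<Longrightarrow> y \<in> N \<Longrightarrow> T (x + y) = T x + T y"
    and T_scale: "x \<in> N \<Longrightarrow> T (c *\<^sub>C x) = c *\<^sub>C T x"
begin

lemmas N_simps = cvs.subspace_add[OF N] cvs.subspace_scale[OF N] cvs.subspace_diff[OF N] cvs.subspace_0[OF N]
  cvs.subspace_sum[OF N]

definition shift :: "complex \<Rightarrow> 'a \<Rightarrow> 'a" where
  "shift \<mu> z = \<mu> *\<^sub>C z - T z"

lemma T_diff: "x \<in> N \<Longrightarrow> y \<in> N \<Longrightarrow> T (x - y) = T x - T y"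
  using T_add[of x "(-1) *\<^sub>C y"] T_scale[of y "-1"] N_simps(2)[of y "-1"] by simp

lemma T_0: "T 0 = 0"
  using T_scale[OF N_simps(4), of 0] by simp

lemma shift_in: "z \<in> N \<Longrightarrow> shift \<mu> z \<in> N"
  by (simp add: shift_def N_simps T_in)

lemma shift_add: "x \<in> N \<Longrightarrow> y \<in> N \<Longrightarrow> shift \<mu> (x + y) = shift \<mu> x + shift \<mu> y"
  by (simp add: shift_def T_add scaleC_add_right)

lemma shift_scale: "x \<in> N \<Longrightarrow> shift \<mu> (c *\<^sub>C x) = c *\<^sub>C shift \<mu> x"
  by (simp add: shift_def T_scale scaleC_diff_right scaleC_scaleC mult.commute)

lemma shift_0: "shift \<mu> 0 = 0"
  by (simp add: shift_def T_0)

lemma shift_commute: "z \<in> N \<Longrightarrow> shift \<mu> (shift \<nu> z) = shift \<nu> (shift \<mu> z)"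
  by (simp add: shift_def T_diff T_scale T_in N_simps scaleC_diff_right scaleC_scaleC mult.commute)

lemma shift_pow_in: "z \<in> N \<Longrightarrow> (shift \<mu> ^^ m) z \<in> N"
  by (induction m) (auto simp: shift_in)

lemma shift_pow_add: "x \<in> N \<Longrightarrow> y \<in> N \<Longrightarrow> (shift \<mu> ^^ m) (x + y) = (shift \<mu> ^^ m) x + (shift \<mu> ^^ m) y"
  by (induction m) (auto simp: shift_add shift_pow_in)

lemma shift_pow_scale: "x \<in> N \<Longrightarrow> (shift \<mu> ^^ m) (c *\<^sub>C x) = c *\<^sub>C (shift \<mu> ^^ m) x"
  by (induction m) (auto simp: shift_scale shift_pow_in)

lemma shift_pow_0: "(shift \<mu> ^^ m) 0 = 0"
  by (induction m) (auto simp: shift_0)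

lemma shift_pow_sum:
  "finite I \<Longrightarrow> (\<And>i. i \<in> I \<Longrightarrow> z i \<in> N) \<Longrightarrow> (shift \<mu> ^^ m) (\<Sum>i\<in>I. z i) = (\<Sum>i\<in>I. (shift \<mu> ^^ m) (z i))"
  by (induction I rule: finite_induct) (auto simp: shift_pow_0 shift_pow_add N_simps)

lemma shift_pow_commute: "z \<in> N \<Longrightarrow> (shift \<mu> ^^ m) (shift \<nu> z) = shift \<nu> ((shift \<mu> ^^ m) z)"
  by (induction m) (auto simp: shift_commute shift_pow_in)

lemma shift_pow_commute2: "z \<in> N \<Longrightarrow> (shift \<mu> ^^ m) ((shift \<nu> ^^ k) z) = (shift \<nu> ^^ k) ((shift \<mu> ^^ m) z)"
  by (induction k) (auto simp: shift_pow_commute shift_pow_in)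

lemma shift_pow_mono: "(shift \<mu> ^^ m) z = 0 \<Longrightarrow> m \<le> n \<Longrightarrow> (shift \<mu> ^^ n) z = 0"
  by (metis le_add_diff_inverse2 funpow_add comp_apply shift_pow_0)

definition gen_eigenspace :: "complex \<Rightarrow> 'a set" where
  "gen_eigenspace \<mu> = {z \<in> N. \<exists>m. (shift \<mu> ^^ m) z = 0}"

definition eigenvalues :: "complex set" where
  "eigenvalues = {\<mu>. \<exists>z\<in>N. z \<noteq> 0 \<and> shift \<mu> z = 0}"

lemma csubspace_gen_eigenspace: "csubspace (gen_eigenspace \<mu>)"
  unfolding cvs.subspace_def
proof (intro conjI ballI allI)
  show "0 \<in> gen_eigenspace \<mu>" by (auto simp: gen_eigenspace_def N_simps intro: exI[of _ 0])
  fix x assume x: "x \<in> gen_eigenspace \<mu>"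
  then obtain m where m: "(shift \<mu> ^^ m) x = 0" "x \<in> N" by (auto simp: gen_eigenspace_def)
  show "c *\<^sub>C x \<in> gen_eigenspace \<mu>" for c
    using m by (auto simp: gen_eigenspace_def N_simps shift_pow_scale intro!: exI[of _ m])
  fix y assume y: "y \<in> gen_eigenspace \<mu>"
  then obtain n where n: "(shift \<mu> ^^ n) y = 0" "y \<in> N" by (auto simp: gen_eigenspace_def)
  have "(shift \<mu> ^^ (m + n)) (x + y) = 0"
    using m n shift_pow_mono[OF m(1), of "m + n"] shift_pow_mono[OF n(1), of "m + n"] by (simp add: shift_pow_add)
  thus "x + y \<in> gen_eigenspace \<mu>" using m n by (auto simp: gen_eigenspace_def N_simps)
qed

text \<open>On the generalized eigenspace of \<open>\<mu>\<close> the map \<open>shift a\<close> is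
  the nonzero scalar \<open>a - \<mu>\<close> plus the nilpotent \<open>shift \<mu>\<close>, hence
  invertible; the induction over the order of nilpotency is the finite Neumann series.\<close>

lemma shift_solve:
  assumes "\<mu> \<noteq> a" "w \<in> gen_eigenspace \<mu>"
  shows "\<exists>v\<in>gen_eigenspace \<mu>. shift a v = w"
proof -
  have "\<forall>w\<in>N. (shift \<mu> ^^ m) w = 0 \<longrightarrow> (\<exists>v\<in>gen_eigenspace \<mu>. shift a v = w)" for m
  proof (induction m)
    case 0
    show ?case using cvs.subspace_0[OF csubspace_gen_eigenspace, of \<mu>] shift_0 by auto
  next
    case (Suc m)
    show ?case
    proof (intro ballI impI)
      fix w assume w: "w \<in> N" "(shift \<mu> ^^ Suc m) w = 0"
      hence "(shift \<mu> ^^ m) (shift \<mu> w) = 0" by (simp add: funpow_swap1)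
      then obtain v where v: "v \<in> gen_eigenspace \<mu>" "shift a v = shift \<mu> w" using Suc shift_in[OF w(1)] by blast
      have vN: "v \<in> N" using v(1) by (simp add: gen_eigenspace_def)
      have wG: "w \<in> gen_eigenspace \<mu>" unfolding gen_eigenspace_def using w by blast
      let ?c = "1 / (a - \<mu>)"
      have vw: "w - v \<in> N" "w - v \<in> gen_eigenspace \<mu>"
        using w vN v(1) wG by (auto simp: N_simps intro: cvs.subspace_diff[OF csubspace_gen_eigenspace])
      have eq: "shift a w = (a - \<mu>) *\<^sub>C w + shift \<mu> w"
        by (simp add: shift_def cvs.scale_left_diff_distrib)
      have "shift a (w - v) = shift a w - shift a v"
        using shift_add[OF vw(1) vN, of a] by simp
      also have "\<dots> = (a - \<mu>) *\<^sub>C w" by (simp add: eq v(2))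
      finally have "shift a (?c *\<^sub>C (w - v)) = w"
        using assms(1) by (simp add: shift_scale[OF vw(1)] scaleC_scaleC)
      thus "\<exists>v\<in>gen_eigenspace \<mu>. shift a v = w"
        using vw(2) by (intro bexI[of _ "?c *\<^sub>C (w - v)"] cvs.subspace_scale[OF csubspace_gen_eigenspace]) auto
    qed
  qed
  thus ?thesis using assms(2) by (auto simp: gen_eigenspace_def)
qed

text \<open>An eigenvector for \<open>a\<close> is multiplied by \<open>\<mu> - a\<close> under
  \<open>shift \<mu>\<close>, and no power of a nonzero scalar annihilates it.\<close>

lemma shift_pow_inj:
  assumes "\<mu> \<noteq> a" "w \<in> gen_eigenspace \<mu>" "(shift a ^^ n) w = 0"
  shows "w = 0"
proof -
  have one: "x = 0" if x: "x \<in> gen_eigenspace \<mu>" "shift a x = 0" for x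
  proof -
    obtain m where m: "(shift \<mu> ^^ m) x = 0" and xN: "x \<in> N" using x(1) by (auto simp: gen_eigenspace_def)
    have "shift \<mu> x = (\<mu> - a) *\<^sub>C x" using x(2) by (simp add: shift_def cvs.scale_left_diff_distrib)
    hence "(shift \<mu> ^^ k) x = (\<mu> - a) ^ k *\<^sub>C x" for k
      by (induction k) (auto simp: shift_scale[OF xN] scaleC_scaleC mult.commute)
    with m have "(\<mu> - a) ^ m *\<^sub>C x = 0" by simp
    thus "x = 0" using assms(1) by (simp add: cvs.scale_eq_0_iff)
  qed
  show ?thesis using assms(2,3)
  proof (induction n arbitrary: w)
    case (Suc n)
    obtain m where m: "(shift \<mu> ^^ m) w = 0" and wN: "w \<in> N" using Suc.prems(1) by (auto simp: gen_eigenspace_def)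
    have "shift a w \<in> gen_eigenspace \<mu>"
      using m wN by (auto simp: gen_eigenspace_def shift_in shift_pow_commute shift_0 intro!: exI[of _ m])
    moreover have "(shift a ^^ n) (shift a w) = 0" using Suc.prems(2) by (simp add: funpow_swap1)
    ultimately have "shift a w = 0" by (rule Suc.IH)
    thus ?case using one Suc.prems(1) by blast
  qed simp
qed

text \<open>A power of \<open>shift a\<close> kills the summand for \<open>a\<close> and is
  injective on the others, so a vanishing sum is reduced to one with fewer summands.\<close>

lemma gen_eigenspaces_independent:
  assumes "finite I"
  shows "independent_family I gen_eigenspace"
  unfolding independent_family_def
  using assms
proof (induction I rule: finite_induct)
  case (insert a I)
  show ?case
  proof (intro allI impI)
    fix z assume z: "(\<forall>i\<in>insert a I. z i \<in> gen_eigenspace i) \<and> (\<Sum>i\<in>insert a I. z i) = 0"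
    have zN: "z i \<in> N" if "i \<in> insert a I" for i using z that by (auto simp: gen_eigenspace_def)
    obtain m where m: "(shift a ^^ m) (z a) = 0" using z by (auto simp: gen_eigenspace_def)
    define y where "y i = (shift a ^^ m) (z i)" for i
    have yG: "y i \<in> gen_eigenspace i" if i: "i \<in> I" for i
    proof -
      obtain k where "(shift i ^^ k) (z i) = 0" using z i by (auto simp: gen_eigenspace_def)
      hence "(shift i ^^ k) (y i) = 0" using zN[of i] i unfolding y_def
        by (subst shift_pow_commute2) (auto simp: shift_pow_0)
      thus ?thesis using zN[of i] i by (auto simp: gen_eigenspace_def y_def shift_pow_in)
    qed
    have "(\<Sum>i\<in>I. y i) = 0"
    proof -
      have "0 = (shift a ^^ m) (\<Sum>i\<in>insert a I. z i)" using z by (simp add: shift_pow_0)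
      also have "\<dots> = (\<Sum>i\<in>insert a I. y i)" unfolding y_def using insert.hyps zN by (intro shift_pow_sum) auto
      also have "\<dots> = (\<Sum>i\<in>I. y i)" using insert.hyps m by (simp add: y_def)
      finally show ?thesis by simp
    qed
    with insert.IH yG have y0: "\<And>i. i \<in> I \<Longrightarrow> y i = 0" by blast
    have zI: "z i = 0" if i: "i \<in> I" for i
      by (rule shift_pow_inj[of i a _ m]) (use z i y0[OF i] insert.hyps in \<open>auto simp: y_def\<close>)
    hence "z a = 0" using z insert.hyps by simp
    thus "\<forall>i\<in>insert a I. z i = 0" using zI by blast
  qed
qed simp

section \<open>Annihilating polynomials and the spectral decomposition\<close>

definition papp :: "complex poly \<Rightarrow> 'a \<Rightarrow> 'a" where
  "papp p z = (\<Sum>i\<le>degree p. coeff p i *\<^sub>C (T ^^ i) z)"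

lemma papp_eq: "degree p \<le> n \<Longrightarrow> papp p z = (\<Sum>i\<le>n. coeff p i *\<^sub>C (T ^^ i) z)"
  unfolding papp_def by (intro sum.mono_neutral_left) (auto simp: coeff_eq_0)

lemma T_pow_in: "z \<in> N \<Longrightarrow> (T ^^ i) z \<in> N"
  by (induction i) (auto simp: T_in)

lemma papp_in: "z \<in> N \<Longrightarrow> papp p z \<in> N"
  unfolding papp_def by (intro N_simps T_pow_in)

lemma papp_diff: "papp (smult a p - smult b q) z = a *\<^sub>C papp p z - b *\<^sub>C papp q z"
proof -
  define n where "n = max (degree p) (degree q)"
  have d: "degree p \<le> n" "degree q \<le> n" "degree (smult a p - smult b q) \<le> n"
    by (auto simp: n_def intro!: degree_diff_le order_trans[OF degree_smult_le])
  show ?thesis unfolding papp_eq[OF d(1)] papp_eq[OF d(2)] papp_eq[OF d(3)]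
    by (simp add: cvs.scale_sum_right scaleC_scaleC cvs.scale_left_diff_distrib sum_subtractf)
qed

text \<open>A linear factor corresponds to applying \<open>T - a\<close> first; the minus sign is
  due to \<open>shift a\<close> being \<open>a - T\<close>.\<close>

lemma papp_linear_factor:
  assumes z: "z \<in> N"
  shows "papp ([:- a, 1:] * q) z = papp q (- shift a z)"
proof -
  let ?n = "degree q"
  have "papp ([:- a, 1:] * q) z = papp (smult 1 (pCons 0 q) - smult a q) z" by simp
  also have "\<dots> = papp (pCons 0 q) z - a *\<^sub>C papp q z" using papp_diff[of 1 "pCons 0 q" a q z] by simp
  also have "papp (pCons 0 q) z = (\<Sum>i\<le>?n. coeff q i *\<^sub>C (T ^^ i) (T z))"
    by (subst papp_eq[of _ "Suc ?n"])
      (simp_all add: degree_pCons_le sum.atMost_Suc_shift funpow_swap1 del: sum.atMost_Suc)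
  also have "\<dots> = papp q (T z)" by (simp add: papp_def)
  finally have 1: "papp ([:- a, 1:] * q) z = papp q (T z) - a *\<^sub>C papp q z" .
  have pow_diff: "(T ^^ i) (x - y) = (T ^^ i) x - (T ^^ i) y" if "x \<in> N" "y \<in> N" for i x y
    using that by (induction i) (auto simp: T_diff T_pow_in)
  have pow_scale: "(T ^^ i) (c *\<^sub>C x) = c *\<^sub>C (T ^^ i) x" if "x \<in> N" for i c x
    using that by (induction i) (auto simp: T_scale T_pow_in)
  have "papp q (T z - a *\<^sub>C z) = papp q (T z) - a *\<^sub>C papp q z"
    unfolding papp_def using z
    by (simp add: pow_diff pow_scale T_in N_simps scaleC_diff_right sum_subtractf cvs.scale_sum_right scaleC_scaleC mult.commute)
  thus ?thesis using 1 by (simp add: shift_def)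
qed

text \<open>The functionals in \<open>V\<close> are cancelled one after the other by combining two
  polynomials of different degree. The arbitrarily large degree in the induction claim supplies the
  second polynomial and keeps the combination nonzero.\<close>

lemma annihilating_poly:
  assumes z: "z \<in> N"
  shows "\<exists>p. p \<noteq> 0 \<and> papp p z = 0"
proof -
  have "finite W \<Longrightarrow> \<forall>n. \<exists>p. p \<noteq> 0 \<and> n \<le> degree p \<and> (\<forall>v\<in>W. cinner (papp p z) v = 0)" for W
  proof (induction W rule: finite_induct)
    case empty
    show ?case by (auto intro!: exI[of _ "monom 1 _"] simp: degree_monom_eq)
  next
    case (insert v W)
    show ?case
    proof
      fix n
      obtain p where p: "p \<noteq> 0" "n \<le> degree p" "\<And>v. v \<in> W \<Longrightarrow> cinner (papp p z) v = 0" using insert.IH by blast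
      obtain q where q: "q \<noteq> 0" "Suc (degree p) \<le> degree q" "\<And>v. v \<in> W \<Longrightarrow> cinner (papp q z) v = 0" using insert.IH by blast
      show "\<exists>p. p \<noteq> 0 \<and> n \<le> degree p \<and> (\<forall>v\<in>insert v W. cinner (papp p z) v = 0)"
      proof (cases "cinner (papp p z) v = 0")
        case True
        thus ?thesis using p by (intro exI[of _ p]) auto
      next
        case False
        let ?r = "smult (cinner (papp p z) v) q - smult (cinner (papp q z) v) p"
        have eq: "coeff ?r (degree q) = cinner (papp p z) v * lead_coeff q"
          using q(2) by (simp add: coeff_eq_0)
        have c: "coeff ?r (degree q) \<noteq> 0" unfolding eq using False q(1) by simp
        hence "degree q \<le> degree ?r" by (rule le_degree)
        hence "n \<le> degree ?r" using p(2) q(2) by linarith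
        moreover have "?r \<noteq> 0" using c by force
        moreover have "\<forall>x\<in>insert v W. cinner (papp ?r z) x = 0"
          using p(3) q(3) by (auto simp: papp_diff cinner_diff_left cinner_scaleC_left mult.commute)
        ultimately show ?thesis by blast
      qed
    qed
  qed
  from this[OF V] obtain p where p: "p \<noteq> 0" "\<And>v. v \<in> V \<Longrightarrow> cinner (papp p z) v = 0" by blast
  thus ?thesis using triv papp_in[OF z] unfolding orth_trivial_def by blast
qed

text \<open>After a root \<open>a\<close> is split off, \<open>T z - a z\<close> decomposes by
  induction. Its components at other indices are lifted by \<open>shift_solve\<close>; what remains
  of \<open>z\<close> is mapped by \<open>shift a\<close> into the generalized eigenspace of
  \<open>a\<close> and so belongs to it.\<close>

lemma decompose_if_annihilated:
  assumes "p \<noteq> 0" "z \<in> N" "papp p z = 0"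
  shows "\<exists>I. finite I \<and> z \<in> subspace_sum I gen_eigenspace"
  using assms
proof (induction "degree p" arbitrary: p z)
  case 0
  then obtain c where c: "p = [:c:]" "c \<noteq> 0" by (metis degree_eq_zeroE pCons_0_0)
  hence "z = 0" using 0 by (simp add: papp_def cvs.scale_eq_0_iff)
  thus ?case by (intro exI[of _ "{}"]) (auto simp: subspace_sum_def)
next
  case (Suc n)
  have "\<not> constant (poly p)" using Suc.hyps(2) by (simp add: constant_degree)
  then obtain a where "poly p a = 0" using fundamental_theorem_of_algebra by blast
  then obtain q where q: "p = [:- a, 1:] * q" by (auto simp: poly_eq_0_iff_dvd dvd_def)
  have q0: "q \<noteq> 0" using q Suc.prems(1) by auto
  have "degree p = Suc (degree q)" unfolding q using q0 by (subst degree_mult_eq) auto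
  hence dq: "n = degree q" using Suc.hyps(2) by simp
  have y: "- shift a z \<in> N" using shift_in[OF Suc.prems(2), of a] N_simps(2)[of "shift a z" "-1"] by simp
  have "papp q (- shift a z) = 0" using Suc.prems papp_linear_factor q by simp
  then obtain I where I: "finite I" "- shift a z \<in> subspace_sum I gen_eigenspace" using Suc.hyps(1)[OF dq q0 y] by blast
  then obtain w where w: "\<And>i. i \<in> I \<Longrightarrow> w i \<in> gen_eigenspace i" "- shift a z = (\<Sum>i\<in>I. w i)"
    by (auto simp: subspace_sum_def)
  have "\<forall>i. \<exists>v. i \<in> I - {a} \<longrightarrow> v \<in> gen_eigenspace i \<and> shift a v = w i"
    using shift_solve w(1) by blast
  then obtain v where v: "\<And>i. i \<in> I - {a} \<Longrightarrow> v i \<in> gen_eigenspace i" "\<And>i. i \<in> I - {a} \<Longrightarrow> shift a (v i) = w i" by metis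
  have vN: "v i \<in> N" if "i \<in> I - {a}" for i using v(1)[OF that] by (simp add: gen_eigenspace_def)
  \<comment> \<open>The lifts solve \<open>shift a (v i) = w i\<close> for the components of
    \<open>- shift a z\<close>, so adding them to \<open>z\<close> cancels every component except
    that at \<open>a\<close>.\<close>
  define x where "x = z + (\<Sum>i\<in>I - {a}. v i)"
  have xN: "x \<in> N" unfolding x_def using Suc.prems(2) vN by (intro N_simps) auto
  have "shift a x = shift a z + (\<Sum>i\<in>I - {a}. w i)"
  proof -
    have "shift a (\<Sum>i\<in>I - {a}. v i) = (\<Sum>i\<in>I - {a}. w i)"
      using shift_pow_sum[where I = "I - {a}" and z = v and \<mu> = a and m = 1] I(1) vN v(2) by simp
    thus ?thesis unfolding x_def using Suc.prems(2) vN by (subst shift_add) (auto intro: N_simps)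
  qed
  also have "\<dots> = (if a \<in> I then - w a else 0)"
  proof -
    have "shift a z = - (\<Sum>i\<in>I. w i)" using w(2) by (metis minus_minus)
    thus ?thesis using I(1) by (auto simp: sum_diff1)
  qed
  finally have sx: "shift a x \<in> gen_eigenspace a"
    using w(1)[of a] cvs.subspace_0[OF csubspace_gen_eigenspace] cvs.subspace_neg[OF csubspace_gen_eigenspace] by auto
  then obtain m where "(shift a ^^ m) (shift a x) = 0" by (auto simp: gen_eigenspace_def)
  hence "(shift a ^^ Suc m) x = 0" by (simp add: funpow_swap1)
  hence xG: "x \<in> gen_eigenspace a" unfolding gen_eigenspace_def using xN by blast
  define u where "u i = (if i = a then x else - v i)" for i
  have "z = (\<Sum>i\<in>insert a I. u i)"
  proof -
    have "(\<Sum>i\<in>insert a I. u i) = u a + (\<Sum>i\<in>I - {a}. u i)" using I(1) by (simp add: sum.insert_remove)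
    also have "(\<Sum>i\<in>I - {a}. u i) = - (\<Sum>i\<in>I - {a}. v i)" by (simp add: u_def sum_negf)
    finally show ?thesis by (simp add: u_def x_def)
  qed
  moreover have "u i \<in> gen_eigenspace i" if "i \<in> insert a I" for i
    using that xG v(1)[of i] cvs.subspace_neg[OF csubspace_gen_eigenspace] by (auto simp: u_def)
  ultimately show ?case using I(1)
    by (intro exI[of _ "insert a I"]) (auto simp: subspace_sum_def intro!: exI[of _ u])
qed

lemma csubspace_subspace_sum: "csubspace (subspace_sum I gen_eigenspace)"
  unfolding cvs.subspace_def
proof (intro conjI ballI allI)
  note sub = csubspace_gen_eigenspace
  show "0 \<in> subspace_sum I gen_eigenspace"
    using cvs.subspace_0[OF sub] by (auto simp: subspace_sum_def intro!: exI[of _ "\<lambda>_. 0"])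
  fix x assume "x \<in> subspace_sum I gen_eigenspace"
  then obtain u where u: "x = (\<Sum>i\<in>I. u i)" "\<forall>i\<in>I. u i \<in> gen_eigenspace i" by (auto simp: subspace_sum_def)
  show "c *\<^sub>C x \<in> subspace_sum I gen_eigenspace" for c
    using u cvs.subspace_scale[OF sub] unfolding subspace_sum_def
    by (auto simp: cvs.scale_sum_right intro!: exI[of _ "\<lambda>i. c *\<^sub>C u i"])
  fix y assume "y \<in> subspace_sum I gen_eigenspace"
  then obtain v where v: "y = (\<Sum>i\<in>I. v i)" "\<forall>i\<in>I. v i \<in> gen_eigenspace i" by (auto simp: subspace_sum_def)
  show "x + y \<in> subspace_sum I gen_eigenspace"
    using u v cvs.subspace_add[OF sub] unfolding subspace_sum_def
    by (auto simp: sum.distrib intro!: exI[of _ "\<lambda>i. u i + v i"])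
qed

lemma subspace_sum_mono:
  assumes "finite J" "I \<subseteq> J" shows "subspace_sum I gen_eigenspace \<subseteq> subspace_sum J gen_eigenspace"
proof
  fix x assume "x \<in> subspace_sum I gen_eigenspace"
  then obtain u where u: "x = (\<Sum>i\<in>I. u i)" "\<forall>i\<in>I. u i \<in> gen_eigenspace i" by (auto simp: subspace_sum_def)
  have "x = (\<Sum>i\<in>J. if i \<in> I then u i else 0)"
    unfolding u(1) using assms by (intro sum.mono_neutral_cong_left) auto
  thus "x \<in> subspace_sum J gen_eigenspace"
    using u(2) cvs.subspace_0[OF csubspace_gen_eigenspace] unfolding subspace_sum_def
    by (auto intro!: exI[of _ "\<lambda>i. if i \<in> I then u i else 0"])
qed

lemma gen_eigenspace_trivial:
  assumes "\<mu> \<notin> eigenvalues" shows "gen_eigenspace \<mu> = {0}"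
proof -
  have "\<forall>z\<in>N. (shift \<mu> ^^ m) z = 0 \<longrightarrow> z = 0" for m
  proof (induction m)
    case (Suc m)
    show ?case
    proof (intro ballI impI)
      fix z assume z: "z \<in> N" "(shift \<mu> ^^ Suc m) z = 0"
      hence "(shift \<mu> ^^ m) (shift \<mu> z) = 0" by (simp add: funpow_swap1)
      hence "shift \<mu> z = 0" using Suc shift_in[OF z(1)] by blast
      thus "z = 0" using assms z(1) by (auto simp: eigenvalues_def)
    qed
  qed simp
  thus ?thesis using cvs.subspace_0[OF csubspace_gen_eigenspace] by (auto simp: gen_eigenspace_def)
qed

lemma gen_eigenspace_subset: "gen_eigenspace \<mu> \<subseteq> N"
  by (auto simp: gen_eigenspace_def)

text \<open>Decomposing finitely many generators involves a finite index set \<open>J\<close>. An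
  eigenvalue outside \<open>J\<close> would contradict independence, and indices in \<open>J\<close>
  that are no eigenvalues have trivial generalized eigenspaces.\<close>

theorem spectral_decomposition:
  shows "finite eigenvalues" "N = subspace_sum eigenvalues gen_eigenspace"
proof -
  obtain F where F: "finite F" "N = cspan F"
    using finite_dim_if_orth_trivial[OF V N triv] by (auto simp: finite_dim_def)
  have "\<forall>f\<in>F. \<exists>I. finite I \<and> f \<in> subspace_sum I gen_eigenspace"
    using annihilating_poly decompose_if_annihilated F(2) cvs.span_superset by blast
  then obtain I where I: "\<And>f. f \<in> F \<Longrightarrow> finite (I f)" "\<And>f. f \<in> F \<Longrightarrow> f \<in> subspace_sum (I f) gen_eigenspace" by metis
  define J where "J = (\<Union>f\<in>F. I f)"
  have J: "finite J" using F(1) I(1) by (simp add: J_def)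
  have "F \<subseteq> subspace_sum J gen_eigenspace"
  proof
    fix f assume f: "f \<in> F"
    hence "I f \<subseteq> J" by (auto simp: J_def)
    thus "f \<in> subspace_sum J gen_eigenspace" using I(2)[OF f] subspace_sum_mono[OF J] by blast
  qed
  from ord_eq_le_trans[OF F(2) cvs.span_minimal[OF this csubspace_subspace_sum]]
  have NJ: "N \<subseteq> subspace_sum J gen_eigenspace" .
  have "eigenvalues \<subseteq> J"
  proof
    fix \<mu> assume "\<mu> \<in> eigenvalues"
    then obtain z where z: "z \<in> N" "z \<noteq> 0" "shift \<mu> z = 0" by (auto simp: eigenvalues_def)
    have zG: "z \<in> gen_eigenspace \<mu>" using z by (auto simp: gen_eigenspace_def intro!: exI[of _ 1])
    show "\<mu> \<in> J"
    proof (rule ccontr)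
      assume n: "\<mu> \<notin> J"
      obtain u where u: "z = (\<Sum>i\<in>J. u i)" "\<forall>i\<in>J. u i \<in> gen_eigenspace i" using NJ z(1) by (auto simp: subspace_sum_def)
      define y where "y i = (if i = \<mu> then - z else u i)" for i
      have "(\<Sum>i\<in>J. y i) = z" unfolding u(1) using n by (intro sum.cong) (auto simp: y_def)
      hence "(\<Sum>i\<in>insert \<mu> J. y i) = 0" using J n by (simp add: y_def)
      moreover have "\<forall>i\<in>insert \<mu> J. y i \<in> gen_eigenspace i"
        using u(2) zG cvs.subspace_neg[OF csubspace_gen_eigenspace] by (auto simp: y_def)
      ultimately have "y \<mu> = 0"
        using gen_eigenspaces_independent[of "insert \<mu> J"] J unfolding independent_family_def by blast
      thus False using z(2) by (simp add: y_def)
    qed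
  qed
  thus fin: "finite eigenvalues" using J finite_subset by blast
  have "subspace_sum J gen_eigenspace \<subseteq> subspace_sum eigenvalues gen_eigenspace"
  proof
    fix x assume "x \<in> subspace_sum J gen_eigenspace"
    then obtain u where u: "x = (\<Sum>i\<in>J. u i)" "\<forall>i\<in>J. u i \<in> gen_eigenspace i" by (auto simp: subspace_sum_def)
    have "x = (\<Sum>i\<in>eigenvalues. u i)"
      unfolding u(1) using J \<open>eigenvalues \<subseteq> J\<close> u(2) gen_eigenspace_trivial
      by (intro sum.mono_neutral_right) auto
    thus "x \<in> subspace_sum eigenvalues gen_eigenspace"
      using u(2) \<open>eigenvalues \<subseteq> J\<close> unfolding subspace_sum_def by blast
  qed
  moreover have "subspace_sum eigenvalues gen_eigenspace \<subseteq> N"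
    using gen_eigenspace_subset by (auto simp: subspace_sum_def intro!: N_simps)
  ultimately show "N = subspace_sum eigenvalues gen_eigenspace" using NJ by blast
qed

end


subsection \<open>The orthogonal complement of the reachable space\<close>

lemma simple_controls_scaleC:
  assumes "u \<in> simple_controls T" shows "(\<lambda>t. c *\<^sub>C u t) \<in> simple_controls T"
  using assms simple_function_compose1[of lebesgue u "\<lambda>x. c *\<^sub>C x"] by (auto simp: simple_controls_def)

lemma regular_controls_scale:
  fixes u :: "real \<Rightarrow> 'u::complex_hilbert"
  assumes "u \<in> regular_controls T" shows "(\<lambda>t. c *\<^sub>R u t) \<in> regular_controls T"
proof -
  obtain v where v: "\<And>n. simple_function lebesgue (v n)" "\<And>t. (\<lambda>n::nat. v n t) \<longlonglongrightarrow> u t"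
    using assms by (auto simp: regular_controls_def)
  have "simple_function lebesgue (\<lambda>t. c *\<^sub>R v n t)" for n by (rule simple_function_compose1[OF v(1)])
  moreover have "(\<lambda>n. c *\<^sub>R v n t) \<longlonglongrightarrow> c *\<^sub>R u t" for t by (intro tendsto_intros v)
  ultimately show ?thesis using assms unfolding regular_controls_def
    by (auto simp: power_mult_distrib intro!: exI[of _ "\<lambda>n t. c *\<^sub>R v n t"])
qed

context control_system
begin

lemma ell_scaleC_u:
  assumes "\<phi> \<in> Ds" shows "ell T \<phi> (\<lambda>t. c *\<^sub>C u t) = ell T (cnj c *\<^sub>C \<phi>) u"
  unfolding ell_def l2ip_def
proof (rule Bochner_Integration.integral_cong[OF refl])
  fix t assume "t \<in> space (Leb T)"
  thus "inner (c *\<^sub>C u t) (Bs (Sa (T - t) \<phi>)) = inner (u t) (Bs (Sa (T - t) (cnj c *\<^sub>C \<phi>)))"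
    using assms by (simp add: Sa_i inner_eq_Re_cinner cinner_scaleC_left cinner_scaleC_right)
qed

text \<open>Makes the facts about generators available for the adjoint semigroup through the
  sublocale \<open>adj\<close>. Averages of the adjoint orbit of \<open>As z\<close> are transposed
  to averages of orbits of \<open>S\<close>, on which \<open>A\<close> is known.\<close>

lemma adjoint_generates: "generates (op_adjoint A) Sa"
proof -
  have lim: "((\<lambda>h. (1 / h) *\<^sub>R (Sa h z - z)) \<longlongrightarrow> As z) (at_right 0)" if z: "z \<in> Ds" for z
  proof (rule Lim_transform_eventually[OF orbit_mean_tendsto[OF c0_adj]])
    show "\<forall>\<^sub>F h in at_right 0. orbit_mean Sa h (As z) = (1 / h) *\<^sub>R (Sa h z - z)"
      unfolding eventually_at_filter
    proof (intro always_eventually allI impI)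
      fix h :: real assume "h \<in> {0<..}"
      hence h: "h > 0" by simp
      show "orbit_mean Sa h (As z) = (1 / h) *\<^sub>R (Sa h z - z)"
      proof (rule cinner_eqI_inner)
        fix x
        have "inner x (integral {0..h} (\<lambda>s. Sa s (As z))) = integral {0..h} ((\<lambda>y. inner x y) \<circ> (\<lambda>s. Sa s (As z)))"
          by (rule integral_linear[symmetric, OF c0_orbit_integrable[OF c0_adj] bounded_linear_inner_right]) simp
        also have "\<dots> = integral {0..h} ((\<lambda>y. inner y (As z)) \<circ> (\<lambda>s. S s x))"
          by (rule Henstock_Kurzweil_Integration.integral_cong) (simp add: Sa_inner)
        also have "\<dots> = inner (integral {0..h} (\<lambda>s. S s x)) (As z)"
          by (rule integral_linear[OF c0_orbit_integrable[OF c0] bounded_linear_inner_left]) simp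
        finally have "inner x (orbit_mean Sa h (As z)) = inner (orbit_mean S h x) (As z)"
          by (simp add: orbit_mean_def)
        also have "\<dots> = inner (snd A (orbit_mean S h x)) z"
          by (rule adjoint_inner[OF z orbit_mean_in_domain(1)[OF h], symmetric])
        also have "\<dots> = inner x ((1 / h) *\<^sub>R (Sa h z - z))"
          using h by (simp add: orbit_mean_in_domain(2) inner_diff_left inner_diff_right Sa_inner)
        finally show "inner x (orbit_mean Sa h (As z)) = inner x ((1 / h) *\<^sub>R (Sa h z - z))" .
      qed
    qed
  qed
  have conv: "z \<in> Ds" if y: "((\<lambda>h. (1 / h) *\<^sub>R (Sa h z - z)) \<longlongrightarrow> y) (at_right 0)" for z y
  proof (rule adjointI(1))
    fix x assume x: "x \<in> fst A"
    have 1: "((\<lambda>h. inner ((1 / h) *\<^sub>R (S h x - x)) z) \<longlongrightarrow> inner (snd A x) z) (at_right 0)"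
      by (intro tendsto_intros A_tendsto[OF x])
    have 2: "((\<lambda>h. inner x ((1 / h) *\<^sub>R (Sa h z - z))) \<longlongrightarrow> inner x y) (at_right 0)"
      by (intro tendsto_intros y)
    have "\<forall>\<^sub>F h in at_right 0. inner x ((1 / h) *\<^sub>R (Sa h z - z)) = inner ((1 / h) *\<^sub>R (S h x - x)) z"
      unfolding eventually_at_filter
      by (intro always_eventually) (auto simp: inner_diff_left inner_diff_right Sa_inner)
    from Lim_transform_eventually[OF 2 this] show "inner (snd A x) z = inner x y"
      by (rule tendsto_unique[OF trivial_limit_at_right_real 1])
  qed
  have dom: "Ds = {z. \<exists>y. ((\<lambda>h. (1 / h) *\<^sub>R (Sa h z - z)) \<longlongrightarrow> y) (at_right 0)}"
    using lim conv by blast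
  show ?thesis unfolding generates_def using c0_adj lim dom by blast
qed

sublocale adj: generator "op_adjoint A" Sa
  by unfold_locales (rule adjoint_generates)

text \<open>\<open>Bs\<close> is continuous for the graph norm only, so the slope must converge in
  that norm; this is why \<open>As z\<close> is required to lie in \<open>Ds\<close> as
  well.\<close>

lemma Bs_Sa_derivative:
  assumes z: "z \<in> Ds" "As z \<in> Ds" and t: "t \<ge> 0"
  shows "((\<lambda>s. Bs (Sa s z)) has_vector_derivative Bs (Sa t (As z))) (at t within {0..})"
proof -
  define \<sigma> where "\<sigma> s = Sa (min s t) (adj.quot z \<bar>s - t\<bar>)" for s
  have qD: "adj.quot z h \<in> Ds" "As (adj.quot z h) = adj.quot (As z) h" if "h \<ge> 0" for h
    using z that by (auto simp: adj.quot_def Ds_scaleR Ds_diff Sa_Ds)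
  have \<sigma>D: "\<sigma> s \<in> Ds" "As (\<sigma> s) = Sa (min s t) (adj.quot (As z) \<bar>s - t\<bar>)" if "s \<ge> 0" for s
    using qD that t by (auto simp: \<sigma>_def Sa_Ds)
  have "continuous_on {0..} \<sigma>"
    unfolding \<sigma>_def using t
    by (intro Sa_continuous continuous_on_compose2[OF adj.quot_continuous[OF z(1)]] continuous_intros) auto
  moreover have "continuous_on {0..} (\<lambda>s. As (\<sigma> s))"
  proof -
    have "continuous_on {0..} (\<lambda>s. Sa (min s t) (adj.quot (As z) \<bar>s - t\<bar>))"
      using t by (intro Sa_continuous continuous_on_compose2[OF adj.quot_continuous[OF z(2)]] continuous_intros) auto
    thus ?thesis by (rule continuous_on_eq) (simp add: \<sigma>D)
  qed
  ultimately have c: "continuous_on {0..} (\<lambda>s. Bs (\<sigma> s))" by (rule Bs_continuous) (simp add: \<sigma>D)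
  show ?thesis
  proof (rule has_vector_derivativeI_slope)
    show "((\<lambda>s. Bs (\<sigma> s)) \<longlongrightarrow> Bs (Sa t (As z))) (at t within {0..})"
    proof -
      have "((\<lambda>s. Bs (\<sigma> s)) \<longlongrightarrow> Bs (\<sigma> t)) (at t within {0..})"
        using c t unfolding continuous_on_def by simp
      thus ?thesis by (simp add: \<sigma>_def adj.quot_0)
    qed
    fix s :: real assume s: "s \<in> {0..}"
    have "Sa s z - Sa t z = (s - t) *\<^sub>R \<sigma> s" using adj.S_slope[of s t z] s t by (simp add: \<sigma>_def)
    hence "Bs (Sa s z - Sa t z) = (s - t) *\<^sub>R Bs (\<sigma> s)"
      using s by (simp add: scaleR_eq_scaleC Bs_scaleC \<sigma>D)
    thus "Bs (Sa s z) - Bs (Sa t z) = (s - t) *\<^sub>R Bs (\<sigma> s)"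
      using z s t by (simp add: Bs_diff Sa_Ds)
  qed
qed

end

text \<open>The squared norm of \<open>b\<close>, weighted by an exponential with rate
  \<open>- 2 * Re \<mu>\<close>, has derivative 0 and is therefore constant.\<close>

lemma linear_ode_zero:
  fixes b :: "real \<Rightarrow> 'u::complex_hilbert"
  assumes der: "\<And>t. t \<ge> 0 \<Longrightarrow> (b has_vector_derivative \<mu> *\<^sub>C b t) (at t within {0..})" and b0: "b 0 = 0" and t: "t \<ge> 0"
  shows "b t = 0"
proof -
  define F where "F s = exp (- (2 * Re \<mu>) * s) * inner (b s) (b s)" for s
  have "(F has_vector_derivative 0) (at s within {0..t})" if s: "s \<in> {0..t}" for s
  proof -
    have d: "(b has_derivative (\<lambda>h. h *\<^sub>R (\<mu> *\<^sub>C b s))) (at s within {0..t})"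
      using has_vector_derivative_within_subset[OF der[of s], of "{0..t}"] s by (auto simp: has_vector_derivative_def)
    have re: "inner (b s) (\<mu> *\<^sub>C b s) = Re \<mu> * inner (b s) (b s)" "inner (\<mu> *\<^sub>C b s) (b s) = Re \<mu> * inner (b s) (b s)"
    proof -
      have i: "Im (cinner (b s) (b s)) = 0"
        using cinner_commute[of "b s" "b s"] by (metis cnj.simps(2) equal_neg_zero)
      show "inner (\<mu> *\<^sub>C b s) (b s) = Re \<mu> * inner (b s) (b s)"
        by (simp add: inner_eq_Re_cinner cinner_scaleC_left i)
      thus "inner (b s) (\<mu> *\<^sub>C b s) = Re \<mu> * inner (b s) (b s)" by (simp add: inner_commute)
    qed
    have "(F has_derivative (\<lambda>h. 0)) (at s within {0..t})"
      unfolding F_def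
      by (rule derivative_eq_intros d refl)+ (auto simp: re algebra_simps)
    thus ?thesis by (simp add: has_vector_derivative_def)
  qed
  hence "(F has_derivative (\<lambda>h. 0)) (at s within {0..t})" if "s \<in> {0..t}" for s
    using that by (simp add: has_vector_derivative_def)
  hence "\<exists>c. \<forall>s\<in>{0..t}. F s = c" by (intro has_derivative_zero_constant) auto
  hence "F t = F 0" using t by auto
  thus ?thesis by (simp add: F_def b0)
qed

section \<open>Reachable sets and unobservable spaces\<close>

context admissible_system
begin

text \<open>Restricting to unit controls gives a bounded symmetric convex set; the full range is
  recovered from it by series.\<close>

definition reach :: "real \<Rightarrow> 'a set" where
  "reach T = \<Phi> T ` unit_controls T"

text \<open>For vectors of \<open>Ds\<close> this means that the observation vanishes almost
  everywhere on \<open>{0..T}\<close>. Orthogonality expresses it for all vectors.\<close>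

definition unobs :: "real \<Rightarrow> 'a set" where
  "unobs T = {z. \<forall>w\<in>reach T. inner w z = 0}"

lemma unit_simple: "u \<in> unit_controls T \<Longrightarrow> u \<in> simple_controls T"
  by (simp add: unit_controls_def)

lemma balanced_reach:
  assumes T: "T \<ge> 0" shows "\<exists>C\<ge>0. balanced_set (reach T) C"
proof -
  obtain C where C: "admissible_bound T C" using admissible_bound_ex[OF T] by blast
  have "balanced_set (reach T) C"
  proof
    have "\<Phi> T (\<lambda>t. 0 *\<^sub>R 0) = 0 *\<^sub>R \<Phi> T (\<lambda>t. 0)"
      by (intro input_map_scale T unit_simple unit_controls_0)
    hence "\<Phi> T (\<lambda>t. 0) = 0" by simp
    thus "0 \<in> reach T" unfolding reach_def using unit_controls_0 by (metis image_eqI)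
    show "- w \<in> reach T" if w: "w \<in> reach T" for w
    proof -
      obtain u where u: "u \<in> unit_controls T" "w = \<Phi> T u" using w by (auto simp: reach_def)
      have "\<Phi> T (\<lambda>t. (-1) *\<^sub>R u t) = (-1) *\<^sub>R \<Phi> T u" by (intro input_map_scale T unit_simple u)
      hence "- w = \<Phi> T (\<lambda>t. - u t)" using u by simp
      thus ?thesis using unit_controls_neg[OF u(1)] by (simp add: reach_def)
    qed
    show "convex (reach T)"
    proof (rule convexI)
      fix x y and a b :: real assume *: "x \<in> reach T" "y \<in> reach T" "0 \<le> a" "0 \<le> b" "a + b = 1"
      obtain u where u: "u \<in> unit_controls T" "x = \<Phi> T u" using * by (auto simp: reach_def)
      obtain v where v: "v \<in> unit_controls T" "y = \<Phi> T v" using * by (auto simp: reach_def)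
      have "l2sq T (\<lambda>t. a *\<^sub>R u t + b *\<^sub>R v t) \<le> a * l2sq T u + b * l2sq T v"
        by (rule l2sq_convex) (use u v * in \<open>auto simp: unit_controls_def\<close>)
      also have "\<dots> \<le> a * 1 + b * 1" using u v * by (intro add_mono mult_left_mono) (auto simp: unit_controls_def)
      finally have "(\<lambda>t. a *\<^sub>R u t + b *\<^sub>R v t) \<in> unit_controls T"
        using u v * by (auto simp: unit_controls_def intro!: simple_controls_add simple_controls_scale)
      moreover have "\<Phi> T (\<lambda>t. a *\<^sub>R u t + b *\<^sub>R v t) = a *\<^sub>R x + b *\<^sub>R y"
        using u v T unit_simple[OF u(1)] unit_simple[OF v(1)]
        by (simp add: input_map_add input_map_scale simple_controls_scale)
      ultimately show "a *\<^sub>R x + b *\<^sub>R y \<in> reach T" by (metis reach_def image_eqI)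
    qed
    show "norm w \<le> C" if w: "w \<in> reach T" for w
    proof -
      obtain u where u: "u \<in> unit_controls T" "w = \<Phi> T u" using w by (auto simp: reach_def)
      have "norm (\<Phi> T u) \<le> C * 1"
        by (rule norm_input_map_le[OF C T simple_controls_regular]) (use u in \<open>auto simp: unit_controls_def\<close>)
      thus ?thesis using u by simp
    qed
  qed
  thus ?thesis using C by (auto simp: admissible_bound_def)
qed

abbreviation "sup_reach T \<equiv> balanced_set.supp (reach T)"

lemma unobs_eq: "T \<ge> 0 \<Longrightarrow> unobs T = balanced_set.annihilator (reach T)"
  using balanced_reach[of T] by (auto simp: unobs_def balanced_set.annihilator_def)

lemma input_map_scaleC:
  assumes "T \<ge> 0" "u \<in> simple_controls T"
  shows "\<Phi> T (\<lambda>t. c *\<^sub>C u t) = c *\<^sub>C \<Phi> T u"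
proof (rule input_map_eqI)
  fix \<phi> assume \<phi>: "\<phi> \<in> Ds"
  have "inner (c *\<^sub>C \<Phi> T u) \<phi> = inner (\<Phi> T u) (cnj c *\<^sub>C \<phi>)"
    by (simp add: inner_eq_Re_cinner cinner_scaleC_left cinner_scaleC_right)
  also have "\<dots> = ell T (cnj c *\<^sub>C \<phi>) u"
    using assms \<phi> by (intro input_map_regular(1) simple_controls_regular Ds_scaleC)
  also have "\<dots> = ell T \<phi> (\<lambda>t. c *\<^sub>C u t)" by (rule ell_scaleC_u[OF \<phi>, symmetric])
  finally show "inner (c *\<^sub>C \<Phi> T u) \<phi> = ell T \<phi> (\<lambda>t. c *\<^sub>C u t)" .
qed (use assms in \<open>auto intro: simple_controls_regular simple_controls_scaleC\<close>)

text \<open>Multiplying the control by \<open>\<i>\<close> turns real orthogonality into complex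
  orthogonality, and scaling removes the restriction to the unit ball.\<close>

lemma unobs_cinner:
  assumes T: "T \<ge> 0" and z: "z \<in> unobs T" and u: "u \<in> simple_controls T"
  shows "cinner (\<Phi> T u) z = 0"
proof -
  have re: "inner (\<Phi> T v) z = 0" if v: "v \<in> simple_controls T" for v
  proof -
    define r where "r = sqrt (l2sq T v) + 1"
    have r: "r > 0" "l2sq T v \<le> r\<^sup>2"
    proof -
      show "r > 0" using l2sq_nonneg[of T v] by (simp add: r_def add_nonneg_pos)
      have "l2sq T v = (sqrt (l2sq T v))\<^sup>2" using l2sq_nonneg[of T v] by simp
      also have "\<dots> \<le> r\<^sup>2" unfolding r_def using l2sq_nonneg[of T v] by (intro power_mono) auto
      finally show "l2sq T v \<le> r\<^sup>2" .
    qed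
    have "inner (\<Phi> T (\<lambda>t. (1 / r) *\<^sub>R v t)) z = 0"
      using z simple_control_scaled_unit[OF v r(2,1)] by (auto simp: unobs_def reach_def)
    thus ?thesis using r by (simp add: input_map_scale[OF T v])
  qed
  have "inner (\<Phi> T u) (\<i> *\<^sub>C z) = - inner (\<Phi> T (\<lambda>t. \<i> *\<^sub>C u t)) z"
    by (simp add: input_map_scaleC[OF T u] inner_scaleC_i)
  also have "\<dots> = 0" by (simp add: re[OF simple_controls_scaleC[OF u]])
  finally show ?thesis using re[OF u] by (simp add: cinner_eq_Complex complex_eq_iff)
qed

lemma unobsI: "(\<And>u. u \<in> unit_controls T \<Longrightarrow> inner (\<Phi> T u) z = 0) \<Longrightarrow> z \<in> unobs T"
  by (auto simp: unobs_def reach_def)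

lemma unobsD: "z \<in> unobs T \<Longrightarrow> u \<in> unit_controls T \<Longrightarrow> inner (\<Phi> T u) z = 0"
  by (auto simp: unobs_def reach_def)

lemma csubspace_unobs: assumes T: "T \<ge> 0" shows "csubspace (unobs T)"
  unfolding cvs.subspace_def
proof (intro conjI ballI allI)
  show "0 \<in> unobs T" by (simp add: unobs_def)
  fix x assume x: "x \<in> unobs T"
  show "c *\<^sub>C x \<in> unobs T" for c
  proof (rule unobsI)
    fix u :: "real \<Rightarrow> 'u" assume "u \<in> unit_controls T"
    hence "cinner (\<Phi> T u) x = 0" by (intro unobs_cinner[OF T x] unit_simple)
    thus "inner (\<Phi> T u) (c *\<^sub>C x) = 0" by (simp add: inner_eq_Re_cinner cinner_scaleC_right)
  qed
  show "x + y \<in> unobs T" if "y \<in> unobs T" for y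
    using x that by (auto simp: unobs_def inner_add_right)
qed

lemma unobs_mono: assumes "0 \<le> t" "t \<le> T" shows "unobs T \<subseteq> unobs t"
proof
  fix z assume z: "z \<in> unobs T"
  show "z \<in> unobs t"
  proof (rule unobsI)
    fix u :: "real \<Rightarrow> 'u" assume u: "u \<in> unit_controls t"
    have e: "t + (T - t) = T" by simp
    have "\<Phi> (t + (T - t)) (\<lambda>s. u (s - (T - t))) = \<Phi> t u"
      using assms u by (intro input_map_shift unit_simple) auto
    moreover have "(\<lambda>s. u (s - (T - t))) \<in> unit_controls (t + (T - t))"
      using assms u by (intro unit_controls_shift) auto
    ultimately show "inner (\<Phi> t u) z = 0" using unobsD[OF z] unfolding e by metis
  qed
qed

text \<open>A control on \<open>{0..T}\<close> followed by free evolution for time \<open>t\<close>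
  is a control on the longer interval.\<close>

lemma unobs_invariant:
  assumes "0 \<le> t" "0 \<le> T" "z \<in> unobs (T + t)" shows "Sa t z \<in> unobs T"
proof (rule unobsI)
  fix u :: "real \<Rightarrow> 'u" assume u: "u \<in> unit_controls T"
  have "inner (\<Phi> T u) (Sa t z) = inner (\<Phi> (T + t) u) z"
    using assms u by (simp add: Sa_inner[symmetric] input_map_extend unit_simple)
  also have "\<dots> = 0" by (rule unobsD[OF assms(3) unit_controls_extend[OF u]]) (use assms in simp)
  finally show "inner (\<Phi> T u) (Sa t z) = 0" .
qed

text \<open>A control on the longer interval is cut into one on \<open>{0..T}\<close>, followed by
  free evolution, and one on the last \<open>t\<close> time units.\<close>

lemma unobs_add:
  assumes "0 \<le> t" "0 \<le> T" "z \<in> unobs t" "Sa t z \<in> unobs T" shows "z \<in> unobs (T + t)"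
proof (rule unobsI)
  fix u :: "real \<Rightarrow> 'u" assume u: "u \<in> unit_controls (T + t)"
  obtain u1 w where uw: "u1 \<in> unit_controls T" "w \<in> unit_controls t"
    "\<And>\<phi>. \<phi> \<in> Ds \<Longrightarrow> ell (T + t) \<phi> u = ell T (Sa t \<phi>) u1 + ell t \<phi> w"
    using unit_controls_split[OF u assms(2,1)] by blast
  have "\<Phi> (T + t) u = S t (\<Phi> T u1) + \<Phi> t w"
  proof (rule input_map_eqI)
    fix \<phi> assume "\<phi> \<in> Ds"
    thus "inner (S t (\<Phi> T u1) + \<Phi> t w) \<phi> = ell (T + t) \<phi> u"
      using uw assms by (simp add: inner_add_left Sa_inner input_map_regular(1) simple_controls_regular unit_simple Sa_Ds)
  qed (use u assms in \<open>auto intro: simple_controls_regular unit_simple\<close>)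
  thus "inner (\<Phi> (T + t) u) z = 0"
    using unobsD[OF assms(3) uw(2)] unobsD[OF assms(4) uw(1)] assms by (simp add: inner_add_left Sa_inner)
qed

definition unobs_inf :: "'a set" where
  "unobs_inf = (\<Inter>T\<in>{0..}. unobs T)"

lemma unobs_inf_subset: "T \<ge> 0 \<Longrightarrow> unobs_inf \<subseteq> unobs T"
  by (auto simp: unobs_inf_def)

lemma csubspace_unobs_inf: "csubspace unobs_inf"
  unfolding unobs_inf_def by (intro cvs.subspace_Inter) (auto intro: csubspace_unobs)

lemma unobs_inf_invariant: "t \<ge> 0 \<Longrightarrow> z \<in> unobs_inf \<Longrightarrow> Sa t z \<in> unobs_inf"
  by (auto simp: unobs_inf_def intro: unobs_invariant)

text \<open>The spaces \<open>unobs T\<close> decrease with \<open>T\<close>, so two of them coincide; the common space is then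
  invariant under the adjoint semigroup.\<close>

lemma unobs_eq_inf:
  assumes V: "finite V" "orth_trivial V (unobs T0)" and T: "0 \<le> T0" "T0 < T"
  shows "unobs T = unobs_inf"
proof -
  \<comment> \<open>Times increasing strictly towards \<open>T\<close>; the offset by two places the
    first one above \<open>T0\<close> rather than at it.\<close>
  define t where "t k = T - (T - T0) / real (Suc (Suc k))" for k
  have t: "T0 < t k" "t k < T" for k
  proof -
    have "(T - T0) / real (Suc (Suc k)) < (T - T0) / 1" using T by (intro divide_strict_left_mono) auto
    thus "T0 < t k" by (simp add: t_def)
    show "t k < T" using T by (simp add: t_def)
  qed
  have tm: "t j < t k" if "j < k" for j k
    using that T unfolding t_def by (intro diff_strict_left_mono divide_strict_left_mono) auto
  have tm': "t j \<le> t k" if "j \<le> k" for j k using tm[of j k] that by (cases "j = k") auto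
  have "\<exists>k. \<forall>j\<ge>k. unobs (t j) = unobs (t k)"
  proof (rule chain_stabilizes[OF V(1)])
    show "csubspace (unobs (t k))" for k using t(1)[of k] T by (intro csubspace_unobs) auto
    show "unobs (t k) \<subseteq> unobs (t j)" if "j \<le> k" for j k
      using tm'[OF that] t(1)[of j] T by (intro unobs_mono) auto
    show "orth_trivial V (unobs (t 0))"
      by (rule orth_trivial_subset[OF V(2) unobs_mono]) (use t(1)[of 0] T in auto)
  qed
  then obtain k where k: "\<And>j. j \<ge> k \<Longrightarrow> unobs (t j) = unobs (t k)" by blast
  define a b where "a = t k" and "b = t (Suc k)"
  have ab: "0 < a" "a < b" "a < T" "b < T" "unobs b = unobs a"
    using t[of k] t[of "Suc k"] tm[of k "Suc k"] T k[of "Suc k"] by (auto simp: a_def b_def)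
  \<comment> \<open>Advancing a vector of \<open>unobs b\<close> by \<open>s\<close> costs
    \<open>s\<close> of its horizon; for \<open>s \<le> b - a\<close> at least \<open>a\<close> is
    left. As \<open>unobs b = unobs a\<close>, this is invariance for short times.\<close>
  have small: "Sa s z \<in> unobs a" if "0 \<le> s" "s \<le> b - a" "z \<in> unobs a" for s z
  proof -
    have "Sa s z \<in> unobs (b - s)" by (rule unobs_invariant) (use that ab in auto)
    thus ?thesis using unobs_mono[of a "b - s"] that ab by auto
  qed
  have inv: "Sa s z \<in> unobs a" if "0 \<le> s" "z \<in> unobs a" for s z
  proof -
    have multi: "Sa (real n * r) z \<in> unobs a" if r: "0 \<le> r" "r \<le> b - a" for n r
    proof (induction n)
      case 0
      show ?case using \<open>z \<in> unobs a\<close> by (simp add: Sa_0)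
    next
      case (Suc n)
      have "Sa (real (Suc n) * r) z = Sa r (Sa (real n * r) z)"
        using Sa_add[of r "real n * r" z] r by (simp add: algebra_simps)
      thus ?case using small[OF r Suc] by simp
    qed
    obtain n :: nat where n: "s / (b - a) < real n" using reals_Archimedean2 by blast
    hence n0: "real n > 0" using that(1) ab by (meson divide_nonneg_pos diff_gt_0_iff_gt le_less_trans)
    hence "s / real n \<le> b - a" using n ab by (simp add: field_simps)
    hence "Sa (real n * (s / real n)) z \<in> unobs a" using that(1) n0 by (intro multi) auto
    thus ?thesis using n0 by simp
  qed
  \<comment> \<open>Invariance lets \<open>unobs_add\<close> prolong the horizon by \<open>a\<close>
    any number of times.\<close>
  have mult: "unobs a \<subseteq> unobs (real (Suc n) * a)" for n
  proof (induction n)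
    case (Suc n)
    show ?case
    proof
      fix z assume z: "z \<in> unobs a"
      have "z \<in> unobs (real (Suc n) * a + a)"
        by (rule unobs_add) (use z ab Suc inv[of a z] in auto)
      thus "z \<in> unobs (real (Suc (Suc n)) * a)" by (simp add: algebra_simps)
    qed
  qed simp
  have "unobs a \<subseteq> unobs_inf"
    unfolding unobs_inf_def
  proof (intro INT_greatest)
    fix T' :: real assume T': "T' \<in> {0..}"
    obtain n :: nat where "T' / a < real n" using reals_Archimedean2 by blast
    hence "T' \<le> real (Suc n) * a" using ab by (simp add: field_simps)
    thus "unobs a \<subseteq> unobs T'" using mult[of n] unobs_mono[of T' "real (Suc n) * a"] T' by auto
  qed
  moreover have "unobs T \<subseteq> unobs a" using ab by (intro unobs_mono) auto
  ultimately show ?thesis using unobs_inf_subset[of T] T by auto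
qed

text \<open>Invariance under the adjoint semigroup passes to averages, as seen by pairing with each
  reachable vector.\<close>

lemma adj_orbit_mean_unobs_inf:
  assumes z: "z \<in> unobs_inf" and h: "h > 0"
  shows "adj (orbit_mean S h) z \<in> unobs_inf"
  unfolding unobs_inf_def
proof (intro INT_I unobsI)
  fix T :: real and u :: "real \<Rightarrow> 'u" assume T: "T \<in> {0..}" and u: "u \<in> unit_controls T"
  have "inner (integral {0..h} (\<lambda>s. S s (\<Phi> T u))) z = integral {0..h} ((\<lambda>y. inner y z) \<circ> (\<lambda>s. S s (\<Phi> T u)))"
    by (rule integral_linear[symmetric, OF c0_orbit_integrable[OF c0] bounded_linear_inner_left]) simp
  also have "\<dots> = integral {0..h} (\<lambda>s. 0)"
  proof (rule Henstock_Kurzweil_Integration.integral_cong)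
    fix s assume "s \<in> {0..h}"
    hence "Sa s z \<in> unobs T" using unobs_inf_invariant[OF _ z, of s] unobs_inf_subset[of T] T by auto
    from unobsD[OF this u] show "((\<lambda>y. inner y z) \<circ> (\<lambda>s. S s (\<Phi> T u))) s = 0"
      using \<open>s \<in> {0..h}\<close> by (simp add: Sa_inner)
  qed
  finally have "inner (orbit_mean S h (\<Phi> T u)) z = 0" by (simp add: orbit_mean_def)
  thus "inner (\<Phi> T u) (adj (orbit_mean S h) z) = 0"
    by (simp add: inner_adj[OF bounded_clinear_orbit_mean[OF c0 h]])
qed

text \<open>The smooth vectors in \<open>unobs_inf\<close> form a finite dimensional subspace, onto
  which one can project. The difference of \<open>z\<close> and its projection is orthogonal to its
  own transposed averages, which are smooth and unobservable; hence it is 0.\<close>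

lemma unobs_inf_Ds:
  assumes V: "finite V" "orth_trivial V unobs_inf"
  shows "unobs_inf \<subseteq> Ds"
proof
  fix z assume z: "z \<in> unobs_inf"
  let ?G = "unobs_inf \<inter> Ds"
  have "csubspace Ds" unfolding cvs.subspace_def by (simp add: Ds_0 Ds_add Ds_scaleC)
  hence "csubspace ?G" by (intro cvs.subspace_inter csubspace_unobs_inf)
  hence "finite_dim ?G"
    by (intro finite_dim_if_orth_trivial[OF V(1)] orth_trivial_subset[OF V(2)]) auto
  then obtain p where p: "p \<in> ?G" "\<And>y. y \<in> ?G \<Longrightarrow> cinner (z - p) y = 0" using finite_dim_projection by blast
  have d: "z - p \<in> unobs_inf" using z p by (intro cvs.subspace_diff[OF csubspace_unobs_inf]) auto
  have "z - p = 0"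
  proof (rule eq_0_if_orthogonal_adj_orbit_mean)
    fix h :: real assume h: "h > 0"
    have "cinner (z - p) (adj (orbit_mean S h) (z - p)) = 0"
      by (rule p(2)) (use adj_orbit_mean_unobs_inf[OF d h] adj_orbit_mean_in_Ds[OF h] in auto)
    thus "inner (adj (orbit_mean S h) (z - p)) (z - p) = 0"
      by (metis inner_eq_Re_cinner inner_commute zero_complex.simps(1))
  qed
  thus "z \<in> Ds" using p(1) by auto
qed

lemma unobs_inf_As:
  assumes z: "z \<in> unobs_inf" "z \<in> Ds"
  shows "As z \<in> unobs_inf"
  unfolding unobs_inf_def
proof (intro INT_I unobsI)
  fix T :: real and u :: "real \<Rightarrow> 'u" assume T: "T \<in> {0..}" and u: "u \<in> unit_controls T"
  have "((\<lambda>h. inner (\<Phi> T u) ((1 / h) *\<^sub>R (Sa h z - z))) \<longlongrightarrow> inner (\<Phi> T u) (As z)) (at_right 0)"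
    by (intro tendsto_intros adj.A_tendsto z)
  moreover have "\<forall>\<^sub>F h in at_right 0. inner (\<Phi> T u) ((1 / h) *\<^sub>R (Sa h z - z)) = 0"
    unfolding eventually_at_filter
  proof (intro always_eventually allI impI)
    fix h :: real assume "h \<in> {0<..}"
    hence "Sa h z \<in> unobs T" "z \<in> unobs T"
      using unobs_inf_invariant[OF _ z(1), of h] unobs_inf_subset[of T] T z(1) by auto
    thus "inner (\<Phi> T u) ((1 / h) *\<^sub>R (Sa h z - z)) = 0"
      using unobsD[OF _ u] by (simp add: inner_diff_right)
  qed
  hence "((\<lambda>h. inner (\<Phi> T u) ((1 / h) *\<^sub>R (Sa h z - z))) \<longlongrightarrow> 0) (at_right 0)"
    by (rule tendsto_eventually)
  ultimately show "inner (\<Phi> T u) (As z) = 0" by (rule tendsto_unique[OF trivial_limit_at_right_real])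
qed

text \<open>If \<open>Bs z\<close> were not 0, the constant control \<open>Bs z\<close> switched on
  shortly before the final time would have a positive pairing with \<open>z\<close>, since the
  observation stays close to \<open>Bs z\<close> there.\<close>

lemma unobs_inf_Bs:
  assumes z: "z \<in> unobs_inf" "z \<in> Ds"
  shows "Bs z = 0"
proof (rule ccontr)
  assume ne: "Bs z \<noteq> 0"
  let ?w = "Bs z"
  let ?g = "\<lambda>t. inner ?w (Bs (Sa (1 - t) z))"
  have gc: "continuous_on {0..1} ?g"
    by (intro continuous_intros Bs_Sa_reversed_continuous z)
  have g1: "?g 1 = (norm ?w)\<^sup>2" by (simp add: Sa_0 power2_norm_eq_inner)
  have wpos: "(norm ?w)\<^sup>2 > 0" using ne by simp
  have "(?g \<longlongrightarrow> ?g 1) (at 1 within {0..1})" using gc unfolding continuous_on_def by (rule bspec) simp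
  hence "\<forall>\<^sub>F t in at 1 within {0..1}. (norm ?w)\<^sup>2 / 2 < ?g t"
    by (rule order_tendstoD(1)) (use g1 wpos in simp)
  then obtain d where d: "d > 0" "\<And>t. t \<in> {0..1} \<Longrightarrow> t \<noteq> 1 \<Longrightarrow> dist t 1 < d \<Longrightarrow> (norm ?w)\<^sup>2 / 2 < ?g t"
    unfolding eventually_at by blast
  \<comment> \<open>The length of the final interval on which the control acts; the cap 1 keeps it
    inside \<open>{0..1}\<close>.\<close>
  define e where "e = min 1 (d / 2)"
  have e: "e > 0" "e \<le> 1" "e < d" using d(1) by (auto simp: e_def)
  have ge: "(norm ?w)\<^sup>2 / 2 \<le> ?g t" if "t \<in> {1 - e..1}" for t
    using d(2)[of t] that e g1 wpos by (cases "t = 1") (auto simp: dist_real_def less_imp_le)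
  define u where "u t = (if t \<in> {1 - e..1} then ?w else 0)" for t :: real
  have "simple_function lebesgue (\<lambda>t. if t \<in> {1 - e..1} then ?w else 0)"
    by (rule simple_function_If_set) auto
  hence us: "u \<in> simple_controls 1" using e by (auto simp: simple_controls_def u_def[abs_def])
  have "ell 1 z u = inner (\<Phi> 1 u) z" using us z(2) by (simp add: input_map_regular(1) simple_controls_regular)
  also have "\<dots> = 0" using unobs_cinner[of 1 z u] unobs_inf_subset[of 1] z(1) us by (auto simp: inner_eq_Re_cinner)
  finally have "0 = integral {0..1} (\<lambda>t. inner (u t) (Bs (Sa (1 - t) z)))"
    unfolding ell_def by (simp add: simple_l2ip_HK(1)[OF simple_controls_simple[OF us] Bs_Sa_reversed_continuous[OF z(2)]])
  also have "\<dots> = integral {0..1} (\<lambda>t. if t \<in> {1 - e..1} then ?g t else 0)"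
    by (rule Henstock_Kurzweil_Integration.integral_cong) (simp add: u_def)
  also have "\<dots> = integral {1 - e..1} ?g"
    using Henstock_Kurzweil_Integration.integral_restrict_Int[of "{0..1}" "{1 - e..1}" ?g] e by (simp add: Int_absorb1)
  also have "\<dots> \<ge> integral {1 - e..1} (\<lambda>t. (norm ?w)\<^sup>2 / 2)"
  proof (rule integral_le)
    show "?g integrable_on {1 - e..1}"
      by (intro integrable_continuous_interval continuous_on_subset[OF gc]) (use e in auto)
  qed (use ge in auto)
  finally have "e * (norm ?w)\<^sup>2 \<le> 0" using e by simp
  thus False using mult_pos_pos[OF e(1) wpos] by linarith
qed

lemma Bs_Sa_zero_imp_unobs_inf:
  assumes z: "z \<in> Ds" and B0: "\<And>t. t \<ge> 0 \<Longrightarrow> Bs (Sa t z) = 0"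
  shows "z \<in> unobs_inf"
  unfolding unobs_inf_def
proof (intro INT_I unobsI)
  fix T :: real and u :: "real \<Rightarrow> 'u" assume T: "T \<in> {0..}" and u: "u \<in> unit_controls T"
  have "inner (\<Phi> T u) z = ell T z u"
    using T u z by (intro input_map_regular(1) simple_controls_regular unit_simple) auto
  also have "\<dots> = (\<integral>t. 0 \<partial>Leb T)"
    unfolding ell_def l2ip_def by (rule Bochner_Integration.integral_cong) (use B0 in auto)
  finally show "inner (\<Phi> T u) z = 0" by simp
qed

end


section \<open>The range of the input map\<close>

context admissible_system
begin

text \<open>Passes from simple unit controls and vectors of \<open>Ds\<close> to all regular
  controls and all vectors; density suffices for the latter because \<open>supp\<close> is
  Lipschitz.\<close>

lemma abs_inner_input_map_le:
  assumes T: "T \<ge> 0" and u: "u \<in> regular_controls T" "l2sq T u \<le> r\<^sup>2" "r \<ge> 0"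
  shows "\<bar>inner (\<Phi> T u) z\<bar> \<le> sup_reach T z * r"
proof -
  obtain C where C: "C \<ge> 0" "balanced_set (reach T) C" using balanced_reach[OF T] by blast
  interpret R: balanced_set "reach T" C by (rule C(2))
  have D: "\<bar>inner (\<Phi> T u) \<phi>\<bar> \<le> R.supp \<phi> * r" if \<phi>: "\<phi> \<in> Ds" for \<phi>
  proof -
    have "\<bar>ell T \<phi> u\<bar> \<le> R.supp \<phi> * r"
    proof (rule ell_regular_le[OF u \<phi>])
      fix v :: "real \<Rightarrow> 'u" assume v: "v \<in> unit_controls T"
      have "\<bar>inner (\<Phi> T v) \<phi>\<bar> \<le> R.supp \<phi>" by (rule R.abs_inner_le_supp) (use v in \<open>simp add: reach_def\<close>)
      thus "\<bar>ell T \<phi> v\<bar> \<le> R.supp \<phi>"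
        using v T \<phi> by (simp add: input_map_regular(1) simple_controls_regular unit_simple)
    qed
    thus ?thesis using T u(1) \<phi> by (simp add: input_map_regular(1))
  qed
  obtain \<phi> where \<phi>: "\<And>n::nat. \<phi> n \<in> Ds" "\<phi> \<longlonglongrightarrow> z" using ex_Ds_seq by blast
  have "\<bar>inner (\<Phi> T u) z\<bar> \<le> (R.supp z + C * norm (z - z)) * r"
  proof (rule LIMSEQ_le)
    show "(\<lambda>n. \<bar>inner (\<Phi> T u) (\<phi> n)\<bar>) \<longlonglongrightarrow> \<bar>inner (\<Phi> T u) z\<bar>" by (intro tendsto_intros \<phi>)
    show "(\<lambda>n. (R.supp z + C * norm (z - \<phi> n)) * r) \<longlonglongrightarrow> (R.supp z + C * norm (z - z)) * r"
      by (intro tendsto_intros \<phi>)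
    have "\<bar>inner (\<Phi> T u) (\<phi> n)\<bar> \<le> (R.supp z + C * norm (z - \<phi> n)) * r" for n
    proof -
      have "R.supp (\<phi> n) \<le> R.supp z + C * norm (z - \<phi> n)"
        using R.supp_diff[of z "z - \<phi> n"] R.supp_le_norm[of "z - \<phi> n"] by simp
      hence "R.supp (\<phi> n) * r \<le> (R.supp z + C * norm (z - \<phi> n)) * r" using u(3) by (rule mult_right_mono)
      thus ?thesis using D[OF \<phi>(1), of n] by linarith
    qed
    thus "\<exists>N. \<forall>n\<ge>N. \<bar>inner (\<Phi> T u) (\<phi> n)\<bar> \<le> (R.supp z + C * norm (z - \<phi> n)) * r" by blast
  qed
  thus ?thesis by simp
qed

text \<open>Otherwise suitable multiples of vectors \<open>z\<close> with small \<open>sup_reach T z\<close> would be bounded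
  on every element of the range, yet not uniformly bounded.\<close>

lemma surjective_lower_bound:
  assumes T: "T \<ge> 0" and surj: "\<And>y. \<exists>u\<in>regular_controls T. \<Phi> T u = y"
  shows "\<exists>c>0. \<forall>z. c * norm z \<le> sup_reach T z"
proof (rule ccontr)
  assume neg: "\<not> ?thesis"
  obtain C where C: "balanced_set (reach T) C" using balanced_reach[OF T] by blast
  interpret R: balanced_set "reach T" C by (rule C)
  have "\<exists>z. R.supp z < 1 / real (Suc n) * norm z" for n
  proof (rule ccontr)
    assume "\<not> ?thesis"
    hence "\<forall>z. 1 / real (Suc n) * norm z \<le> R.supp z" by (meson not_less)
    moreover have "1 / real (Suc n) > 0" by simp
    ultimately show False using neg by blast
  qed
  then obtain z where z: "\<And>n. R.supp (z n) < 1 / real (Suc n) * norm (z n)" by metis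
  have n0: "norm (z n) > 0" for n
    using le_less_trans[OF R.supp_nonneg z[of n]] by (simp add: zero_less_divide_iff)
  define f where "f n y = inner y ((real (Suc n) / norm (z n)) *\<^sub>R z n)" for n y
  have "\<exists>C\<ge>0. \<forall>n\<in>UNIV. \<forall>y. norm (f n y) \<le> C * norm y"
  proof (rule uniform_boundedness)
    show "bounded_linear (f n)" for n unfolding f_def by (rule bounded_linear_inner_left)
    fix y
    obtain u where u: "u \<in> regular_controls T" "\<Phi> T u = y" using surj by blast
    define r where "r = sqrt (l2sq T u)"
    have r: "r \<ge> 0" "l2sq T u \<le> r\<^sup>2" using l2sq_nonneg[of T u] by (auto simp: r_def)
    have "norm (f n y) \<le> r" for n
    proof -
      have "norm (f n y) = (real (Suc n) / norm (z n)) * \<bar>inner y (z n)\<bar>" by (simp add: f_def abs_mult)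
      also have "\<dots> \<le> (real (Suc n) / norm (z n)) * (R.supp (z n) * r)"
        using abs_inner_input_map_le[OF T u(1) r(2,1), of "z n"] u(2) by (intro mult_left_mono) auto
      also have "\<dots> \<le> (real (Suc n) / norm (z n)) * ((1 / real (Suc n) * norm (z n)) * r)"
        using z[of n] r(1) by (intro mult_left_mono mult_right_mono) auto
      also have "\<dots> = r" using n0[of n] by simp
      finally show ?thesis .
    qed
    thus "\<exists>C. \<forall>n\<in>UNIV. norm (f n y) \<le> C" by blast
  qed
  then obtain D where D: "\<And>n y. norm (f n y) \<le> D * norm y" by blast
  obtain n :: nat where n: "D < real n" using reals_Archimedean2 by blast
  have "norm (f n (z n)) = real (Suc n) * norm (z n)"
    using n0[of n] by (simp add: f_def power2_norm_eq_inner[symmetric] power2_eq_square)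
  hence "real (Suc n) * norm (z n) \<le> D * norm (z n)" using D[of n "z n"] by simp
  hence "real (Suc n) \<le> D" using n0[of n] by simp
  thus False using n by simp
qed

text \<open>A vector of the candidate space is scaled into the ball of radius \<open>c\<close> and
  expanded into a series of reachable vectors; the corresponding controls are summed by
  \<open>series_control\<close>, and their sum realises the vector.\<close>

lemma input_map_range:
  assumes T: "T \<ge> 0" and c: "c > 0" "\<And>z. z \<in> balanced_set.biannihilator (reach T) \<Longrightarrow> c * norm z \<le> sup_reach T z"
  shows "\<Phi> T ` regular_controls T = {x. \<forall>z\<in>unobs T. inner x z = 0}"
proof -
  obtain C where C: "balanced_set (reach T) C" using balanced_reach[OF T] by blast
  interpret R: balanced_set "reach T" C by (rule C)
  have bi: "R.biannihilator = {x. \<forall>z\<in>unobs T. inner x z = 0}"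
    by (simp add: R.biannihilator_def unobs_eq[OF T])
  have "\<Phi> T u \<in> R.biannihilator" if u: "u \<in> regular_controls T" for u
    unfolding R.biannihilator_def
  proof (intro CollectI ballI)
    fix z assume "z \<in> R.annihilator"
    hence "R.supp z = 0" by (simp add: R.supp_eq_0_iff)
    thus "inner (\<Phi> T u) z = 0"
      using abs_inner_input_map_le[OF T u, of "sqrt (l2sq T u)" z] l2sq_nonneg[of T u] by simp
  qed
  moreover have "y \<in> \<Phi> T ` regular_controls T" if y: "y \<in> R.biannihilator" for y
  proof -
    define s where "s = c / (norm y + 1)"
    have s: "s > 0" using c(1) by (simp add: s_def add_nonneg_pos)
    have n: "norm (s *\<^sub>R y) \<le> c"
    proof -
      have "norm (s *\<^sub>R y) = c * norm y / (norm y + 1)" using s c(1) by (simp add: s_def)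
      also have "\<dots> \<le> c"
      proof -
        have "norm y + 1 > 0" by (simp add: add_nonneg_pos)
        thus ?thesis using c(1) by (simp add: pos_divide_le_eq algebra_simps)
      qed
      finally show ?thesis .
    qed
    obtain w where w: "\<And>k::nat. w k \<in> reach T" "(\<lambda>k. (1/2) ^ k *\<^sub>R w k) sums (s *\<^sub>R y)"
      using R.series_representation[OF c subspace_scale[OF R.subspace_biannihilator y] n] by blast
    have "\<forall>k. \<exists>u\<in>unit_controls T. w k = \<Phi> T u" using w(1) by (auto simp: reach_def)
    then obtain u where u: "\<And>k. u k \<in> unit_controls T" "\<And>k. w k = \<Phi> T (u k)" by metis
    have "\<exists>v\<in>regular_controls T. \<forall>g. continuous_on {0..T} g \<longrightarrow>
        (\<lambda>k. (1/2) ^ k * l2ip T (u k) g) sums l2ip T v g"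
      by (rule series_control) (use u in \<open>auto simp: unit_controls_def\<close>)
    then obtain v where v: "v \<in> regular_controls T" and
      vs: "\<And>g. continuous_on {0..T} g \<Longrightarrow> (\<lambda>k. (1/2) ^ k * l2ip T (u k) g) sums l2ip T v g" by blast
    have eq: "inner (s *\<^sub>R y) \<phi> = ell T \<phi> v" if \<phi>: "\<phi> \<in> Ds" for \<phi>
    proof -
      have "(\<lambda>k. inner ((1/2) ^ k *\<^sub>R w k) \<phi>) sums inner (s *\<^sub>R y) \<phi>"
        by (rule bounded_linear.sums[OF bounded_linear_inner_left w(2)])
      moreover have "inner ((1/2) ^ k *\<^sub>R w k) \<phi> = (1/2) ^ k * ell T \<phi> (u k)" for k
        using T \<phi> u(1) by (simp add: u(2) input_map_regular(1) simple_controls_regular unit_simple)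
      ultimately have "(\<lambda>k. (1/2) ^ k * ell T \<phi> (u k)) sums inner (s *\<^sub>R y) \<phi>" by simp
      moreover have "(\<lambda>k. (1/2) ^ k * ell T \<phi> (u k)) sums ell T \<phi> v"
        unfolding ell_def by (rule vs[OF Bs_Sa_reversed_continuous[OF \<phi>]])
      ultimately show ?thesis by (rule sums_unique2)
    qed
    have "\<Phi> T (\<lambda>t. (1 / s) *\<^sub>R v t) = y"
    proof (rule input_map_eqI[OF T regular_controls_scale[OF v]])
      fix \<phi> assume "\<phi> \<in> Ds"
      from eq[OF this] show "inner y \<phi> = ell T \<phi> (\<lambda>t. (1 / s) *\<^sub>R v t)"
        using s by (simp add: ell_scale_u field_simps)
    qed
    thus ?thesis using regular_controls_scale[OF v] by blast
  qed
  ultimately show ?thesis unfolding bi[symmetric] by blast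
qed

text \<open>A control for the shorter time is delayed so as to end at the later final time.\<close>

lemma reach_mono: assumes "0 \<le> t" "t \<le> T" shows "reach t \<subseteq> reach T"
proof
  fix w assume "w \<in> reach t"
  then obtain u where u: "u \<in> unit_controls t" "w = \<Phi> t u" by (auto simp: reach_def)
  have e: "t + (T - t) = T" by simp
  have "\<Phi> (t + (T - t)) (\<lambda>s. u (s - (T - t))) = \<Phi> t u"
    using assms u by (intro input_map_shift unit_simple) auto
  moreover have "(\<lambda>s. u (s - (T - t))) \<in> unit_controls (t + (T - t))"
    using assms u by (intro unit_controls_shift) auto
  ultimately show "w \<in> reach T" unfolding e u(2) reach_def by (metis image_eqI)
qed

lemma sup_reach_mono: assumes "0 \<le> t" "t \<le> T" shows "sup_reach t z \<le> sup_reach T z"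
proof -
  obtain C where C: "balanced_set (reach T) C" using balanced_reach[of T] assms by auto
  interpret R: balanced_set "reach T" C by (rule C)
  obtain D where D: "balanced_set (reach t) D" using balanced_reach[of t] assms by auto
  interpret Q: balanced_set "reach t" D by (rule D)
  show ?thesis using reach_mono[OF assms] R.inner_le_supp by (intro Q.supp_leI) blast
qed

end

section \<open>The unobservable space under observability up to finitely many functionals\<close>

locale observable_up_to_finite = admissible_system A B
  for A :: "'a::complex_hilbert unbdd_op" and B :: "'u::complex_hilbert \<Rightarrow> 'a \<Rightarrow> complex" +
  fixes T0 c :: real and V :: "'a set"
  assumes T0: "T0 \<ge> 0" and V: "finite V" and c: "c \<ge> 0"
    and obs: "norm z \<le> c * (sup_reach T0 z + (\<Sum>v\<in>V. \<bar>inner z v\<bar>))"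
begin

text \<open>On unobservable vectors only the functionals of \<open>V\<close> remain on the
  right-hand side of the inequality.\<close>

lemma orth_trivial_unobs: "orth_trivial V (unobs T0)"
  unfolding orth_trivial_def
proof (intro ballI impI)
  fix z assume z: "z \<in> unobs T0" "\<forall>v\<in>V. cinner z v = 0"
  obtain C where C: "balanced_set (reach T0) C" using balanced_reach[OF T0] by blast
  interpret R: balanced_set "reach T0" C by (rule C)
  have "R.supp z = 0" using z(1) by (simp add: R.supp_eq_0_iff unobs_eq[OF T0])
  moreover have "(\<Sum>v\<in>V. \<bar>inner z v\<bar>) = 0" using z(2) by (intro sum.neutral) (auto simp: inner_eq_Re_cinner)
  ultimately show "z = 0" using obs[of z] by simp
qed

lemma orth_trivial_unobs_inf: "orth_trivial V unobs_inf"
  by (rule orth_trivial_subset[OF orth_trivial_unobs unobs_inf_subset[OF T0]])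

lemma unobs_inf_domain: "unobs_inf \<subseteq> Ds"
  by (rule unobs_inf_Ds[OF V orth_trivial_unobs_inf])

text \<open>The inequality persists for longer times because the reachable sets grow; strictly
  beyond \<open>T0\<close> the unobservable space no longer depends on the time.\<close>

lemma input_map_range_eq:
  assumes T: "T > T0"
  shows "\<Phi> T ` regular_controls T = {x. \<forall>z\<in>unobs_inf. inner x z = 0}"
proof -
  have T': "T \<ge> 0" using T T0 by simp
  obtain C where C: "balanced_set (reach T) C" using balanced_reach[OF T'] by blast
  interpret R: balanced_set "reach T" C by (rule C)
  have "norm z \<le> c * (R.supp z + (\<Sum>v\<in>V. \<bar>inner z v\<bar>))" for z
  proof -
    have "c * (sup_reach T0 z + (\<Sum>v\<in>V. \<bar>inner z v\<bar>)) \<le> c * (R.supp z + (\<Sum>v\<in>V. \<bar>inner z v\<bar>))"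
      using sup_reach_mono[OF T0, of T z] T by (intro mult_left_mono c) auto
    thus ?thesis using obs[of z] by linarith
  qed
  then obtain c' where "c' > 0" "\<forall>z\<in>R.biannihilator. c' * norm z \<le> R.supp z"
    using R.supp_lower_bound[OF V c] by blast
  thus ?thesis
    using input_map_range[OF T'] unobs_eq_inf[OF V orth_trivial_unobs T0 T] by metis
qed

sublocale L: finite_dim_operator unobs_inf V As
  using unobs_inf_domain
  by unfold_locales
    (auto simp: V csubspace_unobs_inf orth_trivial_unobs_inf Ds_add Ds_scaleC unobs_inf_As subset_iff)

text \<open>Translates the powers occurring in \<open>E_space\<close> into iterates of
  \<open>L.shift\<close>; the domain of a power records that all earlier iterates lie in
  \<open>Ds\<close>.\<close>

lemma op_power_shift:
  "snd (op_power (op_shift \<mu> (op_adjoint A)) m) z = (L.shift \<mu> ^^ m) z"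
  "z \<in> fst (op_power (op_shift \<mu> (op_adjoint A)) m) \<longleftrightarrow> (\<forall>k<m. (L.shift \<mu> ^^ k) z \<in> Ds)"
proof -
  have s: "op_shift \<mu> (op_adjoint A) = (Ds, L.shift \<mu>)"
    by (simp add: op_shift_def L.shift_def fun_eq_iff)
  show "snd (op_power (op_shift \<mu> (op_adjoint A)) m) z = (L.shift \<mu> ^^ m) z"
    unfolding s by (induction m arbitrary: z) (simp_all add: funpow_swap1)
  show "z \<in> fst (op_power (op_shift \<mu> (op_adjoint A)) m) \<longleftrightarrow> (\<forall>k<m. (L.shift \<mu> ^^ k) z \<in> Ds)"
    unfolding s
  proof (induction m arbitrary: z)
    case (Suc m)
    show ?case by (simp add: Suc All_less_Suc2 funpow_swap1)
  qed simp
qed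

lemma Bs_0: "Bs 0 = 0"
  using Bs_scaleC[OF Ds_0(1), of 0] by simp

text \<open>The observation of \<open>z\<close> satisfies the linear equation with rate
  \<open>\<mu>\<close> up to the observation of the next vector \<open>y\<close> of the Jordan
  chain, which vanishes by induction; starting at 0, it stays 0. That \<open>As z\<close> lies in
  \<open>Ds\<close>, as the derivative requires, comes from \<open>y\<close>.\<close>

lemma chain_in_unobs_inf:
  assumes "\<And>k. k < m \<Longrightarrow> (L.shift \<mu> ^^ k) z \<in> Ds" "(L.shift \<mu> ^^ m) z = 0" "\<And>k. Bs ((L.shift \<mu> ^^ k) z) = 0"
  shows "z \<in> Ds \<and> (\<forall>t\<ge>0. Bs (Sa t z) = 0)"
  using assms
proof (induction m arbitrary: z)
  case 0
  hence "z = 0" by simp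
  thus ?case by (simp add: Ds_0 linear_simps[OF Sa_linear] Bs_0)
next
  case (Suc m)
  define y where "y = L.shift \<mu> z"
  have y: "y \<in> Ds" "\<And>t. t \<ge> 0 \<Longrightarrow> Bs (Sa t y) = 0"
  proof -
    have p: "(L.shift \<mu> ^^ k) y = (L.shift \<mu> ^^ Suc k) z" for k by (simp add: y_def funpow_swap1)
    have "y \<in> Ds \<and> (\<forall>t\<ge>0. Bs (Sa t y) = 0)"
    proof (rule Suc.IH)
      show "(L.shift \<mu> ^^ k) y \<in> Ds" if "k < m" for k unfolding p by (rule Suc.prems(1)) (use that in simp)
      show "(L.shift \<mu> ^^ m) y = 0" unfolding p by (rule Suc.prems(2))
      show "Bs ((L.shift \<mu> ^^ k) y) = 0" for k unfolding p by (rule Suc.prems(3))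
    qed
    thus "y \<in> Ds" "\<And>t. t \<ge> 0 \<Longrightarrow> Bs (Sa t y) = 0" by auto
  qed
  have z: "z \<in> Ds" using Suc.prems(1)[of 0] by simp
  have Az: "As z = \<mu> *\<^sub>C z - y" by (simp add: y_def L.shift_def)
  have AD: "As z \<in> Ds" unfolding Az by (intro Ds_diff(1) Ds_scaleC(1) z y)
  have "Bs (Sa t z) = 0" if t: "t \<ge> 0" for t
  proof (rule linear_ode_zero[of "\<lambda>t. Bs (Sa t z)" \<mu>, OF _ _ t])
    fix t :: real assume t: "t \<ge> 0"
    have "Bs (Sa t (As z)) = \<mu> *\<^sub>C Bs (Sa t z)"
      unfolding Az using t z y
      by (simp add: linear_simps[OF Sa_linear] Sa_scaleC Bs_diff Bs_scaleC Sa_Ds Ds_scaleC)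
    with Bs_Sa_derivative[OF z AD t]
    show "((\<lambda>t. Bs (Sa t z)) has_vector_derivative \<mu> *\<^sub>C Bs (Sa t z)) (at t within {0..})" by simp
  next
    show "Bs (Sa 0 z) = 0" using Suc.prems(3)[of 0] by (simp add: Sa_0)
  qed
  thus ?case using z by blast
qed

text \<open>Jordan chains annihilated by \<open>Bs\<close> are unobservable for all times;
  conversely everything in \<open>unobs_inf\<close> is smooth and annihilated by \<open>Bs\<close>.
  This identifies a set defined by the unbounded operator with one of its restriction.\<close>

lemma E_space_eq: "E_space A B \<mu> = L.gen_eigenspace \<mu>"
proof (intro equalityI subsetI)
  fix z assume "z \<in> E_space A B \<mu>"
  then obtain m where m: "z \<in> op_ker (op_power (op_shift \<mu> (op_adjoint A)) m)"
    "\<And>k. Bs ((L.shift \<mu> ^^ k) z) = 0" by (auto simp: E_space_def op_power_shift)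
  hence ch: "(L.shift \<mu> ^^ m) z = 0" "\<And>k. k < m \<Longrightarrow> (L.shift \<mu> ^^ k) z \<in> Ds"
    by (auto simp: op_ker_def op_power_shift)
  have "z \<in> unobs_inf"
    using chain_in_unobs_inf[OF ch(2,1) m(2)] Bs_Sa_zero_imp_unobs_inf by blast
  thus "z \<in> L.gen_eigenspace \<mu>" using ch(1) by (auto simp: L.gen_eigenspace_def)
next
  fix z assume "z \<in> L.gen_eigenspace \<mu>"
  then obtain m where m: "z \<in> unobs_inf" "(L.shift \<mu> ^^ m) z = 0" by (auto simp: L.gen_eigenspace_def)
  have in': "(L.shift \<mu> ^^ k) z \<in> unobs_inf" for k by (rule L.shift_pow_in[OF m(1)])
  \<comment> \<open>\<open>E_space\<close> admits only exponents from 1 on, whereas \<open>m\<close>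
    may be 0.\<close>
  have "(L.shift \<mu> ^^ Suc m) z = 0" by (rule L.shift_pow_mono[OF m(2)]) simp
  hence "z \<in> op_ker (op_power (op_shift \<mu> (op_adjoint A)) (Suc m))"
    unfolding op_ker_def using in' unobs_inf_domain by (auto simp only: op_power_shift mem_Collect_eq subset_iff)
  moreover have "Bs (snd (op_power (op_shift \<mu> (op_adjoint A)) k) z) = 0" for k
    unfolding op_power_shift using in' unobs_inf_domain by (intro unobs_inf_Bs) auto
  ultimately show "z \<in> E_space A B \<mu>" unfolding E_space_def by (auto intro!: bexI[of _ "Suc m"])
qed

lemma sigma_F_eq: "sigma_F A B = L.eigenvalues"
proof (intro equalityI subsetI)
  fix \<mu> assume "\<mu> \<in> sigma_F A B"
  \<comment> \<open>As 0 always belongs to the intersection, being different from \<open>{0}\<close>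
    means containing a nonzero vector.\<close>
  moreover have "0 \<in> op_ker (op_shift \<mu> (op_adjoint A)) \<inter> {z \<in> Ds. Bs z = 0}"
    by (simp add: op_ker_def op_shift_def Ds_0 Bs_0)
  ultimately obtain z where z: "z \<noteq> 0" "z \<in> Ds" "L.shift \<mu> z = 0" "Bs z = 0"
    by (auto simp: sigma_F_def op_ker_def op_shift_def L.shift_def)
  have "z \<in> Ds \<and> (\<forall>t\<ge>0. Bs (Sa t z) = 0)"
  proof (rule chain_in_unobs_inf[of 1 \<mu>])
    fix k
    show "Bs ((L.shift \<mu> ^^ k) z) = 0"
    proof (cases k)
      case (Suc n)
      have "(L.shift \<mu> ^^ Suc n) z = 0" by (rule L.shift_pow_mono[where m = 1]) (use z in auto)
      thus ?thesis by (simp only: Suc Bs_0)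
    qed (use z in simp)
  qed (use z in auto)
  hence "z \<in> unobs_inf" using Bs_Sa_zero_imp_unobs_inf by blast
  thus "\<mu> \<in> L.eigenvalues" using z by (auto simp: L.eigenvalues_def)
next
  fix \<mu> assume "\<mu> \<in> L.eigenvalues"
  then obtain z where z: "z \<in> unobs_inf" "z \<noteq> 0" "L.shift \<mu> z = 0" by (auto simp: L.eigenvalues_def)
  have "z \<in> Ds" using z(1) unobs_inf_domain by blast
  moreover have "Bs z = 0" by (rule unobs_inf_Bs[OF z(1) \<open>z \<in> Ds\<close>])
  ultimately show "\<mu> \<in> sigma_F A B"
    using z(2,3) by (auto simp: sigma_F_def op_ker_def op_shift_def L.shift_def)
qed

lemma finite_sigma_F: "finite (sigma_F A B)"
  unfolding sigma_F_eq by (rule L.spectral_decomposition)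

lemma finite_dim_E_space: "finite_dim (E_space A B \<mu>)"
  unfolding E_space_eq
  by (rule finite_dim_if_orth_trivial[OF V L.csubspace_gen_eigenspace
        orth_trivial_subset[OF orth_trivial_unobs_inf L.gen_eigenspace_subset]])

lemma independent_E_space: "independent_family (sigma_F A B) (E_space A B)"
proof -
  have "E_space A B = L.gen_eigenspace" by (rule ext) (rule E_space_eq)
  thus ?thesis unfolding sigma_F_eq using L.gen_eigenspaces_independent[OF L.spectral_decomposition(1)] by simp
qed

lemma input_map_image_eq:
  assumes T: "T > T0"
  shows "\<Phi> T ` L2 {0<..} = orth_compl (subspace_sum (sigma_F A B) (E_space A B))"
proof -
  have "E_space A B = L.gen_eigenspace" by (rule ext) (rule E_space_eq)
  hence "subspace_sum (sigma_F A B) (E_space A B) = unobs_inf"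
    unfolding sigma_F_eq using L.spectral_decomposition(2) by simp
  moreover have "\<Phi> T ` L2 {0<..} = {x. \<forall>z\<in>unobs_inf. inner x z = 0}"
    using input_map_L2[of T] input_map_range_eq[OF T] T T0 by simp
  \<comment> \<open>The real annihilator is the complex orthogonal complement since
    \<open>unobs_inf\<close> is a complex subspace.\<close>
  moreover have "{x. \<forall>z\<in>unobs_inf. inner x z = 0} = orth_compl unobs_inf"
    unfolding orth_compl_def
    using cinner_zero_iff_inner[of unobs_inf] cvs.subspace_scale[OF csubspace_unobs_inf] by blast
  ultimately show ?thesis by simp
qed

end

section \<open>Transfer of observability to the perturbed system\<close>

context perturbed_system
begin

text \<open>The two observation norms differ by at most \<open>a\<close> times the size of
  \<open>adj K\<close> along the perturbed orbit; by compactness this is a small multiple of the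
  norm plus finitely many functionals, and the small multiple is absorbed on the left. The estimate
  is proved on \<open>Ds\<close>, where \<open>ell\<close> represents the pairing, and extended by
  density.\<close>

lemma perturbed_observability:
  assumes T: "T \<ge> 0" and c: "c > 0" "\<And>z. c * norm z \<le> U.sup_reach T z" and comp: "compact_op K"
  shows "\<exists>V c'. finite V \<and> c' \<ge> 0 \<and> (\<forall>z. norm z \<le> c' * (admissible_system.sup_reach (op_perturb A K) B T z + (\<Sum>v\<in>V. \<bar>inner z v\<bar>)))"
proof -
  interpret PA: admissible_system "op_perturb A K" B
    by unfold_locales (rule admissible_perturb)
  obtain C where C: "balanced_set (U.reach T) C" using U.balanced_reach[OF T] by blast
  interpret RU: balanced_set "U.reach T" C by (rule C)
  obtain D where D: "balanced_set (PA.reach T) D" using PA.balanced_reach[OF T] by blast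
  interpret RP: balanced_set "PA.reach T" D by (rule D)
  obtain a where a: "a \<ge> 0" "\<And>\<phi> u m. \<phi> \<in> U.Ds \<Longrightarrow> u \<in> unit_controls T \<Longrightarrow> (\<forall>s\<in>{0..T}. norm (adj K (P.Sa s \<phi>)) \<le> m) \<Longrightarrow>
     \<bar>U.ell T \<phi> u - P.ell T \<phi> u\<bar> \<le> a * m" using ell_difference_ex[OF T] by blast
  \<comment> \<open>Small enough that \<open>a * \<epsilon>\<close> uses up at most half of the
    lower bound \<open>c\<close>.\<close>
  define \<epsilon> where "\<epsilon> = c / (2 * (a + 1))"
  have e: "\<epsilon> > 0" "a * \<epsilon> \<le> c / 2" using a(1) c(1) by (auto simp: \<epsilon>_def field_simps)
  obtain V where V: "finite V" "\<And>\<phi> s. s \<in> {0..T} \<Longrightarrow> norm (adj K (P.Sa s \<phi>)) \<le> \<epsilon> * norm \<phi> + (\<Sum>v\<in>V. \<bar>inner \<phi> v\<bar>)"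
    using compact_perturbation_small[OF comp e(1), of T] by blast
  define q where "q z = (\<Sum>v\<in>V. \<bar>inner z v\<bar>)" for z
  \<comment> \<open>Dividing by the remaining \<open>c / 2\<close> gives \<open>2 / c\<close>;
    \<open>1 + a\<close> majorises the coefficients 1 and \<open>a\<close> of the two terms
    left.\<close>
  define c' where "c' = 2 / c * (1 + a)"
  have c'0: "c' \<ge> 0" using c(1) a(1) by (simp add: c'_def)
  have q0: "q z \<ge> 0" for z by (simp add: q_def sum_nonneg)
  have D: "norm \<phi> \<le> c' * (RP.supp \<phi> + q \<phi>)" if \<phi>: "\<phi> \<in> U.Ds" for \<phi>
  proof -
    have "RU.supp \<phi> \<le> RP.supp \<phi> + a * (\<epsilon> * norm \<phi> + q \<phi>)"
    proof (rule RU.supp_leI)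
      fix w assume "w \<in> U.reach T"
      then obtain u where u: "u \<in> unit_controls T" "w = U.\<Phi> T u" by (auto simp: U.reach_def)
      have ur: "u \<in> regular_controls T" using u(1) by (intro simple_controls_regular U.unit_simple)
      have "inner w \<phi> = U.ell T \<phi> u" using u ur \<phi> T by (simp add: U.input_map_regular(1))
      also have "\<dots> \<le> P.ell T \<phi> u + a * (\<epsilon> * norm \<phi> + q \<phi>)"
        using a(2)[OF \<phi> u(1), of "\<epsilon> * norm \<phi> + q \<phi>"] V(2) unfolding q_def by fastforce
      also have "P.ell T \<phi> u = inner (PA.\<Phi> T u) \<phi>" using ur \<phi> T by (simp add: PA.input_map_regular(1) Ds_eq)
      also have "\<dots> \<le> RP.supp \<phi>" by (rule RP.inner_le_supp) (use u in \<open>simp add: PA.reach_def\<close>)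
      finally show "inner w \<phi> \<le> RP.supp \<phi> + a * (\<epsilon> * norm \<phi> + q \<phi>)" by simp
    qed
    moreover have "a * \<epsilon> * norm \<phi> \<le> c / 2 * norm \<phi>" by (intro mult_right_mono e) auto
    ultimately have "c / 2 * norm \<phi> \<le> RP.supp \<phi> + a * q \<phi>" using c(2)[of \<phi>] by (simp add: algebra_simps)
    also have "\<dots> \<le> (1 + a) * (RP.supp \<phi> + q \<phi>)"
      using a(1) RP.supp_nonneg[of \<phi>] q0[of \<phi>] by (simp add: algebra_simps)
    finally have "2 / c * (c / 2 * norm \<phi>) \<le> 2 / c * ((1 + a) * (RP.supp \<phi> + q \<phi>))"
      using c(1) by (intro mult_left_mono) auto
    moreover have "2 / c * (c / 2 * norm \<phi>) = norm \<phi>" using c(1) by simp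
    ultimately show ?thesis by (simp only: c'_def mult.assoc)
  qed
  have "norm z \<le> c' * (RP.supp z + q z)" for z
  proof -
    obtain \<phi> where \<phi>: "\<And>n::nat. \<phi> n \<in> U.Ds" "\<phi> \<longlonglongrightarrow> z" using U.ex_Ds_seq by blast
    have "norm z \<le> c' * ((RP.supp z + D * norm (z - z)) + q z)"
    proof (rule LIMSEQ_le)
      show "(\<lambda>n. norm (\<phi> n)) \<longlonglongrightarrow> norm z" by (intro tendsto_intros \<phi>)
      show "(\<lambda>n. c' * ((RP.supp z + D * norm (z - \<phi> n)) + q (\<phi> n))) \<longlonglongrightarrow> c' * ((RP.supp z + D * norm (z - z)) + q z)"
        unfolding q_def by (intro tendsto_intros \<phi>)
      have "norm (\<phi> n) \<le> c' * ((RP.supp z + D * norm (z - \<phi> n)) + q (\<phi> n))" for n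
      proof -
        have "RP.supp (\<phi> n) \<le> RP.supp z + D * norm (z - \<phi> n)"
          using RP.supp_diff[of z "z - \<phi> n"] RP.supp_le_norm[of "z - \<phi> n"] by simp
        hence "c' * (RP.supp (\<phi> n) + q (\<phi> n)) \<le> c' * ((RP.supp z + D * norm (z - \<phi> n)) + q (\<phi> n))"
          by (intro mult_left_mono c'0) auto
        thus ?thesis using D[OF \<phi>(1), of n] by linarith
      qed
      thus "\<exists>N. \<forall>n\<ge>N. norm (\<phi> n) \<le> c' * ((RP.supp z + D * norm (z - \<phi> n)) + q (\<phi> n))" by blast
    qed
    thus ?thesis by simp
  qed
  thus ?thesis unfolding q_def using V(1) c'0 by blast
qed

end

lemma generates_semigroup_of:
  assumes "is_generator A" shows "generates A (semigroup_of A)"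
  using assms unfolding is_generator_def semigroup_of_def by (rule someI_ex)

theorem theorem1p2:
  fixes A0 :: "'h::complex_hilbert unbdd_op"
    and B :: "'u::complex_hilbert \<Rightarrow> 'h \<Rightarrow> complex"
    and K :: "'h \<Rightarrow> 'h"
    and T0 :: real
  defines "AK \<equiv> op_perturb A0 K"
  assumes "is_generator A0"
    and "admissible_control A0 B"
    and "bounded_clinear K"
    and "T0 > 0" and "exactly_controllable A0 B T0"
    and "compact_op K"
  shows "is_generator AK \<and> admissible_control AK B \<and>
    finite (sigma_F AK B) \<and>
    (\<forall>\<mu>. finite_dim (E_space AK B \<mu>)) \<and>
    independent_family (sigma_F AK B) (E_space AK B) \<and>
    (\<forall>T>T0. input_map AK B T ` L2 {0<..} =
       orth_compl (subspace_sum (sigma_F AK B) (E_space AK B)))"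
proof -
  interpret U: admissible_system A0 B
    using generates_semigroup_of[OF assms(2)] assms(3) by unfold_locales (auto simp: admissible_control_def)
  interpret bp: bounded_perturbation A0 "semigroup_of A0" K
    by unfold_locales (rule assms(4))
  have gen: "is_generator AK"
    unfolding AK_def is_generator_def using bp.generates_perturb by blast
  have gK: "generator (op_perturb A0 K) (semigroup_of (op_perturb A0 K))"
    using generates_semigroup_of[OF gen] unfolding AK_def by unfold_locales
  interpret PS: perturbed_system A0 B K
  proof -
    have "control_system (op_perturb A0 K) B"
      using gK U.control_op_perturb[OF assms(4) gK]
      by (simp add: control_system_def control_system_axioms_def)
    thus "perturbed_system A0 B K"
      using U.admissible_system_axioms assms(4) by (simp add: perturbed_system_def perturbed_system_axioms_def)
  qed
  have adm: "admissible_control AK B" unfolding AK_def by (rule PS.admissible_perturb)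
  interpret PA: admissible_system AK B
    using PS.P.control_system_axioms adm unfolding AK_def
    by (simp add: admissible_system_def admissible_system_axioms_def)
  have T0: "T0 \<ge> 0" using assms(5) by simp
  \<comment> \<open>Steering from the initial state 0 makes every \<open>y\<close> a value of the
    input map.\<close>
  have "\<exists>u\<in>regular_controls T0. input_map A0 B T0 u = y" for y
  proof -
    obtain u where "u \<in> L2 {0<..<T0}" "solution A0 B 0 u T0 = y"
      using assms(6) unfolding exactly_controllable_def by blast
    moreover have "semigroup_of A0 T0 0 = 0" using linear_simps(3)[OF U.S_linear[OF T0]] .
    ultimately have "y \<in> input_map A0 B T0 ` L2 {0<..<T0}" by (auto simp: solution_def)
    also have "\<dots> \<subseteq> input_map A0 B T0 ` regular_controls T0" by (rule U.input_map_image[OF T0]) auto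
    finally show ?thesis by blast
  qed
  then obtain c where c: "c > 0" "\<And>z. c * norm z \<le> U.sup_reach T0 z"
    using U.surjective_lower_bound[OF T0] by blast
  obtain V c' where V: "finite V" "c' \<ge> 0" "\<And>z. norm z \<le> c' * (PA.sup_reach T0 z + (\<Sum>v\<in>V. \<bar>inner z v\<bar>))"
    using PS.perturbed_observability[OF T0 c assms(7)] unfolding AK_def by blast
  interpret O: observable_up_to_finite AK B T0 c' V
    by unfold_locales (use T0 V in auto)
  show ?thesis
    using gen adm O.finite_sigma_F O.finite_dim_E_space O.independent_E_space O.input_map_image_eq by blast
qed

end
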